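(* Let $n\geq 2$ and let $Y=\operatorname{Adj}(X,x_j,A_j,a_j)$ be the shrinking adjunction space where $X$ is a one-dimensional Peano continuum and each $A_j$ is an $(n-1)$-connected polyhedron. Then the natural homomorphism $\Lambda_n:\pi_n(Y)\to \check{\pi}_n(Y)$ from the $n$-th homotopy group to the $n$-th Čech (shape) homotopy group is injective.
   Context: Shrinking adjunction space: given a space $X$, a sequence of points $x_j\in X$, and based spaces $(A_j,a_j)$, $j\in\mathbb{N}$, let $Y_k$ be the ordinary adjunction space obtained by attaching $A_1,\dots,A_k$ to $X$ via $a_j\sim x_j$, with retractions $Y_{k+1}\to Y_k$ collapsing $A_{k+1}$ to $x_{k+1}$; then $Y=\operatorname{Adj}(X,x_j,A_j,a_j)=\varprojlim_k Y_k$ (inverse limit topology). A Peano continuum is a connected, locally path-connected compact metric space. Write $X=\varprojlim_m (X_m,b_{m+1,m})$ as an inverse limit of finite graphs $X_m$ with retraction bonding maps and projections $b_m:X\to X_m$. For $k,m\in\mathbb{N}$, let $Y_{k,m}$ be the space obtained by attaching $A_1,\dots,A_k$ to $X_m$ via $a_j\sim b_m(x_j)$; these form a polyhedral (HPol) expansion of $Y$, and the $n$-th Čech homotopy group is $\check{\pi}_n(Y)\cong\varprojlim_{(k,m)\in\mathbb{N}^2}\pi_n(Y_{k,m})$. $\Lambda_n$ is the homomorphism induced by the canonical retractions $Y\to Y_{k,m}$. *)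

theory Defs
  imports "HOL-Analysis.Analysis"
begin

text \<open>Base point of the n-sphere (nsphere n lives in the (n+1)-dim coordinate space).\<close>
definition sphere_base :: "nat \<Rightarrow> real" where
  "sphere_base = (\<lambda>i. if i = 0 then 1 else 0)"

text \<open>Two based maps S^n -> (Y,y0) represent the same element of pi_n(Y,y0).\<close>
definition based_homotopic :: "nat \<Rightarrow> 'a topology \<Rightarrow> 'a \<Rightarrow> ((nat \<Rightarrow> real) \<Rightarrow> 'a) \<Rightarrow> ((nat \<Rightarrow> real) \<Rightarrow> 'a) \<Rightarrow> bool" where
  "based_homotopic n Y y0 f g \<longleftrightarrow> homotopic_with (\<lambda>h. h sphere_base = y0) (nsphere n) Y f g"

definition based_map :: "nat \<Rightarrow> 'a topology \<Rightarrow> 'a \<Rightarrow> ((nat \<Rightarrow> real) \<Rightarrow> 'a) \<Rightarrow> bool" where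
  "based_map n Y y0 f \<longleftrightarrow> continuous_map (nsphere n) Y f \<and> f sphere_base = y0"

definition k_connected_space :: "nat \<Rightarrow> 'a topology \<Rightarrow> bool" where
  "k_connected_space k A \<longleftrightarrow> topspace A \<noteq> {} \<and> path_connected_space A \<and>
     (\<forall>i. 1 \<le> i \<and> i \<le> k \<longrightarrow> (\<forall>a0\<in>topspace A. \<forall>f. based_map i A a0 f \<longrightarrow>
         based_homotopic i A a0 f (\<lambda>_. a0)))"

definition simplicial_cx :: "'v set set \<Rightarrow> bool" where
  "simplicial_cx K \<longleftrightarrow> (\<forall>\<sigma>\<in>K. finite \<sigma> \<and> \<sigma> \<noteq> {}) \<and> (\<forall>\<sigma>\<in>K. \<forall>\<tau>. \<tau> \<subseteq> \<sigma> \<and> \<tau> \<noteq> {} \<longrightarrow> \<tau> \<in> K)"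

definition geom_simplex :: "'v set \<Rightarrow> ('v \<Rightarrow> real) set" where
  "geom_simplex \<sigma> = {t. (\<forall>i. i \<notin> \<sigma> \<longrightarrow> t i = 0) \<and> (\<forall>i. 0 \<le> t i) \<and> sum t \<sigma> = 1}"

definition realization_carrier :: "'v set set \<Rightarrow> ('v \<Rightarrow> real) set" where
  "realization_carrier K = (\<Union>\<sigma>\<in>K. geom_simplex \<sigma>)"

definition realization_open :: "'v set set \<Rightarrow> ('v \<Rightarrow> real) set \<Rightarrow> bool" where
  "realization_open K U \<longleftrightarrow> U \<subseteq> realization_carrier K \<and>
      (\<forall>\<sigma>\<in>K. openin (subtopology (powertop_real UNIV) (geom_simplex \<sigma>)) (U \<inter> geom_simplex \<sigma>))"

lemma istopology_realization_open: "istopology (realization_open K)"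
  unfolding istopology_def
proof (intro conjI allI impI)
  fix S T assume S: "realization_open K S" and T: "realization_open K T"
  have 1: "\<And>\<sigma>. S \<inter> T \<inter> geom_simplex \<sigma> = (S \<inter> geom_simplex \<sigma>) \<inter> (T \<inter> geom_simplex \<sigma>)" by blast
  show "realization_open K (S \<inter> T)"
    using S T unfolding realization_open_def 1 by auto
next
  fix \<K> assume H: "\<forall>S\<in>\<K>. realization_open K S"
  have 1: "\<And>\<sigma>. \<Union>\<K> \<inter> geom_simplex \<sigma> = (\<Union>S\<in>\<K>. S \<inter> geom_simplex \<sigma>)" by blast
  have 2: "openin (subtopology (powertop_real UNIV) (geom_simplex \<sigma>)) (\<Union>S\<in>\<K>. S \<inter> geom_simplex \<sigma>)"
    if "\<sigma> \<in> K" for \<sigma>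
    using H that unfolding realization_open_def by (intro openin_Union) auto
  show "realization_open K (\<Union>\<K>)"
    using H 2 unfolding realization_open_def 1 by auto
qed

definition realization :: "'v set set \<Rightarrow> ('v \<Rightarrow> real) topology" where
  "realization K = topology (realization_open K)"

text \<open>A polyhedron: a space homeomorphic to the realization of a simplicial complex.
  Vertices may be taken among the points of the space itself (any triangulation's
  vertex set injects into the space), so the vertex type is the point type.\<close>
definition polyhedron_space :: "'a topology \<Rightarrow> bool" where
  "polyhedron_space A \<longleftrightarrow> (\<exists>K :: 'a set set. simplicial_cx K \<and> A homeomorphic_space realization K)"

definition finite_graph :: "'a topology \<Rightarrow> bool" where
  "finite_graph G \<longleftrightarrow> (\<exists>K :: 'a set set. simplicial_cx K \<and> finite K \<and> (\<forall>\<sigma>\<in>K. card \<sigma> \<le> 2) \<and>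
      G homeomorphic_space realization K)"

definition peano_continuum :: "'a topology \<Rightarrow> bool" where
  "peano_continuum X \<longleftrightarrow> topspace X \<noteq> {} \<and> metrizable_space X \<and> compact_space X \<and>
     connected_space X \<and> locally_path_connected_space X"

definition cov_dim_le :: "'a topology \<Rightarrow> nat \<Rightarrow> bool" where
  "cov_dim_le X n \<longleftrightarrow> (\<forall>\<U>. finite \<U> \<and> (\<forall>U\<in>\<U>. openin X U) \<and> \<Union>\<U> = topspace X \<longrightarrow>
     (\<exists>\<V>. finite \<V> \<and> (\<forall>V\<in>\<V>. openin X V) \<and> \<Union>\<V> = topspace X \<and> (\<forall>V\<in>\<V>. \<exists>U\<in>\<U>. V \<subseteq> U) \<and>
        (\<forall>p\<in>topspace X. card {V\<in>\<V>. p \<in> V} \<le> n + 1)))"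

definition one_dimensional :: "'a topology \<Rightarrow> bool" where
  "one_dimensional X \<longleftrightarrow> cov_dim_le X 1 \<and> \<not> cov_dim_le X 0"

text \<open>Points of the adjunction space: Inl p for p in X, Inr (j,q) for q in A j minus a j.
  (A_j indexed from 0; Y_k attaches A_0,...,A_(k-1).)\<close>
definition adj_carrier :: "'a topology \<Rightarrow> (nat \<Rightarrow> 'b topology) \<Rightarrow> (nat \<Rightarrow> 'b) \<Rightarrow> nat \<Rightarrow> ('a + nat \<times> 'b) set" where
  "adj_carrier X A a k = Inl ` topspace X \<union> {Inr (j, q) | j q. j < k \<and> q \<in> topspace (A j) \<and> q \<noteq> a j}"

definition glue :: "(nat \<Rightarrow> 'a) \<Rightarrow> (nat \<Rightarrow> 'b) \<Rightarrow> nat \<Rightarrow> 'b \<Rightarrow> 'a + nat \<times> 'b" where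
  "glue x a j q = (if q = a j then Inl (x j) else Inr (j, q))"

definition adj_open :: "'a topology \<Rightarrow> (nat \<Rightarrow> 'a) \<Rightarrow> (nat \<Rightarrow> 'b topology) \<Rightarrow> (nat \<Rightarrow> 'b) \<Rightarrow> nat \<Rightarrow> ('a + nat \<times> 'b) set \<Rightarrow> bool" where
  "adj_open X x A a k U \<longleftrightarrow> U \<subseteq> adj_carrier X A a k \<and> openin X {p \<in> topspace X. Inl p \<in> U} \<and>
      (\<forall>j<k. openin (A j) {q \<in> topspace (A j). glue x a j q \<in> U})"

lemma istopology_adj_open: "istopology (adj_open X x A a k)"
  unfolding istopology_def
proof (intro conjI allI impI)
  fix S T assume S: "adj_open X x A a k S" and T: "adj_open X x A a k T"
  have 1: "{p \<in> topspace X. Inl p \<in> S \<inter> T} = {p \<in> topspace X. Inl p \<in> S} \<inter> {p \<in> topspace X. Inl p \<in> T}" by blast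
  have 2: "\<And>j. {q \<in> topspace (A j). glue x a j q \<in> S \<inter> T} = {q \<in> topspace (A j). glue x a j q \<in> S} \<inter> {q \<in> topspace (A j). glue x a j q \<in> T}" by blast
  show "adj_open X x A a k (S \<inter> T)"
    using S T unfolding adj_open_def 1 2 by auto
next
  fix \<K> assume H: "\<forall>S\<in>\<K>. adj_open X x A a k S"
  have 1: "{p \<in> topspace X. Inl p \<in> \<Union>\<K>} = (\<Union>S\<in>\<K>. {p \<in> topspace X. Inl p \<in> S})" by blast
  have 2: "\<And>j. {q \<in> topspace (A j). glue x a j q \<in> \<Union>\<K>} = (\<Union>S\<in>\<K>. {q \<in> topspace (A j). glue x a j q \<in> S})" by blast
  show "adj_open X x A a k (\<Union>\<K>)"
    using H unfolding adj_open_def 1 2 by (auto intro!: openin_Union)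
qed

definition adj_space :: "'a topology \<Rightarrow> (nat \<Rightarrow> 'a) \<Rightarrow> (nat \<Rightarrow> 'b topology) \<Rightarrow> (nat \<Rightarrow> 'b) \<Rightarrow> nat \<Rightarrow> ('a + nat \<times> 'b) topology" where
  "adj_space X x A a k = topology (adj_open X x A a k)"

definition collapse :: "(nat \<Rightarrow> 'a) \<Rightarrow> nat \<Rightarrow> 'a + nat \<times> 'b \<Rightarrow> 'a + nat \<times> 'b" where
  "collapse x k z = (case z of Inl p \<Rightarrow> Inl p | Inr (j, q) \<Rightarrow> if j = k then Inl (x k) else Inr (j, q))"

definition shrinking_adj :: "'a topology \<Rightarrow> (nat \<Rightarrow> 'a) \<Rightarrow> (nat \<Rightarrow> 'b topology) \<Rightarrow> (nat \<Rightarrow> 'b) \<Rightarrow> (nat \<Rightarrow> 'a + nat \<times> 'b) topology" where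
  "shrinking_adj X x A a = subtopology (product_topology (\<lambda>k. adj_space X x A a k) UNIV)
      {y. \<forall>k. y k \<in> topspace (adj_space X x A a k) \<and> collapse x k (y (Suc k)) = y k}"

definition graph_inverse_limit_rep :: "'a topology \<Rightarrow> (nat \<Rightarrow> 'c topology) \<Rightarrow> (nat \<Rightarrow> 'c \<Rightarrow> 'c) \<Rightarrow> (nat \<Rightarrow> 'a \<Rightarrow> 'c) \<Rightarrow> bool" where
  "graph_inverse_limit_rep X Xm bb b \<longleftrightarrow>
     (\<forall>m. finite_graph (Xm m)) \<and>
     (\<forall>m. topspace (Xm m) \<subseteq> topspace (Xm (Suc m)) \<and> subtopology (Xm (Suc m)) (topspace (Xm m)) = Xm m) \<and>
     (\<forall>m. continuous_map (Xm (Suc m)) (Xm m) (bb m) \<and> (\<forall>p\<in>topspace (Xm m). bb m p = p)) \<and>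
     (\<forall>m. continuous_map X (Xm m) (b m) \<and> (\<forall>p\<in>topspace X. bb m (b (Suc m) p) = b m p)) \<and>
     homeomorphic_map X
       (subtopology (product_topology Xm UNIV) {z. \<forall>m. z m \<in> topspace (Xm m) \<and> bb m (z (Suc m)) = z m})
       (\<lambda>p m. b m p)"

definition canon_proj :: "(nat \<Rightarrow> 'a \<Rightarrow> 'c) \<Rightarrow> nat \<Rightarrow> nat \<Rightarrow> (nat \<Rightarrow> 'a + nat \<times> 'b) \<Rightarrow> 'c + nat \<times> 'b" where
  "canon_proj b k m y = map_sum (b m) id (y k)"

end

theory Submission
 imports Defs
begin

text \<open>A map from the cube to \<open>Y\<close> is described by its projection to \<open>X\<close> and its components in the \<open>A j\<close>.
 Over each graph \<open>X m\<close> the projections of \<open>f\<close> and \<open>g\<close> lift to a tree; together the lifts factor the two projections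
 through a continuum \<open>D\<close> in which the intersection of two subcontinua is connected, because this holds in trees. Hence any
 two points of \<open>D\<close> are joined by a canonical arc depending continuously on them.

 Connectivity of the \<open>A j\<close> allows \<open>f\<close> to be deformed so that each component lives on small disjoint discs, on each of which
 the map to \<open>D\<close> is constant. Moving along the canonical arcs, faster and faster back and forth through a path in \<open>D\<close>
 that rests at every point carrying a disc, all discs are carried into disjoint slabs, one slab for every pair of an index \<open>j\<close>
 and a point \<open>t\<close> of \<open>D\<close>. The element of the \<open>n\<close>-th homotopy group of \<open>A j\<close> found in this slab is the part of the component
 \<open>j\<close> of \<open>f\<close> that lies over \<open>t\<close>. Lifting a homotopy over the stage \<open>X m\<close> to the tree separates the parts over finitely many
 given points once \<open>m\<close> is large, so the elements for \<open>f\<close> and \<open>g\<close> agree and the homotopies can be performed slab by slab.\<close>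

text \<open>The difficulty is to move infinitely many discs in one homotopy. A disc of component
  \<open>j\<close> may only sit where the map to \<open>X\<close> equals \<open>x j\<close>, so the
  map to \<open>D\<close> has to be deformed along with it, and this deformation must tend to
  nothing as the parameter \<open>tau\<close> tends to 0. A wave of high frequency takes every value
  of a path in \<open>D\<close> close to every point, so a disc finds its own value after a slight
  shift. For small \<open>tau\<close> the frequency is high and the map is pushed only a distance of
  order \<open>tau\<close> along the canonical arcs; as \<open>tau\<close> grows the frequency drops
  in steps. Consecutive waves use two coordinates in turn: while one coordinate carries the wave,
  the discs slide in the other one to positions that suit the next wave. This needs
  \<open>n >= 2\<close>, as does the connectedness of a spherical shell, which keeps the lifts
  constant near the boundary of the cube. At \<open>tau = 1\<close> the map to \<open>D\<close>
  depends on the path alone, hence is the same for \<open>f\<close> and \<open>g\<close>, and only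
  the contents of the slabs remain to be compared. Every component has finitely many discs, so
  finitely many points \<open>t\<close> occur with it, and a single stage tells them apart.\<close>

abbreviation cmap_on :: "'a::topological_space set => 'b topology => ('a => 'b) => bool" where
 "cmap_on S == continuous_map (top_of_set S)"

lemmas cmap_comp = continuous_map_compose
lemmas cmap_image = continuous_map_image_subset_topspace
lemmas continuous_on_coords = continuous_on_coordinatewise_then_product
lemmas continuous_on_coord = continuous_on_product_then_coordinatewise

section \<open>Trees of reduced words\<close>

fun lcp :: "nat list => nat list => nat" where
 "lcp (x # xs) (y # ys) = (if x = y then Suc (lcp xs ys) else 0)"
| "lcp _ _ = 0"

lemma lcp_commute: "lcp u w = lcp w u"
 by (induction u w rule: lcp.induct) (auto, (case_tac "va"; simp)?)

lemma lcp_le: "lcp u w <= length u" "lcp u w <= length w"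
 by (induction u w rule: lcp.induct) auto

lemma lcp_same [simp]: "lcp u u = length u"
 by (induction u) auto

lemma lcp_ultra: "min (lcp u v) (lcp v w) <= lcp u w"
proof (induction u w arbitrary: v rule: lcp.induct)
 case (1 x xs y ys)
 thus ?case by (cases v) (auto simp: min_le_iff_disj)
qed auto

lemma lcp_full: "lcp u w = length u ==> take (length u) w = u"
 by (induction u w rule: lcp.induct) (auto split: if_splits)

lemma lcp_take: "lcp (take k u) w = min k (lcp u w)"
proof (induction u w arbitrary: k rule: lcp.induct)
 case (1 x xs y ys)
 thus ?case by (cases k) auto
qed (auto simp: take_Cons split: nat.split)

lemma lcp_append: "lcp (u @ v) (u @ w) = length u + lcp v w"
 by (induction u) auto

text \<open>Neighbouring letters span an edge of the complete graph, and letters two apart differ,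
  so the edge path does not turn back. These words are the vertices of the universal covering of the
  complete graph, one copy for each first letter.\<close>

definition reduced :: "nat list => bool" where
 "reduced w \<longleftrightarrow> (ALL i. Suc i < length w --> w ! i ~= w ! Suc i) &
   (ALL i. Suc (Suc i) < length w --> w ! i ~= w ! Suc (Suc i))"

lemma reduced_take: "reduced w ==> reduced (take k w)"
 by (auto simp: reduced_def)

lemma reduced_single [simp]: "reduced [v]"
 by (auto simp: reduced_def)

text \<open>A code stands for the point at distance \<open>t\<close> from the penultimate vertex on
  the last edge of the path \<open>w\<close>; excluding \<open>t = 0\<close> makes codes unique. A
  one-letter word has no last edge and codes only its vertex, with \<open>t = 1\<close>.\<close>

definition tree_code :: "nat list => real => bool" where
 "tree_code w t \<longleftrightarrow> w ~= [] & reduced w & 0 < t & t <= 1 & (length w = 1 --> t = 1)"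

typedef rtree = "{(w, t). tree_code w t}" morphisms rt_rep rt_abs
 by (rule exI[of _ "([0], 1)"]) (auto simp: tree_code_def)

definition rword :: "rtree => nat list" where "rword y = fst (rt_rep y)"
definition rfrac :: "rtree => real" where "rfrac y = snd (rt_rep y)"
definition rmk :: "nat list => real => rtree" where "rmk w t = rt_abs (w, t)"

lemma tree_code_rep: "tree_code (rword y) (rfrac y)"
 using rt_rep[of y] by (auto simp: rword_def rfrac_def)

lemma rword_rmk [simp]: "tree_code w t ==> rword (rmk w t) = w"
 and rfrac_rmk [simp]: "tree_code w t ==> rfrac (rmk w t) = t"
 by (auto simp: rword_def rfrac_def rmk_def rt_abs_inverse)

lemma rmk_rep [simp]: "rmk (rword y) (rfrac y) = y"
 by (simp add: rword_def rfrac_def rmk_def rt_rep_inverse)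

lemma rtree_eqI: "rword y = rword z ==> rfrac y = rfrac z ==> y = z"
 by (metis rmk_rep)

lemma rword_ne [simp]: "rword y ~= []" and rfrac_pos: "0 < rfrac y" and rfrac_le: "rfrac y <= 1"
 and reduced_rword: "reduced (rword y)"
 using tree_code_rep[of y] by (auto simp: tree_code_def)

section \<open>Heights, overlaps and the path metric\<close>

definition rht :: "rtree => real" where "rht y = real (length (rword y)) - 1 + rfrac y"
text \<open>Heights count from a virtual point one unit below all one-letter words, and
  \<open>rov\<close> is the Gromov product at that point. Points with different first letters have
  overlap 0.\<close>

definition rov :: "rtree => rtree => real" where
 "rov y z = min (min (rht y) (rht z)) (real (lcp (rword y) (rword z)))"

lemma rht_rmk [simp]: "tree_code w t ==> rht (rmk w t) = real (length w) - 1 + t"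
 by (simp add: rht_def)

lemma rht_le: "rht y <= length (rword y)" and rht_gt: "real (length (rword y)) - 1 < rht y"
 using rfrac_pos[of y] rfrac_le[of y] by (auto simp: rht_def)

lemma rht_ge1: "1 <= rht y"
proof (cases "length (rword y) = 1")
 case True
 thus ?thesis using tree_code_rep[of y] by (auto simp: rht_def tree_code_def)
next
 case False
 have "length (rword y) ~= 0" by simp
 with False have "2 <= length (rword y)" by linarith
 thus ?thesis using rfrac_pos[of y] by (auto simp: rht_def)
qed

lemma rov_commute: "rov y z = rov z y"
 by (simp add: rov_def lcp_commute[of "rword y"] min.commute[of "rht y"])

lemma rov_le: "rov y z <= rht y" "rov y z <= rht z"
 by (auto simp: rov_def)

lemma rov_self [simp]: "rov y y = rht y"
 using rht_le[of y] by (simp add: rov_def)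

lemma rov_ultra: "min (rov x y) (rov y z) <= rov x z"
 using lcp_ultra[of "rword x" "rword y" "rword z"]
 by (auto simp: rov_def min_le_iff_disj)

lemma rov_eqI:
 assumes "rov y z = rht y" "rov y z = rht z" shows "y = z"
proof -
 let ?l = "lcp (rword y) (rword z)"
 have a: "rht y <= ?l" "rht z <= ?l" using assms by (auto simp: rov_def)
 have "real (length (rword y)) < real ?l + 1" "real (length (rword z)) < real ?l + 1"
  using a rht_gt[of y] rht_gt[of z] by linarith+
 hence "length (rword y) <= ?l" "length (rword z) <= ?l" by linarith+
 with lcp_le[of "rword y" "rword z"] have l: "?l = length (rword y)" "length (rword y) = length (rword z)"
  by linarith+
 have w: "rword y = rword z" using lcp_full[OF l(1)] l(2) by (metis order_refl take_all)
 moreover have "rfrac y = rfrac z" using assms w by (simp add: rht_def)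
 ultimately show ?thesis by (rule rtree_eqI)
qed

instantiation rtree :: metric_space
begin

text \<open>The length of the way down to the height where the two branches part and up again. The
  triangle inequality rests on \<open>rov_ultra\<close>.\<close>

definition dist_rtree :: "rtree => rtree => real" where
 "dist_rtree y z = rht y + rht z - 2 * rov y z"

definition uniformity_rtree :: "(rtree \<times> rtree) filter" where
 "uniformity_rtree = (INF e\<in>{0<..}. principal {(x, y). dist x y < e})"

definition open_rtree :: "rtree set => bool" where
 "open_rtree U \<longleftrightarrow> (ALL x:U. eventually (%(x', y). x' = x --> y : U) uniformity)"

instance
proof
 fix x y z :: rtree
 show "dist x y = 0 \<longleftrightarrow> x = y"
 proof
  assume "dist x y = 0"
  thus "x = y" using rov_le[of x y] by (intro rov_eqI) (auto simp: dist_rtree_def)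
 qed (simp add: dist_rtree_def)
 show "dist x y <= dist x z + dist y z"
  using rov_ultra[of x z y] rov_le[of x z] rov_le[of z y] rov_commute[of y z]
  by (auto simp: dist_rtree_def min_def split: if_splits)
qed (simp_all add: uniformity_rtree_def open_rtree_def)
end

lemma rht_lipschitz: "abs (rht y - rht z) <= dist y z"
 using rov_le[of y z] by (simp add: dist_rtree_def)

lemma rov_dist: "rov y z = (rht y + rht z - dist y z) / 2"
 by (simp add: dist_rtree_def)

lemma continuous_rht: "continuous_on S rht"
 unfolding continuous_on_iff
proof (intro ballI allI impI)
 fix x e assume "0 < (e::real)"
 thus "EX d>0. ALL x':S. dist x' x < d --> dist (rht x') (rht x) < e"
  using rht_lipschitz le_less_trans unfolding dist_real_def by (intro exI[of _ e]) blast
qed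

text \<open>The 1-skeleton of the full simplex with vertex set \<open>\<nat>\<close>, in barycentric coordinates.\<close>

definition in_graph :: "(nat => real) => bool" where
 "in_graph x \<longleftrightarrow> (EX u v t. u ~= v & 0 <= t & t <= 1 & x = (%i. if i = u then 1 - t else if i = v then t else 0))"

text \<open>The covering map. For a one-letter word \<open>last (butlast w)\<close> is unspecified,
  but its weight \<open>1 - rfrac y\<close> is then 0.\<close>

definition rproj :: "rtree => nat => real" where
 "rproj y = (%i. if i = last (rword y) then rfrac y
         else if i = last (butlast (rword y)) then 1 - rfrac y else 0)"

lemma length_ge2_snoc:
 assumes "2 <= length w" obtains w' a b where "w = w' @ [a, b]"
proof -
 obtain v b where v: "w = v @ [b]" using assms by (cases w rule: rev_cases) auto
 then obtain w' a where "v = w' @ [a]" using assms by (cases v rule: rev_cases) auto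
 thus ?thesis using v that by simp
qed

lemma last_butlast_ne:
 assumes "reduced w" "2 <= length w" shows "last (butlast w) ~= last w"
proof -
 obtain w' a b where w: "w = w' @ [a, b]" using length_ge2_snoc assms(2) by blast
 have "a ~= b" using assms(1) unfolding w reduced_def
  by (auto dest!: spec[of _ "length w'"] simp: nth_append)
 thus ?thesis by (simp add: w butlast_append)
qed

lemma rproj_in_graph: "in_graph (rproj y)"
proof (cases "length (rword y) = 1")
 case True
 hence 1: "rfrac y = 1" using tree_code_rep[of y] by (auto simp: tree_code_def)
 show ?thesis unfolding in_graph_def
  by (rule exI[of _ "Suc (last (rword y))"], rule exI[of _ "last (rword y)"], rule exI[of _ 1])
   (use 1 in "auto simp: rproj_def")
next
 case False
 have "length (rword y) ~= 0" by simp
 with False have "2 <= length (rword y)" by linarith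
 hence ne: "last (butlast (rword y)) ~= last (rword y)"
  using last_butlast_ne reduced_rword by blast
 show ?thesis unfolding in_graph_def
  by (rule exI[of _ "last (butlast (rword y))"], rule exI[of _ "last (rword y)"], rule exI[of _ "rfrac y"])
   (use ne rfrac_le[of y] rfrac_pos[of y] in "auto simp: rproj_def")
qed

section \<open>Charts over the open stars of vertices\<close>

definition other :: "nat => (nat => real) => nat" where
 "other v x = (SOME u. u ~= v & 0 < x u)"

lemma in_graph_other:
 assumes "in_graph x" "0 < x v" "x v ~= 1"
 shows "other v x ~= v" "0 < x (other v x)" "x (other v x) = 1 - x v"
  "!!u. u ~= v ==> 0 < x u ==> u = other v x"
  "x = (%i. if i = v then x v else if i = other v x then 1 - x v else 0)"
proof -
 obtain a b t where ab: "a ~= b" "0 <= t" "t <= 1" and x: "x = (%i. if i = a then 1 - t else if i = b then t else 0)"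
  using assms(1) unfolding in_graph_def by blast
 obtain u where u: "u ~= v" "0 < x u" "x u = 1 - x v" "!!i. i ~= v ==> i ~= u ==> x i = 0"
 proof (cases "v = a")
  case True
  show ?thesis by (rule that[of b]) (use assms ab True in "auto simp: x")
 next
  case False
  hence "v = b" using assms(2) by (auto simp: x split: if_splits)
  thus ?thesis by (intro that[of a]) (use assms ab in "auto simp: x")
 qed
 have uniq: "i = u" if "i ~= v" "0 < x i" for i
  using u(4)[of i] that by force
 have o: "other v x = u"
  unfolding other_def
 proof (rule some_equality)
  show "u ~= v & 0 < x u" using u by blast
 qed (use uniq in blast)
 show "other v x ~= v" "0 < x (other v x)" "x (other v x) = 1 - x v" using u o by auto
 show "i = other v x" if "i ~= v" "0 < x i" for i using uniq that o by auto
 show "x = (%i. if i = v then x v else if i = other v x then 1 - x v else 0)"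
  unfolding o using u by (intro ext) auto
qed

lemma in_graph_bounds: "in_graph x ==> 0 <= x v & x v <= 1"
 by (auto simp: in_graph_def)

lemma in_graph_one: "in_graph x ==> x v = 1 ==> x = (%i. if i = v then 1 else 0)"
proof -
 assume "in_graph x" and v: "x v = 1"
 then obtain a b t where ab: "a ~= b" "0 <= t" "t <= 1" and x: "x = (%i. if i = a then 1 - t else if i = b then t else 0)"
  unfolding in_graph_def by blast
 consider "v = a" "t = 0" | "v = b" "t = 1" using v ab unfolding x by (auto split: if_splits)
 thus ?thesis unfolding x using ab by cases auto
qed

text \<open>The inverse of \<open>rproj\<close> over the open star of \<open>last w\<close>, with
  values around the tree vertex \<open>w\<close>. The second case is the edge back to the parent of
  \<open>w\<close>, the third an edge away from the root.\<close>

definition rlift :: "nat list => (nat => real) => rtree" where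
 "rlift w x = (let v = last w; u = other v x in
   if x v = 1 then rmk w 1
   else if 2 <= length w & u = last (butlast w) then rmk w (x v)
   else rmk (w @ [u]) (x u))"

lemma reduced_snoc:
 assumes "reduced w" "w ~= []" "u ~= last w" "2 <= length w ==> u ~= last (butlast w)"
 shows "reduced (w @ [u])"
proof -
 have 1: "(w @ [u]) ! i ~= (w @ [u]) ! Suc i" if "Suc i < length (w @ [u])" for i
 proof (cases "Suc i < length w")
  case True
  thus ?thesis using assms(1) by (auto simp: reduced_def nth_append)
 next
  case False
  hence "i = length w - 1" using that assms(2) by auto
  thus ?thesis using assms(2,3) by (auto simp: nth_append last_conv_nth)
 qed
 have 2: "(w @ [u]) ! i ~= (w @ [u]) ! Suc (Suc i)" if "Suc (Suc i) < length (w @ [u])" for i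
 proof (cases "Suc (Suc i) < length w")
  case True
  thus ?thesis using assms(1) by (auto simp: reduced_def nth_append)
 next
  case False
  hence i: "i = length w - 2" "2 <= length w" using that by auto
  obtain w' a b where "w = w' @ [a, b]" using length_ge2_snoc i(2) by blast
  hence "last (butlast w) = w ! (length w - 2)"
   by (simp add: butlast_append nth_append)
  thus ?thesis using assms(4) i by (auto simp: nth_append numeral_2_eq_2)
 qed
 show ?thesis using 1 2 unfolding reduced_def by blast
qed

lemma rlift_cases [consumes 4, case_names one up down]:
 assumes w: "reduced w" "w ~= []" and x: "in_graph x" "0 < x (last w)"
 obtains "x (last w) = 1" "rlift w x = rmk w 1" "tree_code w 1"
 | "x (last w) ~= 1" "2 <= length w" "other (last w) x = last (butlast w)" "rlift w x = rmk w (x (last w))" "tree_code w (x (last w))"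
 | "x (last w) ~= 1" "2 <= length w ==> other (last w) x ~= last (butlast w)"
   "rlift w x = rmk (w @ [other (last w) x]) (x (other (last w) x))"
   "tree_code (w @ [other (last w) x]) (x (other (last w) x))"
proof -
 have c1: "tree_code w 1" using w by (auto simp: tree_code_def)
 show thesis
 proof (cases "x (last w) = 1")
  case True
  thus ?thesis using c1 that(1) by (simp add: rlift_def)
 next
  case False
  note o = in_graph_other[OF x False]
  show ?thesis
  proof (cases "2 <= length w & other (last w) x = last (butlast w)")
   case True
   have "tree_code w (x (last w))"
    using True w x(2) in_graph_bounds[OF x(1), of "last w"] by (auto simp: tree_code_def)
   thus ?thesis using False True by (intro that(2)) (auto simp: rlift_def Let_def)
  next
   case False': False
   have "reduced (w @ [other (last w) x])"
    by (rule reduced_snoc[OF w o(1)]) (use False' in blast)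
   hence "tree_code (w @ [other (last w) x]) (x (other (last w) x))"
    using w(2) o(2) in_graph_bounds[OF x(1), of "other (last w) x"] by (auto simp: tree_code_def)
   moreover have "rlift w x = rmk (w @ [other (last w) x]) (x (other (last w) x))"
    using False False' by (auto simp: rlift_def Let_def)
   ultimately show ?thesis using False False' by (intro that(3)) blast+
  qed
 qed
qed

lemma rproj_rmk: "tree_code w t ==> rproj (rmk w t) = (%i. if i = last w then t else if i = last (butlast w) then 1 - t else 0)"
 by (rule ext) (simp add: rproj_def)

lemma rproj_rlift:
 assumes w: "reduced w" "w ~= []" and x: "in_graph x" "0 < x (last w)"
 shows "rproj (rlift w x) = x"
 using w x
proof (cases rule: rlift_cases)
 case one
 show ?thesis unfolding one(2) rproj_rmk[OF one(3)]
  by (subst in_graph_one[OF x(1) one(1)]) auto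
next
 case up
 show ?thesis unfolding up(4) rproj_rmk[OF up(5)]
  by (subst (3) in_graph_other(5)[OF x up(1)]) (use up in auto)
next
 case down
 show ?thesis unfolding down(3) rproj_rmk[OF down(4)]
 proof
  fix i
  have "x i = (if i = last w then x (last w) else if i = other (last w) x then 1 - x (last w) else 0)"
   by (subst in_graph_other(5)[OF x down(1)]) simp
  thus "(if i = last (w @ [other (last w) x]) then x (other (last w) x)
    else if i = last (butlast (w @ [other (last w) x])) then 1 - x (other (last w) x) else 0) = x i"
   using in_graph_other(1,3)[OF x down(1)] by auto
 qed
qed

lemma dist_rlift_vertex:
 assumes w: "reduced w" "w ~= []" and x: "in_graph x" "0 < x (last w)"
 shows "dist (rlift w x) (rmk w 1) = 1 - x (last w)"
proof -
 have c1: "tree_code w 1" using w by (auto simp: tree_code_def)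
 note b = in_graph_bounds[OF x(1), of "last w"]
 show ?thesis
  using w x
 proof (cases rule: rlift_cases)
  case one
  show ?thesis unfolding one(2) using one(1) by simp
 next
  case up
  show ?thesis unfolding up(4) using up c1 b
   by (simp add: dist_rtree_def rov_def)
 next
  case down
  have "lcp (w @ [other (last w) x]) w = length w"
   using lcp_append[of w "[other (last w) x]" "[]"] by simp
  moreover have "x (other (last w) x) = 1 - x (last w)" using in_graph_other(3)[OF x down(1)] .
  ultimately show ?thesis unfolding down(3) using down(4) c1 x(2) b
   by (simp add: dist_rtree_def rov_def)
 qed
qed

lemma dist_rlift_same:
 assumes w: "reduced w" "w ~= []" and x: "in_graph x" "0 < x (last w)" and z: "in_graph z" "0 < z (last w)"
  and u: "u ~= last w" "0 < x u" "0 < z u"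
 shows "dist (rlift w x) (rlift w z) = abs (x (last w) - z (last w))"
proof -
 have n1: "x (last w) ~= 1" "z (last w) ~= 1"
  using in_graph_one[OF x(1), of "last w"] in_graph_one[OF z(1), of "last w"] u by auto
 have o: "u = other (last w) x" "u = other (last w) z"
  using in_graph_other(4)[OF x n1(1) u(1,2)] in_graph_other(4)[OF z n1(2) u(1,3)] by auto
 have s: "x u = 1 - x (last w)" "z u = 1 - z (last w)"
  using in_graph_other(3)[OF x n1(1)] in_graph_other(3)[OF z n1(2)] o by metis+
 note b = in_graph_bounds[OF z(1), of "last w"] in_graph_bounds[OF x(1), of "last w"]
 show ?thesis
  using w x
 proof (cases rule: rlift_cases)
  case one
  thus ?thesis using n1 by simp
 next
  case up
  have e: "rlift w z = rmk w (z (last w))" using n1 o up(2,3) by (simp add: rlift_def Let_def)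
  have c: "tree_code w (z (last w))" using up(2) w z b by (auto simp: tree_code_def)
  show ?thesis unfolding e up(4) using c up(5) b
   by (auto simp: dist_rtree_def rov_def abs_if)
 next
  case down
  have e: "rlift w z = rmk (w @ [u]) (z u)" using n1(2) o down(2) unfolding rlift_def Let_def by metis
  have c: "tree_code (w @ [u]) (z u)" using down(4)[folded o(1)] w(2) in_graph_bounds[OF z(1), of "u"] u(3)
   by (simp add: tree_code_def)
  show ?thesis unfolding e down(3) o(1)[symmetric] using c down(4)[folded o(1)] s b
   by (auto simp: dist_rtree_def rov_def abs_if)
 qed
qed

definition rnear :: "rtree => nat list" where
 "rnear y = (if 1/2 <= rfrac y then rword y else butlast (rword y))"

lemma rnear_props:
 shows "reduced (rnear y)" "rnear y ~= []" "1/2 <= rproj y (last (rnear y))" "rlift (rnear y) (rproj y) = y"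
proof -
 let ?w = "rword y"
 have len: "2 <= length ?w" if "rfrac y ~= 1"
 proof -
  have "length ?w ~= 0" "length ?w ~= 1" using tree_code_rep[of y] that by (auto simp: tree_code_def)
  thus ?thesis by linarith
 qed
 have ne: "last (butlast ?w) ~= last ?w" if "rfrac y ~= 1"
  using last_butlast_ne reduced_rword len[OF that] by blast
 have bl: "butlast ?w = take (length ?w - 1) ?w" by (simp add: butlast_conv_take)
 have "reduced (butlast ?w)" unfolding bl by (rule reduced_take[OF reduced_rword])
 thus r: "reduced (rnear y)" using reduced_rword by (simp add: rnear_def)
 have bne: "butlast ?w ~= []" if "rfrac y ~= 1" using len[OF that] by (cases ?w) auto
 thus n: "rnear y ~= []" by (auto simp: rnear_def)
 show h: "1/2 <= rproj y (last (rnear y))"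
  using ne by (auto simp: rnear_def rproj_def)
 have g: "in_graph (rproj y)" by (rule rproj_in_graph)
 show "rlift (rnear y) (rproj y) = y"
 proof (cases "rfrac y = 1")
  case True
  thus ?thesis by (simp add: rnear_def rlift_def rproj_def) (metis rmk_rep)
 next
  case False
  note ne = ne[OF False] and len = len[OF False]
  have pl: "rproj y (last ?w) = rfrac y" "rproj y (last (butlast ?w)) = 1 - rfrac y"
   using ne by (auto simp: rproj_def)
  have f: "0 < rfrac y" "rfrac y < 1" using rfrac_pos[of y] rfrac_le[of y] False by auto
  show ?thesis
  proof (cases "1/2 <= rfrac y")
   case True
   have "last (butlast ?w) = other (last ?w) (rproj y)"
    using in_graph_other(4)[OF g, of "last ?w" "last (butlast ?w)"] pl f ne by auto
   thus ?thesis using True len pl f by (simp add: rnear_def rlift_def Let_def)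
  next
   case False
   let ?v = "butlast ?w"
   have o: "last ?w = other (last ?v) (rproj y)"
    using in_graph_other(4)[OF g, of "last ?v" "last ?w"] pl f ne by auto
   have "last (butlast ?v) ~= last ?w" if l2: "2 <= length ?v"
   proof -
    obtain w1 a b where "?v = w1 @ [a, b]" using length_ge2_snoc[OF l2] by metis
    then obtain w' c where w': "?w = w' @ [a, b, c]"
     by (metis append.assoc append_Cons append_Nil append_butlast_last_id rword_ne)
    have "a ~= c" using reduced_rword[of y] unfolding w' reduced_def
     by (auto dest!: spec[of _ "length w'"] simp: nth_append)
    thus ?thesis by (simp add: w' butlast_append)
   qed
   hence "rlift ?v (rproj y) = rmk (?v @ [last ?w]) (rproj y (last ?w))"
    using o pl f by (auto simp: rlift_def Let_def)
   also have "... = y" using pl by simp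
   finally show ?thesis using False by (simp add: rnear_def)
  qed
 qed
qed

text \<open>The open unit ball about a tree vertex is its open star. If \<open>w\<close> were not a
  prefix of the word of \<open>y\<close>, descending from \<open>w\<close> to the branch point would
  alone cost 1; so the word is \<open>w\<close> with at most one further, incomplete edge.\<close>

lemma rstar:
 assumes w: "reduced w" "w ~= []" and d: "dist y (rmk w 1) < 1"
 shows "0 < rproj y (last w)" "rlift w (rproj y) = y"
proof -
 have c1: "tree_code w 1" using w by (auto simp: tree_code_def)
 let ?w = "rword y" and ?l = "lcp (rword y) w"
 have D: "dist y (rmk w 1) = rht y + length w - 2 * rov y (rmk w 1)"
  using c1 by (simp add: dist_rtree_def)
 have ov: "rov y (rmk w 1) = min (min (rht y) (length w)) ?l" using c1 by (simp add: rov_def)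
 have "?l = length w"
 proof (rule ccontr)
  assume "?l ~= length w"
  hence "real ?l <= real (length w) - 1" using lcp_le(2)[of ?w w] by linarith
  thus False using d D ov by linarith
 qed
 hence pre: "take (length w) ?w = w" using lcp_full[of w ?w] lcp_commute[of w ?w] by simp
 then obtain v where v: "?w = w @ v" by (metis append_take_drop_id)
 have "rht y >= length w" if "v ~= []"
 proof -
  have "length ?w >= length w + 1" using that v by (cases v) auto
  thus ?thesis using rht_gt[of y] by linarith
 qed
 hence rv: "rht y < length w + 1" if "v ~= []" using d D ov `?l = length w` that by simp
 consider "v = []" | u where "v = [u]" "rfrac y < 1"
 proof (cases v)
  case (Cons u v')
  hence "real (length w + 1 + length v') - 1 + rfrac y < length w + 1" using rv v by (simp add: rht_def)
  hence "v' = [] & rfrac y < 1" using rfrac_pos[of y] by (cases v') auto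
  thus ?thesis using that Cons by auto
 qed (use that in auto)
 hence "0 < rproj y (last w) & rlift w (rproj y) = y"
 proof cases
  case 1
  hence ww: "?w = w" using v by simp
  have "0 < rproj y (last w)" using ww rfrac_pos[of y] by (simp add: rproj_def)
  moreover have g: "in_graph (rproj y)" by (rule rproj_in_graph)
  have "rlift w (rproj y) = y"
  proof (cases "rfrac y = 1")
   case True
   thus ?thesis using ww by (simp add: rlift_def rproj_def) (metis rmk_rep)
  next
   case False
   hence len: "2 <= length w" using tree_code_rep[of y] ww w by (cases w; cases "tl w") (auto simp: tree_code_def)
   have ne: "last (butlast w) ~= last w" using last_butlast_ne w len by blast
   have f: "0 < rfrac y" "rfrac y < 1" using rfrac_pos[of y] rfrac_le[of y] False by auto
   have pl: "rproj y (last w) = rfrac y" "rproj y (last (butlast w)) = 1 - rfrac y"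
    using ne ww by (auto simp: rproj_def)
   have "last (butlast w) = other (last w) (rproj y)"
    using in_graph_other(4)[OF g, of "last w" "last (butlast w)"] pl f ne by auto
   thus ?thesis using len pl f ww by (simp add: rlift_def Let_def) (metis rmk_rep)
  qed
  ultimately show ?thesis by blast
 next
  case 2
  hence ww: "?w = w @ [u]" using v by simp
  have len: "2 <= length ?w" using ww w by (cases w) auto
  have ne: "last w ~= u" using last_butlast_ne[OF reduced_rword len] ww by simp
  have f: "0 < rfrac y" "rfrac y < 1" using rfrac_pos[of y] 2 by auto
  have pl: "rproj y u = rfrac y" "rproj y (last w) = 1 - rfrac y"
   using ne ww by (auto simp: rproj_def)
  have pos: "0 < rproj y (last w)" using pl f by simp
  have g: "in_graph (rproj y)" by (rule rproj_in_graph)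
  have o: "u = other (last w) (rproj y)" using in_graph_other(4)[OF g, of "last w" u] pl f ne by auto
  have "last (butlast w) ~= u" if l2: "2 <= length w"
  proof -
   obtain w' a b where w': "w = w' @ [a, b]"
    using length_ge2_snoc[OF l2] by metis
   have "a ~= u" using reduced_rword[of y] unfolding ww w' reduced_def
     by (auto dest!: spec[of _ "length w'"] simp: nth_append)
   thus ?thesis by (simp add: w' butlast_append)
  qed
  hence "rlift w (rproj y) = rmk (w @ [u]) (rproj y u)"
   using o pl f by (auto simp: rlift_def Let_def)
  also have "... = y" using pl ww by (metis rmk_rep)
  finally show ?thesis using pos by blast
 qed
 thus "0 < rproj y (last w)" "rlift w (rproj y) = y" by auto
qed

text \<open>On the interior of an edge the charts of its two ends agree: what leads away from the
  root at \<open>w\<close> leads back to the parent at \<open>w'\<close>.\<close>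

lemma rlift_edge:
 assumes w: "reduced w" "w ~= []" and w': "w' = w @ [u]" "reduced w'"
  and x: "in_graph x" "0 < x (last w)" "0 < x u"
 shows "rlift w x = rlift w' x"
proof -
 have len: "2 <= length w'" using w w' by (cases w) auto
 have ne: "last w ~= u" using last_butlast_ne[OF w'(2) len] w' by simp
 have n1: "x (last w) ~= 1" "x u ~= 1"
  using in_graph_one[OF x(1), of "last w"] in_graph_one[OF x(1), of u] x ne by auto
 have o: "u = other (last w) x" "last w = other u x"
  using in_graph_other(4)[OF x(1,2) n1(1)] in_graph_other(4)[OF x(1,3) n1(2)] ne x by auto
 have "last (butlast w) ~= u" if l2: "2 <= length w"
 proof -
  obtain w1 a b where w1: "w = w1 @ [a, b]" using length_ge2_snoc[OF l2] by metis
  have "a ~= u" using w'(2) unfolding w' w1 reduced_def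
   by (auto dest!: spec[of _ "length w1"] simp: nth_append)
  thus ?thesis by (simp add: w1 butlast_append)
 qed
 hence "rlift w x = rmk w' (x u)"
  using n1 unfolding rlift_def Let_def o(1)[symmetric] w'(1) by metis
 also have "... = rlift w' x"
  using n1 len w'(1) by (simp add: rlift_def Let_def flip: o(2))
 finally show ?thesis .
qed

lemma dist_rnear: "dist y (rmk (rnear y) 1) <= 1/2"
 using dist_rlift_vertex[OF rnear_props(1,2) rproj_in_graph, of y y] rnear_props(3,4)[of y] by simp

lemma rproj_vertex:
 assumes "0 < rproj y u"
 obtains w where "reduced w" "w ~= []" "last w = u" "rlift w (rproj y) = y"
proof -
 let ?w = "rnear y"
 note w = rnear_props(1,2)[of y] and g = rproj_in_graph[of y]
 have y: "0 < rproj y (last ?w)" "rlift ?w (rproj y) = y" using rnear_props(3,4)[of y] by auto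
 show ?thesis
 proof (cases "u = last ?w")
  case True
  thus ?thesis using that w y by blast
 next
  case False
  from w g y(1) show ?thesis
  proof (cases rule: rlift_cases)
   case one
   thus ?thesis using in_graph_one[OF g one(1)] assms False by auto
  next
   case up
   have u: "u = other (last ?w) (rproj y)" using in_graph_other(4)[OF g y(1) up(1) False assms] .
   obtain w' a b where w': "?w = w' @ [a, b]" using length_ge2_snoc[OF up(2)] by metis
   have r: "reduced (butlast ?w)" using reduced_take[OF w(1)] by (simp add: butlast_conv_take)
   have "rlift (butlast ?w) (rproj y) = rlift ?w (rproj y)"
   proof (rule rlift_edge[OF r _ _ w(1) g])
    show "butlast ?w ~= []" using w' by (simp add: butlast_append)
    show "?w = butlast ?w @ [last ?w]" using w(2) by simp
    show "0 < rproj y (last (butlast ?w))" using u up(3) assms by simp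
    show "0 < rproj y (last ?w)" by (rule y(1))
   qed
   moreover have "butlast ?w ~= []" using w' by (simp add: butlast_append)
   ultimately show ?thesis using that[OF r] u up(3) y(2) by simp
  next
   case down
   have u: "u = other (last ?w) (rproj y)" using in_graph_other(4)[OF g y(1) down(1) False assms] .
   have r: "reduced (?w @ [u])" using down(4) u by (simp add: tree_code_def)
   have "rlift ?w (rproj y) = rlift (?w @ [u]) (rproj y)"
    by (rule rlift_edge[OF w refl r g y(1) assms])
   thus ?thesis using that[of "?w @ [u]"] r y by simp
  qed
 qed
qed

text \<open>Where coordinate \<open>u\<close> is positive, it is 1 minus the distance to a tree
  vertex lying over \<open>u\<close>, and distance functions are 1-Lipschitz.\<close>

lemma rproj_dist: "abs (rproj y u - rproj z u) <= dist y z"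
proof -
 have *: "rproj y u - rproj z u <= dist y z" for y z
 proof (cases "0 < rproj y u")
  case False
  thus ?thesis using in_graph_bounds[OF rproj_in_graph, of y u] in_graph_bounds[OF rproj_in_graph, of z u]
   by (metis diff_le_0_iff_le order.trans not_less zero_le_dist)
 next
  case True
  then obtain w where w: "reduced w" "w ~= []" "last w = u" "rlift w (rproj y) = y" by (rule rproj_vertex)
  have d: "dist y (rmk w 1) = 1 - rproj y u"
   using dist_rlift_vertex[OF w(1,2) rproj_in_graph, of y] w True by simp
  have t: "dist z (rmk w 1) <= dist y z + dist y (rmk w 1)"
   using dist_triangle[of z "rmk w 1" y] by (simp add: dist_commute)
  show ?thesis
  proof (cases "dist z (rmk w 1) < 1")
   case True
   note z = rstar[OF w(1,2) True]
   have "dist z (rmk w 1) = 1 - rproj z u"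
    using dist_rlift_vertex[OF w(1,2) rproj_in_graph z(1)] w z by simp
   thus ?thesis using d t by simp
  next
   case False
   thus ?thesis using d t in_graph_bounds[OF rproj_in_graph, of z u] by linarith
  qed
 qed
 show ?thesis using *[of y z] *[of z y] by (simp add: abs_le_iff dist_commute)
qed

lemma continuous_rproj: "continuous_on S rproj"
proof (rule continuous_on_coords)
 fix u show "continuous_on S (%y. rproj y u)"
  unfolding continuous_on_iff
 proof (intro ballI allI impI)
  fix x e assume "0 < (e::real)"
  thus "EX d>0. ALL x':S. dist x' x < d --> dist (rproj x' u) (rproj x u) < e"
   using rproj_dist le_less_trans unfolding dist_real_def by (intro exI[of _ e]) blast
 qed
qed

section \<open>Uniqueness and existence of lifts\<close>

lemma rproj_inj_near:
 assumes "dist y z < 1/2" shows "rlift (rnear y) (rproj z) = z" "0 < rproj z (last (rnear y))"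
proof -
 have "dist z (rmk (rnear y) 1) <= dist y z + dist y (rmk (rnear y) 1)"
  using dist_triangle[of z "rmk (rnear y) 1" y] by (simp add: dist_commute)
 also have "... < 1" using assms dist_rnear[of y] by simp
 finally have "dist z (rmk (rnear y) 1) < 1" .
 from rstar[OF rnear_props(1,2) this] show "rlift (rnear y) (rproj z) = z" "0 < rproj z (last (rnear y))" by auto
qed

text \<open>Points closer than 1/2 lie in a common chart, so two lifts that are this close agree.
  The set of agreement is therefore open as well as closed.\<close>

lemma rlift_unique:
 fixes F G :: "'z::topological_space => rtree"
 assumes "connected Z" "continuous_on Z F" "continuous_on Z G" "!!z. z : Z ==> rproj (F z) = rproj (G z)"
  and "z0 : Z" "F z0 = G z0" "z : Z"
 shows "F z = G z"
proof -
 let ?E = "{z : Z. F z = G z}"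
 have cont: "continuous_on Z (%z. dist (F z) (G z))" by (intro continuous_intros assms)
 have E1: "?E = {z : Z. dist (F z) (G z) : {0}}" by auto
 have cl: "closedin (top_of_set Z) ?E"
  unfolding E1 using continuous_closedin_preimage[OF cont, of "{0}"] by (simp add: vimage_def Int_def conj_commute)
 have E2: "?E = {z : Z. dist (F z) (G z) : {..<1/2}}"
 proof -
  have "F z = G z" if "z : Z" "dist (F z) (G z) < 1/2" for z
   using rproj_inj_near(1)[OF that(2)] rproj_inj_near(1)[of "F z" "F z"] assms(4)[OF that(1)] by simp
  thus ?thesis by auto
 qed
 have op: "openin (top_of_set Z) ?E"
  unfolding E2 using continuous_openin_preimage_gen[OF cont, of "{..<1/2}"] by (simp add: vimage_def Int_def conj_commute)
 have "?E = {} | ?E = Z" using assms(1) cl op unfolding connected_clopen by blast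
 thus ?thesis using assms by blast
qed

definition rstep :: "rtree => (nat => real) => rtree" where
 "rstep y x = rlift (rnear y) x"

text \<open>The nearest vertices of \<open>y\<close> and \<open>z\<close> are equal or adjacent, and
  then \<open>rlift_edge\<close> identifies their charts at \<open>x\<close>. The constants leave
  room: a weight of at least 1/2 at \<open>y\<close> is at least 3/8 at \<open>z\<close> and still
  positive at \<open>x\<close>.\<close>

lemma rstep_local:
 assumes d: "dist y z <= 1/8" and x: "in_graph x" "!!u. abs (rproj z u - x u) < 1/4"
 shows "rstep z x = rlift (rnear y) x" "0 < x (last (rnear y))" "0 < x (last (rnear z))"
proof -
 let ?w = "rnear y" and ?v = "rnear z"
 have hy: "1/2 <= rproj y (last ?w)" and hz: "1/2 <= rproj z (last ?v)" using rnear_props(3) by auto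
 have pz: "3/8 <= rproj z (last ?w)" using hy rproj_dist[of y "last ?w" z] d by linarith
 show xw: "0 < x (last ?w)" using pz x(2)[of "last ?w"] by linarith
 show xv: "0 < x (last ?v)" using hz x(2)[of "last ?v"] by linarith
 note w = rnear_props(1,2)[of y] and v = rnear_props(1,2)[of z] and g = rproj_in_graph[of z]
 have c: "tree_code ?v 1" "tree_code ?w 1" using w v by (auto simp: tree_code_def)
 have zv: "dist z (rmk ?v 1) = 1 - rproj z (last ?v)" "dist z (rmk ?w 1) = 1 - rproj z (last ?w)"
  using dist_rlift_vertex[OF v g] rnear_props(4)[of z] hz
   dist_rlift_vertex[OF w g] rproj_inj_near(1)[of y z] d pz by auto
 \<comment> \<open>If the two vertices differ, \<open>z\<close> lies on an edge between their images
   and the two weights add up to 1; otherwise the weight, being at least 1/2, is counted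
   twice.\<close>
 have "1 <= rproj z (last ?v) + rproj z (last ?w)"
 proof (cases "last ?v = last ?w")
  case True
  thus ?thesis using hz by simp
 next
  case False
  have pzw: "0 < rproj z (last ?w)" and pzv: "0 < rproj z (last ?v)" using pz hz by auto
  have n1: "rproj z (last ?w) ~= 1" using in_graph_one[OF g, of "last ?w"] False pzv by auto
  have o: "last ?v = other (last ?w) (rproj z)" using in_graph_other(4)[OF g pzw n1 False pzv] .
  show ?thesis using in_graph_other(3)[OF g pzw n1] o by simp
 qed
 moreover have "dist (rmk ?v 1) (rmk ?w 1) <= dist z (rmk ?v 1) + dist z (rmk ?w 1)"
  using dist_triangle[of "rmk ?v 1" "rmk ?w 1" z] by (simp add: dist_commute)
 ultimately have le1: "dist (rmk ?v 1) (rmk ?w 1) <= 1" using zv by simp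
 let ?l = "lcp ?v ?w"
 have D: "dist (rmk ?v 1) (rmk ?w 1) = (length ?v - ?l) + (length ?w - ?l)"
  using c lcp_le[of ?v ?w] by (auto simp: dist_rtree_def rov_def of_nat_diff)
 with le1 lcp_le[of ?v ?w] have "length ?v - ?l + (length ?w - ?l) <= 1" by linarith
 then consider "length ?v = ?l" "length ?w = ?l" | "length ?v = ?l" "length ?w = Suc ?l" | "length ?v = Suc ?l" "length ?w = ?l"
  using lcp_le[of ?v ?w] by linarith
 hence "rlift ?v x = rlift ?w x"
 proof cases
  case 1
  hence "?v = ?w" using lcp_full[of ?v ?w] by simp
  thus ?thesis by simp
 next
  case 2
  hence "take (length ?v) ?w = ?v" using lcp_full[of ?v ?w] by simp
  hence "?w = ?v @ [last ?w]" using 2 w(2) by (metis append_butlast_last_id butlast_conv_take diff_Suc_1)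
  from rlift_edge[OF v this w(1) x(1) xv xw] show ?thesis .
 next
  case 3
  hence "take (length ?w) ?v = ?w" using lcp_full[of ?w ?v] by (simp add: lcp_commute[of ?w])
  hence "?v = ?w @ [last ?v]" using 3 v(2) by (metis append_butlast_last_id butlast_conv_take diff_Suc_1)
  from rlift_edge[OF w this v(1) x(1) xw xv] show ?thesis by simp
 qed
 thus "rstep z x = rlift ?w x" by (simp add: rstep_def)
qed

lemma rproj_rstep:
 assumes "in_graph x" "!!u. abs (rproj z u - x u) < 1/4"
 shows "rproj (rstep z x) = x"
 unfolding rstep_def using rstep_local(2)[of z z x] assms rnear_props(1,2)
 by (intro rproj_rlift) auto

text \<open>Continuity of local lifting: only the other vertex of the edge containing \<open>x\<close> matters near \<open>x\<close>,
 and near a vertex both points are close to that vertex.\<close>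

lemma rlift_continuous_at:
 fixes ph :: "'z::topological_space => nat => real"
 assumes w: "reduced w" "w ~= []" and Z: "z0 : Z" "continuous_on Z ph" "!!z. z : Z ==> in_graph (ph z)"
  and p: "!!z. z : Z ==> 0 < ph z (last w)"
 shows "((%z. rlift w (ph z)) \<longlongrightarrow> rlift w (ph z0)) (at z0 within Z)"
proof -
 have lim: "((%z. ph z u) \<longlongrightarrow> ph z0 u) (at z0 within Z)" for u
  using continuous_on_coord[OF Z(2), of u] Z(1) by (simp add: continuous_on_def)
 have inZ: "\<forall>\<^sub>F z in at z0 within Z. z : Z" by (simp add: eventually_at_filter)
 show ?thesis
 proof (cases "ph z0 (last w) = 1")
  case True
  have "ph z0 = (%i. if i = last w then 1 else 0)" using in_graph_one[OF Z(3)[OF Z(1)] True] .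
  hence r0: "rlift w (ph z0) = rmk w 1" by (simp add: rlift_def)
  have "((%z. 1 - ph z (last w)) \<longlongrightarrow> 0) (at z0 within Z)"
   using tendsto_diff[OF tendsto_const lim, of 1 "last w"] True by simp
  moreover have "\<forall>\<^sub>F z in at z0 within Z. dist (rlift w (ph z)) (rlift w (ph z0)) = 1 - ph z (last w)"
   using inZ by eventually_elim (use r0 dist_rlift_vertex[OF w Z(3) p] in auto)
  ultimately show ?thesis unfolding tendsto_dist_iff[of _ "rlift w (ph z0)"] by (simp cong: filterlim_cong)
 next
  case False
  note g = Z(3)[OF Z(1)] and p0 = p[OF Z(1)]
  define u where "u = other (last w) (ph z0)"
  have u: "u ~= last w" "0 < ph z0 u" using in_graph_other(1,2)[OF g p0 False] by (auto simp: u_def)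
  have "\<forall>\<^sub>F z in at z0 within Z. 0 < ph z u" using order_tendstoD(1)[OF lim u(2)] .
  with inZ have "\<forall>\<^sub>F z in at z0 within Z. dist (rlift w (ph z)) (rlift w (ph z0)) = abs (ph z (last w) - ph z0 (last w))"
   by eventually_elim (use dist_rlift_same[OF w Z(3) p g p0 u(1) _ u(2)] in auto)
  moreover have "((%z. abs (ph z (last w) - ph z0 (last w))) \<longlongrightarrow> 0) (at z0 within Z)"
   using tendsto_rabs[OF tendsto_diff[OF lim tendsto_const], of "last w" "ph z0 (last w)"] by simp
  ultimately show ?thesis unfolding tendsto_dist_iff[of _ "rlift w (ph z0)"] by (simp cong: filterlim_cong)
 qed
qed

text \<open>Although \<open>rnear (G z)\<close> jumps, \<open>rstep_local\<close> allows the chart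
  at \<open>rnear (G z0)\<close> to be used for all \<open>z\<close> near \<open>z0\<close>.\<close>

lemma rstep_continuous:
 fixes G :: "'z::metric_space => rtree"
 assumes G: "continuous_on Z G" and ph: "continuous_on Z ph" "!!z. z : Z ==> in_graph (ph z)"
  and close: "!!z u. z : Z ==> abs (rproj (G z) u - ph z u) < 1/4"
 shows "continuous_on Z (%z. rstep (G z) (ph z))"
 unfolding continuous_on_def
proof
 fix z0 assume z0: "z0 : Z"
 let ?w = "rnear (G z0)"
 let ?U = "{z : Z. dist (G z0) (G z) < 1/8}"
 have U: "z : ?U ==> rstep (G z) (ph z) = rlift ?w (ph z) & 0 < ph z (last ?w)" for z
  using rstep_local(1,2)[of "G z0" "G z" "ph z"] ph(2) close by auto
 have z0U: "z0 : ?U" using z0 by simp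
 have cG: "continuous_on Z (%z. dist (G z0) (G z))" by (intro continuous_intros G)
 have "openin (top_of_set Z) ?U"
  using continuous_openin_preimage_gen[OF cG, of "{..<1/8}"] by (simp add: vimage_def Int_def conj_commute)
 then obtain T where T: "open T" "?U = T Int Z" by (auto simp: openin_open)
 have "((%z. rlift ?w (ph z)) \<longlongrightarrow> rlift ?w (ph z0)) (at z0 within ?U)"
  by (rule rlift_continuous_at[OF rnear_props(1,2)]) (use z0U U ph in "auto intro: continuous_on_subset")
 moreover have "\<forall>\<^sub>F z in at z0 within ?U. rlift ?w (ph z) = rstep (G z) (ph z)"
  using U by (simp add: eventually_at_filter)
 ultimately have "((%z. rstep (G z) (ph z)) \<longlongrightarrow> rlift ?w (ph z0)) (at z0 within ?U)"
  using tendsto_cong[of "%z. rlift ?w (ph z)" "%z. rstep (G z) (ph z)" "at z0 within ?U"] by simp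
 hence "((%z. rstep (G z) (ph z)) \<longlongrightarrow> rstep (G z0) (ph z0)) (at z0 within ?U)"
  using U[OF z0U] by simp
 moreover have "at z0 within ?U = at z0 within Z"
  by (rule at_within_nhd[of _ T]) (use T z0U in auto)
 ultimately show "((%z. rstep (G z) (ph z)) \<longlongrightarrow> rstep (G z0) (ph z0)) (at z0 within Z)" by simp
qed

text \<open>The lift is built by following the contraction \<open>c\<close> in small steps.\<close>

lemma rlift_exists:
 fixes c :: "'z::metric_space \<times> real => 'z" and ph :: "'z => nat => real"
 assumes Z: "compact Z" "z0 : Z"
  and c: "continuous_on (Z \<times> {0..1}) c" "!!z t. z : Z ==> t : {0..1} ==> c (z, t) : Z"
   "!!z. z : Z ==> c (z, 0) = z0" "!!z. z : Z ==> c (z, 1) = z" "!!t. t : {0..1} ==> c (z0, t) = z0"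
  and ph: "continuous_on Z ph" "!!z. z : Z ==> in_graph (ph z)" "!!z u. z : Z ==> V <= u ==> ph z u = 0"
  and y0: "rproj y0 = ph z0"
 obtains F where "continuous_on Z F" "!!z. z : Z ==> rproj (F z) = ph z" "F z0 = y0"
proof -
 define psi where "psi = ph o c"
 have cp: "compact (Z \<times> {0..1::real})" using Z by (intro compact_Times) auto
 have psi: "continuous_on (Z \<times> {0..1}) psi"
  unfolding psi_def by (intro continuous_on_compose c continuous_on_subset[OF ph(1)]) (use c(2) in auto)
 have "EX d>0. ALL p:Z \<times> {0..1}. ALL q:Z \<times> {0..1}. dist q p < d --> abs (psi q u - psi p u) < 1/4" for u
  using compact_uniformly_continuous[OF continuous_on_coord[OF psi, of u] cp]
  unfolding uniformly_continuous_on_def dist_real_def by (elim allE[of _ "1/4"]) simp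
 then obtain d where d: "!!u. 0 < d u" "!!u p q. p : Z \<times> {0..1} ==> q : Z \<times> {0..1} ==> dist q p < d u ==> abs (psi q u - psi p u) < 1/4"
  by metis
 \<comment> \<open>Continuity into the function space is coordinatewise, so each coordinate has its
   own modulus. The coordinates from \<open>V\<close> on vanish, hence a minimum over finitely many
   moduli suffices.\<close>
 define e where "e = Min (insert 1 (d ` {..<V}))"
 have e: "0 < e" "!!u. u < V ==> e <= d u" using d(1) by (auto simp: e_def)
 obtain N :: nat where N: "N > 0" "1 / N < e" using reals_Archimedean[OF e(1)] by (metis inverse_eq_divide zero_less_Suc)
 define F where "F = rec_nat (%z. y0) (%i f z. rstep (f z) (psi (z, real (Suc i) / N)))"
 have FS: "F (Suc i) z = rstep (F i z) (psi (z, real (Suc i) / N))" and F0: "F 0 z = y0" for i z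
  by (simp_all add: F_def)
 have near: "abs (psi (z, real i / N) u - psi (z, real (Suc i) / N) u) < 1/4" if "z : Z" "Suc i <= N" for z i u
 proof (cases "u < V")
  case True
  have "dist (z, real i / N) (z, real (Suc i) / N) = 1 / N"
   by (simp add: dist_Pair_Pair dist_real_def flip: diff_divide_distrib)
  thus ?thesis using d(2)[of "(z, real (Suc i) / N)" "(z, real i / N)" u] e(2)[OF True] N that by simp
 next
  case False
  have "psi (z, real i / N) u = 0" "psi (z, real (Suc i) / N) u = 0"
   unfolding psi_def o_def by (intro ph(3) c(2); use that N False in simp)+
  thus ?thesis by simp
 qed
 have main: "continuous_on Z (F i) & (ALL z:Z. rproj (F i z) = psi (z, real i / N)) & F i z0 = y0" if "i <= N" for i
  using that
 proof (induction i)
  case 0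
  thus ?case using c(3) y0 by (auto simp: F0 psi_def)
 next
  case (Suc i)
  hence IH: "continuous_on Z (F i)" "!!z. z : Z ==> rproj (F i z) = psi (z, real i / N)" "F i z0 = y0" by auto
  have t: "real (Suc i) / N : {0..1}" using Suc.prems N by simp
  have g: "in_graph (psi (z, real (Suc i) / N))" if "z : Z" for z
   unfolding psi_def o_def by (intro ph(2) c(2) that t)
  have cl: "abs (rproj (F i z) u - psi (z, real (Suc i) / N) u) < 1/4" if "z : Z" for z u
   using near[OF that Suc.prems] IH(2)[OF that] by simp
  have "continuous_on Z (%z. psi (z, real (Suc i) / N))"
   by (rule continuous_on_compose2[OF psi]) (use t in "auto intro!: continuous_intros")
  from rstep_continuous[OF IH(1) this g cl] have "continuous_on Z (F (Suc i))" unfolding FS .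
  moreover have "rproj (F (Suc i) z) = psi (z, real (Suc i) / N)" if "z : Z" for z
   unfolding FS by (rule rproj_rstep[OF g[OF that] cl[OF that]])
  moreover have "F (Suc i) z0 = y0"
   using c(5)[OF t] y0 rnear_props(4)[of y0] IH(3) by (simp add: FS psi_def rstep_def)
  ultimately show ?case by blast
 qed
 have "rproj (F N z) = ph z" if "z : Z" for z
  using main[of N] that N c(4) by (simp add: psi_def)
 thus ?thesis using that[of "F N"] main[of N] by auto
qed

section \<open>Ancestors at a given height, and connected subsets of the forest\<close>

definition ranc :: "rtree => real => rtree" where
 "ranc y r = rmk (take (nat \<lceil>r\<rceil>) (rword y)) (r - (real (nat \<lceil>r\<rceil>) - 1))"

lemma ranc_code:
 assumes "1 <= r" "r <= rht y"
 shows "tree_code (take (nat \<lceil>r\<rceil>) (rword y)) (r - (real (nat \<lceil>r\<rceil>) - 1))"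
  "nat \<lceil>r\<rceil> <= length (rword y)" "1 <= nat \<lceil>r\<rceil>" "r <= real (nat \<lceil>r\<rceil>)"
proof -
 show k: "nat \<lceil>r\<rceil> <= length (rword y)" using assms rht_le[of y] by linarith
 show k1: "1 <= nat \<lceil>r\<rceil>" using assms(1) by linarith
 show k2: "r <= real (nat \<lceil>r\<rceil>)" by linarith
 have k3: "real (nat \<lceil>r\<rceil>) - 1 < r" using assms(1) by linarith
 have "r = 1" if "nat \<lceil>r\<rceil> = 1" using that k2 assms(1) by simp
 thus "tree_code (take (nat \<lceil>r\<rceil>) (rword y)) (r - (real (nat \<lceil>r\<rceil>) - 1))"
  using k k1 k2 k3 reduced_take[OF reduced_rword] unfolding tree_code_def by auto
qed

lemma rht_ranc: "1 <= r ==> r <= rht y ==> rht (ranc y r) = r"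
 using ranc_code[of r y] by (simp add: ranc_def)

lemma rov_ranc: "1 <= r ==> r <= rht y ==> rov (ranc y r) z = min r (rov y z)"
 using ranc_code[of r y] rht_ranc[of r y] unfolding rov_def
 by (auto simp: ranc_def lcp_take min_def intro: order_trans[OF le_of_int_ceiling])

lemma dist_ranc:
 assumes "1 <= r" "r <= rht y" "1 <= s" "s <= rht z"
 shows "dist (ranc y r) (ranc z s) = r + s - 2 * min r (min s (rov y z))"
 using assms by (simp add: dist_rtree_def rht_ranc rov_ranc rov_commute[of y "ranc z s"] rov_commute[of z y])

lemma ranc_full: "ranc y (rht y) = y"
proof -
 have "nat \<lceil>rht y\<rceil> = length (rword y)" using rht_le[of y] rht_gt[of y] by linarith
 thus ?thesis by (simp add: ranc_def rht_def)
qed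

lemma ranc_eqI:
 assumes "1 <= r" "r <= rov y z" shows "ranc y r = ranc z r"
proof -
 have "dist (ranc y r) (ranc z r) = 0"
  using assms rov_le[of y z] by (subst dist_ranc) auto
 thus ?thesis by simp
qed

lemma continuous_ranc:
 fixes G :: "'z::topological_space => rtree"
 assumes "continuous_on Z G" "continuous_on Z R" "!!z. z : Z ==> 1 <= R z & R z <= rht (G z)"
 shows "continuous_on Z (%z. ranc (G z) (R z))"
 unfolding continuous_on_def
proof
 fix z0 assume z0: "z0 : Z"
 have b: "dist (ranc (G z) (R z)) (ranc (G z0) (R z0)) <= abs (R z - R z0) + dist (G z) (G z0)" if "z : Z" for z
  using assms(3)[OF that] assms(3)[OF z0] rov_le[of "G z" "G z0"]
  by (auto simp: dist_ranc dist_rtree_def[of "G z"] min_def)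
 have "((%z. abs (R z - R z0) + dist (G z) (G z0)) \<longlongrightarrow> abs (R z0 - R z0) + dist (G z0) (G z0)) (at z0 within Z)"
  using assms(1,2) z0 by (intro tendsto_intros) (auto simp: continuous_on_def)
 hence "((%z. abs (R z - R z0) + dist (G z) (G z0)) \<longlongrightarrow> 0) (at z0 within Z)" by simp
 hence "((%z. dist (ranc (G z) (R z)) (ranc (G z0) (R z0))) \<longlongrightarrow> 0) (at z0 within Z)"
  by (rule tendsto_sandwich[OF _ _ tendsto_const, rotated 2]) (use b in "auto simp: eventually_at_filter")
 thus "((%z. ranc (G z) (R z)) \<longlongrightarrow> ranc (G z0) (R z0)) (at z0 within Z)"
  using tendsto_dist_iff by blast
qed

lemma continuous_rov: "continuous_on S (%z. rov z y)"
 unfolding rov_dist by (intro continuous_intros continuous_rht continuous_on_id) auto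

text \<open>No overlap lies strictly between 0 and 1. The overlap with a fixed point is continuous,
  so a connected set cannot contain points with different first letters.\<close>

lemma rov_connected:
 assumes "connected K" "y : K" "z : K" shows "1 <= rov y z"
proof -
 have cases: "rov u v = 0 | 1 <= rov u v" for u v
 proof (cases "lcp (rword u) (rword v) = 0")
  case True
  thus ?thesis using rht_ge1[of u] rht_ge1[of v] by (simp add: rov_def)
 next
  case False
  thus ?thesis using rht_ge1[of u] rht_ge1[of v] by (simp add: rov_def)
 qed
 show ?thesis
 proof (rule ccontr)
  assume "~ 1 <= rov y z"
  hence z: "rov z y = 0" using cases[of y z] rov_commute by metis
  have y: "rov y y >= 1" using rht_ge1 by simp
  have "connected ((%u. rov u y) ` K)" by (rule connected_continuous_image[OF continuous_rov assms(1)])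
  hence "1/2 : (%u. rov u y) ` K"
   using connected_contains_Icc[of "(%u. rov u y) ` K" "rov z y" "rov y y"] imageI[OF assms(2), of "%u. rov u y"]
    imageI[OF assms(3), of "%u. rov u y"] z y by auto
  then obtain u where "rov u y = 1/2" by auto
  thus False using cases[of u y] by simp
 qed
qed

text \<open>A point on the way from \<open>y\<close> down to the branch point separates
  \<open>y\<close> from \<open>z\<close>: once it is removed, the points whose overlap with
  \<open>y\<close> exceeds \<open>r\<close> and the remaining points form two open sets.\<close>

lemma ranc_in_connected:
 assumes K: "connected K" "y : K" "z : K" and r: "rov y z <= r" "r <= rht y"
 shows "ranc y r : K"
proof (rule ccontr)
 assume a: "ranc y r ~: K"
 let ?a = "ranc y r"
 have r1: "1 <= r" using rov_connected[OF K] r by simp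
 have ry: "r < rht y" using a K r ranc_full[of y] by (cases "r = rht y") auto
 let ?U = "{x. r < rov x y}" and ?V = "{x. rov x y <= r & x ~= ?a}"
 have oU: "open ?U" using continuous_rov[of UNIV y] by (intro open_Collect_less) (auto intro: continuous_intros)
 have oV: "open ?V"
  unfolding open_dist
 proof (intro ballI)
  fix x assume x: "x : ?V"
  show "EX e>0. ALL x'. dist x' x < e --> x' : ?V"
  proof (intro exI conjI allI impI)
   show "0 < dist x ?a" using x by simp
   fix x' assume d: "dist x' x < dist x ?a"
   have "x' ~= ?a" using d by (auto simp: dist_commute)
   moreover have "rov x' y <= r"
   proof (rule ccontr)
    assume n: "~ rov x' y <= r"
    have "rov x ?a = rov x y"
     using x rov_ranc[OF r1 r(2), of x] by (simp add: rov_commute)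
    hence da: "dist x ?a = rht x + r - 2 * rov x y" using rht_ranc[OF r1 r(2)] by (simp add: dist_rtree_def)
    have "rov x' x = (rht x' + rht x - dist x' x) / 2" by (rule rov_dist)
    hence "rov x' x > (rht x' - r) / 2 + rov x y" using d da by (simp add: field_simps)
    moreover have "rht x' > r" using n rov_le(1)[of x' y] by simp
    ultimately have "rov x' x > rov x y" by (simp add: field_simps)
    hence "rov x y < min (rov x x') (rov x' y)" using n x by (simp add: rov_commute)
    thus False using rov_ultra[of x x' y] by linarith
   qed
   ultimately show "x' : ?V" by simp
  qed
 qed
 have "K <= ?U Un ?V" using a by auto
 moreover have "y : ?U Int K" using ry K by simp
 moreover have "z : ?V Int K" using K r a by (auto simp: rov_commute)
 moreover have "?U Int ?V Int K = {}" by auto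
 ultimately show False using connectedD[OF K(1) oU oV] by blast
qed

text \<open>Both sets contain the two branches from \<open>y\<close> and \<open>z\<close> down to
  their common point at height \<open>rov y z\<close>, so these branches connect \<open>y\<close>
  and \<open>z\<close> inside the intersection.\<close>

lemma connected_Int_rtree:
 fixes K L :: "rtree set"
 assumes "connected K" "connected L" shows "connected (K Int L)"
 unfolding connected_iff_connected_component
proof (intro ballI)
 fix y z assume yz: "y : K Int L" "z : K Int L"
 let ?o = "rov y z"
 have o1: "1 <= ?o" using rov_connected[OF assms(1)] yz by blast
 let ?A = "ranc y ` {?o..rht y}" and ?B = "ranc z ` {?o..rht z}"
 have "connected ?A" by (intro connected_continuous_image continuous_ranc continuous_intros) (use o1 in auto)
 moreover have "connected ?B" by (intro connected_continuous_image continuous_ranc continuous_intros) (use o1 in auto)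
 moreover have "ranc y ?o = ranc z ?o" by (rule ranc_eqI[OF o1 order_refl])
 hence "?A Int ?B ~= {}" using rov_le[of y z] by force
 ultimately have "connected (?A Un ?B)" by (rule connected_Un)
 moreover have "?A <= K Int L"
  using ranc_in_connected[OF assms(1), of y z] ranc_in_connected[OF assms(2), of y z] yz by auto
 moreover have "?B <= K Int L"
  using ranc_in_connected[OF assms(1), of z y] ranc_in_connected[OF assms(2), of z y] yz by (auto simp: rov_commute[of z y])
 moreover have "y : ?A" using ranc_full[of y] rov_le[of y z] by (metis atLeastAtMost_iff image_eqI order_refl)
 moreover have "z : ?B" using ranc_full[of z] rov_le[of y z] by (metis atLeastAtMost_iff image_eqI order_refl)
 ultimately show "connected_component (K Int L) y z" unfolding connected_component_def
  by (intro exI[of _ "?A Un ?B"] conjI Un_least) (assumption | rule UnI1 UnI2, assumption)+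
qed

text \<open>Here \<open>F\<close> lifts a map to a graph and \<open>F'\<close> lifts its composition
  with \<open>G\<close>. The point is that \<open>F'\<close> factors through \<open>F\<close>: the
  map \<open>G o rproj\<close> is lifted over a contractible piece of the tree containing the image
  of \<open>F\<close>, and uniqueness of lifts identifies the composition with
  \<open>F'\<close>.\<close>

lemma rlift_compatible:
 fixes F F' :: "'z::metric_space => rtree" and G :: "(nat => real) => nat => real"
 assumes Z: "compact Z" "connected Z" "z0 : Z" and F: "continuous_on Z F" "continuous_on Z F'"
  and G: "continuous_on Ga G" "!!x. x : Ga ==> in_graph (G x)" "!!x u. x : Ga ==> V <= u ==> G x u = 0"
  and Ga: "!!x x'. x : Ga ==> in_graph x' ==> (!!u. 0 < x' u ==> 0 < x u) ==> x' : Ga"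
  and p: "!!z. z : Z ==> rproj (F z) : Ga" "!!z. z : Z ==> rproj (F' z) = G (rproj (F z))"
  and base: "in_graph x0" "0 < x0 v0" "F z0 = rlift [v0] x0"
  and eq: "z : Z" "z' : Z" "F z = F z'"
 shows "F' z = F' z'"
proof -
 define H where "H = (%y t. 1 + t * (rht y - 1))"
 have H: "1 <= H y t" "H y t <= rht y" if "t : {0..1}" for y t
  using that rht_ge1[of y] mult_right_mono[of t 1 "rht y - 1"] by (auto simp: H_def)
 have H01: "H y 0 = 1" "H y 1 = rht y" for y by (simp_all add: H_def)
 \<comment> \<open>All ancestors of points in the image of \<open>F\<close>. Lowering heights
   contracts this compact set to the root \<open>rh\<close>.\<close>
 define M where "M = (%(z, t). ranc (F z) (H (F z) t)) ` (Z \<times> {0..1})"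
 have FM: "F z : M" if "z : Z" for z
  unfolding M_def by (rule image_eqI[of _ _ "(z, 1)"]) (use that in "auto simp: H01 ranc_full")
 have Frt: "1 <= rov (F z) (F z0)" if "z : Z" for z
  using rov_connected[OF connected_continuous_image[OF F(1) Z(2)]] that Z(3) by blast
 let ?y0 = "F z0"
 define rh where "rh = ranc ?y0 1"
 have root: "ranc (F z) 1 = rh" if "z : Z" for z unfolding rh_def by (rule ranc_eqI[OF _ Frt[OF that]]) simp
 have rhM: "rh : M" unfolding M_def by (rule image_eqI[of _ _ "(z0, 0)"]) (use Z in "auto simp: H01 rh_def")
 have contF: "continuous_on (Z \<times> {0..1}) (%p. F (fst p))"
  by (rule continuous_on_compose2[OF F(1)]) (auto intro: continuous_intros)
 have cM: "compact M"
  unfolding M_def case_prod_beta H_def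
  by (intro compact_continuous_image compact_Times Z compact_Icc continuous_ranc contF)
   (use H in "auto intro!: continuous_intros continuous_on_compose2[OF continuous_rht[of UNIV] contF] simp: H_def")
 \<comment> \<open>Ancestors below the image of \<open>F\<close> are ancestors of the base lift.
   This lift lies in the star of a one-letter word, so they lie on the same edge, and
   \<open>Ga\<close> contains them by its closure under smaller supports.\<close>
 have near0: "rproj (ranc ?y0 r) u > 0 ==> rproj ?y0 u > 0" if r: "1 <= r" "r <= rht ?y0" for r u
 proof -
  let ?w = "rword ?y0"
  have red: "reduced [v0]" by (simp add: reduced_def)
  have l2: "length ?w <= 2 & (length ?w = 2 --> rfrac ?y0 < 1)"
   by (rule rlift_cases[of "[v0]" x0]) (use base red in_graph_other(3)[OF base(1,2)] in auto)
  have c: "tree_code (take (nat \<lceil>r\<rceil>) ?w) (r - (real (nat \<lceil>r\<rceil>) - 1))" by (rule ranc_code[OF r])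
  assume pos: "rproj (ranc ?y0 r) u > 0"
  show "rproj ?y0 u > 0"
  proof (cases "length ?w = 1")
   case True
   hence "rht ?y0 = 1" using rht_ge1[of ?y0] rht_le[of ?y0] by simp
   hence "ranc ?y0 r = ?y0" using r ranc_full[of ?y0] by simp
   thus ?thesis using pos by simp
  next
   case False
   then obtain v b where w: "?w = [v, b]" using conjunct1[OF l2] rword_ne[of ?y0]
    by (cases ?w; cases "tl ?w"; cases "tl (tl ?w)") auto
   have "1 > rfrac ?y0" using l2 w by simp
   hence pp: "rproj ?y0 v > 0" "rproj ?y0 b > 0"
    using rfrac_pos[of ?y0] by (auto simp: rproj_def w)
   have "u = v | u = b"
   proof (cases "nat \<lceil>r\<rceil> = 1")
    case True
    hence "r = 1" using r by linarith
    thus ?thesis using pos c by (simp add: ranc_def rproj_rmk w split: if_splits)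
   next
    case False
    hence "take (nat \<lceil>r\<rceil>) ?w = [v, b]" using ranc_code(3)[OF r] by (simp add: w)
    thus ?thesis using pos c by (simp add: ranc_def rproj_rmk split: if_splits)
   qed
   thus ?thesis using pp by blast
  qed
 qed
 have y0Ga: "rproj (ranc ?y0 r) : Ga" if r: "1 <= r" "r <= rht ?y0" for r
  by (rule Ga[OF p(1)[OF Z(3)] rproj_in_graph near0[OF r]])
 have MGa: "rproj a : Ga" if aM: "a : M" for a
 proof -
  obtain x t where x: "x : Z" "t : {0..1}" and a: "a = ranc (F x) (H (F x) t)" using aM by (auto simp: M_def)
  let ?r = "H (F x) t"
  have r: "1 <= ?r" "?r <= rht (F x)" using H x by auto
  show ?thesis
  proof (cases "rov (F x) ?y0 <= ?r")
   case True
   have "a : F ` Z" unfolding a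
    by (rule ranc_in_connected[OF connected_continuous_image[OF F(1) Z(2)] _ _ True r(2)]) (use x Z in auto)
   thus ?thesis using p(1) by auto
  next
   case False
   hence "a = ranc ?y0 ?r" unfolding a by (intro ranc_eqI r(1)) simp
   thus ?thesis using y0Ga[OF r(1)] False rov_le(2)[of "F x" ?y0] by simp
  qed
 qed
 have cGM: "continuous_on M (%a. G (rproj a))"
  by (rule continuous_on_compose2[OF G(1) continuous_rproj]) (use MGa in auto)
 \<comment> \<open>The lift over \<open>M\<close> is to be prescribed at the root, whereas
   \<open>F'\<close> is known at \<open>z0\<close>. Lifting the path from \<open>F z0\<close> to the
   root transfers the base value.\<close>
 define P where "P = (%t. ranc ?y0 (H ?y0 (1 - t)))"
 have P: "continuous_on {0..1} P" "P t : M" "P 0 = ?y0" "P 1 = rh" if "t : {0..1}" for t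
 proof -
  show "continuous_on {0..1} P" unfolding P_def
   by (intro continuous_ranc continuous_intros) (use H in "auto simp: H_def intro!: continuous_intros")
  show "P t : M" unfolding M_def P_def by (rule image_eqI[of _ _ "(z0, 1 - t)"]) (use that Z in auto)
 qed (auto simp: P_def H01 ranc_full rh_def)
 have P': "continuous_on {0..1} P" "P 0 = ?y0" "P 1 = rh" using P[of 0] by auto
 obtain Q where Q: "continuous_on {0..1} Q" "!!t. t : {0..1} ==> rproj (Q t) = G (rproj (P t))" "Q 0 = F' z0"
 proof (rule rlift_exists[of "{0..1::real}" 0 "%(z, t). t * z" "%t. G (rproj (P t))" V "F' z0"])
  show "continuous_on ({0..1} \<times> {0..1}) (%(z, t). t * z :: real)" unfolding case_prod_beta by (intro continuous_intros)
  show "continuous_on {0..1} (%t. G (rproj (P t)))"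
   by (rule continuous_on_compose2[OF cGM P'(1)]) (use P in auto)
  show "rproj (F' z0) = G (rproj (P 0))" using p(2)[OF Z(3)] P' by simp
  show "in_graph (G (rproj (P z)))" if "z : {0..1}" for z using G(2) MGa P that by blast
  show "G (rproj (P z)) u = 0" if "z : {0..1}" "V <= u" for z u using G(3) MGa P that by blast
 qed (auto intro: mult_le_one)
 define yr where "yr = Q 1"
 have M1: "ranc a 1 = rh" "ranc a (H a t) : M" if a: "a : M" and t: "t : {0..1}" for a t
 proof -
  obtain x s where x: "x : Z" "s : {0..1}" and ax: "a = ranc (F x) (H (F x) s)" using a by (auto simp: M_def)
  let ?r = "H (F x) s"
  have r: "1 <= ?r" "?r <= rht (F x)" using H x by auto
  have ha: "rht a = ?r" unfolding ax by (rule rht_ranc[OF r])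
  have e: "ranc a q = ranc (F x) q" if "1 <= q" "q <= ?r" for q
   by (rule ranc_eqI[OF that(1)]) (use r that in "simp add: ax rov_ranc")
  show "ranc a 1 = rh" using e[of 1] r root[OF x(1)] by simp
  let ?q = "H a t"
  have q: "1 <= ?q" "?q <= ?r" using H[OF t, of a] ha by auto
  show "ranc a ?q : M"
  proof (cases "rht (F x) = 1")
   case True
   hence "?q = 1" using q r by simp
   thus ?thesis using e[of 1] r root[OF x(1)] rhM by simp
  next
   case False
   hence g: "rht (F x) - 1 > 0" using rht_ge1[of "F x"] by simp
   let ?s = "(?q - 1) / (rht (F x) - 1)"
   have "?s : {0..1}" using g q r by auto
   moreover have "H (F x) ?s = ?q" using g by (simp add: H_def)
   ultimately show ?thesis unfolding e[OF q] M_def using x(1)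
    by (intro image_eqI[of _ _ "(x, ?s)"]) auto
  qed
 qed
 have cfst: "continuous_on (M \<times> {0..1}) (%p. rht (fst p))"
  by (rule continuous_on_compose2[OF continuous_rht[of UNIV]]) (auto intro: continuous_intros)
 have rhfix: "ranc rh (H rh t) = rh" for t
 proof -
  have "rht rh = 1" unfolding rh_def by (rule rht_ranc) (use rht_ge1 in auto)
  thus ?thesis using ranc_full[of rh] by (simp add: H_def)
 qed
 obtain L where L: "continuous_on M L" "!!a. a : M ==> rproj (L a) = G (rproj a)" "L rh = yr"
 proof (rule rlift_exists[of M rh "%(a, t). ranc a (H a t)" "%a. G (rproj a)" V yr])
  show "continuous_on (M \<times> {0..1}) (%(a, t). ranc a (H a t))"
   unfolding case_prod_beta
   by (intro continuous_ranc) (use H cfst in "auto simp: H_def intro!: continuous_intros")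
  show "rproj yr = G (rproj rh)" using Q(2)[of 1] P' by (simp add: yr_def)
 qed (use cM rhM M1(2) M1(1)[of _ 0] cGM G(2,3) MGa in "auto simp: H01 ranc_full rhfix")
 have "L (P 0) = Q 0"
  by (rule rlift_unique[of "{0..1}" "%t. L (P t)" Q 1 0])
   (use Q L P P' in "auto simp: yr_def intro: continuous_on_compose2[OF L(1)]")
 hence b: "L (F z0) = F' z0" using P' Q by simp
 have "L (F x) = F' x" if "x : Z" for x
  by (rule rlift_unique[of Z "%x. L (F x)" F' z0])
   (use Z F FM L p b that in "auto intro: continuous_on_compose2[OF L(1)]")
 thus ?thesis using eq by metis
qed

section \<open>Continua with connected intersections\<close>

text \<open>The last assumption is hereditary unicoherence, \<open>small\<close> is local
  connectedness in a uniform form. No arcs are assumed; \<open>seg\<close> below takes their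
  place.\<close>

locale dendrite =
 fixes D :: "'d::metric_space set"
 assumes compD: "compact D" and connD: "connected D"
  and small: "!!e. 0 < e ==> EX d>0. ALL u:D. ALL v:D. dist u v < d -->
    (EX K. compact K & connected K & K <= D & u : K & v : K & K <= cball u e)"
  and unicoherent: "!!K L. [|compact K; connected K; K <= D; compact L; connected L; L <= D|] ==> connected (K Int L)"
begin

definition ctm :: "'d set => bool" where "ctm K \<longleftrightarrow> compact K & connected K & K <= D"

definition seg :: "'d => 'd => 'd set" where
 "seg u v = \<Inter>{K. ctm K & u : K & v : K}"

lemma ctm_D: "ctm D" using compD connD by (simp add: ctm_def)

lemma ctm_Un: "ctm K ==> ctm L ==> K Int L ~= {} ==> ctm (K Un L)"
 by (auto simp: ctm_def intro: connected_Un)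

lemma ctm_Int: "ctm K ==> ctm L ==> ctm (K Int L)"
 unfolding ctm_def using unicoherent by (auto intro: compact_Int)

lemma seg_min: "ctm K ==> u : K ==> v : K ==> seg u v <= K"
 by (auto simp: seg_def)

lemma seg_ends: "u : seg u v" "v : seg u v"
 by (auto simp: seg_def)

lemma seg_commute: "seg u v = seg v u"
 by (auto simp: seg_def)

text \<open>Finite intersections of subcontinua are connected by unicoherence. A separation of the
  full intersection would, by compactness, already separate a finite one.\<close>

lemma ctm_seg:
 assumes "u : D" "v : D" shows "ctm (seg u v)"
proof -
 let ?F = "{K. ctm K & u : K & v : K}"
 have DF: "D : ?F" using assms ctm_D by simp
 have sub: "seg u v <= D" using DF by (auto simp: seg_def)
 have cl: "closed (seg u v)" unfolding seg_def by (intro closed_Inter) (auto simp: ctm_def compact_imp_closed)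
 have cp: "compact (seg u v)" using cl sub compD compact_Int_closed[of D "seg u v"] by (simp add: Int_absorb1)
 have fin: "\<Inter>G : ?F" if "finite G" "G <= ?F" "G ~= {}" for G
  using that(1,3,2)
 proof (induction G rule: finite_ne_induct)
  case (insert x G)
  have "x : ?F" "G <= ?F" using insert.prems by (simp_all only: insert_subset)
  from insert.IH[OF this(2)] this(1) have "\<Inter>G : ?F" "x : ?F" by simp_all
  thus ?case using ctm_Int[of x "\<Inter>G"] by simp
 qed simp
 have "connected (seg u v)"
  unfolding connected_closed_set[OF cl]
 proof
  assume "EX A B. closed A & closed B & A ~= {} & B ~= {} & A Un B = seg u v & A Int B = {}"
  then obtain A B where AB: "closed A" "closed B" "A ~= {}" "B ~= {}" "A Un B = seg u v" "A Int B = {}" by blast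
  obtain U V where UV: "open U" "open V" "A <= U" "B <= V" "U Int V = {}"
   using t4_space[OF AB(1,2,6)] by blast
  have "compact (D - (U Un V))" using compD UV by (intro compact_diff open_Un)
  moreover have "(D - (U Un V)) Int \<Inter>?F = {}"
  proof -
   have "\<Inter>?F <= U Un V" using AB(5) UV(3,4) unfolding seg_def by (metis Un_mono)
   thus ?thesis by (metis (no_types, lifting) Diff_disjoint Int_mono disjoint_iff subsetD Diff_iff)
  qed
  moreover have "!!T. T : ?F ==> closed T" by (auto simp: ctm_def compact_imp_closed)
  ultimately obtain G where G: "finite G" "G <= ?F" "(D - (U Un V)) Int \<Inter>G = {}"
   using compact_imp_fip[of "D - (U Un V)" ?F] by (metis (no_types, lifting))
  have "insert D G <= ?F" using G DF by blast
  hence K: "\<Inter>(insert D G) : ?F" using G(1) by (intro fin) simp_all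
  let ?K = "\<Inter>(insert D G)"
  have "connected ?K" using K by (simp add: ctm_def)
  moreover have "?K <= U Un V" using G(3) by auto
  moreover have "seg u v <= ?K" using K seg_min[of ?K u v] by simp
  hence "A <= U Int ?K" "B <= V Int ?K" using AB(5) UV(3,4) by auto
  hence "U Int ?K ~= {}" "V Int ?K ~= {}" using AB(3,4) by (metis subset_empty)+
  ultimately show False using connectedD[of ?K U V] UV(1,2,5) by auto
 qed
 thus ?thesis using cp sub by (simp add: ctm_def)
qed

lemma seg_D: "u : D ==> v : D ==> seg u v <= D"
 using ctm_seg by (simp add: ctm_def)

lemma seg_closed: "u : D ==> v : D ==> closed (seg u v)"
 using ctm_seg by (auto simp: ctm_def compact_imp_closed)

lemma seg_refl: "u : D ==> seg u u = {u}"
 using seg_min[of "{u}" u u] seg_ends by (fastforce simp: ctm_def)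

lemma seg_tri:
 assumes "u : D" "v : D" "w : D" shows "seg u v <= seg u w Un seg w v"
 using assms seg_ends by (intro seg_min ctm_Un ctm_seg) blast+

lemma seg_sub:
 assumes "u : D" "v : D" "p : seg u v" shows "seg u p <= seg u v" "seg p v <= seg u v"
 using seg_min[OF ctm_seg[OF assms(1,2)]] seg_ends[of u v] seg_ends(2)[of v u] assms(3) by (meson subset_refl)+

lemma seg_small:
 assumes "0 < e" obtains d where "0 < d" "!!u v. u : D ==> v : D ==> dist u v < d ==> seg u v <= cball u e"
proof -
 obtain d where d: "d > 0" "ALL u:D. ALL v:D. dist u v < d -->
    (EX K. compact K & connected K & K <= D & u : K & v : K & K <= cball u e)"
  using small[OF assms] by blast
 show ?thesis
 proof (rule that[OF d(1)])
  fix u v assume "u : D" "v : D" "dist u v < d"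
  then obtain K where "compact K" "connected K" "K <= D" "u : K" "v : K" "K <= cball u e" using d(2) by meson
  thus "seg u v <= cball u e" using seg_min[of K u v] by (auto simp: ctm_def)
 qed
qed

text \<open>Suppose \<open>p\<close> and \<open>p'\<close> differ. By boundary bumping the component
  \<open>C\<close> of \<open>w\<close> off a small ball around \<open>p'\<close> comes near
  \<open>p'\<close>. A small segment avoiding \<open>p\<close> joins it to \<open>p'\<close>, so the
  segment from \<open>p'\<close> to \<open>w\<close>, and with it \<open>p\<close>, is caught in the
  union. Thus \<open>p\<close> is in \<open>C\<close>, and then \<open>C\<close> contains the whole
  segment, including \<open>p'\<close>.\<close>

lemma seg_inj_aux:
 assumes D: "p : D" "p' : D" "w : D" and eq: "seg p w = seg p' w"
 shows "p = p'"
proof (rule ccontr)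
 assume ne: "p ~= p'"
 let ?S = "seg p w" and ?e = "dist p' p / 2"
 have "0 < ?e" using ne by (simp add: dist_commute)
 then obtain d where d: "0 < d" and dK: "!!u v. u : D ==> v : D ==> dist u v < d ==> seg u v <= cball u ?e"
  using seg_small[of ?e] by metis
 have notp: "p ~: seg p' v" if "v : D" "dist p' v < d" for v
  using dK[OF D(2) that] ne by (auto simp: dist_commute)
 have pS: "p : ?S" "p' : ?S" "w : ?S" using seg_ends eq by auto
 have wfar: "d <= dist p' w" using notp[OF D(3)] pS eq by force
 let ?T = "top_of_set ?S" and ?B = "?S - ball p' (d/2)"
 have cS: "ctm ?S" using ctm_seg D by blast
 have clB: "closedin ?T ?B" by (auto simp: closedin_closed intro!: exI[of _ "- ball p' (d/2)"])
 have wB: "w : ?B" using wfar d pS by auto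
 define C where "C = connected_component_set ?B w"
 have CB: "C <= ?B" "w : C" "connected C" using wB connected_component_subset[of ?B w]
  by (auto simp: C_def intro: connected_component_refl)
 have CC: "C : connected_components_of (subtopology ?T ?B)"
 proof -
  have "subtopology ?T ?B = top_of_set ?B" by (simp add: subtopology_subtopology Int_absorb1 Diff_subset)
  thus ?thesis using wB unfolding connected_components_of_def C_def
   by (auto simp: connected_component_def connected_component_of_def connectedin_subtopology intro!: image_eqI[of _ _ w])
 qed
 have compC: "compact C" unfolding C_def
 proof -
  have cB: "compact ?B" using cS by (auto simp: ctm_def intro!: compact_diff)
  hence "closed (connected_component_set ?B w)" by (intro closed_connected_component compact_imp_closed)
  from compact_Int_closed[OF cB this] show "compact (connected_component_set ?B w)"
   using connected_component_subset[of ?B w] by (simp add: Int_absorb1)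
 qed
 have "C Int ?T frontier_of ?B ~= {}"
 proof (rule boundary_bumping_theorem_closed[OF _ _ _ clB _ CC])
  show "connected_space ?T" using cS by (simp add: ctm_def connected_space_subtopology)
  show "compact_space ?T" using cS by (simp add: ctm_def compact_space_subtopology)
  show "Hausdorff_space ?T" by (simp add: Hausdorff_space_subtopology)
  have "p' : topspace ?T" "p' ~: ?B" using pS d by auto
  thus "?B ~= topspace ?T" by metis
 qed
 then obtain v where v: "v : C" "v : ?T frontier_of ?B" by blast
 have "?T frontier_of ?B <= ?T closure_of (?S - ?B)"
  by (simp add: frontier_of_closures)
 also have "... <= cball p' (d/2)"
 proof -
  have "closedin ?T (?S Int cball p' (d/2))" by (auto simp: closedin_closed)
  hence "?T closure_of (?S - ?B) <= ?S Int cball p' (d/2)" by (intro closure_of_minimal) auto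
  thus ?thesis by blast
 qed
 finally have dv: "dist p' v < d" using v d by auto
 have vD: "v : D" using v CB seg_D[OF D(1,3)] by blast
 have ctmC: "ctm C" using compC CB seg_D[OF D(1,3)] by (auto simp: ctm_def)
 have "ctm (C Un seg p' v)" by (rule ctm_Un[OF ctmC ctm_seg[OF D(2) vD]]) (use v seg_ends in auto)
 hence "seg p' w <= C Un seg p' v" using CB seg_ends by (intro seg_min) auto
 hence "p : C" using notp[OF vD dv] pS eq by blast
 hence "seg p w <= C" using ctmC CB by (intro seg_min) auto
 hence "p' : C" using pS by blast
 thus False using CB d by auto
qed

text \<open>If neither point preceded the other, each would lie on the remaining segment of the
  other towards \<open>w\<close>; these two remainders would coincide, contrary to
  \<open>seg_inj_aux\<close>.\<close>

lemma seg_comparable: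
 assumes D: "u : D" "w : D" and p: "p : seg u w" "p' : seg u w"
 shows "p' : seg u p | p : seg u p'"
proof (rule ccontr)
 assume n: "~ ?thesis"
 have pD: "p : D" "p' : D" using p seg_D[OF D] by auto
 have "p' : seg p w" using seg_tri[OF D pD(1)] p n by blast
 moreover have "p : seg p' w" using seg_tri[OF D pD(2)] p n by blast
 ultimately have "seg p w = seg p' w" using seg_sub pD D by (metis subset_antisym)
 hence "p = p'" using seg_inj_aux pD D by blast
 thus False using n seg_ends by blast
qed

end

text \<open>A countable family of bump functions with small supports around a dense sequence
 yields a strictly monotone size for subcontinua through a point.\<close>

locale dendrite_bumps = dendrite D for D :: "'d::metric_space set" +
 fixes q :: "nat => 'd" assumes dense: "!!x e. x : D ==> 0 < e ==> EX i. dist x (q i) < e"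
begin

definition bump :: "nat => 'd => real" where
 "bump n x = max 0 (1 / Suc (snd (prod_decode n)) - dist x (q (fst (prod_decode n))))"

lemma bump_bounds: "0 <= bump n x" "bump n x <= 1"
proof -
 have "1 / real (Suc (snd (prod_decode n))) <= 1" by simp
 thus "bump n x <= 1" unfolding bump_def
  using zero_le_dist[of x "q (fst (prod_decode n))"] by linarith
qed (simp add: bump_def)

lemma bump_lip: "abs (bump n x - bump n y) <= dist x y"
proof -
 have "abs (dist x z - dist y z) <= dist x y" for z by (metis abs_dist_diff_le dist_commute)
 from this[of "q (fst (prod_decode n))"] show ?thesis unfolding bump_def by (auto simp: max_def abs_if split: if_splits)
qed

definition S :: "nat => 'd => 'd => real" where
 "S n u p = (SUP x\<in>seg u p. abs (bump n x - bump n u))"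

lemma bump_diff: "abs (bump n x - bump n u) <= 1"
 using bump_bounds[of n x] bump_bounds[of n u] by linarith

lemma S_upper: "x : seg u p ==> abs (bump n x - bump n u) <= S n u p"
 unfolding S_def
proof (rule cSUP_upper)
 show "bdd_above ((%x. abs (bump n x - bump n u)) ` seg u p)"
  using bump_diff by (intro bdd_aboveI[of _ 1]) auto
qed

lemma S_least: "(!!x. x : seg u p ==> abs (bump n x - bump n u) <= c) ==> S n u p <= c"
 unfolding S_def using seg_ends by (intro cSUP_least) blast+

lemma S_bounds: "0 <= S n u p" "S n u p <= 1"
proof -
 show "0 <= S n u p" using S_upper[of u u p n] seg_ends by simp
 show "S n u p <= 1" using bump_diff by (intro S_least)
qed

definition lam :: "'d => 'd => real" where
 "lam u p = (\<Sum>n. (1/2)^n * S n u p)"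

lemma lam_summable: "summable (%n. (1/2)^n * S n u p)"
 by (rule summable_comparison_test'[of "%n. (1/2)^n" 0])
  (use S_bounds in "auto simp: summable_geometric mult_left_le")

lemma lam_nonneg: "0 <= lam u p"
 unfolding lam_def using S_bounds by (intro suminf_nonneg lam_summable) simp

lemma lam_refl: "u : D ==> lam u u = 0"
 by (simp add: lam_def S_def seg_refl)

text \<open>Each \<open>S n\<close> changes by at most \<open>2 * r\<close>, and the weights
  \<open>(1/2)^n\<close> sum to 2.\<close>

lemma lam_near:
 assumes D: "u : D" "p : D" "u' : D" "p' : D" and r: "seg u u' <= cball u r" "seg p p' <= cball p r"
 shows "lam u' p' <= lam u p + 4 * r"
proof -
 have r0: "0 <= r" using r(1) seg_ends(1)[of u u'] by auto
 have S: "S n u' p' <= S n u p + 2 * r" for n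
 proof (rule S_least)
  fix x assume "x : seg u' p'"
  then consider "x : seg u u'" | "x : seg u p" | "x : seg p p'"
   using seg_tri[OF D(3,4,1)] seg_tri[OF D(1,4,2)] seg_commute[of u u'] by blast
  moreover have "abs (bump n u - bump n u') <= r" using bump_lip[of n u u'] r(1) seg_ends(2)[of u' u] by force
  ultimately show "abs (bump n x - bump n u') <= S n u p + 2 * r"
  proof cases
   case 1
   hence "abs (bump n u - bump n x) <= r" using bump_lip[of n u x] r(1) by force
   thus ?thesis using `abs (bump n u - bump n u') <= r` S_bounds(1)[of n u p] by linarith
  next
   case 2
   thus ?thesis using S_upper[of x u p n] `abs (bump n u - bump n u') <= r` r0 by linarith
  next
   case 3
   hence "abs (bump n p - bump n x) <= r" using bump_lip[of n p x] r(2) by force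
   thus ?thesis using S_upper[OF seg_ends(2)[of p u], of n] `abs (bump n u - bump n u') <= r` by linarith
  qed
 qed
 have g: "summable (%n. (1/2)^n * (2 * r) :: real)" by (intro summable_mult2 summable_geometric) simp
 have "lam u' p' <= (\<Sum>n. (1/2)^n * S n u p + (1/2)^n * (2 * r))"
  unfolding lam_def
  by (intro suminf_le lam_summable summable_add g) (use S in "auto simp flip: distrib_left")
 also have "... = lam u p + (\<Sum>n. (1/2)^n * (2 * r))"
  unfolding lam_def by (rule suminf_add[symmetric, OF lam_summable g])
 also have "(\<Sum>n. (1/2)^n * (2 * r)) = 4 * r"
  by (subst suminf_mult2[symmetric]) (simp_all add: suminf_geometric summable_geometric)
 finally show ?thesis .
qed

text \<open>A point on the longer but not on the shorter segment is detected by a narrow bump around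
  it that vanishes on the shorter segment.\<close>

lemma lam_strict:
 assumes D: "u : D" "p : D" "p' : D" and sub: "seg u p <= seg u p'" "seg u p ~= seg u p'"
 shows "lam u p < lam u p'"
proof -
 obtain x where x: "x : seg u p'" "x ~: seg u p" using sub by blast
 have xD: "x : D" using x seg_D D by blast
 obtain e where e: "0 < e" "ball x e Int seg u p = {}"
 proof -
  have "open (- seg u p)" using seg_closed[OF D(1,2)] by auto
  then obtain e where "0 < e" "ball x e <= - seg u p" using x(2) openE by (metis ComplI)
  thus ?thesis using that by blast
 qed
 obtain k where k: "1 / real (Suc k) < e / 2" using reals_Archimedean[of "e/2"] e(1) by (auto simp: inverse_eq_divide)
 obtain i where i: "dist x (q i) < 1 / real (Suc k)" using dense[OF xD, of "1 / real (Suc k)"] by auto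
 define n where "n = prod_encode (i, k)"
 have b: "bump n z = max 0 (1 / Suc k - dist z (q i))" for z by (simp add: bump_def n_def)
 have bx: "0 < bump n x" using i by (simp add: b)
 have b0: "bump n z = 0" if "z : seg u p" for z
 proof -
  have "e <= dist x z" using e(2) that by force
  hence "1 / Suc k <= dist z (q i)" using dist_triangle[of x z "q i"] i k by (simp add: dist_commute)
  thus ?thesis by (simp add: b)
 qed
 have "S n u p <= 0" using b0 seg_ends by (intro S_least) auto
 moreover have "0 < S n u p'" using S_upper[OF x(1), of n] b0[OF seg_ends(1)] bx by simp
 ultimately have Sn: "S n u p < S n u p'" by simp
 have S: "S m u p <= S m u p'" for m using S_upper sub by (intro S_least) blast
 have sm: "summable (%n. (1/2)^n * S n u p' - (1/2)^n * S n u p)" by (intro summable_diff lam_summable)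
 have "0 < (\<Sum>n. (1/2)^n * S n u p' - (1/2)^n * S n u p)"
  by (rule suminf_pos2[OF sm, of n]) (use S Sn in auto)
 also have "... = lam u p' - lam u p" unfolding lam_def by (rule suminf_diff[symmetric, OF lam_summable lam_summable])
 finally show ?thesis by simp
qed

lemma lam_continuous: "continuous_on (D \<times> D) (%(u, p). lam u p)"
 unfolding continuous_on_iff
proof (intro ballI allI impI)
 fix x e assume x: "x : D \<times> D" and e: "0 < (e::real)"
 obtain u p where up: "x = (u, p)" "u : D" "p : D" using x by auto
 obtain d where d: "0 < d" and dK: "!!u v. u : D ==> v : D ==> dist u v < d ==> seg u v <= cball u (e/8)"
  using seg_small[of "e/8"] e by auto
 show "EX d>0. ALL x':D \<times> D. dist x' x < d --> dist (case x' of (u, p) => lam u p) (case x of (u, p) => lam u p) < e"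
 proof (intro exI[of _ d] conjI d ballI impI)
  fix x' assume x': "x' : D \<times> D" and dx: "dist x' x < d"
  obtain u' p' where up': "x' = (u', p')" "u' : D" "p' : D" using x' by auto
  have "dist u' u < d" "dist p' p < d" using dx dist_fst_le[of x' x] dist_snd_le[of x' x] by (auto simp: up up')
  hence "lam u' p' <= lam u p + 4 * (e/8)" "lam u p <= lam u' p' + 4 * (e/8)"
   using up up' by (intro lam_near dK; simp add: dist_commute)+
  hence "dist (lam u' p') (lam u p) < e" using e unfolding dist_real_def by linarith
  thus "dist (case x' of (u, p) => lam u p) (case x of (u, p) => lam u p) < e" by (simp add: up up')
 qed
qed

lemma lam_inj:
 assumes D: "u : D" "w : D" and p: "p : seg u w" "p' : seg u w" and eq: "lam u p = lam u p'"
 shows "p = p'"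
proof -
 have *: "p = p'" if "p' : seg u p" "p : D" "p' : D" "lam u p = lam u p'" for p p'
 proof -
  have "seg u p' <= seg u p" using seg_sub[OF D(1) that(2,1)] by blast
  hence "seg u p' = seg u p" using lam_strict[OF D(1) that(3,2)] that(4) by fastforce
  thus ?thesis using seg_inj_aux[OF that(2,3) D(1)] by (simp add: seg_commute)
 qed
 have "p : D" "p' : D" using p seg_D[OF D] by auto
 thus ?thesis using seg_comparable[OF D p] *[of p p'] *[of p' p] eq by metis
qed

definition flow :: "'d => 'd => real => 'd" where
 "flow u w z = (THE p. p : seg u w & lam u p = min z (lam u w))"

lemma flow_unique:
 assumes "u : D" "w : D" "p : seg u w" "lam u p = min z (lam u w)" shows "flow u w z = p"
 unfolding flow_def by (rule the_equality) (use assms lam_inj in auto)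

lemma flow_props:
 assumes D: "u : D" "w : D" and z: "0 <= z"
 shows "flow u w z : seg u w" "lam u (flow u w z) = min z (lam u w)"
proof -
 have c: "connected (seg u w)" using ctm_seg[OF D] by (simp add: ctm_def)
 have "continuous_on (seg u w) (%p. case (u, p) of (u, p) => lam u p)"
  by (rule continuous_on_compose2[OF lam_continuous]) (use D seg_D[OF D] in "auto intro!: continuous_intros")
 hence "connected (lam u ` seg u w)" using connected_continuous_image[OF _ c] by simp
 moreover have "0 : lam u ` seg u w" using lam_refl[OF D(1)] seg_ends by force
 moreover have "lam u w : lam u ` seg u w" using seg_ends by blast
 ultimately have "{0..lam u w} <= lam u ` seg u w" using connected_contains_Icc by blast
 hence "min z (lam u w) : lam u ` seg u w" using z lam_nonneg[of u w] by (auto simp: min_def)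
 then obtain p where "p : seg u w" "lam u p = min z (lam u w)" by auto
 thus "flow u w z : seg u w" "lam u (flow u w z) = min z (lam u w)"
  using flow_unique[OF D] by auto
qed

lemma flow_0: "u : D ==> w : D ==> flow u w 0 = u"
 using flow_unique[of u w u 0] seg_ends lam_refl lam_nonneg by (simp add: min_def)

lemma flow_end: "u : D ==> w : D ==> lam u w <= z ==> flow u w z = w"
 using flow_unique[of u w w z] seg_ends by simp

lemma flow_D: "u : D ==> w : D ==> 0 <= z ==> flow u w z : D"
 using flow_props seg_D by blast

text \<open>By compactness the values along a sequence violating continuity accumulate at some
  \<open>p\<close>. Segments with nearby ends differ only inside small balls about the ends, so
  \<open>p\<close> lies on the limit segment, and its size is right because \<open>lam\<close> is
  continuous. These two conditions determine the flow.\<close>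

lemma flow_continuous: "continuous_on (D \<times> D \<times> {0..}) (%(u, w, z). flow u w z)"
proof (rule continuous_on_sequentiallyI)
 fix x a assume x: "ALL n. x n : D \<times> D \<times> {0::real..}" and a: "a : D \<times> D \<times> {0::real..}" and lim: "x \<longlonglongrightarrow> a"
 let ?f = "%(u, w, z). flow u w z"
 obtain u w z where a': "a = (u, w, z)" "u : D" "w : D" "0 <= z" using a by auto
 show "(%n. ?f (x n)) \<longlonglongrightarrow> ?f a"
 proof (rule ccontr)
  assume "~ ?thesis"
  then obtain e where e: "0 < e" "~ (\<forall>\<^sub>F n in sequentially. dist (?f (x n)) (?f a) < e)"
   unfolding tendsto_iff by blast
  hence "infinite {n. e <= dist (?f (x n)) (?f a)}"
   unfolding infinite_nat_iff_unbounded_le eventually_sequentially by (simp add: not_less)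
  then obtain r :: "nat => nat" where r: "strict_mono r" "!!n. e <= dist (?f (x (r n))) (?f a)"
   using infinite_enumerate by (metis (mono_tags, lifting) mem_Collect_eq)
  have fD: "?f (x n) : D" for n using x flow_D by (metis (mono_tags, lifting) atLeast_iff case_prod_conv mem_Sigma_iff prod.collapse)
  then obtain p s where s: "p : D" "strict_mono s" "(%n. ?f (x (r (s n)))) \<longlonglongrightarrow> p"
   using compD[unfolded compact_def, rule_format, of "%n. ?f (x (r n))"] by (auto simp: o_def)
  define U W Z where "U = (%n. fst (x (r (s n))))" and "W = (%n. fst (snd (x (r (s n)))))" and "Z = (%n. snd (snd (x (r (s n)))))"
  have xx: "x (r (s n)) = (U n, W n, Z n)" for n by (simp add: U_def W_def Z_def)
  have UWZ: "U n : D" "W n : D" "0 <= Z n" for n using x[rule_format, of "r (s n)"] by (auto simp: xx)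
  have "(%n. x (r (s n))) \<longlonglongrightarrow> a"
   using LIMSEQ_subseq_LIMSEQ[OF LIMSEQ_subseq_LIMSEQ[OF lim r(1)] s(2)] by (simp add: o_def)
  hence lims: "U \<longlonglongrightarrow> u" "W \<longlonglongrightarrow> w" "Z \<longlonglongrightarrow> z"
   unfolding U_def W_def Z_def a'
   using tendsto_fst[of "%n. x (r (s n))"] tendsto_snd[of "%n. x (r (s n))"] tendsto_fst[of "%n. snd (x (r (s n)))"]
    tendsto_snd[of "%n. snd (x (r (s n)))"] by (metis fst_conv snd_conv)+
  define P where "P n = flow (U n) (W n) (Z n)" for n
  have P: "P \<longlonglongrightarrow> p" using s(3) by (simp add: xx P_def[abs_def])
  have Pp: "P n : seg (U n) (W n)" "lam (U n) (P n) = min (Z n) (lam (U n) (W n))" "P n : D" for n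
   unfolding P_def using flow_props[OF UWZ] flow_D[OF UWZ] by auto
  have pin: "p : cball u d Un seg u w Un cball w d" if d: "0 < d" for d
  proof -
   obtain b where b: "0 < b" and bK: "!!u v. u : D ==> v : D ==> dist u v < b ==> seg u v <= cball u d"
    using seg_small[OF d] by blast
   have "closed (cball u d Un seg u w Un cball w d)" using seg_closed a' by blast
   moreover have "\<forall>\<^sub>F n in sequentially. P n : cball u d Un seg u w Un cball w d"
    using tendstoD[OF lims(1) b] tendstoD[OF lims(2) b]
   proof eventually_elim
    case (elim n)
    have "seg (U n) (W n) <= seg u (U n) Un (seg u w Un seg w (W n))"
     using seg_tri[OF UWZ(1,2) a'(2), of n n] seg_tri[OF a'(2) UWZ(2) a'(3), of n] by (auto simp: seg_commute)
    moreover have "seg u (U n) <= cball u d" "seg w (W n) <= cball w d"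
     using elim by (intro bK a' UWZ; simp add: dist_commute)+
    ultimately show ?case using Pp(1)[of n] by blast
   qed
   ultimately show ?thesis using P by (intro Lim_in_closed_set[of _ P sequentially]) auto
  qed
  have "p : seg u w"
  proof (rule ccontr)
   assume np: "p ~: seg u w"
   hence "p ~= u" "p ~= w" using seg_ends by auto
   hence pos: "0 < dist u p" "0 < dist w p" by (auto simp: dist_commute)
   define m where "m = min (dist u p) (dist w p) / 2"
   have "0 < min (dist u p) (dist w p)" using pos by (simp only: min_less_iff_conj)
   hence "0 < m" "m < dist u p" "m < dist w p"
    using min.cobounded1[of "dist u p" "dist w p"] min.cobounded2[of "dist u p" "dist w p"] unfolding m_def by linarith+
   thus False using pin[of m] np by auto
  qed
  moreover have "lam u p = min z (lam u w)"
  proof (rule LIMSEQ_unique)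
   have l: "(%n. lam (A n) (B n)) \<longlonglongrightarrow> lam a b" if "!!n. A n : D" "!!n. B n : D" "a : D" "b : D" "A \<longlonglongrightarrow> a" "B \<longlonglongrightarrow> b" for A B a b
    using continuous_on_tendsto_compose[OF lam_continuous tendsto_Pair[OF that(5,6)]] that by simp
   show "(%n. lam (U n) (P n)) \<longlonglongrightarrow> lam u p" by (intro l UWZ Pp a' s lims P)
   show "(%n. lam (U n) (P n)) \<longlonglongrightarrow> min z (lam u w)"
    unfolding Pp by (intro tendsto_min l UWZ a' lims)
  qed
  ultimately have "flow u w z = p" using flow_unique a' by blast
  hence "(%n. dist (P n) (?f a)) \<longlonglongrightarrow> dist p p" using tendsto_dist[OF P tendsto_const[of p]] by (simp add: a')
  hence "\<forall>\<^sub>F n in sequentially. dist (P n) (?f a) < e" using e(1) order_tendstoD(2)[of _ 0] by simp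
  then obtain n where "dist (P n) (?f a) < e" by (auto simp: eventually_sequentially)
  thus False using r(2)[of "s n"] by (simp add: xx P_def)
 qed
qed

end

lemma compact_dense_sequence:
 fixes D :: "'d::metric_space set"
 assumes "compact D" obtains q :: "nat => 'd" where "!!x e. x : D ==> 0 < e ==> EX i. dist x (q i) < e"
proof -
 have "EX Q. finite Q & D <= (\<Union>x\<in>Q. ball x (1 / Suc k))" for k
  using seq_compact_imp_totally_bounded[of D] assms unfolding compact_eq_seq_compact_metric
  by (metis divide_pos_pos of_nat_0_less_iff zero_less_Suc zero_less_one)
 then obtain Q where Q: "!!k. finite (Q k)" "!!k. D <= (\<Union>x\<in>Q k. ball x (1 / Suc k))" by metis
 define C where "C = insert undefined (\<Union>k. Q k)"
 have C: "countable C" "C ~= {}" unfolding C_def using Q(1) by (auto intro: countable_finite)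
 show ?thesis
 proof (rule that[of "from_nat_into C"])
  fix x and e :: real assume x: "x : D" and e: "0 < e"
  obtain k where k: "1 / real (Suc k) < e" using reals_Archimedean[OF e] by (auto simp: inverse_eq_divide)
  obtain c where c: "c : Q k" "dist c x < 1 / Suc k" using Q(2)[of k] x by auto
  have "c : C" using c by (auto simp: C_def)
  then obtain i where "from_nat_into C i = c" using from_nat_into_surj[OF C(1)] by blast
  thus "EX i. dist x (from_nat_into C i) < e" using c k by (intro exI[of _ i]) (simp add: dist_commute)
 qed
qed

text \<open>Only continuity, the initial and final values and the bound \<open>l u w\<close> on the
  arrival time matter from here on; the bumps are forgotten.\<close>

lemma (in dendrite) flow_exists:
 obtains l sig where "continuous_on (D \<times> D) (%(u, p). l u p)" "!!u p. 0 <= (l u p :: real)" "!!u. u : D ==> l u u = 0"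
  "continuous_on (D \<times> D \<times> {0::real..}) (%(u, w, z). sig u w z)"
  "!!u w z. u : D ==> w : D ==> 0 <= z ==> sig u w z : D"
  "!!u w. u : D ==> w : D ==> sig u w 0 = u"
  "!!u w z. u : D ==> w : D ==> l u w <= z ==> sig u w z = w"
proof -
 obtain q :: "nat => 'd" where q: "!!x e. x : D ==> 0 < e ==> EX i. dist x (q i) < e"
  using compact_dense_sequence[OF compD] by blast
 interpret dendrite_bumps D q by unfold_locales (rule q)
 show ?thesis by (rule that[OF lam_continuous lam_nonneg lam_refl flow_continuous flow_D flow_0 flow_end])
qed

section \<open>Homotopies of maps of cubes\<close>

definition cube :: "nat => (nat => real) set" where
 "cube n = {s. (ALL i<n. -1 <= s i & s i <= 1) & (ALL i>=n. s i = 0)}"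

abbreviation prism :: "nat => (real \<times> (nat => real)) set" where
 "prism n == {0..1} \<times> cube n"

definition bdry :: "nat => (nat => real) set" where
 "bdry n = {s : cube n. EX i<n. abs (s i) = 1}"

lemma compact_cube: "compact (cube n)"
proof -
 have "cube n = PiE UNIV (%i. if i < n then {-1..1} else {0})"
  by (rule set_eqI) (simp add: cube_def PiE_iff if_distrib[of "%X. _ : X"] cong: if_cong, meson linorder_not_le)
 moreover have "compactin (product_topology (%i. euclideanreal) UNIV) (PiE UNIV (%i. if i < n then {-1..1} else {0::real}))"
  unfolding compactin_PiE by auto
 hence "compact (PiE UNIV (%i. if i < n then {-1..1} else {0::real}))"
  by (simp add: euclidean_product_topology)
 ultimately show ?thesis by simp
qed

lemma coord_continuous [continuous_intros]: "continuous_on S (%s::nat => real. s i)"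
 by (rule continuous_on_coord[OF continuous_on_id])

lemma coord_snd_continuous [continuous_intros]: "continuous_on S (%x. (snd x :: nat => real) i)"
 by (rule continuous_on_coord[OF continuous_on_snd[OF continuous_on_id]])

lemma cmap_on_cases_le:
 fixes p :: "'a::topological_space => real"
 assumes "cmap_on {x : S. p x <= c} Y f" "cmap_on {x : S. c <= p x} Y g" "continuous_on S p"
  "!!x. x : S ==> p x = c ==> f x = g x"
 shows "cmap_on S Y (%x. if p x <= c then f x else g x)"
 by (rule continuous_map_cases_le) (use assms in "auto simp: subtopology_subtopology Int_def")

text \<open>The predicate \<open>Q\<close> bounds the support of the homotopy. With the support of
  the first map as \<open>Q\<close>, homotopies of different components can be performed together
  without leaving the adjunction space.\<close>

definition qhom :: "nat => 'b topology => 'b => ((nat => real) => bool) => ((nat => real) => 'b) => ((nat => real) => 'b) => bool" where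
 "qhom d A a Q f g \<longleftrightarrow> (EX h. cmap_on (prism d) A h &
   (ALL s:cube d. h (0, s) = f s & h (1, s) = g s) & (ALL t:{0..1}. ALL s:cube d. ~ Q s --> h (t, s) = a))"

lemma qhomI:
 assumes "cmap_on (prism d) A h" "!!s. s : cube d ==> h (0, s) = f s"
  "!!s. s : cube d ==> h (1, s) = g s" "!!t s. t : {0..1} ==> s : cube d ==> ~ Q s ==> h (t, s) = a"
 shows "qhom d A a Q f g"
 using assms unfolding qhom_def by blast

lemma qhom_mono: "qhom d A a Q f g ==> (!!s. s : cube d ==> Q s ==> Q' s) ==> qhom d A a Q' f g"
 unfolding qhom_def by blast

lemma qhom_trans:
 assumes "qhom d A a Q f g" "qhom d A a Q g k" shows "qhom d A a Q f k"
proof -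
 let ?D = "prism d"
 obtain h where h: "cmap_on ?D A h"
  "ALL s:cube d. h (0, s) = f s & h (1, s) = g s" "ALL t:{0..1}. ALL s:cube d. ~ Q s --> h (t, s) = a"
  using assms(1) unfolding qhom_def by blast
 obtain h' where h': "cmap_on ?D A h'"
  "ALL s:cube d. h' (0, s) = g s & h' (1, s) = k s" "ALL t:{0..1}. ALL s:cube d. ~ Q s --> h' (t, s) = a"
  using assms(2) unfolding qhom_def by blast
 let ?H = "%z. if fst z <= 1/2 then (h o (%z. (2 * fst z, snd z))) z else (h' o (%z. (2 * fst z - 1, snd z))) z"
 have "cmap_on ?D A ?H"
 proof (rule cmap_on_cases_le)
  show "cmap_on {x : ?D. fst x <= 1/2} A (h o (%z. (2 * fst z, snd z)))"
   by (rule cmap_comp[OF _ h(1)]) (auto intro!: continuous_intros)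
  show "cmap_on {x : ?D. 1/2 <= fst x} A (h' o (%z. (2 * fst z - 1, snd z)))"
   by (rule cmap_comp[OF _ h'(1)]) (auto intro!: continuous_intros)
  fix x assume x: "x : ?D" "fst x = 1/2"
  hence "2 * fst x = 1" "2 * fst x - 1 = 0" "snd x : cube d" by auto
  thus "(h o (%z. (2 * fst z, snd z))) x = (h' o (%z. (2 * fst z - 1, snd z))) x"
   using h(2) h'(2) unfolding o_def by simp
 qed (intro continuous_intros)
 thus ?thesis by (rule qhomI) (use h h' in auto)
qed

lemma qhom_sym: assumes "qhom d A a Q f g" shows "qhom d A a Q g f"
proof -
 let ?D = "prism d"
 obtain h where h: "cmap_on ?D A h"
  "ALL s:cube d. h (0, s) = f s & h (1, s) = g s" "ALL t:{0..1}. ALL s:cube d. ~ Q s --> h (t, s) = a"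
  using assms(1) unfolding qhom_def by blast
 show ?thesis
 proof (rule qhomI[of _ _ "h o (%z. (1 - fst z, snd z))"])
  show "cmap_on ?D A (h o (%z. (1 - fst z, snd z)))"
   by (rule cmap_comp[OF _ h(1)]) (auto intro!: continuous_intros)
 qed (use h in auto)
qed

lemma qhom_cong: "qhom d A a Q f g ==> (!!s. s : cube d ==> f s = f' s) ==> (!!s. s : cube d ==> g s = g' s) ==> qhom d A a Q f' g'"
 unfolding qhom_def by metis

lemma qhom_refl:
 assumes "cmap_on (cube d) A f" "!!s. s : cube d ==> ~ Q s ==> f s = a" shows "qhom d A a Q f f"
proof (rule qhomI[of _ _ "f o snd"])
 show "cmap_on (prism d) A (f o snd)"
  by (rule cmap_comp[OF _ assms(1)]) (auto intro: continuous_intros)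
qed (use assms in auto)

lemma qhom_end:
 assumes "qhom d A a Q f g"
 shows "cmap_on (cube d) A f" "cmap_on (cube d) A g"
  "!!s. s : cube d ==> g s ~= a ==> Q s"
proof -
 obtain h where h: "cmap_on (prism d) A h"
  "ALL s:cube d. h (0, s) = f s & h (1, s) = g s" "ALL t:{0..1}. ALL s:cube d. ~ Q s --> h (t, s) = a"
  using assms unfolding qhom_def by blast
 have "cmap_on (cube d) A (h o (%s. (t, s)))" if "t : {0..1}" for t
  by (rule cmap_comp[OF _ h(1)]) (use that in "auto intro!: continuous_intros")
 from this[of 0] this[of 1] show "cmap_on (cube d) A f" "cmap_on (cube d) A g"
  using h(2) by (auto intro: continuous_map_eq[of _ _ "h o Pair 0"] continuous_map_eq[of _ _ "h o Pair 1"])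
 show "g s ~= a ==> Q s" if "s : cube d" for s using h that by (metis atLeastAtMost_iff order_refl zero_le_one)
qed

definition chom :: "nat => 'a topology => 'a => ((nat => real) => 'a) => ((nat => real) => 'a) => bool" where
 "chom n Y y0 f g \<longleftrightarrow> (EX h. cmap_on (prism n) Y h &
   (ALL s:cube n. h (0, s) = f s & h (1, s) = g s) & (ALL t:{0..1}. ALL s:bdry n. h (t, s) = y0))"

definition cmap :: "nat => 'a topology => 'a => ((nat => real) => 'a) => bool" where
 "cmap n Y y0 f \<longleftrightarrow> cmap_on (cube n) Y f & (ALL s:bdry n. f s = y0)"

lemma bdry_cube: "bdry n <= cube n" by (auto simp: bdry_def)

lemma chom_qhom: "chom n Y y0 f g = qhom n Y y0 (%s. s ~: bdry n) f g"
 unfolding chom_def qhom_def using bdry_cube by blast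

lemma chom_refl: "cmap n Y y0 f ==> chom n Y y0 f f"
 unfolding chom_qhom cmap_def by (rule qhom_refl) auto

lemma chom_sym: "chom n Y y0 f g ==> chom n Y y0 g f"
 unfolding chom_qhom by (rule qhom_sym)

lemma chom_trans: "chom n Y y0 f g ==> chom n Y y0 g k ==> chom n Y y0 f k"
 unfolding chom_qhom by (rule qhom_trans)

lemma chom_compose:
 assumes "chom n Y y0 f g" "continuous_map Y Z r" shows "chom n Z (r y0) (r o f) (r o g)"
proof -
 obtain h where h: "cmap_on (prism n) Y h"
  "ALL s:cube n. h (0, s) = f s & h (1, s) = g s" "ALL t:{0..1}. ALL s:bdry n. h (t, s) = y0"
  using assms(1) unfolding chom_def by blast
 show ?thesis unfolding chom_def
  by (rule exI[of _ "r o h"]) (use cmap_comp[OF h(1) assms(2)] h in auto)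
qed

lemma chom_cong:
 assumes "chom n Y y0 f g" "!!s. s : cube n ==> f s = f' s" "!!s. s : cube n ==> g s = g' s"
 shows "chom n Y y0 f' g'"
 using assms unfolding chom_def by metis

lemma chom_cmap: "chom n Y y0 f g ==> cmap n Y y0 f & cmap n Y y0 g"
 using qhom_end[of n Y y0 "%s. s ~: bdry n"] chom_sym[of n Y y0 f g] bdry_cube unfolding chom_qhom cmap_def by blast

section \<open>The cube modulo its boundary as a sphere\<close>

definition ebump :: "nat => (nat => real) => real" where "ebump n s = (\<Prod>i<n. 1 - (s i)\<^sup>2)"
definition nsq :: "nat => (nat => real) => real" where "nsq n s = (\<Sum>i<n. (s i)\<^sup>2)"

text \<open>Inverse stereographic projection of \<open>s / ebump n s\<close>: the boundary, where \<open>ebump\<close> vanishes, goes to the base point.\<close>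

definition kap :: "nat => (nat => real) => nat => real" where
 "kap n s = (%i. if i = 0 then (nsq n s - (ebump n s)\<^sup>2) / (nsq n s + (ebump n s)\<^sup>2)
   else if i <= n then 2 * ebump n s * s (i - 1) / (nsq n s + (ebump n s)\<^sup>2) else 0)"

lemma ebump_nonneg: "s : cube n ==> 0 <= ebump n s"
 unfolding ebump_def cube_def by (intro prod_nonneg) (auto simp: abs_square_le_1 abs_le_iff)

lemma ebump_zero: "s : cube n ==> ebump n s = 0 \<longleftrightarrow> s : bdry n"
 unfolding ebump_def bdry_def cube_def by (auto simp: power2_eq_1_iff abs_if)

lemma den_pos: "0 < nsq n s + (ebump n s)\<^sup>2"
proof (cases "ALL i<n. s i = 0")
 case True
 thus ?thesis by (simp add: nsq_def ebump_def)
next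
 case False
 then obtain i where "i < n" "s i ~= 0" by blast
 hence "0 < nsq n s" unfolding nsq_def by (intro sum_pos2[of _ i]) auto
 thus ?thesis by (simp add: add_pos_nonneg)
qed

lemma kap_sphere: "kap n s : topspace (nsphere n)"
proof -
 let ?N = "nsq n s" and ?e = "ebump n s" and ?d = "nsq n s + (ebump n s)\<^sup>2"
 have "(\<Sum>i\<le>n. (kap n s i)\<^sup>2) = (kap n s 0)\<^sup>2 + (\<Sum>i<n. (kap n s (Suc i))\<^sup>2)"
  by (subst lessThan_Suc_atMost[symmetric], subst sum.lessThan_Suc_shift) simp
 also have "(\<Sum>i<n. (kap n s (Suc i))\<^sup>2) = (\<Sum>i<n. (2 * ?e / ?d)\<^sup>2 * (s i)\<^sup>2)"
  by (intro sum.cong) (auto simp: kap_def power_mult_distrib power_divide)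
 also have "... = (2 * ?e / ?d)\<^sup>2 * ?N" by (simp add: nsq_def sum_distrib_left)
 also have "(kap n s 0)\<^sup>2 + (2 * ?e / ?d)\<^sup>2 * ?N = ((?N - ?e\<^sup>2)\<^sup>2 + 4 * ?e\<^sup>2 * ?N) / ?d\<^sup>2"
  by (simp add: kap_def power_divide power_mult_distrib add_divide_distrib)
 also have "(?N - ?e\<^sup>2)\<^sup>2 + 4 * ?e\<^sup>2 * ?N = ?d\<^sup>2" by (simp add: power2_eq_square algebra_simps)
 finally show ?thesis using den_pos[of n s] by (auto simp: nsphere kap_def)
qed

lemma continuous_ebump: "continuous_on S (ebump n)" and continuous_nsq: "continuous_on S (nsq n)"
 unfolding ebump_def[abs_def] nsq_def[abs_def] by (intro continuous_intros)+

lemma continuous_kap: "cmap_on (cube n) (nsphere n) (kap n)"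
proof -
 have "continuous_on (cube n) (%s. kap n s i)" for i
  unfolding kap_def using den_pos[of n] less_imp_neq[OF den_pos[of n]]
  by (cases "i = 0"; cases "i <= n") (auto intro!: continuous_intros continuous_ebump continuous_nsq simp: less_imp_neq[symmetric])
 hence "continuous_on (cube n) (kap n)" by (rule continuous_on_coords)
 hence "cmap_on (cube n) (powertop_real UNIV) (kap n)"
  by (simp add: euclidean_product_topology)
 thus ?thesis using kap_sphere unfolding nsphere by (auto simp: continuous_map_in_subtopology)
qed

lemma kap_bdry: "s : bdry n ==> kap n s = sphere_base"
proof -
 assume s: "s : bdry n"
 hence e: "ebump n s = 0" using ebump_zero bdry_cube by blast
 hence "nsq n s ~= 0" using den_pos[of n s] by simp
 thus ?thesis using e by (auto simp: kap_def sphere_base_def fun_eq_iff)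
qed

text \<open>Off the boundary \<open>kap n s\<close> determines the quotients
  \<open>s i / ebump n s\<close>. The point with the smaller bump then has the smaller coordinates
  in absolute value, hence the larger bump; so the bumps agree.\<close>

lemma kap_inj:
 assumes s: "s : cube n" "s' : cube n" and eq: "kap n s = kap n s'"
 shows "s = s' | (s : bdry n & s' : bdry n)"
proof -
 have main: "s = s'" if s: "s : cube n" "s' : cube n" and eq: "kap n s = kap n s'" and e: "0 < ebump n s" "0 < ebump n s'" and le: "ebump n s <= ebump n s'" for s s'
 proof -
  let ?e = "ebump n s" and ?e' = "ebump n s'"
  define r where "r = nsq n s / ?e\<^sup>2"
  define r' where "r' = nsq n s' / ?e'\<^sup>2"
  have r0: "0 <= r" "0 <= r'" by (auto simp: r_def r'_def nsq_def intro!: divide_nonneg_nonneg sum_nonneg)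
  have k0: "kap n s 0 = (r - 1) / (r + 1)" "kap n s' 0 = (r' - 1) / (r' + 1)"
   using e by (simp_all add: kap_def r_def r'_def divide_simps)
  have rr: "r = r'" using k0 eq r0 by (simp add: divide_simps) (simp add: algebra_simps)
  have ki: "kap n s (Suc i) = 2 * (s i / ?e) / (r + 1)" "kap n s' (Suc i) = 2 * (s' i / ?e') / (r' + 1)" if "i < n" for i
   using e that den_pos[of n s] den_pos[of n s'] by (simp_all add: kap_def r_def r'_def divide_simps power2_eq_square)
  have si: "s i / ?e = s' i / ?e'" if "i < n" for i
  proof -
   have "2 * (s i / ?e) / (r + 1) = 2 * (s' i / ?e') / (r + 1)" using ki[OF that] eq rr by metis
   moreover have "A = B" if "2 * A / (r + 1) = 2 * B / (r + 1)" for A B :: real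
    using that r0(1) by (auto simp: divide_simps)
   ultimately show ?thesis by blast
  qed
  have "s i = (?e / ?e') * s' i" if "i < n" for i using si[OF that] e by (simp add: field_simps)
  hence abs: "abs (s i) <= abs (s' i)" if "i < n" for i
  proof -
   have "abs (s i) = (?e / ?e') * abs (s' i)" unfolding `!!i. i < n ==> s i = (?e / ?e') * s' i`[OF that] using e by (simp add: abs_mult)
   also have "... <= 1 * abs (s' i)" using e le by (intro mult_right_mono) auto
   finally show ?thesis by simp
  qed
  have "?e' <= ?e" unfolding ebump_def
   by (intro prod_mono) (use abs s in "auto simp: cube_def abs_le_square_iff[symmetric] abs_square_le_1 abs_le_iff")
  hence ee: "?e = ?e'" using le by simp
  show "s = s'"
  proof
   fix i show "s i = s' i" using si[of i] ee e s by (cases "i < n") (auto simp: cube_def)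
  qed
 qed
 have z: "ebump n s = 0 \<longleftrightarrow> ebump n s' = 0"
 proof -
  have "kap n s 0 = 1 \<longleftrightarrow> ebump n s = 0" for s using den_pos[of n s] by (auto simp: kap_def divide_simps)
  thus ?thesis using eq by metis
 qed
 show ?thesis
 proof (cases "ebump n s = 0")
  case True
  thus ?thesis using z ebump_zero s by blast
 next
  case False
  hence "0 < ebump n s" "0 < ebump n s'" using z ebump_nonneg s by (metis order_le_less)+
  thus ?thesis using main[OF s eq] main[OF s(2,1) eq[symmetric]] by force
 qed
qed

text \<open>With \<open>p\<close> the stereographic image of \<open>x\<close>, a point
  \<open>t * p\<close> of the cube is wanted whose bump equals \<open>t\<close>. The intermediate
  value theorem on the ray through \<open>p\<close> provides it, the bump being 1 at the origin and
  0 where the ray leaves the cube.\<close>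

lemma kap_surj:
 assumes n: "1 <= n" and x: "x : topspace (nsphere n)"
 shows "EX s:cube n. kap n s = x"
proof (cases "x 0 = 1")
 case True
 have sum: "(\<Sum>i\<le>n. (x i)\<^sup>2) = 1" and out: "!!i. n < i ==> x i = 0" using x by (auto simp: nsphere)
 have "x i = 0" if "i ~= 0" for i
 proof (cases "i <= n")
  case i: True
  have "(\<Sum>i\<le>n. (x i)\<^sup>2) = (x 0)\<^sup>2 + (\<Sum>i\<in>{..n} - {0}. (x i)\<^sup>2)" by (subst sum.remove[of _ 0]) auto
  hence "(\<Sum>i\<in>{..n} - {0}. (x i)\<^sup>2) = 0" using sum True by simp
  thus ?thesis using i that by (subst (asm) sum_nonneg_eq_0_iff) auto
 qed (use out in auto)
 hence "x = sphere_base" using True by (auto simp: sphere_base_def fun_eq_iff)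
 moreover have "(%i. if i = 0 then 1 else 0) : bdry n" using n by (auto simp: bdry_def cube_def intro!: exI[of _ 0])
 ultimately show ?thesis using kap_bdry bdry_cube by blast
next
 case False
 have sum: "(\<Sum>i\<le>n. (x i)\<^sup>2) = 1" and out: "!!i. n < i ==> x i = 0" using x by (auto simp: nsphere)
 define p where "p = (%i. if i < n then x (Suc i) / (1 - x 0) else 0)"
 have s2: "(x 0)\<^sup>2 + (\<Sum>i<n. (x (Suc i))\<^sup>2) = 1"
  using sum by (subst (asm) lessThan_Suc_atMost[symmetric], subst (asm) sum.lessThan_Suc_shift) simp
 hence "(x 0)\<^sup>2 <= 1" using sum_nonneg[of "{..<n}" "%i. (x (Suc i))\<^sup>2"] by simp
 hence x01: "x 0 < 1" using False by (simp add: abs_square_le_1 abs_le_iff)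
 have P: "nsq n p = (1 + x 0) / (1 - x 0)"
 proof -
  have "nsq n p = (\<Sum>i<n. (x (Suc i))\<^sup>2) / (1 - x 0)\<^sup>2"
   by (simp add: nsq_def p_def power_divide sum_divide_distrib)
  also have "(\<Sum>i<n. (x (Suc i))\<^sup>2) = (1 + x 0) * (1 - x 0)" using s2 by (simp add: power2_eq_square algebra_simps)
  finally show ?thesis using x01 by (simp add: power2_eq_square)
 qed
 define E where "E = (%t. ebump n (%i. t * p i))"
 have contE: "continuous_on UNIV E" unfolding E_def ebump_def by (intro continuous_intros)
 have "EX t>0. E t = t & (ALL i<n. abs (t * p i) <= 1)"
 proof (cases "ALL i<n. p i = 0")
  case True
  thus ?thesis by (intro exI[of _ 1]) (auto simp: E_def ebump_def)
 next
  case False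
  define m where "m = Max ((%i. abs (p i)) ` {..<n})"
  have m: "abs (p i) <= m" if "i < n" for i using that by (auto simp: m_def intro!: Max_ge)
  have m0: "0 < m" using False m by (metis less_le_trans zero_less_abs_iff)
  have "m : (%i. abs (p i)) ` {..<n}" unfolding m_def by (intro Max_in) (use n in "auto simp: lessThan_empty_iff")
  then obtain i0 where i0: "i0 < n" "abs (p i0) = m" by auto
  have "(1 / m * p i0)\<^sup>2 = 1" using i0 m0 by (simp add: power_mult_distrib power_divide flip: i0(2))
  hence E1: "E (1 / m) = 0" unfolding E_def ebump_def using i0 by (intro prod_zero) (auto intro!: bexI[of _ i0])
  have "EX t>=0. t <= 1 / m & t - E t = 0"
  proof (rule IVT'[of "%t. t - E t"])
   show "0 - E 0 <= 0" by (simp add: E_def ebump_def)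
   show "continuous_on {0..1 / m} (%t. t - E t)" by (intro continuous_intros continuous_on_subset[OF contE]) auto
  qed (use E1 m0 in auto)
  then obtain t where t: "0 <= t" "t <= 1 / m" "E t = t" by auto
  have "t ~= 0" using t(3) by (auto simp: E_def ebump_def)
  moreover have "abs (t * p i) <= 1" if "i < n" for i
  proof -
   have "abs (t * p i) <= (1 / m) * m" unfolding abs_mult using t m[OF that] m0 by (intro mult_mono) auto
   thus ?thesis using m0 by simp
  qed
  ultimately show ?thesis using t by (intro exI[of _ t]) auto
 qed
 then obtain t where t: "0 < t" "E t = t" "!!i. i < n ==> abs (t * p i) <= 1" by blast
 let ?s = "%i. t * p i"
 have sc: "?s : cube n" using t(3)
 proof -
  have "-1 <= t * p i & t * p i <= 1" if "i < n" for i using t(3)[OF that] unfolding abs_le_iff by linarith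
  thus ?thesis by (auto simp: cube_def p_def)
 qed
 have e: "ebump n ?s = t" using t(2) by (simp add: E_def)
 have N: "nsq n ?s = t\<^sup>2 * nsq n p" by (simp add: nsq_def power_mult_distrib sum_distrib_left)
 have "kap n ?s i = x i" for i
 proof -
  have d: "nsq n ?s + (ebump n ?s)\<^sup>2 = t\<^sup>2 * (2 / (1 - x 0))" unfolding N e P using x01 by (simp add: field_simps)
  consider "i = 0" | j where "i = Suc j" "j < n" | "i > n" by (cases i) (auto, metis Suc_lessI less_antisym not_less_eq)
  thus ?thesis
  proof cases
   case 1
   thus ?thesis unfolding kap_def d using t x01 unfolding N e P by (simp add: field_simps power2_eq_square)
  next
   case 2
   thus ?thesis unfolding kap_def d using t x01 unfolding e by (simp add: p_def field_simps power2_eq_square)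
  next
   case 3
   thus ?thesis using out by (simp add: kap_def)
  qed
 qed
 thus ?thesis using sc by (intro bexI[of _ ?s]) auto
qed

text \<open>A continuous surjection from a compact to a Hausdorff space is a quotient map, and the
  fibres of \<open>kap\<close> with more than one point lie in the boundary, where \<open>F\<close>
  is constant.\<close>

lemma sphere_cube_lift:
 assumes n: "1 <= n" and F: "cmap n Y y0 F"
 obtains f where "based_map n Y y0 f" "!!s. s : cube n ==> f (kap n s) = F s"
proof -
 define f where "f x = F (SOME s. s : cube n & kap n s = x)" for x
 have fk: "f (kap n s) = F s" if "s : cube n" for s
 proof -
  have "EX s'. s' : cube n & kap n s' = kap n s" using that by blast
  from someI_ex[OF this] show ?thesis
   unfolding f_def using kap_inj[OF _ that] F by (metis (no_types, lifting) cmap_def)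
 qed
 have q: "quotient_map (top_of_set (cube n)) (nsphere n) (kap n)"
 proof (rule continuous_imp_quotient_map[OF continuous_kap])
  show "compact_space (top_of_set (cube n))" using compact_cube by (simp add: compact_space_subtopology)
  show "Hausdorff_space (nsphere n)" by (simp add: nsphere_def Euclidean_space_def Hausdorff_space_subtopology Hausdorff_space_product_topology)
  show "kap n ` topspace (top_of_set (cube n)) = topspace (nsphere n)" using kap_surj[OF n] kap_sphere by fastforce
 qed
 have "cmap_on (cube n) Y (f o kap n)"
  by (rule continuous_map_eq[of _ _ F]) (use F fk in "auto simp: cmap_def")
 hence "continuous_map (nsphere n) Y f" using continuous_compose_quotient_map_eq[OF q] by blast
 moreover have "f sphere_base = y0"
 proof -
  have b: "(%i. if i = 0 then 1 else 0) : bdry n" using n by (auto simp: bdry_def cube_def intro!: exI[of _ 0])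
  thus ?thesis using fk kap_bdry[OF b] F bdry_cube by (metis (no_types, lifting) cmap_def subsetD)
 qed
 ultimately show ?thesis using that fk by (simp add: based_map_def)
qed

lemma sphere_chom:
 assumes n: "1 <= n"
 shows "based_homotopic n Y y0 f g \<longleftrightarrow> chom n Y y0 (f o kap n) (g o kap n)"
proof -
 let ?D = "top_of_set (prism n)" and ?N = "prod_topology (top_of_set {0..1::real}) (nsphere n)"
 let ?k = "%(t, s). (t, kap n s)"
 have base: "(%i. if i = 0 then 1 else 0) : bdry n" using n by (auto simp: bdry_def cube_def intro!: exI[of _ 0])
 have bh: "based_homotopic n Y y0 f g \<longleftrightarrow> (EX h. continuous_map ?N Y h & (ALL x:topspace (nsphere n). h (0, x) = f x) &
   (ALL x:topspace (nsphere n). h (1, x) = g x) & (ALL t:{0..1}. h (t, sphere_base) = y0))"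
  unfolding based_homotopic_def
  by (subst homotopic_with) (use in_topspace_nsphere[of n] in "auto simp: sphere_base_def")
 have De: "?D = prod_topology (top_of_set {0..1::real}) (top_of_set (cube n))"
  by (metis euclidean_product_topology prod_topology_subtopology_eu)
 have ck: "continuous_map ?D ?N ?k"
  unfolding De case_prod_beta
  by (intro continuous_map_pairedI continuous_map_fst cmap_comp[OF continuous_map_snd continuous_kap, unfolded o_def])
 have q: "quotient_map ?D ?N ?k"
 proof (rule continuous_imp_quotient_map[OF ck])
  show "compact_space ?D" using compact_Times[OF compact_Icc compact_cube] by (simp add: compact_space_subtopology)
  have "Hausdorff_space (nsphere n)" by (simp add: nsphere_def Euclidean_space_def Hausdorff_space_subtopology Hausdorff_space_product_topology)
  thus "Hausdorff_space ?N" by (simp add: Hausdorff_space_prod_topology Hausdorff_space_subtopology)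
  show "?k ` topspace ?D = topspace ?N" using kap_surj[OF n] kap_sphere by (force simp: image_iff)
 qed
 show ?thesis
 proof
  assume "based_homotopic n Y y0 f g"
  then obtain h where h: "continuous_map ?N Y h" "ALL x:topspace (nsphere n). h (0, x) = f x"
   "ALL x:topspace (nsphere n). h (1, x) = g x" "ALL t:{0..1}. h (t, sphere_base) = y0" unfolding bh by blast
  show "chom n Y y0 (f o kap n) (g o kap n)" unfolding chom_def
   by (rule exI[of _ "h o ?k"]) (use cmap_comp[OF ck h(1)] h kap_sphere kap_bdry in auto)
 next
  assume "chom n Y y0 (f o kap n) (g o kap n)"
  then obtain H where H: "continuous_map ?D Y H" "ALL s:cube n. H (0, s) = f (kap n s) & H (1, s) = g (kap n s)"
   "ALL t:{0..1}. ALL s:bdry n. H (t, s) = y0" unfolding chom_def by auto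
  define h where "h z = H (fst z, SOME s. s : cube n & kap n s = snd z)" for z
  have hk: "h (t, kap n s) = H (t, s)" if "s : cube n" "t : {0..1}" for s t
  proof -
   have "EX s'. s' : cube n & kap n s' = kap n s" using that by blast
   from someI_ex[OF this] show ?thesis
    unfolding h_def fst_conv snd_conv using kap_inj[OF _ that(1)] H(3) that(2) by (metis (no_types, lifting))
  qed
  have "continuous_map ?D Y (h o ?k)"
   by (rule continuous_map_eq[OF H(1)]) (use hk in auto)
  hence "continuous_map ?N Y h" using continuous_compose_quotient_map_eq[OF q] by blast
  moreover have "h (t, sphere_base) = y0" if "t : {0..1}" for t
   using hk[of "%i. if i = 0 then 1 else 0" t] kap_bdry[OF base] that H(3) base bdry_cube by (metis (no_types, lifting) subsetD)
  moreover have "h (0, x) = f x" "h (1, x) = g x" if "x : topspace (nsphere n)" for x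
   using kap_surj[OF n that] hk H(2) by auto
  ultimately show "based_homotopic n Y y0 f g" unfolding bh by blast
 qed
qed

section \<open>Coordinates on the adjunction space\<close>

lemma openin_adj_space: "openin (adj_space X x A a k) U \<longleftrightarrow> adj_open X x A a k U"
 unfolding adj_space_def using topology_inverse'[OF istopology_adj_open[of X x A a k]] by simp

lemma topspace_adj_space:
 assumes "!!j. x j : topspace X" shows "topspace (adj_space X x A a k) = adj_carrier X A a k"
proof -
 have g: "glue x a j q : adj_carrier X A a k" if "j < k" "q : topspace (A j)" for j q
  using that assms by (auto simp: glue_def adj_carrier_def)
 have "adj_open X x A a k (adj_carrier X A a k)"
  unfolding adj_open_def
 proof (intro conjI allI impI)
  have "{p : topspace X. Inl p : adj_carrier X A a k} = topspace X" by (auto simp: adj_carrier_def)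
  thus "openin X {p : topspace X. Inl p : adj_carrier X A a k}" by simp
  fix j assume "j < k"
  hence "{q : topspace (A j). glue x a j q : adj_carrier X A a k} = topspace (A j)" using g by auto
  thus "openin (A j) {q : topspace (A j). glue x a j q : adj_carrier X A a k}" by simp
 qed simp
 moreover have "U <= adj_carrier X A a k" if "adj_open X x A a k U" for U using that by (simp add: adj_open_def)
 ultimately show ?thesis unfolding topspace_def openin_adj_space by blast
qed

text \<open>The shrinking adjunction space is coordinatised by the retraction to \<open>X\<close> and the retractions to the
 attached spaces: its points are pairs \<open>(p, al)\<close> with at most one \<open>al j\<close> off the base point, and then \<open>p = x j\<close>.\<close>

definition espace :: "'a topology => (nat => 'a) => (nat => 'b topology) => (nat => 'b) => ('a \<times> (nat => 'b)) topology" where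
 "espace X x A a = subtopology (prod_topology X (product_topology A UNIV))
   {(p, al). ALL j. al j ~= a j --> p = x j & (ALL i. i ~= j --> al i = a i)}"

definition ret_X :: "(nat => 'a) => 'a + nat \<times> 'b => 'a" where
 "ret_X x z = (case z of Inl p => p | Inr (j, q) => x j)"

definition ret_A :: "(nat => 'b) => nat => 'a + nat \<times> 'b => 'b" where
 "ret_A a j z = (case z of Inl p => a j | Inr (i, q) => if i = j then q else a j)"

lemma continuous_ret_X:
 assumes "!!j. x j : topspace X" shows "continuous_map (adj_space X x A a k) X (ret_X x)"
 unfolding continuous_map_def openin_adj_space adj_open_def topspace_adj_space[of x X A a k, OF assms]
proof (intro conjI allI impI)
 show "ret_X x : adj_carrier X A a k \<rightarrow> topspace X"
  using assms by (auto simp: ret_X_def adj_carrier_def)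
 fix U assume U: "openin X U"
 show "{z : adj_carrier X A a k. ret_X x z : U} <= adj_carrier X A a k" by auto
 have "{p : topspace X. Inl p : {z : adj_carrier X A a k. ret_X x z : U}} = U"
  using openin_subset[OF U] by (auto simp: ret_X_def adj_carrier_def)
 thus "openin X {p : topspace X. Inl p : {z : adj_carrier X A a k. ret_X x z : U}}" using U by simp
 fix j assume j: "j < k"
 have "{q : topspace (A j). glue x a j q : {z : adj_carrier X A a k. ret_X x z : U}} = (if x j : U then topspace (A j) else {})"
  using j assms by (auto simp: ret_X_def adj_carrier_def glue_def)
 thus "openin (A j) {q : topspace (A j). glue x a j q : {z : adj_carrier X A a k. ret_X x z : U}}" by simp
qed

lemma continuous_ret_A:
 assumes "!!j. x j : topspace X" "!!j. a j : topspace (A j)" "i < k"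
 shows "continuous_map (adj_space X x A a k) (A i) (ret_A a i)"
 unfolding continuous_map_def openin_adj_space adj_open_def topspace_adj_space[of x X A a k, OF assms(1)]
proof (intro conjI allI impI)
 show "ret_A a i : adj_carrier X A a k \<rightarrow> topspace (A i)"
  using assms by (auto simp: ret_A_def adj_carrier_def)
 fix U assume U: "openin (A i) U"
 show "{z : adj_carrier X A a k. ret_A a i z : U} <= adj_carrier X A a k" by auto
 have "{p : topspace X. Inl p : {z : adj_carrier X A a k. ret_A a i z : U}} = (if a i : U then topspace X else {})"
  by (auto simp: ret_A_def adj_carrier_def)
 thus "openin X {p : topspace X. Inl p : {z : adj_carrier X A a k. ret_A a i z : U}}" by simp
 fix j assume j: "j < k"
 have "{q : topspace (A j). glue x a j q : {z : adj_carrier X A a k. ret_A a i z : U}}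
   = (if j = i then U else if a i : U then topspace (A j) else {})"
  using j assms openin_subset[OF U] by (auto simp: ret_A_def adj_carrier_def glue_def)
 thus "openin (A j) {q : topspace (A j). glue x a j q : {z : adj_carrier X A a k. ret_A a i z : U}}" using U by simp
qed

text \<open>On \<open>espace\<close> at most one component is off its base point, so the
  \<open>THE\<close> is well defined there. A component not yet attached at stage \<open>k\<close>
  is collapsed to its attaching point.\<close>

definition stage :: "(nat => 'b) => nat => 'a \<times> (nat => 'b) => 'a + nat \<times> 'b" where
 "stage a k e = (if EX j<k. snd e j ~= a j then (let j = (THE j. snd e j ~= a j) in Inr (j, snd e j)) else Inl (fst e))"

lemma topspace_espace: "e : topspace (espace X x A a) \<longleftrightarrow> fst e : topspace X & (ALL j. snd e j : topspace (A j)) &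
  (ALL j. snd e j ~= a j --> fst e = x j & (ALL i. i ~= j --> snd e i = a i))"
 by (cases e) (auto simp: espace_def)

lemma stage_Inr:
 assumes e: "e : topspace (espace X x A a)" and j: "j < k" "snd e j ~= a j"
 shows "stage a k e = Inr (j, snd e j)"
proof -
 have "(THE j. snd e j ~= a j) = j"
  by (rule the_equality) (use e j in "auto simp: topspace_espace")
 thus ?thesis using j by (auto simp: stage_def Let_def)
qed

lemma stage_Inl: "(!!j. j < k ==> snd e j = a j) ==> stage a k e = Inl (fst e)"
 by (auto simp: stage_def)

lemma continuous_espace_components:
 "continuous_map Z (espace X x A a) h \<longleftrightarrow> continuous_map Z X (fst o h) & (ALL j. continuous_map Z (A j) (%z. snd (h z) j)) &
   (ALL z:topspace Z. ALL j. snd (h z) j ~= a j --> fst (h z) = x j & (ALL i. i ~= j --> snd (h z) i = a i))"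
proof -
 have "h : topspace Z \<rightarrow> {(p, al). ALL j. al j ~= a j --> p = x j & (ALL i. i ~= j --> al i = a i)} \<longleftrightarrow>
  (ALL z:topspace Z. ALL j. snd (h z) j ~= a j --> fst (h z) = x j & (ALL i. i ~= j --> snd (h z) i = a i))"
  by (simp add: Pi_iff case_prod_beta)
 thus ?thesis
  unfolding espace_def continuous_map_in_subtopology continuous_map_pairwise continuous_map_componentwise_UNIV
  by (simp add: o_def)
qed

lemma continuous_stage:
 fixes k :: nat
 assumes x: "!!j. x j : topspace X" and a: "!!j. a j : topspace (A j)"
  and T: "t1_space X" "!!j. t1_space (A j)"
 shows "continuous_map (espace X x A a) (adj_space X x A a k) (stage a k)"
proof -
 let ?E = "espace X x A a"
 have cX: "continuous_map ?E X fst" and cA: "!!j. continuous_map ?E (A j) (%e. snd e j)"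
  using continuous_espace_components[of ?E X x A a "%e. e"] by (auto simp: o_def)
 have nea: "openin (A j) (topspace (A j) - {a j})" for j
  using T(2)[of j] a[of j] by (metis closedin_def closedin_t1_singleton)
 have nex: "openin X (topspace X - {x j})" for j
  using T(1) x[of j] by (metis closedin_def closedin_t1_singleton)
 show ?thesis
  unfolding continuous_map_def
 proof (intro conjI allI impI)
  have "stage a k e : adj_carrier X A a k" if e: "e : topspace ?E" for e
  proof (cases "EX j<k. snd e j ~= a j")
   case True
   then obtain j where "j < k" "snd e j ~= a j" by blast
   thus ?thesis using stage_Inr[OF e] e by (auto simp: adj_carrier_def topspace_espace)
  next
   case False
   thus ?thesis using stage_Inl[of k e a] e by (auto simp: adj_carrier_def topspace_espace)
  qed
  thus "stage a k : topspace ?E \<rightarrow> topspace (adj_space X x A a k)"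
   by (simp add: topspace_adj_space[of x X A a k, OF x])
  fix U assume "openin (adj_space X x A a k) U"
  hence U: "openin X {p : topspace X. Inl p : U}" "!!j. j < k ==> openin (A j) {q : topspace (A j). glue x a j q : U}"
   by (auto simp: openin_adj_space adj_open_def)
  let ?W = "{e : topspace ?E. stage a k e : U}"
  show "openin ?E ?W"
  proof (subst openin_subopen, intro ballI)
   fix e0 assume "e0 : ?W"
   hence e0: "e0 : topspace ?E" "stage a k e0 : U" by auto
   show "EX T. openin ?E T & e0 : T & T <= ?W"
   proof (cases "EX j<k. snd e0 j ~= a j")
    case True
    then obtain j where j: "j < k" "snd e0 j ~= a j" by blast
    let ?V = "{q : topspace (A j). glue x a j q : U} Int (topspace (A j) - {a j})"
    have "openin ?E {e : topspace ?E. snd e j : ?V}"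
     by (rule openin_continuous_map_preimage[OF cA]) (use U(2)[OF j(1)] nea in blast)
    moreover have "e0 : {e : topspace ?E. snd e j : ?V}"
     using e0 j stage_Inr[OF e0(1) j] by (auto simp: topspace_espace glue_def)
    moreover have "{e : topspace ?E. snd e j : ?V} <= ?W"
     using stage_Inr[OF _ j(1), of _ X x A a] by (auto simp: glue_def)
    ultimately show ?thesis by blast
   next
    case False
    let ?p = "fst e0"
    have s0: "Inl ?p : U" using stage_Inl[of k e0 a] False e0 by auto
    \<comment> \<open>If \<open>A j\<close> is attached at the current point, its component must
      stay in the glued part of \<open>U\<close>. If it is attached elsewhere, staying away from
      \<open>x j\<close> forces its component to the base point. Only the finitely many
      \<open>j < k\<close> matter.\<close>
    define T where "T j = (if x j = ?p then {e : topspace ?E. snd e j : {q : topspace (A j). glue x a j q : U}}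
     else {e : topspace ?E. fst e : topspace X - {x j}})" for j
    let ?T0 = "{e : topspace ?E. fst e : {p : topspace X. Inl p : U}}"
    let ?T = "\<Inter>(insert ?T0 (T ` {..<k}))"
    have oT: "openin ?E (T j)" if "j < k" for j
     unfolding T_def using openin_continuous_map_preimage[OF cA U(2)[OF that]] openin_continuous_map_preimage[OF cX nex] by simp
    have "openin ?E ?T" by (rule openin_Inter) (use oT openin_continuous_map_preimage[OF cX U(1)] in auto)
    moreover have "e0 : T j" if "j < k" for j
     unfolding T_def using False that e0(1) s0 a by (auto simp: topspace_espace glue_def)
    hence "e0 : ?T" using e0 s0 by (auto simp: topspace_espace)
    moreover have "?T <= ?W"
    proof
     fix e assume e: "e : ?T"
     hence eE: "e : topspace ?E" "Inl (fst e) : U" and eT: "!!j. j < k ==> e : T j" by auto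
     show "e : ?W"
     proof (cases "EX j<k. snd e j ~= a j")
      case True
      then obtain j where j: "j < k" "snd e j ~= a j" by blast
      have "fst e = x j" using eE(1) j by (simp add: topspace_espace)
      hence "glue x a j (snd e j) : U" using eT[OF j(1)] by (auto simp: T_def split: if_splits)
      thus ?thesis using stage_Inr[OF eE(1) j] eE(1) j by (simp add: glue_def)
     next
      case False
      thus ?thesis using stage_Inl[of k e a] eE by auto
     qed
    qed
    ultimately show ?thesis by blast
   qed
  qed
 qed
qed

context
 fixes X :: "'a topology" and x :: "nat => 'a" and A :: "nat => 'b topology" and a :: "nat => 'b"
 assumes x: "!!j. x j : topspace X" and a: "!!j. a j : topspace (A j)"
begin

text \<open>Stage 0 is \<open>X\<close> itself, and \<open>A j\<close> is present from stage
  \<open>Suc j\<close> on.\<close>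

definition from_Y :: "(nat => 'a + nat \<times> 'b) => 'a \<times> (nat => 'b)" where
 "from_Y y = (ret_X x (y 0), %j. ret_A a j (y (Suc j)))"

lemma topspace_shrinking:
 "y : topspace (shrinking_adj X x A a) \<longleftrightarrow> (ALL k. y k : adj_carrier X A a k & collapse x k (y (Suc k)) = y k)"
 unfolding shrinking_adj_def by (auto simp: topspace_adj_space[of x X A a, OF x] PiE_UNIV_domain)

lemma shrinking_Inl_down:
 assumes y: "y : topspace (shrinking_adj X x A a)" and "i <= k" "y k = Inl p" shows "y i = Inl p"
 using assms(2,3)
proof (induction rule: inc_induct)
 case (step m)
 hence "y (Suc m) = Inl p" by simp
 moreover have "collapse x m (y (Suc m)) = y m" using y by (auto simp: topspace_shrinking)
 ultimately show ?case by (simp add: collapse_def)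
qed

lemma shrinking_step:
 assumes y: "y : topspace (shrinking_adj X x A a)" and "ret_A a j (y (Suc j)) ~= a j"
 shows "y (Suc j) = Inr (j, ret_A a j (y (Suc j)))" "!!i. i <= j ==> y i = Inl (x j)"
proof -
 show 1: "y (Suc j) = Inr (j, ret_A a j (y (Suc j)))"
  using assms(2) by (auto simp: ret_A_def split: sum.splits if_splits)
 have "collapse x j (y (Suc j)) = y j" using y by (auto simp: topspace_shrinking)
 hence "y j = Inl (x j)" by (subst (asm) 1) (simp add: collapse_def)
 thus "!!i. i <= j ==> y i = Inl (x j)" using shrinking_Inl_down[OF y] by blast
qed

lemma from_Y_espace:
 assumes y: "y : topspace (shrinking_adj X x A a)" shows "from_Y y : topspace (espace X x A a)"
 unfolding topspace_espace
proof (intro conjI allI impI)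
 have c: "y k : adj_carrier X A a k" for k using y by (auto simp: topspace_shrinking)
 show "fst (from_Y y) : topspace X" using c[of 0] by (auto simp: from_Y_def adj_carrier_def ret_X_def)
 show "snd (from_Y y) j : topspace (A j)" for j
  using c[of "Suc j"] a[of j] by (auto simp: from_Y_def adj_carrier_def ret_A_def)
 fix j assume "snd (from_Y y) j ~= a j"
 hence j: "ret_A a j (y (Suc j)) ~= a j" by (simp add: from_Y_def)
 show "fst (from_Y y) = x j" using shrinking_step(2)[OF y j, of 0] by (simp add: from_Y_def ret_X_def)
 fix i assume "i ~= j"
 show "snd (from_Y y) i = a i"
 proof (rule ccontr)
  assume "snd (from_Y y) i ~= a i"
  hence i: "ret_A a i (y (Suc i)) ~= a i" by (simp add: from_Y_def)
  show False
  proof (cases "i < j")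
   case True
   thus ?thesis using shrinking_step(1)[OF y i] shrinking_step(2)[OF y j, of "Suc i"] by simp
  next
   case False
   thus ?thesis using `i ~= j` shrinking_step(1)[OF y j] shrinking_step(2)[OF y i, of "Suc j"] by simp
  qed
 qed
qed

lemma stage_from_Y:
 assumes y: "y : topspace (shrinking_adj X x A a)" shows "stage a k (from_Y y) = y k"
proof (induction k)
 case 0
 have "y 0 : adj_carrier X A a 0" using y by (auto simp: topspace_shrinking)
 thus ?case by (auto simp: stage_def from_Y_def adj_carrier_def ret_X_def)
next
 case (Suc k)
 note e = from_Y_espace[OF y]
 have col: "collapse x k (y (Suc k)) = y k" and c: "y (Suc k) : adj_carrier X A a (Suc k)" using y by (auto simp: topspace_shrinking)
 show ?case
 proof (cases "ret_A a k (y (Suc k)) = a k")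
  case False
  hence "snd (from_Y y) k ~= a k" by (simp add: from_Y_def)
  hence "stage a (Suc k) (from_Y y) = Inr (k, snd (from_Y y) k)" using stage_Inr[OF e] by blast
  thus ?thesis using shrinking_step(1)[OF y False] by (simp add: from_Y_def)
 next
  case True
  hence "y (Suc k) = y k" using col c by (auto simp: collapse_def ret_A_def adj_carrier_def split: sum.splits if_splits)
  moreover have "stage a (Suc k) (from_Y y) = stage a k (from_Y y)"
  proof -
   have "snd (from_Y y) k = a k" using True by (simp add: from_Y_def)
   hence "(EX j<Suc k. snd (from_Y y) j ~= a j) \<longleftrightarrow> (EX j<k. snd (from_Y y) j ~= a j)" by (metis less_Suc_eq)
   thus ?thesis by (simp add: stage_def)
  qed
  ultimately show ?thesis using Suc by simp
 qed
qed

lemma continuous_from_Y: "continuous_map (shrinking_adj X x A a) (espace X x A a) from_Y"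
 unfolding continuous_espace_components
proof (intro conjI allI impI ballI)
 have c: "continuous_map (shrinking_adj X x A a) (adj_space X x A a k) (%y. y k)" for k
  unfolding shrinking_adj_def by (intro continuous_map_from_subtopology continuous_map_product_projection) simp
 show "continuous_map (shrinking_adj X x A a) X (fst o from_Y)"
  using cmap_comp[OF c continuous_ret_X[of x X, OF x]] by (simp add: from_Y_def o_def)
 show "continuous_map (shrinking_adj X x A a) (A j) (%y. snd (from_Y y) j)" for j
  using cmap_comp[OF c continuous_ret_A[of x X a A j "Suc j", OF x a]] by (simp add: from_Y_def o_def)
 fix y j assume "y : topspace (shrinking_adj X x A a)" and j: "snd (from_Y y) j ~= a j"
 hence "from_Y y : topspace (espace X x A a)" using from_Y_espace by blast
 thus "fst (from_Y y) = x j" "i ~= j ==> snd (from_Y y) i = a i" for i using j by (auto simp: topspace_espace)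
qed

lemma continuous_to_Y:
 assumes T: "t1_space X" "!!j. t1_space (A j)"
 shows "continuous_map (espace X x A a) (shrinking_adj X x A a) (%e k. stage a k e)"
proof -
 have c: "continuous_map (espace X x A a) (adj_space X x A a k) (stage a k)" for k
  by (rule continuous_stage[OF x a T])
 have "collapse x k (stage a (Suc k) e) = stage a k e" if e: "e : topspace (espace X x A a)" for e k
 proof (cases "EX j<Suc k. snd e j ~= a j")
  case True
  then obtain j where j: "j < Suc k" "snd e j ~= a j" by blast
  show ?thesis
  proof (cases "j = k")
   case True
   have "stage a k e = Inl (fst e)" by (rule stage_Inl) (use e j True in "auto simp: topspace_espace")
   moreover have "fst e = x k" using e j True by (auto simp: topspace_espace)
   ultimately show ?thesis using stage_Inr[OF e j] True by (simp add: collapse_def)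
  next
   case False
   thus ?thesis using stage_Inr[OF e j] stage_Inr[OF e _ j(2), of k] j by (simp add: collapse_def)
  qed
 next
  case False
  hence "stage a (Suc k) e = Inl (fst e)" "stage a k e = Inl (fst e)" by (auto intro!: stage_Inl)
  thus ?thesis by (simp add: collapse_def)
 qed
 thus ?thesis
  unfolding shrinking_adj_def continuous_map_in_subtopology continuous_map_componentwise_UNIV
  using c cmap_image[OF c] by (auto simp: image_subset_iff)
qed

lemma chom_Y_iff:
 assumes T: "t1_space X" "!!j. t1_space (A j)"
  and fg: "cmap n (shrinking_adj X x A a) y0 f" "cmap n (shrinking_adj X x A a) y0 g" "y0 : topspace (shrinking_adj X x A a)"
  and h: "chom n (espace X x A a) (from_Y y0) (from_Y o f) (from_Y o g)"
 shows "chom n (shrinking_adj X x A a) y0 f g"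
proof -
 let ?t = "%e k. stage a k e"
 have inv: "?t (from_Y y) = y" if "y : topspace (shrinking_adj X x A a)" for y
  using stage_from_Y[OF that] by auto
 have "chom n (shrinking_adj X x A a) (?t (from_Y y0)) (?t o (from_Y o f)) (?t o (from_Y o g))"
  by (rule chom_compose[OF h continuous_to_Y[OF T]])
 thus ?thesis
  unfolding inv[OF fg(3)]
 proof (rule chom_cong)
  fix s assume "s : cube n"
  hence "f s : topspace (shrinking_adj X x A a)" "g s : topspace (shrinking_adj X x A a)"
   using fg by (auto simp: cmap_def dest!: cmap_image)
  thus "(?t o (from_Y o f)) s = f s" "(?t o (from_Y o g)) s = g s" using inv by auto
 qed
qed

text \<open>The retractions of a finite stage give coordinates there as well, with the components
  from \<open>k\<close> on set to their base points.\<close>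

lemma chom_stage:
 assumes b: "!!p. p : topspace X ==> bm p : topspace X'"
  and h: "chom n (adj_space X' (%j. bm (x j)) A a k) (map_sum bm id (y0 k)) (%s. map_sum bm id (f s k)) (%s. map_sum bm id (g s k))"
  and fg: "!!s. s : cube n ==> f s : topspace (shrinking_adj X x A a)" "!!s. s : cube n ==> g s : topspace (shrinking_adj X x A a)"
   "y0 : topspace (shrinking_adj X x A a)"
 shows "chom n (espace X' (%j. bm (x j)) A a) (bm (fst (from_Y y0)), %j. if j < k then snd (from_Y y0) j else a j)
   (%s. (bm (fst (from_Y (f s))), %j. if j < k then snd (from_Y (f s)) j else a j))
   (%s. (bm (fst (from_Y (g s))), %j. if j < k then snd (from_Y (g s)) j else a j))"
proof -
 let ?x = "%j. bm (x j)"
 let ?r = "%z. (ret_X ?x z, %j. if j < k then ret_A a j z else a j)"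
 have x': "!!j. ?x j : topspace X'" using b x by blast
 have "continuous_map (adj_space X' ?x A a k) (espace X' ?x A a) ?r"
  unfolding continuous_espace_components
 proof (intro conjI allI ballI impI)
  show "continuous_map (adj_space X' ?x A a k) X' (fst o ?r)"
   using continuous_ret_X[of ?x X', OF x'] by (simp add: o_def)
  show "continuous_map (adj_space X' ?x A a k) (A j) (%z. snd (?r z) j)" for j
   using continuous_ret_A[of ?x X' a A j k, OF x' a] a by (cases "j < k") auto
 qed (auto simp: ret_A_def ret_X_def split: sum.splits if_splits)
 note c = chom_compose[OF h this]
 have eq: "?r (map_sum bm id (y k)) = (bm (fst (from_Y y)), %j. if j < k then snd (from_Y y) j else a j)"
  if y: "y : topspace (shrinking_adj X x A a)" for y
 proof -
  have e: "from_Y y : topspace (espace X x A a)" by (rule from_Y_espace[OF y])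
  have st: "y k = stage a k (from_Y y)" using stage_from_Y[OF y] by simp
  show ?thesis
  proof (cases "EX j<k. snd (from_Y y) j ~= a j")
   case True
   then obtain j where j: "j < k" "snd (from_Y y) j ~= a j" by blast
   have "fst (from_Y y) = x j" "!!i. i ~= j ==> snd (from_Y y) i = a i" using e j by (auto simp: topspace_espace)
   thus ?thesis unfolding st stage_Inr[OF e j] using j by (auto simp: ret_X_def ret_A_def fun_eq_iff)
  next
   case False
   thus ?thesis unfolding st using stage_Inl[of k "from_Y y" a] by (auto simp: ret_X_def ret_A_def fun_eq_iff)
  qed
 qed
 show ?thesis
  using chom_cong[OF c, of "%s. (bm (fst (from_Y (f s))), %j. if j < k then snd (from_Y (f s)) j else a j)"
    "%s. (bm (fst (from_Y (g s))), %j. if j < k then snd (from_Y (g s)) j else a j)"] eq fg by simp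
qed

end

section \<open>Maximum norm, rescaling and change of base point\<close>

primrec mx :: "nat => (nat => real) => real" where
 "mx 0 s = 0"
| "mx (Suc n) s = max (mx n s) (abs (s n))"

lemma mx_le: "0 <= c ==> mx n s <= c \<longleftrightarrow> (ALL i<n. abs (s i) <= c)"
 by (induction n) (auto simp: less_Suc_eq)

lemma mx_nonneg: "0 <= mx n s"
 by (induction n) auto

lemma mx_ge: "0 < c ==> c <= mx n s \<longleftrightarrow> (EX i<n. c <= abs (s i))"
 by (induction n) (auto simp: less_Suc_eq le_max_iff_disj)

lemma continuous_mx: "(!!i. i < n ==> continuous_on S (%z. g z i)) ==> continuous_on S (%z. mx n (g z))"
 by (induction n) (auto intro!: continuous_intros)

lemma mx_cube: "s : cube n ==> mx n s <= 1"
 by (subst mx_le) (auto simp: cube_def abs_le_iff)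

lemma mx_bdry:
 assumes s: "s : cube n"
 shows "s : bdry n \<longleftrightarrow> mx n s = 1"
proof -
 have "mx n s = 1 \<longleftrightarrow> 1 <= mx n s" using mx_cube[OF s] by auto
 also have "... \<longleftrightarrow> (EX i<n. 1 <= abs (s i))" by (rule mx_ge) simp
 also have "... \<longleftrightarrow> s : bdry n" using s by (force simp: bdry_def cube_def)
 finally show ?thesis by simp
qed

definition csc :: "real => (nat => real) => nat => real" where
 "csc l s = (%i. max (-1) (min 1 (l * s i)))"

lemma csc_cube: "s : cube n ==> csc l s : cube n"
 by (auto simp: cube_def csc_def)

lemma csc_bdry:
 assumes s: "s : cube n" and l: "0 < l" and m: "1 <= l * mx n s"
 shows "csc l s : bdry n"
proof -
 have "1 / l <= mx n s" using l m by (simp add: field_simps)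
 then obtain i where "i < n" "1 / l <= abs (s i)" using mx_ge[of "1 / l" n s] l by auto
 hence "i < n" "1 <= abs (l * s i)" using l by (auto simp: field_simps abs_mult)
 moreover have "abs (max (-1) (min 1 u)) = 1" if "1 <= abs u" for u :: real
  using that by (cases "0 <= u") (auto simp: abs_if min_def max_def)
 ultimately show ?thesis using csc_cube[OF s, of l] by (auto simp: bdry_def csc_def)
qed

lemma csc_id: "s : cube n ==> csc 1 s = s"
proof
 fix i assume "s : cube n"
 thus "csc 1 s i = s i" by (cases "i < n") (auto simp: csc_def cube_def)
qed

lemma continuous_csc: "continuous_on S (%z. csc (fst z) (snd z))"
 unfolding csc_def by (intro continuous_on_coords continuous_intros)

lemma mx_csc:
 assumes s: "s : cube n" and l: "0 <= l" and m: "l * mx n s <= 1"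
 shows "mx n (csc l s) = l * mx n s"
proof -
 have b: "abs (l * s i) <= 1" if "i < n" for i
 proof -
  have "abs (s i) <= mx n s" using mx_le[OF mx_nonneg, of n s n s] that by auto
  hence "l * abs (s i) <= l * mx n s" using l by (rule mult_left_mono)
  thus ?thesis using m l by (simp add: abs_mult)
 qed
 have "mx k (csc l s) = l * mx k s" if "k <= n" for k
  using that
 proof (induction k)
  case (Suc k)
  hence "csc l s k = l * s k" using b[of k] by (auto simp: csc_def abs_le_iff)
  thus ?case using Suc l by (simp add: abs_mult max_mult_distrib_left)
 qed simp
 thus ?thesis by simp
qed

lemma chom_csc:
 assumes f: "cmap n Y y0 f" and l: "1 <= l" shows "chom n Y y0 f (f o csc l)"
 unfolding chom_def
proof (intro exI conjI ballI)
 let ?h = "f o (%(t, s). csc (1 + t * (l - 1)) s)"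
 have "continuous_on S (%x. csc (1 + fst x * (l - 1)) (snd x))" for S :: "(real \<times> (nat => real)) set"
  by (rule continuous_on_compose2[OF continuous_csc[of UNIV], of S "%x. (1 + fst x * (l - 1), snd x)", simplified])
   (intro continuous_intros)
 thus "cmap_on (prism n) Y ?h"
  using f unfolding cmap_def by (intro cmap_comp[of _ "top_of_set (cube n)"]) (auto simp: case_prod_beta csc_cube)
 show "?h (0, s) = f s" "?h (1, s) = (f o csc l) s" if "s : cube n" for s
  using csc_id[OF that] by simp_all
 fix t :: real and s assume t: "t : {0..1}" and s: "s : bdry n"
 have "mx n s = 1" using s mx_bdry bdry_cube by blast
 hence "csc (1 + t * (l - 1)) s : bdry n" using s bdry_cube t l by (intro csc_bdry) (auto intro: add_pos_nonneg)
 thus "?h (t, s) = y0" using f by (simp add: cmap_def)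
qed

text \<open>Change of base point along a path \<open>de\<close>: shrink \<open>f\<close> and run \<open>de\<close> in the collar.\<close>

definition transp :: "nat => (real => 'a) => ((nat => real) => 'a) => (nat => real) => 'a" where
 "transp n de f s = (if mx n s <= 1/2 then f (csc 2 s) else de (2 * mx n s - 1))"

context
 fixes n :: nat and Y :: "'a topology" and de :: "real => 'a" and y0 y1 :: 'a
 assumes de: "cmap_on {0..1} Y de" "de 0 = y0" "de 1 = y1"
begin

lemma transp_chom:
 assumes "chom n Y y0 f g" shows "chom n Y y1 (transp n de f) (transp n de g)"
proof -
 let ?D = "prism n"
 obtain h where h: "cmap_on ?D Y h"
  "ALL s:cube n. h (0, s) = f s & h (1, s) = g s" "ALL t:{0..1}. ALL s:bdry n. h (t, s) = y0"
  using assms(1) unfolding chom_def by blast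
 let ?H = "%z. if mx n (snd z) <= 1/2 then (h o (%z. (fst z, csc 2 (snd z)))) z else (de o (%z. 2 * mx n (snd z) - 1)) z"
 have cs: "continuous_on S (%x. csc 2 (snd x))" for S :: "(real \<times> (nat => real)) set"
  by (rule continuous_on_compose2[OF continuous_csc[of UNIV], of S "%x. (2, snd x)", simplified])
   (intro continuous_intros)
 have cm: "continuous_on S (%z. mx n (snd z))" for S :: "(real \<times> (nat => real)) set"
  by (intro continuous_mx continuous_intros)
 have "cmap_on ?D Y ?H"
 proof (rule cmap_on_cases_le)
  show "cmap_on {x : ?D. mx n (snd x) <= 1/2} Y (h o (%z. (fst z, csc 2 (snd z))))"
   by (rule cmap_comp[OF _ h(1)]) (auto simp: subtopology_subtopology csc_cube intro!: continuous_intros cs)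
  show "cmap_on {x : ?D. 1/2 <= mx n (snd x)} Y (de o (%z. 2 * mx n (snd z) - 1))"
   by (rule cmap_comp[OF _ de(1)]) (auto simp: subtopology_subtopology mx_cube intro!: continuous_intros cm)
  show "continuous_on ?D (%z. mx n (snd z))" by (rule cm)
  fix x assume x: "x : ?D" "mx n (snd x) = 1/2"
  hence "csc 2 (snd x) : bdry n" by (intro csc_bdry) auto
  hence "h (fst x, csc 2 (snd x)) = y0" using h(3) x by auto
  moreover have m: "2 * mx n (snd x) - 1 = 0" using x by simp
  have "de (2 * mx n (snd x) - 1) = y0" unfolding m by (rule de(2))
  ultimately show "(h o (%z. (fst z, csc 2 (snd z)))) x = (de o (%z. 2 * mx n (snd z) - 1)) x"
   by (simp only: o_def)
 qed
 moreover have "?H (t, s) = y1" if "s : bdry n" for t s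
 proof -
  have "mx n s = 1" using that mx_bdry[of s n] bdry_cube by blast
  thus ?thesis using de(3) by simp
 qed
 ultimately show ?thesis unfolding chom_def
  by (intro exI[of _ ?H]) (use h(2) csc_cube in "auto simp: transp_def")
qed

lemma transp_cmap: "cmap n Y y0 f ==> cmap n Y y1 (transp n de f)"
 using transp_chom[OF chom_refl, of f] chom_cmap[of n Y y1 "transp n de f"] by simp

end

lemma transp_back:
 assumes de: "cmap_on {0..1} Y de" "de 0 = y0" "de 1 = y1" and f: "cmap n Y y0 f"
 shows "chom n Y y0 (transp n (%t. de (1 - t)) (transp n de f)) f"
proof -
 let ?D = "prism n"
 \<comment> \<open>After transport there and back the collar begins at norm 1/4. This tent is 0 at
   1/4, 1 at 1/2 and 0 at 1, so \<open>de\<close> is run to its end and back; scaling the tent by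
   \<open>1 - t\<close> removes the detour.\<close>
 let ?et = "%r::real. min (4 * r - 1) (2 - 2 * r)"
 let ?H = "%z. if mx n (snd z) <= 1/4 then (f o (%z. csc 4 (snd z))) z else (de o (%z. (1 - fst z) * ?et (mx n (snd z)))) z"
 have cs: "continuous_on S (%x. csc 4 (snd x))" for S :: "(real \<times> (nat => real)) set"
  by (rule continuous_on_compose2[OF continuous_csc[of UNIV], of S "%x. (4, snd x)", simplified])
   (intro continuous_intros)
 have cm: "continuous_on S (%z. mx n (snd z))" for S :: "(real \<times> (nat => real)) set"
  by (intro continuous_mx continuous_intros)
 have rng: "(1 - t) * ?et r : {0..1}" if "t : {0..1}" "1/4 <= r" "r <= 1" for t r
 proof -
  have "0 <= ?et r" "?et r <= 1" using that by (auto simp: min_def)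
  thus ?thesis using that by (auto intro!: mult_nonneg_nonneg mult_le_one)
 qed
 have cH: "cmap_on ?D Y ?H"
 proof (rule cmap_on_cases_le)
  show "cmap_on {x : ?D. mx n (snd x) <= 1/4} Y (f o (%z. csc 4 (snd z)))"
   by (rule cmap_comp[of _ "top_of_set (cube n)"])
    (use f in "auto simp: cmap_def subtopology_subtopology csc_cube intro!: continuous_intros cs")
  show "cmap_on {x : ?D. 1/4 <= mx n (snd x)} Y (de o (%z. (1 - fst z) * ?et (mx n (snd z))))"
  proof (rule cmap_comp[OF _ de(1)])
   have "(%z. (1 - fst z) * ?et (mx n (snd z))) : ?D Int {x : ?D. 1/4 <= mx n (snd x)} \<rightarrow> {0..1}"
    using rng mx_cube by (intro funcsetI) (force simp del: atLeastAtMost_iff)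
   thus "cmap_on {x : ?D. 1/4 <= mx n (snd x)} (top_of_set {0..1}) (%z. (1 - fst z) * ?et (mx n (snd z)))"
    by (auto simp: subtopology_subtopology simp del: atLeastAtMost_iff intro!: continuous_intros cm)
  qed
  show "continuous_on ?D (%z. mx n (snd z))" by (rule cm)
  fix x assume x: "x : ?D" "mx n (snd x) = 1/4"
  hence "csc 4 (snd x) : bdry n" by (intro csc_bdry) auto
  moreover have "?et (mx n (snd x)) = 0" using x by (simp add: min_def)
  ultimately show "(f o (%z. csc 4 (snd z))) x = (de o (%z. (1 - fst z) * ?et (mx n (snd z)))) x"
   using f de(2) unfolding o_def cmap_def by simp
 qed
 have csc2: "csc 2 (csc 2 s) = csc 4 s" if "mx n s <= 1/4" "s : cube n" for s
 proof
  fix i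
  have "abs (s i) <= 1/4" using mx_le[of "1/4" n s] that by (cases "i < n") (auto simp: cube_def)
  thus "csc 2 (csc 2 s) i = csc 4 s i" by (auto simp: csc_def abs_le_iff)
 qed
 have "chom n Y y0 (transp n (%t. de (1 - t)) (transp n de f)) (f o csc 4)"
  unfolding chom_def
 proof (intro exI[of _ ?H] conjI ballI cH)
  fix s assume s: "s : cube n"
  consider "mx n s <= 1/4" | "1/4 < mx n s" "mx n s <= 1/2" | "1/2 < mx n s" by linarith
  thus "?H (0, s) = transp n (%t. de (1 - t)) (transp n de f) s"
  proof cases
   case 1
   thus ?thesis using csc2[OF 1 s] mx_csc[OF s, of 2] by (simp add: transp_def)
  next
   case 2
   thus ?thesis using mx_csc[OF s, of 2] by (simp add: transp_def min_def)
  next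
   case 3
   thus ?thesis by (simp add: transp_def min_def algebra_simps)
  qed
  have "csc 4 s : bdry n" if "1/4 <= mx n s" using csc_bdry[OF s, of 4] that by simp
  thus "?H (1, s) = (f o csc 4) s" using f de by (auto simp: cmap_def)
 next
  fix t :: real and s assume "t : {0..1}" "s : bdry n"
  hence "mx n s = 1" using mx_bdry[of s n] bdry_cube by blast
  thus "?H (t, s) = y0" using de(2) by (simp add: min_def)
 qed
 thus ?thesis using chom_trans chom_sym[OF chom_csc[OF f, of 4]] by force
qed

lemma chom_transp_iff:
 assumes de: "cmap_on {0..1} Y de" "de 0 = y0" "de 1 = y1"
  and f: "cmap n Y y0 f" "cmap n Y y0 g" and h: "chom n Y y1 (transp n de f) (transp n de g)"
 shows "chom n Y y0 f g"
proof -
 have r: "cmap_on {0..1} Y (%t. de (1 - t))"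
 proof -
  have "continuous_on {0..1::real} (%t. 1 - t)" by (intro continuous_intros)
  thus ?thesis using cmap_comp[OF _ de(1), of "top_of_set {0..1}" "%t. 1 - t"] by (auto simp: o_def)
 qed
 have "chom n Y y0 (transp n (%t. de (1 - t)) (transp n de f)) (transp n (%t. de (1 - t)) (transp n de g))"
  by (rule transp_chom[OF r _ _ h]) (use de in auto)
 thus ?thesis
  using chom_trans[OF chom_trans[OF chom_sym[OF transp_back[OF de f(1)]]] transp_back[OF de f(2)]] by blast
qed

section \<open>Polyhedra are well pointed\<close>

text \<open>A deformation of the identity that fixes \<open>a\<close> and collapses a neighbourhood
  of \<open>a\<close>. Composed with a map, it shrinks the support into a closed set.\<close>

definition well_pointed :: "'b topology => 'b => bool" where
 "well_pointed A a \<longleftrightarrow> (EX h N. continuous_map (prod_topology (top_of_set {0..1::real}) A) A h &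
   (ALL q:topspace A. h (0, q) = q) & (ALL t:{0..1}. h (t, a) = a) &
   openin A N & a : N & (ALL q:N. h (1, q) = a))"

lemma openin_realization: "openin (realization K) U \<longleftrightarrow> realization_open K U"
 unfolding realization_def using topology_inverse'[OF istopology_realization_open[of K]] by simp

lemma topspace_realization: "topspace (realization K) = realization_carrier K"
proof -
 have "realization_open K (realization_carrier K)"
  unfolding realization_open_def realization_carrier_def
 proof (intro conjI ballI)
  fix sig assume "sig : K"
  hence "(\<Union>sig\<in>K. geom_simplex sig) Int geom_simplex sig = geom_simplex sig" by blast
  thus "openin (subtopology (powertop_real UNIV) (geom_simplex sig)) ((\<Union>sig\<in>K. geom_simplex sig) Int geom_simplex sig)"
   by (auto simp: openin_subtopology intro!: exI[of _ UNIV] openin_topspace[of "powertop_real UNIV", simplified])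
 qed simp
 thus ?thesis unfolding topspace_def openin_realization
  by (auto simp: realization_open_def)
qed

lemma realization_coarser:
 assumes "openin (powertop_real UNIV) U" shows "openin (realization K) (U Int realization_carrier K)"
 unfolding openin_realization realization_open_def
proof (intro conjI ballI)
 fix sig assume "sig : K"
 hence "U Int realization_carrier K Int geom_simplex sig = U Int geom_simplex sig" by (auto simp: realization_carrier_def)
 thus "openin (subtopology (powertop_real UNIV) (geom_simplex sig)) (U Int realization_carrier K Int geom_simplex sig)"
  using assms by (auto simp: openin_subtopology)
qed auto

lemma continuous_realization_id: "continuous_map (realization K) (powertop_real UNIV) id"
 unfolding continuous_map_def topspace_realization
proof (intro conjI allI impI)
 fix U :: "('a => real) set" assume "openin (powertop_real UNIV) U"
 from realization_coarser[OF this, of K] show "openin (realization K) {x : realization_carrier K. id x : U}"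
  by (simp add: Int_def conj_commute)
qed auto

lemma Hausdorff_realization: "Hausdorff_space (realization K)"
 by (rule Hausdorff_space_injective_preimage[OF _ continuous_realization_id])
  (auto simp: Hausdorff_space_product_topology inj_on_def)

lemma Hausdorff_polyhedron: "polyhedron_space A ==> Hausdorff_space A"
 unfolding polyhedron_space_def using Hausdorff_realization homeomorphic_Hausdorff_space by blast

lemma homeomorphic_map_well_pointed:
 assumes f: "homeomorphic_maps A B f g" and a: "a : topspace A" and B: "well_pointed B (f a)"
 shows "well_pointed A a"
proof -
 have cf: "continuous_map A B f" and cg: "continuous_map B A g" and gf: "!!x. x : topspace A ==> g (f x) = x"
  using f by (auto simp: homeomorphic_maps_def)
 obtain h N where h: "continuous_map (prod_topology (top_of_set {0..1::real}) B) B h"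
   "ALL q:topspace B. h (0, q) = q" "ALL t:{0..1}. h (t, f a) = f a" "openin B N" "f a : N" "ALL q:N. h (1, q) = f a"
  using B unfolding well_pointed_def by blast
 let ?h = "%z. g (h (fst z, f (snd z)))"
 have "continuous_map (prod_topology (top_of_set {0..1::real}) A) (prod_topology (top_of_set {0..1::real}) B) (%z. (fst z, f (snd z)))"
  by (intro continuous_map_pairedI continuous_map_fst cmap_comp[OF continuous_map_snd cf, unfolded o_def])
 from cmap_comp[OF cmap_comp[OF this h(1)] cg]
 have "continuous_map (prod_topology (top_of_set {0..1::real}) A) A ?h" by (simp add: o_def)
 moreover have "openin A {x : topspace A. f x : N}" by (rule openin_continuous_map_preimage[OF cf h(4)])
 ultimately show ?thesis unfolding well_pointed_def
  by (intro exI[of _ ?h] exI[of _ "{x : topspace A. f x : N}"])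
   (use h a gf cmap_image[OF cf] in auto)
qed

definition supp :: "('v => real) => 'v set" where "supp y = {v. y v ~= 0}"

text \<open>\<open>ratio p y\<close> is the largest \<open>mu\<close> for which \<open>y\<close> is a convex combination \<open>(1 - mu) z + mu p\<close> within its simplex.\<close>

definition ratio :: "('v => real) => ('v => real) => real" where
 "ratio p y = Min ((%v. y v / p v) ` supp p)"

definition squash :: "('v => real) => real \<times> ('v => real) => 'v => real" where
 "squash p = (%(t, y) i. (1 - t * min 1 (2 * ratio p y)) * y i + t * min 1 (2 * ratio p y) * p i)"

lemma continuous_Min_image:
 assumes "finite S" "S ~= {}" "!!v. v : S ==> continuous_on T (%y. f v y :: real)"
 shows "continuous_on T (%y. Min ((%v. f v y) ` S))"
 using assms
proof (induction S rule: finite_ne_induct)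
 case (insert v S)
 thus ?case by (simp add: Min_insert) (intro continuous_on_min, auto)
qed simp

context
 fixes K :: "'v set set" and p :: "'v => real"
 assumes K: "simplicial_cx K" and p: "p : realization_carrier K"
begin

lemma simplex_finite: "sig : K ==> finite sig"
 using K by (auto simp: simplicial_cx_def)

lemma supp_p: "finite (supp p)" "supp p ~= {}" "!!v. v : supp p ==> 0 < p v"
proof -
 obtain sig where s: "sig : K" "p : geom_simplex sig" using p by (auto simp: realization_carrier_def)
 have "supp p <= sig" using s(2) by (auto simp: supp_def geom_simplex_def)
 thus "finite (supp p)" using simplex_finite[OF s(1)] finite_subset by blast
 show "supp p ~= {}"
 proof
  assume "supp p = {}"
  hence "sum p sig = 0" by (intro sum.neutral) (auto simp: supp_def)
  thus False using s(2) by (simp add: geom_simplex_def)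
 qed
 show "!!v. v : supp p ==> 0 < p v" using s(2) by (auto simp: supp_def geom_simplex_def order_less_le)
qed

lemma continuous_ratio: "continuous_on S (ratio p)"
 unfolding ratio_def[abs_def]
 by (intro continuous_Min_image supp_p continuous_on_divide continuous_on_const
   continuous_on_coord[OF continuous_on_id]) (auto simp: supp_def)

lemma continuous_squash: "continuous_on S (squash p)"
proof -
 have r: "continuous_on S (%z. ratio p (snd z))"
  by (rule continuous_on_compose2[OF continuous_ratio[of UNIV]]) (auto intro: continuous_intros)
 have c: "continuous_on S (%z. snd z i)" for i :: 'v and S :: "(real \<times> ('v => real)) set"
  by (rule continuous_on_coord[OF continuous_on_snd[OF continuous_on_id]])
 show ?thesis unfolding squash_def case_prod_beta
  by (intro continuous_on_coords continuous_intros r c)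
qed

lemma ratio_bounds:
 assumes "sig : K" "y : geom_simplex sig" shows "0 <= ratio p y" "ratio p y <= 1" "0 < ratio p y ==> p : geom_simplex sig"
proof -
 have y: "!!i. 0 <= y i" "sum y sig = 1" "!!i. i ~: sig ==> y i = 0" using assms(2) by (auto simp: geom_simplex_def)
 have "ratio p y : (%v. y v / p v) ` supp p" unfolding ratio_def by (intro Min_in) (use supp_p in auto)
 thus 0: "0 <= ratio p y" using y supp_p(3) by (force intro!: divide_nonneg_pos)
 have le: "ratio p y * p v <= y v" if "v : supp p" for v
 proof -
  have "ratio p y <= y v / p v" unfolding ratio_def by (rule Min_le) (use supp_p that in auto)
  thus ?thesis using supp_p(3)[OF that] by (simp add: field_simps)
 qed
 obtain sig' where s': "sig' : K" "p : geom_simplex sig'" using p by (auto simp: realization_carrier_def)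
 have sub': "supp p <= sig'" using s'(2) by (auto simp: supp_def geom_simplex_def)
 have "sum p (supp p) = sum p sig'"
  by (rule sum.mono_neutral_left) (use sub' simplex_finite[OF s'(1)] in "auto simp: supp_def")
 hence sp: "sum p (supp p) = 1" using s'(2) by (simp add: geom_simplex_def)
 have p0: "0 <= p i" for i using s'(2) by (simp add: geom_simplex_def)
 have inside: "supp p <= sig" if "0 < ratio p y"
 proof
  fix v assume v: "v : supp p"
  have "0 < y v" using le[OF v] supp_p(3)[OF v] that by (meson less_le_trans mult_pos_pos)
  thus "v : sig" using y(3) by force
 qed
 show "ratio p y <= 1"
 proof (cases "0 < ratio p y")
  case True
  have "ratio p y = (\<Sum>v\<in>supp p. ratio p y * p v)" using sp by (simp flip: sum_distrib_left)
  also have "... <= sum y (supp p)" by (intro sum_mono le)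
  also have "... <= sum y sig" by (intro sum_mono2 inside[OF True] simplex_finite assms y)
  finally show ?thesis using y by simp
 qed simp
 assume pos: "0 < ratio p y"
 have "sum p sig = sum p (supp p)"
  by (rule sum.mono_neutral_right) (use inside[OF pos] simplex_finite[OF assms(1)] in "auto simp: supp_def")
 thus "p : geom_simplex sig" using sp p0 inside[OF pos] by (auto simp: geom_simplex_def supp_def)
qed

lemma squash_simplex:
 assumes "sig : K" "y : geom_simplex sig" "t : {0..1}" shows "squash p (t, y) : geom_simplex sig"
proof (cases "0 < ratio p y")
 case False
 hence "squash p (t, y) = y" using ratio_bounds(1)[OF assms(1,2)] by (simp add: squash_def)
 thus ?thesis using assms by simp
next
 case True
 have ps: "p : geom_simplex sig" using ratio_bounds(3)[OF assms(1,2) True] .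
 let ?c = "t * min 1 (2 * ratio p y)"
 have c: "0 <= ?c" "?c <= 1" using assms(3) True by (auto intro: mult_le_one)
 have "sum (squash p (t, y)) sig = (1 - ?c) * sum y sig + ?c * sum p sig"
  by (simp add: squash_def sum.distrib flip: sum_distrib_left)
 thus ?thesis using ps assms(2) c by (auto simp: geom_simplex_def squash_def intro!: add_nonneg_nonneg mult_nonneg_nonneg)
qed

text \<open>Openness in the realization is tested on one simplex at a time, but the time interval
  must be the same for all. So a compact interval \<open>J\<close> is fixed by means of the simplex
  of \<open>y0\<close>; the points staying in \<open>U\<close> throughout \<open>J\<close> form an
  open set, because projection along a compact factor is closed.\<close>

lemma continuous_squash_realization:
 "continuous_map (prod_topology (top_of_set {0..1::real}) (realization K)) (realization K) (squash p)"
 unfolding continuous_map_def topspace_prod_topology topspace_realization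
proof (intro conjI allI impI)
 show "squash p : topspace (top_of_set {0..1}) \<times> realization_carrier K \<rightarrow> realization_carrier K"
  using squash_simplex by (force simp: realization_carrier_def)
 fix U assume U: "openin (realization K) U"
 let ?W = "{z : topspace (top_of_set {0..1}) \<times> realization_carrier K. squash p z : U}"
 show "openin (prod_topology (top_of_set {0..1::real}) (realization K)) ?W"
 proof (subst openin_subopen, clarify)
  fix t0 y0 assume t0: "t0 : topspace (top_of_set {0..1::real})" and y0: "y0 : realization_carrier K" and z0: "squash p (t0, y0) : U"
  have Us: "EX G. open G & U Int geom_simplex sig = G Int geom_simplex sig" if "sig : K" for sig
   using U that unfolding openin_realization realization_open_def openin_subtopology
   by (auto simp: euclidean_product_topology)
  obtain sig0 where s0: "sig0 : K" "y0 : geom_simplex sig0" using y0 by (auto simp: realization_carrier_def)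
  obtain O0 where O0: "open O0" "U Int geom_simplex sig0 = O0 Int geom_simplex sig0" using Us[OF s0(1)] by blast
  have "continuous_on {0..1} (%t. squash p (t, y0))"
   by (rule continuous_on_compose2[OF continuous_squash[of UNIV]]) (auto intro!: continuous_intros)
  hence "openin (top_of_set {0..1}) ({0..1} Int (%t. squash p (t, y0)) -` O0)"
   using O0(1) by (rule continuous_openin_preimage_gen)
  moreover have "squash p (t0, y0) : O0" using z0 squash_simplex[OF s0] t0 O0(2) by auto
  ultimately obtain d where d: "0 < d" "!!t. t : {0..1} ==> dist t t0 < d ==> squash p (t, y0) : O0"
  proof -
   assume *: "openin (top_of_set {0..1}) ({0..1} Int (%t. squash p (t, y0)) -` O0)" "squash p (t0, y0) : O0"
   hence "t0 : {0..1} Int (%t. squash p (t, y0)) -` O0" using t0 by simp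
   then obtain e where "0 < e" "ALL x':{0..1}. dist x' t0 < e --> x' : {0..1} Int (%t. squash p (t, y0)) -` O0"
    using *(1) unfolding openin_euclidean_subtopology_iff by blast
   thus ?thesis using that[of e] by blast
  qed
  define J where "J = {0..1} Int cball t0 (d/2)"
  have J: "compact J" "t0 : J" "J <= {0..1}" using d(1) t0 by (auto simp: J_def)
  define V where "V = {y : realization_carrier K. ALL t:J. squash p (t, y) : U}"
  have y0V: "y0 : V"
   unfolding V_def using y0 d O0(2) squash_simplex[OF s0] by (auto simp: J_def dist_commute)
  have oV: "openin (realization K) V"
   unfolding openin_realization realization_open_def
  proof (intro conjI ballI)
   show "V <= realization_carrier K" by (auto simp: V_def)
   fix sig assume s: "sig : K"
   obtain G where O: "open G" "U Int geom_simplex sig = G Int geom_simplex sig" using Us[OF s] by blast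
   let ?g = "geom_simplex sig"
   let ?C = "{z : J \<times> ?g. squash p z ~: G}"
   have "?C = (J \<times> ?g) Int squash p -` (- G)" by auto
   hence clC: "closedin (top_of_set (J \<times> ?g)) ?C"
    using continuous_closedin_preimage[OF continuous_squash, of "- G"] O(1) by (simp add: closed_def)
   have "top_of_set (J \<times> ?g) = prod_topology (top_of_set J) (top_of_set ?g)"
    by (metis euclidean_product_topology prod_topology_subtopology_eu)
   moreover have "closed_map (prod_topology (top_of_set J) (top_of_set ?g)) (top_of_set ?g) snd"
    by (rule closed_map_snd) (simp add: J compact_space_subtopology)
   ultimately have "closedin (top_of_set ?g) (snd ` ?C)" using clC by (simp add: closed_map_def)
   moreover have "V Int ?g = ?g - snd ` ?C"
   proof -
    have "squash p (t, y) : U \<longleftrightarrow> squash p (t, y) : G" if "t : J" "y : ?g" for t y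
     using squash_simplex[OF s that(2)] that(1) J(3) O(2) by blast
    thus ?thesis using s by (auto simp: V_def realization_carrier_def image_iff)
   qed
   ultimately have "openin (top_of_set ?g) (V Int ?g)" by (simp add: openin_diff)
   thus "openin (subtopology (powertop_real UNIV) ?g) (V Int ?g)" by (simp add: euclidean_product_topology)
  qed
  let ?T = "({0..1} Int ball t0 (d/2)) \<times> V"
  have "openin (prod_topology (top_of_set {0..1::real}) (realization K)) ?T"
   unfolding openin_prod_Times_iff using oV by auto
  moreover have "(t0, y0) : ?T" using y0V t0 d(1) by auto
  moreover have "?T <= ?W" by (auto simp: V_def J_def)
  ultimately show "EX T. openin (prod_topology (top_of_set {0..1::real}) (realization K)) T & (t0, y0) : T & T <= ?W" by blast
 qed
qed

lemma well_pointed_realization: "well_pointed (realization K) p"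
 unfolding well_pointed_def
proof (intro exI conjI)
 let ?N = "{y. 1/2 < ratio p y} Int realization_carrier K"
 have rp: "ratio p p = 1"
 proof -
  have "(%v. p v / p v) ` supp p = {1}" using supp_p(2) by (force simp: supp_def)
  thus ?thesis by (simp add: ratio_def)
 qed
 have "open {y. 1/2 < ratio p y}"
  using continuous_ratio[of UNIV] by (intro open_Collect_less) (auto intro: continuous_intros)
 thus "openin (realization K) ?N" by (intro realization_coarser) (simp add: euclidean_product_topology)
 show "p : ?N" using p rp by simp
 show "ALL q:?N. squash p (1, q) = p" by (auto simp: squash_def)
 show "ALL t:{0..1}. squash p (t, p) = p" by (auto simp: squash_def fun_eq_iff algebra_simps)
 show "ALL q:topspace (realization K). squash p (0, q) = q" by (auto simp: squash_def)
qed (rule continuous_squash_realization)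

end

lemma well_pointed_polyhedron:
 assumes "polyhedron_space A" "a : topspace A" shows "well_pointed A a"
proof -
 obtain K :: "'a set set" where K: "simplicial_cx K" "A homeomorphic_space realization K"
  using assms(1) unfolding polyhedron_space_def by blast
 then obtain f g where fg: "homeomorphic_maps A (realization K) f g" unfolding homeomorphic_space_def by blast
 have "f a : realization_carrier K"
  using fg assms(2) cmap_image unfolding homeomorphic_maps_def topspace_realization[symmetric] by blast
 thus ?thesis using homeomorphic_map_well_pointed[OF fg assms(2)] well_pointed_realization[OF K(1)] by blast
qed

section \<open>Moving supports off a grid\<close>

definition cl :: "real => real => real" where "cl c y = max (-c) (min c y)"

text \<open>\<open>clip\<close> collapses \<open>[-1/4, 1/4]\<close> to \<open>0\<close> and is the identity outside \<open>[-1/2, 1/2]\<close>.\<close>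

definition clip :: "real => real" where "clip z = z - 2 * cl (1/4) z + cl (1/2) z"

lemma clip_zero: "abs z <= 1/4 ==> clip z = 0"
 by (auto simp: clip_def cl_def)

lemma clip_id: "1/2 <= abs z ==> clip z = z"
 by (auto simp: clip_def cl_def)

lemma clip_between: "0 <= z ==> 0 <= clip z & clip z <= z" "z <= 0 ==> z <= clip z & clip z <= 0"
 by (auto simp: clip_def cl_def min_def max_def)

lemma continuous_clip: "continuous_on S f ==> continuous_on S (%x. clip (f x))"
 unfolding clip_def cl_def by (intro continuous_intros)

definition del :: "nat => (nat => real) => nat => real" where
 "del i s = (%l. if l < i then s l else s (Suc l))"

definition ins :: "nat => real => (nat => real) => nat => real" where
 "ins i c u = (%l. if l < i then u l else if l = i then c else u (l - 1))"

lemma ins_del: "ins i c (del i s) = s(i := c)"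
 by (auto simp: ins_def del_def fun_eq_iff)

lemma del_cube: "i < d ==> s : cube d ==> del i s : cube (d - 1)"
 by (auto simp: cube_def del_def)

lemma ins_cube: "i < d ==> u : cube (d - 1) ==> abs c <= 1 ==> ins i c u : cube d"
 by (auto simp: cube_def ins_def abs_le_iff)

lemma ins_bdry:
 assumes "i < d" "u : bdry (d - 1)" "abs c <= 1" shows "ins i c u : bdry d"
proof -
 obtain l where l: "l < d - 1" "abs (u l) = 1" using assms(2) by (auto simp: bdry_def)
 have "ins i c u : cube d" using assms bdry_cube by (intro ins_cube) auto
 moreover have "EX l<d. abs (ins i c u l) = 1"
 proof (cases "l < i")
  case True
  thus ?thesis using l by (intro exI[of _ l]) (auto simp: ins_def)
 next
  case False
  thus ?thesis using l by (intro exI[of _ "Suc l"]) (auto simp: ins_def)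
 qed
 ultimately show ?thesis by (simp add: bdry_def)
qed

lemma continuous_del: "continuous_on S f ==> continuous_on S (%x. del i (f x))"
 unfolding del_def
 by (intro continuous_on_coords, rename_tac l, case_tac "l < i") (simp_all add: continuous_on_coord)

lemma continuous_ins: "continuous_on S f ==> continuous_on S (%x. ins i c (f x))"
 unfolding ins_def
 by (intro continuous_on_coords, rename_tac l, case_tac "l < i"; case_tac "l = i") (simp_all add: continuous_on_coord)

lemma continuous_upd:
 fixes f :: "'z::topological_space => nat => real"
 shows "continuous_on S f ==> continuous_on S g ==> continuous_on S (%x. (f x)(i := g x))"
 by (intro continuous_on_coords, rename_tac l, case_tac "l = i") (simp_all add: continuous_on_coord)

text \<open>\<open>moved M i j s s'\<close>: \<open>s'\<close> arises from \<open>s\<close> by moving coordinate \<open>i\<close> within all grid cells containing \<open>s\<close>,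
 and only if \<open>s\<close> is close to the hyperplane \<open>M s i = j\<close>.\<close>

definition moved :: "real => nat => int => (nat => real) => (nat => real) => bool" where
 "moved M i j s s' \<longleftrightarrow> s' = s(i := s' i) & (ALL m::int. of_int m <= M * s i & M * s i <= of_int m + 1 --> of_int m <= M * s' i & M * s' i <= of_int m + 1)
   & (1/2 < abs (M * s i - of_int j) --> s' = s)"

lemma movedI:
 assumes M: "0 < M" and w: "M * c = of_int j + w" and z: "z = M * s i - of_int j"
  and b: "(0 <= w & w <= z) | (z <= w & w <= 0)" and far: "1/2 < abs z ==> w = z"
 shows "moved M i j s (s(i := c))"
 unfolding moved_def
proof (intro conjI allI impI)
 show "s(i := c) = s(i := (s(i := c)) i)" by simp
 have wz: "c = s i" if "w = z" using that w z M by auto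
 show "s(i := c) = s" if "1/2 < abs (M * s i - of_int j)" using far wz that z by auto
 fix m :: int assume m: "of_int m <= M * s i & M * s i <= of_int m + 1"
 hence m1: "of_int m <= of_int j + z" "of_int j + z <= of_int m + 1" using z by auto
 have "of_int m <= of_int j + w & of_int j + w <= of_int m + 1"
 proof (cases "1/2 < abs z")
  case True
  thus ?thesis using far m1 by simp
 next
  case False
  hence "real_of_int m < real_of_int (j + 1)" "real_of_int j < real_of_int (m + 2)" using m1 by auto
  hence "m <= j" "j <= m + 1" by linarith+
  hence "real_of_int m <= j" "real_of_int j <= of_int m + 1" by linarith+
  thus ?thesis using b m1 by auto
 qed
 thus "of_int m <= M * (s(i := c)) i" "M * (s(i := c)) i <= of_int m + 1" using w by auto
qed

definition clipmap :: "real => nat => int => real => (nat => real) => nat => real" where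
 "clipmap M i j u s = s(i := (of_int j + ((1 - u) * (M * s i - of_int j) + u * clip (M * s i - of_int j))) / M)"

lemma clipmap_moved:
 assumes M: "0 < M" and u: "u : {0..1}" shows "moved M i j s (clipmap M i j u s)"
 unfolding clipmap_def
proof (rule movedI[OF M _ refl])
 let ?z = "M * s i - of_int j" let ?w = "(1 - u) * ?z + u * clip ?z"
 show "M * ((of_int j + ?w) / M) = of_int j + ?w" using M by simp
 show "?w = ?z" if "1/2 < abs ?z"
 proof -
  have c: "clip ?z = ?z" using clip_id[of ?z] that by simp
  show ?thesis unfolding c by (simp add: algebra_simps)
 qed
 show "0 <= ?w & ?w <= ?z | ?z <= ?w & ?w <= 0"
 proof (cases "0 <= ?z")
  case True
  have "?w <= (1 - u) * ?z + u * ?z" using clip_between(1)[OF True] u by (intro add_left_mono mult_left_mono) auto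
  moreover have "0 <= ?w" using clip_between(1)[OF True] u True by (intro add_nonneg_nonneg mult_nonneg_nonneg) auto
  ultimately show ?thesis by (simp add: algebra_simps)
 next
  case False
  have "(1 - u) * ?z + u * ?z <= ?w" using clip_between(2)[of ?z] u False by (intro add_left_mono mult_left_mono) auto
  moreover have "?w <= 0" using clip_between(2)[of ?z] u False by (intro add_nonpos_nonpos mult_nonneg_nonpos) auto
  ultimately show ?thesis by (simp add: algebra_simps)
 qed
qed

lemma moved_cube:
 assumes "moved (real N) i j s s'" "s : cube d" "0 < N" "i < d" shows "s' : cube d"
proof -
 have si: "-1 <= s i" "s i <= 1" using assms by (auto simp: cube_def)
 have m: "of_int m <= real N * s' i & real N * s' i <= of_int m + 1" if "of_int m <= real N * s i & real N * s i <= of_int m + 1" for m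
  using assms(1) that unfolding moved_def by blast
 let ?f = "\<lfloor>real N * s i\<rfloor>"
 have NN: "- real N <= real N * s i" "real N * s i <= real N" using si assms(3) mult_left_mono[of "-1" "s i" "real N"] mult_left_mono[of "s i" 1 "real N"] by auto
 have f: "of_int ?f <= real N * s' i" "real N * s' i <= of_int ?f + 1" using m[of ?f] by auto
 have "- int N <= ?f" using NN(1) by (simp add: le_floor_iff)
 hence "- real N <= real N * s' i" using f(1) by linarith
 moreover have "real N * s' i <= real N"
 proof (cases "real N * s i = real N")
  case True
  thus ?thesis using m[of "int N - 1"] by auto
 next
  case False
  hence "?f < int N" using NN(2) by (simp add: floor_less_iff)
  thus ?thesis using f(2) by linarith
 qed
 ultimately have "real N * (-1) <= real N * s' i" "real N * s' i <= real N * 1" by auto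
 hence "-1 <= s' i" "s' i <= 1" using assms(3) by (simp_all only: mult_le_cancel_left_pos of_nat_0_less_iff)
 hence "s(i := s' i) : cube d" using assms(2,4) by (auto simp: cube_def)
 moreover have "s' = s(i := s' i)" using assms(1) by (simp add: moved_def)
 ultimately show ?thesis by simp
qed

lemma moved_trans: "moved M i j s s' ==> moved M i j s' s'' ==> moved M i j s s''"
 unfolding moved_def by (metis fun_upd_upd)

text \<open>Three deformations. Clipping makes \<open>be\<close> independent of the normal
  coordinate near the hyperplane. The contraction of the slice \<open>g\<close> is then applied, for
  a time that fades out towards the edge of the slab, which gives \<open>a\<close> on the hyperplane
  itself. A second clipping spreads this over the slab.\<close>

lemma hyperplane_stage:
 fixes A :: "'b topology"
 assumes d: "i < d" and N: "0 < N" and j: "abs j <= int N"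
  and be: "cmap_on (cube d) A be" "!!s. s : bdry d ==> be s = a"
  and V: "!!g. cmap_on (cube (d - 1)) A g ==> (!!u. u : bdry (d - 1) ==> g u = a) ==> qhom (d - 1) A a (%u. g u ~= a) g (%_. a)"
 obtains be' where "qhom d A a (%s. EX s'. moved N i j s s' & s' : cube d & be s' ~= a) be be'"
  "!!s. s : cube d ==> abs (real N * s i - of_int j) <= 1/4 ==> be' s = a"
proof -
 let ?D = "prism d" and ?M = "real N"
 let ?Q = "%s. EX s'. moved N i j s s' & s' : cube d & be s' ~= a"
 have M: "0 < ?M" using N by simp
 let ?c = "real_of_int j / ?M"
 have c1: "abs ?c <= 1" using j M by (simp add: abs_divide divide_le_eq)
 have cc: "clipmap ?M i j u s : cube d" if "u : {0..1}" "s : cube d" for u s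
  using moved_cube[OF clipmap_moved[OF M that(1)] that(2) N d] .
 have contc: "continuous_on S (%z. clipmap ?M i j (fst z) (snd z))" for S
  unfolding clipmap_def by (intro continuous_upd continuous_intros continuous_clip) (use M in auto)
 have h1: "qhom d A a ?Q be (be o clipmap ?M i j 1)"
 proof (rule qhomI[of _ _ "be o (%z. clipmap ?M i j (fst z) (snd z))"])
  show "cmap_on ?D A (be o (%z. clipmap ?M i j (fst z) (snd z)))"
   by (rule cmap_comp[OF _ be(1)]) (use contc cc in auto)
  show "(be o (%z. clipmap ?M i j (fst z) (snd z))) (0, s) = be s" for s
   using M by (simp add: clipmap_def)
  fix t :: real and s assume "t : {0..1}" "s : cube d" "~ ?Q s"
  thus "(be o (%z. clipmap ?M i j (fst z) (snd z))) (t, s) = a"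
   using clipmap_moved[OF M] cc by auto
 qed simp
 define g where "g u = be (ins i ?c u)" for u
 have "cmap_on (cube (d - 1)) A (be o ins i ?c)"
  by (rule cmap_comp[OF _ be(1)]) (auto intro!: continuous_ins continuous_on_id ins_cube[OF d _ c1])
 moreover have "g u = a" if "u : bdry (d - 1)" for u unfolding g_def using be(2) ins_bdry[OF d that c1] by blast
 ultimately have "qhom (d - 1) A a (%u. g u ~= a) g (%_. a)" by (intro V) (auto simp: g_def[abs_def] o_def)
 then obtain k where k: "cmap_on (prism (d - 1)) A k"
  "!!u. u : cube (d - 1) ==> k (0, u) = g u & k (1, u) = a"
  "!!t u. t : {0..1} ==> u : cube (d - 1) ==> g u = a ==> k (t, u) = a"
  unfolding qhom_def by blast
 have contc1: "continuous_on S (%z. clipmap ?M i j 1 (snd z))" for S :: "(real \<times> (nat => real)) set"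
  unfolding clipmap_def by (intro continuous_upd continuous_intros continuous_clip) (use M in auto)
 let ?z = "%s. abs (?M * s i - of_int j)"
 let ?H = "%x. if ?z (snd x) <= 1/4 then (k o (%x. (fst x * (1 - 4 * ?z (snd x)), del i (snd x)))) x
   else (be o (%x. clipmap ?M i j 1 (snd x))) x"
 have cz: "continuous_on S (%x. ?z (snd x))" for S :: "(real \<times> (nat => real)) set" by (intro continuous_intros)
 have strip: "g (del i s) = be (clipmap ?M i j 1 s)" if "?z s <= 1/4" for s
  unfolding g_def ins_del clipmap_def using clip_zero[of "?M * s i - of_int j"] that by simp
 have H: "cmap_on ?D A ?H"
 proof (rule cmap_on_cases_le)
  have r: "(%x. (fst x * (1 - 4 * ?z (snd x)), del i (snd x))) : {x : ?D. ?z (snd x) <= 1/4} \<rightarrow> prism (d - 1)"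
   using del_cube[OF d] by (auto intro!: mult_nonneg_nonneg mult_le_one)
  have cd: "continuous_on S (%x. del i (snd x))" for S :: "(real \<times> (nat => real)) set"
   by (intro continuous_del continuous_on_snd continuous_on_id)
  show "cmap_on {x : ?D. ?z (snd x) <= 1/4} A (k o (%x. (fst x * (1 - 4 * ?z (snd x)), del i (snd x))))"
   by (rule cmap_comp[OF _ k(1)], unfold continuous_map_subtopology_eu, intro conjI continuous_on_Pair r cd) (intro continuous_intros)
  show "cmap_on {x : ?D. 1/4 <= ?z (snd x)} A (be o (%x. clipmap ?M i j 1 (snd x)))"
   by (rule cmap_comp[OF _ be(1)])
    (use cc[of 1] contc1 in "auto simp: subtopology_subtopology")
  show "continuous_on ?D (%x. ?z (snd x))" by (rule cz)
  fix x assume x: "x : ?D" "?z (snd x) = 1/4"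
  have E: "(k o (%x. (fst x * (1 - 4 * ?z (snd x)), del i (snd x)))) x = g (del i (snd x))"
   unfolding o_def x(2) using k(2)[OF del_cube[OF d]] x(1) by auto
  have E': "g (del i (snd x)) = be (clipmap ?M i j 1 (snd x))" by (rule strip) (use x(2) in linarith)
  show "(k o (%x. (fst x * (1 - 4 * ?z (snd x)), del i (snd x)))) x = (be o (%x. clipmap ?M i j 1 (snd x))) x"
   unfolding E E' by simp
 qed
 have Q1: "?Q (clipmap ?M i j u s) ==> ?Q s" if "u : {0..1}" for u s
  using moved_trans[OF clipmap_moved[OF M that]] by blast
 have HQ: "?H (t, s) = a" if t: "t : {0..1}" and s: "s : cube d" and nq: "~ ?Q s" for t s
 proof (cases "?z s <= 1/4")
  case True
  have "moved N i j s (clipmap ?M i j 1 s)" by (rule clipmap_moved[OF M]) simp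
  hence "g (del i s) = a" using strip[of s] True nq cc[of 1 s] s by auto
  moreover have "t * (1 - 4 * ?z s) : {0..1}" using t True by (auto intro!: mult_nonneg_nonneg mult_le_one)
  ultimately show ?thesis using k(3)[OF _ del_cube[OF d s]] True by simp
 next
  case False
  thus ?thesis using nq cc[of 1 s] s clipmap_moved[OF M, of 1 i j s] by auto
 qed
 have h2: "qhom d A a ?Q (be o clipmap ?M i j 1) (%s. ?H (1, s))"
  by (rule qhomI[OF H]) (use k(2) del_cube[OF d] strip HQ in auto)
 define be2 where "be2 s = ?H (1, s)" for s
 have h2: "qhom d A a ?Q (be o clipmap ?M i j 1) be2" using h2 unfolding be2_def .
 have be2Q: "be2 s = a" if "s : cube d" "~ ?Q s" for s unfolding be2_def by (rule HQ) (use that in auto)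
 have cb: "cmap_on (cube d) A be2" using qhom_end(2)[OF h2] .
 let ?be' = "be2 o clipmap ?M i j 1"
 have h3: "qhom d A a ?Q be2 ?be'"
 proof (rule qhomI[of _ _ "be2 o (%z. clipmap ?M i j (fst z) (snd z))"])
  show "cmap_on ?D A (be2 o (%z. clipmap ?M i j (fst z) (snd z)))"
   by (rule cmap_comp[OF _ cb]) (use contc cc in auto)
  have "clipmap ?M i j 0 s = s" for s using M by (simp add: clipmap_def)
  thus "(be2 o (%z. clipmap ?M i j (fst z) (snd z))) (0, s) = be2 s" for s by simp
  fix t :: real and s assume t: "t : {0..1}" "s : cube d" "~ ?Q s"
  hence "~ ?Q (clipmap ?M i j t s)" using Q1[OF t(1)] by blast
  thus "(be2 o (%z. clipmap ?M i j (fst z) (snd z))) (t, s) = a"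
   using be2Q[OF cc[OF t(1,2)]] by simp
 qed simp
 show ?thesis
 proof (rule that[OF qhom_trans[OF h1 qhom_trans[OF h2 h3]]])
  fix s assume s: "s : cube d" "?z s <= 1/4"
  let ?s = "clipmap ?M i j 1 s"
  have "?M * ?s i - of_int j = 0" using clip_zero[of "?M * s i - of_int j"] s(2) M by (simp add: clipmap_def)
  hence "be2 ?s = k (1, del i ?s)" by (simp add: be2_def)
  thus "?be' s = a" using k(2)[OF del_cube[OF d cc[of 1 s]]] s(1) by simp
 qed
qed

section \<open>Grid cells and supported contractions\<close>

definition incell :: "nat => nat => (nat => int) => (nat => real) => bool" where
 "incell d N m s \<longleftrightarrow> (ALL i<d. of_int (m i) <= real N * s i & real N * s i <= of_int (m i) + 1)"

lemma moved_incell: "moved N i j s s' ==> incell d N m s ==> incell d N m s'"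
 unfolding incell_def moved_def by (metis fun_upd_other)

text \<open>A support need not be closed. The new one lies in a closed set \<open>C\<close> inside
  the old one, so that a grid can be chosen fine with respect to the gap.\<close>

lemma squash_hom:
 assumes wp: "well_pointed A a" and al: "cmap_on (cube d) A al"
 obtains al1 C where "qhom d A a (%s. al s ~= a) al al1" "closedin (top_of_set (cube d)) C" "!!s. s : C ==> al s ~= a"
  "!!s. s : cube d ==> al1 s ~= a ==> s : C"
proof -
 obtain h N where h: "continuous_map (prod_topology (top_of_set {0..1::real}) A) A h"
   "ALL q:topspace A. h (0, q) = q" "ALL t:{0..1}. h (t, a) = a" "openin A N" "a : N" "ALL q:N. h (1, q) = a"
  using wp unfolding well_pointed_def by blast
 let ?D = "top_of_set (prism d)"
 have alt: "al s : topspace A" if "s : cube d" for s using cmap_image[OF al] that by auto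
 have "continuous_map ?D (prod_topology (top_of_set {0..1::real}) A) (%z. (fst z, (al o snd) z))"
  by (intro continuous_map_pairedI cmap_comp[OF _ al]) (auto intro!: continuous_intros)
 from cmap_comp[OF this h(1)]
 have c: "continuous_map ?D A (%z. h (fst z, al (snd z)))" by (simp add: o_def)
 let ?C = "cube d - {s : cube d. al s : N}"
 have "openin (top_of_set (cube d)) {s : cube d. al s : N}"
  using openin_continuous_map_preimage[OF al h(4)] by simp
 hence "closedin (top_of_set (cube d)) ?C" using closedin_diff[OF closedin_topspace] by fastforce
 moreover have "qhom d A a (%s. al s ~= a) al (%s. h (1, al s))"
  by (rule qhomI[OF c]) (use h(2,3) alt in auto)
 moreover have "al s ~= a" if "s : ?C" for s using that h(5) by auto
 moreover have "s : ?C" if "s : cube d" "h (1, al s) ~= a" for s using that h(6) by auto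
 ultimately show ?thesis using that[of "%s. h (1, al s)" ?C] by blast
qed

lemma cube_gap:
 assumes K: "compact K" "K <= cube d \<times> cube d" "!!s. (s, s) ~: K"
 obtains k :: nat where "!!s s'. (s, s') : K ==> 1 / real (Suc k) < mx d (%i. s i - s' i)"
proof (cases "K = {}")
 case False
 let ?f = "%z. mx d (%i. fst z i - snd z i)"
 have cf: "continuous_on K ?f"
  by (intro continuous_mx continuous_intros continuous_on_coord[OF continuous_on_fst[OF continuous_on_id]])
 obtain z where z: "z : K" "!!w. w : K ==> ?f z <= ?f w" using continuous_attains_inf[OF K(1) False cf] by blast
 have "0 < ?f z"
 proof (rule ccontr)
  assume "~ 0 < ?f z"
  hence e: "fst z i = snd z i" if "i < d" for i using mx_le[of 0 d "%i. fst z i - snd z i"] that by auto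
  have c: "fst z : cube d" "snd z : cube d" using z(1) K(2) by auto
  have "fst z i = snd z i" for i using e c by (cases "i < d") (auto simp: cube_def)
  thus False using z(1) K(3)[of "fst z"] by (metis ext prod.collapse)
 qed
 then obtain k where "1 / real (Suc k) < ?f z" using reals_Archimedean by (metis inverse_eq_divide)
 thus ?thesis using z(2) that[of k] by force
qed (use that in blast)

lemma lebesgue_grid:
 assumes C: "closedin (top_of_set (cube d)) C" and U: "openin (top_of_set (cube d)) U" "C <= U"
 obtains N :: nat where "0 < N" "!!s s'. s : C ==> s' : cube d ==> (!!i. i < d ==> abs (s i - s' i) <= 1 / N) ==> s' : U"
proof -
 have "closedin (top_of_set (cube d)) (cube d - U)" using U(1) by (metis closedin_diff closedin_topspace topspace_euclidean_subtopology)
 hence "compact (cube d - U)" using compact_cube closedin_compact by blast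
 moreover have "compact C" using C compact_cube closedin_compact by blast
 ultimately have "compact (C \<times> (cube d - U))" by (intro compact_Times)
 then obtain k where k: "!!s s'. (s, s') : C \<times> (cube d - U) ==> 1 / real (Suc k) < mx d (%i. s i - s' i)"
  by (rule cube_gap) (use U(2) closedin_imp_subset[OF C] in auto)
 show ?thesis
 proof (rule that[of "Suc k"])
  fix s s' assume s: "s : C" "s' : cube d" "!!i. i < d ==> abs (s i - s' i) <= 1 / real (Suc k)"
  have "mx d (%i. s i - s' i) <= 1 / real (Suc k)" by (subst mx_le) (use s(3) in auto)
  thus "s' : U" using k[of s s'] s by fastforce
 qed simp
qed

text \<open>Moves that respect all cells containing a point preserve this property. It therefore
  survives the clearing of every slab and keeps the support inside \<open>Q\<close>.\<close>

definition cellsub :: "nat => nat => ((nat => real) => bool) => (nat => real) => bool" where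
 "cellsub d N Q s \<longleftrightarrow> (ALL m. incell d N m s --> (ALL s':cube d. incell d N m s' --> Q s'))"

lemma incell_exists: "EX m. incell d N m s"
 by (rule exI[of _ "%i. \<lfloor>real N * s i\<rfloor>"]) (auto simp: incell_def)

lemma cellsub_self: "s : cube d ==> cellsub d N Q s ==> Q s"
 using incell_exists unfolding cellsub_def by blast

text \<open>The hyperplanes are cleared one after another by \<open>hyperplane_stage\<close>, each
  clearing using the contraction of slices of dimension \<open>d - 1\<close> provided by
  \<open>V\<close>.\<close>

lemma grid_vanish:
 fixes A :: "'b topology"
 assumes wp: "well_pointed A a" and T: "t1_space A" "a : topspace A"
  and al: "cmap_on (cube d) A al" "!!s. s : bdry d ==> al s = a"
  and V: "!!g. 0 < d ==> cmap_on (cube (d - 1)) A g ==> (!!u. u : bdry (d - 1) ==> g u = a) ==> qhom (d - 1) A a (%u. g u ~= a) g (%_. a)"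
 obtains N :: nat and be where "0 < N" "qhom d A a (%s. al s ~= a) al be"
  "!!s i j. s : cube d ==> be s ~= a ==> i < d ==> 1/4 < abs (real N * s i - of_int j)"
  "!!s. s : cube d ==> be s ~= a ==> cellsub d N (%s. al s ~= a) s"
proof -
 let ?Q = "%s. al s ~= a"
 obtain al1 C where s1: "qhom d A a ?Q al al1" "closedin (top_of_set (cube d)) C" "!!s. s : C ==> al s ~= a"
  "!!s. s : cube d ==> al1 s ~= a ==> s : C"
  using squash_hom[OF wp al(1)] by blast
 let ?U = "{s : cube d. al s : topspace A - {a}}"
 have "openin A (topspace A - {a})" using T by (metis closedin_def closedin_t1_singleton)
 hence U: "openin (top_of_set (cube d)) ?U" using openin_continuous_map_preimage[OF al(1)] by fastforce
 have CU: "C <= ?U" using s1(3) closedin_imp_subset[OF s1(2)] cmap_image[OF al(1)] by auto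
 obtain N :: nat where N: "0 < N" "!!s s'. s : C ==> s' : cube d ==> (!!i. i < d ==> abs (s i - s' i) <= 1 / N) ==> s' : ?U"
  using lebesgue_grid[OF s1(2) U CU] by blast
 have T1: "cellsub d N ?Q s" if s: "s : cube d" "al1 s ~= a" for s
  unfolding cellsub_def
 proof (intro allI impI ballI)
  fix m s' assume m: "incell d N m s" and s': "s' : cube d" "incell d N m s'"
  have "abs (s i - s' i) <= 1 / N" if i: "i < d" for i
  proof -
   have "of_int (m i) <= real N * s i & real N * s i <= of_int (m i) + 1"
    "of_int (m i) <= real N * s' i & real N * s' i <= of_int (m i) + 1" using m s'(2) i unfolding incell_def by blast+
   hence "abs (real N * s i - real N * s' i) <= 1" by linarith
   hence "real N * abs (s i - s' i) <= 1" by (simp add: abs_mult flip: right_diff_distrib)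
   thus ?thesis using N(1) by (simp add: field_simps)
  qed
  from N(2)[OF s1(4)[OF s] s'(1) this] show "al s' ~= a" by simp
 qed
 define I where "I P be \<longleftrightarrow> qhom d A a ?Q al1 be & (ALL s:cube d. be s ~= a --> cellsub d N ?Q s) & (ALL s:bdry d. be s = a)
  & (ALL s:cube d. ALL (i, j):P. abs (real N * s i - of_int j) <= 1/4 --> be s = a)" for P be
 have step: "EX be'. I (insert (i, j) P) be'" if I: "I P be" and i: "i < d" and j: "abs j <= int N" for i j P be
 proof -
  have be: "qhom d A a ?Q al1 be" "!!s. s : cube d ==> be s ~= a ==> cellsub d N ?Q s" "!!s. s : bdry d ==> be s = a"
   "!!s i j. s : cube d ==> (i, j) : P ==> abs (real N * s i - of_int j) <= 1/4 ==> be s = a"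
   using I unfolding I_def by auto
  let ?R = "%s. EX s'. moved N i j s s' & s' : cube d & be s' ~= a"
  have d0: "0 < d" using i by simp
  obtain be' where b': "qhom d A a ?R be be'" "!!s. s : cube d ==> abs (real N * s i - of_int j) <= 1/4 ==> be' s = a"
   using hyperplane_stage[OF i N(1) j qhom_end(2)[OF be(1)] be(3) V[OF d0]] by blast
  have R: "cellsub d N ?Q s" if "s : cube d" "?R s" for s
   using that be(2) moved_incell unfolding cellsub_def by blast
  have "qhom d A a ?Q be be'"
  proof (rule qhom_mono[OF b'(1)])
   fix s assume "s : cube d" "?R s" thus "al s ~= a" using cellsub_self[OF _ R, of s] by blast
  qed
  hence 1: "qhom d A a ?Q al1 be'" using qhom_trans[OF be(1)] by blast
  have 2: "EX s'. moved N i j s s' & s' : cube d & be s' ~= a" if "s : cube d" "be' s ~= a" for s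
   using qhom_end(3)[OF b'(1) that] .
  \<comment> \<open>A coordinate of absolute value 1 lies on the grid, and a point that stays in
    both adjacent cell layers cannot change it; so boundary points are moved within the
    boundary.\<close>
  have 3: "be' s = a" if s: "s : bdry d" for s
  proof (rule ccontr)
   assume "be' s ~= a"
   then obtain s' where s': "moved N i j s s'" "s' : cube d" "be s' ~= a" using 2 s bdry_cube by blast
   obtain l where l: "l < d" "abs (s l) = 1" using s by (auto simp: bdry_def)
   have "abs (s' l) = 1"
   proof (cases "l = i")
    case False
    thus ?thesis using s'(1) l unfolding moved_def by (metis fun_upd_other)
   next
    case True
    have m: "of_int m <= real N * s' i & real N * s' i <= of_int m + 1" if "of_int m <= real N * s i & real N * s i <= of_int m + 1" for m
     using s'(1) that unfolding moved_def by blast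
    consider "s i = 1" | "s i = -1" using l True by (auto simp: abs_if split: if_splits)
    hence "s' i = s i"
    proof cases
     case 1
     hence "real N * s' i = real N * 1" using m[of "int N"] m[of "int N - 1"] by auto
     thus ?thesis using N(1) 1 by (simp only: mult_left_cancel of_nat_eq_0_iff neq0_conv)
    next
     case 2
     hence "real N * s' i = real N * (-1)" using m[of "- int N"] m[of "- int N - 1"] by auto
     thus ?thesis using N(1) 2 by (simp only: mult_left_cancel of_nat_eq_0_iff neq0_conv)
    qed
    thus ?thesis using l True by simp
   qed
   hence "s' : bdry d" using l s'(2) by (auto simp: bdry_def)
   thus False using be(3) s'(3) by blast
  qed
  \<comment> \<open>Slabs cleared before remain clear: the moves change only coordinate
    \<open>i\<close>, and only within 1/2 of hyperplane \<open>j\<close>, whereas the slab of width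
    1/4 around a parallel hyperplane is at least 3/4 away.\<close>
  have 4: "be' s = a" if s: "s : cube d" "(i', j') : insert (i, j) P" "abs (real N * s i' - of_int j') <= 1/4" for s i' j'
  proof (rule ccontr)
   assume ne: "be' s ~= a"
   hence nij: "(i', j') ~= (i, j)" using b'(2) s by auto
   hence P: "(i', j') : P" using s by auto
   obtain s' where s': "moved N i j s s'" "s' : cube d" "be s' ~= a" using 2[OF s(1) ne] by blast
   have "s' i' = s i'"
   proof (cases "i' = i")
    case False
    thus ?thesis using s'(1) unfolding moved_def by (metis fun_upd_other)
   next
    case True
    hence "j' ~= j" using nij by simp
    hence "1 <= abs (real_of_int j' - real_of_int j)" by linarith
    moreover have "abs (real N * s i - of_int j') <= 1/4" using s(3) True by simp
    ultimately have "1/2 < abs (real N * s i - of_int j)" by linarith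
    thus ?thesis using s'(1) unfolding moved_def by metis
   qed
   thus False using be(4)[OF s'(2) P] s(3) s'(3) by simp
  qed
  show ?thesis
   unfolding I_def
  proof (intro exI[of _ be'] conjI ballI impI)
   fix s assume "s : cube d" "be' s ~= a" thus "cellsub d N ?Q s" using 2 R by blast
  next
   fix s p assume "s : cube d" "p : insert (i, j) P" thus "case p of (i, j) => abs (real N * s i - of_int j) <= 1/4 --> be' s = a"
    using 4 by (cases p) blast
  qed (use 1 3 in blast)+
 qed
 have base: "I {} al1"
  unfolding I_def
 proof (intro conjI ballI impI)
  show "qhom d A a ?Q al1 al1" by (rule qhom_refl[OF qhom_end(2)[OF s1(1)]]) (use qhom_end(3)[OF s1(1)] in blast)
  fix s assume s: "s : bdry d"
  hence "s : cube d" using bdry_cube by blast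
  thus "al1 s = a" using qhom_end(3)[OF s1(1), of s] al(2)[OF s] by blast
 qed (use T1 in auto)
 let ?P = "{..<d} \<times> {- int N..int N}"
 have "EX be. I P be" if "finite P" "P <= ?P" for P
  using that
 proof (induction P rule: finite_induct)
  case empty
  thus ?case using base by blast
 next
  case (insert p P)
  then obtain be where "I P be" by auto
  moreover obtain i j where "p = (i, j)" "i < d" "abs j <= int N" using insert.prems by (cases p) auto
  ultimately show ?case using step by blast
 qed
 then obtain be where "I ?P be" by fastforce
 hence be: "qhom d A a ?Q al1 be" "!!s. s : cube d ==> be s ~= a ==> cellsub d N ?Q s"
   "!!s i j. s : cube d ==> i < d ==> abs j <= int N ==> abs (real N * s i - of_int j) <= 1/4 ==> be s = a"
 proof -
  show "qhom d A a ?Q al1 be" using `I ?P be` unfolding I_def by blast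
  show "cellsub d N ?Q s" if "s : cube d" "be s ~= a" for s using `I ?P be` that unfolding I_def by blast
  fix s i and j :: int assume *: "s : cube d" "i < d" "abs j <= int N" "abs (real N * s i - of_int j) <= 1/4"
  have "(i, j) : ?P" using * by auto
  thus "be s = a" using `I ?P be` *(1,4) unfolding I_def by blast
 qed
 show ?thesis
 proof (rule that[OF N(1) qhom_trans[OF s1(1) be(1)] _ be(2)])
  fix s i and j :: int assume s: "s : cube d" "be s ~= a" "i < d"
  show "1/4 < abs (real N * s i - of_int j)"
  proof (cases "abs j <= int N")
   case True
   thus ?thesis using be(3)[OF s(1,3)] s(2) by (metis linorder_not_le)
  next
   \<comment> \<open>Hyperplanes outside the cube are at distance at least 1 in the scaled
     coordinate.\<close>
   case False
   have "abs (s i) <= 1" using s by (auto simp: cube_def abs_le_iff)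
   hence "abs (real N * s i) <= real N" using mult_left_mono[of "abs (s i)" 1 "real N"] by (simp add: abs_mult)
   moreover have "real N + 1 <= abs (real_of_int j)" using False by linarith
   ultimately show ?thesis by linarith
  qed
 qed assumption+
qed

lemma k_connected_cube:
 assumes A: "k_connected_space c A" "a : topspace A" and d: "1 <= d" "d <= c" and al: "cmap d A a al"
 shows "chom d A a al (%_. a)"
proof -
 obtain f where f: "based_map d A a f" "!!s. s : cube d ==> f (kap d s) = al s" using sphere_cube_lift[OF d(1) al] by blast
 have "ALL i. 1 <= i & i <= c --> (ALL a0:topspace A. ALL f. based_map i A a0 f --> based_homotopic i A a0 f (%_. a0))"
  using A(1) unfolding k_connected_space_def by (elim conjE)
 hence "based_homotopic d A a f (%_. a)" using d A(2) f(1) by simp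
 hence "chom d A a (f o kap d) ((%_. a) o kap d)" by (rule iffD1[OF sphere_chom[OF d(1)]])
 thus ?thesis by (rule chom_cong) (use f in auto)
qed

text \<open>The cell is rescaled to the cube by \<open>bf\<close>, with inverse \<open>af\<close>.
  Since \<open>be\<close> avoids the hyperplanes, it is \<open>a\<close> on the boundary of the cell
  and the contraction extends by the identity.\<close>

lemma cell_stage:
 fixes A :: "'b topology"
 assumes N: "0 < N" and be: "cmap_on (cube d) A be"
  and van: "!!s i j. s : cube d ==> be s ~= a ==> i < d ==> real N * s i ~= of_int j"
  and m: "!!i. i < d ==> - int N <= m i & m i < int N"
  and con: "!!g. cmap d A a g ==> chom d A a g (%_. a)"
 obtains be' where "qhom d A a (%s. be s ~= a | incell d N m s) be be'" "!!s. s : cube d ==> incell d N m s ==> be' s = a"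
  "!!s. s : cube d ==> be' s ~= a ==> be s ~= a"
proof -
 let ?M = "real N"
 have M: "0 < ?M" using N by simp
 define af where "af u = (%i. if i < d then (of_int (m i) + (u i + 1) / 2) / ?M else 0)" for u :: "nat => real"
 define bf where "bf s = (%i. if i < d then 2 * (?M * s i - of_int (m i)) - 1 else 0)" for s :: "nat => real"
 have ab: "af (bf s) = s" if "s : cube d" for s using that M by (auto simp: af_def bf_def cube_def fun_eq_iff field_simps)
 have afc: "af u : cube d" if "u : cube d" for u
 proof -
  have "-1 <= (of_int (m i) + (u i + 1) / 2) / ?M & (of_int (m i) + (u i + 1) / 2) / ?M <= 1" if "i < d" for i
  proof -
   have "-1 <= u i" "u i <= 1" using `u : cube d` that by (auto simp: cube_def)
   moreover have "- real N <= of_int (m i)" "of_int (m i) <= real N - 1" using m[OF that] by linarith+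
   ultimately have "- ?M <= of_int (m i) + (u i + 1) / 2" "of_int (m i) + (u i + 1) / 2 <= ?M" by (auto simp: field_simps)
   thus ?thesis using M by (simp add: le_divide_eq divide_le_eq)
  qed
  thus ?thesis by (simp add: cube_def af_def)
 qed
 have bmx: "mx d (bf s) <= 1 \<longleftrightarrow> incell d N m s" for s
  by (subst mx_le) (auto simp: bf_def incell_def abs_le_iff)
 have bfc: "bf s : cube d" if "incell d N m s" for s
  using that by (auto simp: bf_def incell_def cube_def)
 have bval: "be s = a" if "s : cube d" "mx d (bf s) = 1" for s
 proof (rule ccontr)
  assume ne: "be s ~= a"
  have "incell d N m s" using bmx[of s] that(2) by (metis order_refl)
  hence "bf s : bdry d" using mx_bdry[OF bfc] that(2) by blast
  then obtain i where i: "i < d" "abs (2 * (?M * s i - of_int (m i)) - 1) = 1" by (auto simp: bdry_def bf_def)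
  hence "?M * s i = of_int (m i) | ?M * s i = of_int (m i + 1)" by (auto simp: abs_if split: if_splits)
  thus False using van[OF that(1) ne i(1), of "m i"] van[OF that(1) ne i(1), of "m i + 1"] by (elim disjE notE)
 qed
 have caf: "continuous_on S af" for S unfolding af_def
  by (intro continuous_on_coords, rename_tac l, case_tac "l < d") (simp_all, intro continuous_intros, use M in auto)
 have cbf: "continuous_on S (%z. bf (snd z))" for S :: "(real \<times> (nat => real)) set" unfolding bf_def
  by (intro continuous_on_coords, rename_tac l, case_tac "l < d") (simp_all, intro continuous_intros)
 have "cmap d A a (be o af)"
  unfolding cmap_def
 proof (intro conjI ballI)
  show "cmap_on (cube d) A (be o af)"
   by (rule cmap_comp[OF _ be]) (use caf afc in auto)
  fix u assume u: "u : bdry d"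
  have "u : cube d" using u bdry_cube by blast
  moreover have "bf (af u) = u" using `u : cube d` M by (auto simp: af_def bf_def cube_def fun_eq_iff field_simps)
  ultimately show "(be o af) u = a" using bval[OF afc, of u] mx_bdry[of u d] u by simp
 qed
 from con[OF this] obtain k where k: "cmap_on (prism d) A k"
  "!!s. s : cube d ==> k (0, s) = be (af s) & k (1, s) = a" "!!t s. t : {0..1} ==> s : bdry d ==> k (t, s) = a"
  unfolding chom_def by auto
 let ?D = "prism d"
 let ?H = "%z. if mx d (bf (snd z)) <= 1 then (k o (%z. (fst z, bf (snd z)))) z else (be o snd) z"
 have cm: "continuous_on S (%z. mx d (bf (snd z)))" for S :: "(real \<times> (nat => real)) set"
  by (intro continuous_mx continuous_on_coord[OF cbf])
 have H: "cmap_on ?D A ?H"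
 proof (rule cmap_on_cases_le)
  show "cmap_on {x : ?D. mx d (bf (snd x)) <= 1} A (k o (%z. (fst z, bf (snd z))))"
   by (rule cmap_comp[OF _ k(1)])
    (auto simp: subtopology_subtopology bmx bfc intro!: continuous_on_Pair continuous_on_fst continuous_on_id cbf)
  show "cmap_on {x : ?D. 1 <= mx d (bf (snd x))} A (be o snd)"
   by (rule cmap_comp[OF _ be]) (auto simp: subtopology_subtopology intro!: continuous_on_snd continuous_on_id)
  show "continuous_on ?D (%z. mx d (bf (snd z)))" by (rule cm)
  fix x assume x: "x : ?D" "mx d (bf (snd x)) = 1"
  hence "incell d N m (snd x)" using bmx[of "snd x"] by (metis order_refl)
  hence "bf (snd x) : bdry d" using mx_bdry[OF bfc] x by blast
  thus "(k o (%z. (fst z, bf (snd z)))) x = (be o snd) x" using k(3) bval[of "snd x"] x by auto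
 qed
 have q: "qhom d A a (%s. be s ~= a | incell d N m s) be (%s. ?H (1, s))"
  by (rule qhomI[OF H]) (use k(2)[OF bfc] ab bmx in auto)
 show ?thesis
  by (rule that[OF q]) (use k(2)[OF bfc] bmx in "auto split: if_splits")
qed

text \<open>Induction on the dimension. The previous case clears all hyperplanes; what is left sits
  in single cells inside the support of \<open>al\<close>, and each cell is contracted by the
  connectivity of \<open>A\<close>. In dimension 0 the cube is a point and a path to
  \<open>a\<close> is enough.\<close>

lemma contract_supported:
 fixes A :: "'b topology"
 assumes wp: "well_pointed A a" and T: "t1_space A" "a : topspace A" and A: "k_connected_space c A"
  and d: "d <= c" and al: "cmap_on (cube d) A al" "!!s. s : bdry d ==> al s = a"
 shows "qhom d A a (%s. al s ~= a) al (%_. a)"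
 using d al
proof (induction d arbitrary: al)
 case 0
 let ?o = "%_::nat. 0::real"
 have c0: "cube 0 = {?o}" by (auto simp: cube_def)
 show ?case
 proof (cases "al ?o = a")
  case True
  have "qhom 0 A a (%s. al s ~= a) al al" by (rule qhom_refl[OF 0(2)]) simp
  thus ?thesis by (rule qhom_cong) (use True c0 in auto)
 next
  case False
  have "al ?o : topspace A" using cmap_image[OF 0(2)] c0 by auto
  then obtain g where g: "pathin A g" "g 0 = al ?o" "g 1 = a"
   using A T(2) unfolding k_connected_space_def path_connected_space_def by blast
  show ?thesis
  proof (rule qhomI[of _ _ "g o fst"])
   show "cmap_on (prism 0) A (g o fst)"
    by (rule cmap_comp[of _ "top_of_set {0..1}"]) (use g(1) in "auto simp: pathin_def intro: continuous_intros")
  qed (use g c0 False in auto)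
 qed
next
 case (Suc d)
 have V: "qhom (Suc d - 1) A a (%u. g u ~= a) g (%_. a)"
  if "cmap_on (cube (Suc d - 1)) A g" "!!u. u : bdry (Suc d - 1) ==> g u = a" for g
  using Suc.IH[of g] Suc.prems(1) that by simp
 obtain N :: nat and be where b: "0 < N" "qhom (Suc d) A a (%s. al s ~= a) al be"
  "!!s i j. s : cube (Suc d) ==> be s ~= a ==> i < Suc d ==> 1/4 < abs (real N * s i - of_int j)"
  "!!s. s : cube (Suc d) ==> be s ~= a ==> cellsub (Suc d) N (%s. al s ~= a) s"
  using grid_vanish[OF wp T Suc.prems(2,3) V] by blast
 let ?d = "Suc d"
 let ?Q = "%s. al s ~= a"
 let ?C = "PiE {..<?d} (%_. {- int N..<int N})"
 have con: "chom ?d A a g (%_. a)" if "cmap ?d A a g" for g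
  by (rule k_connected_cube[OF A T(2) _ _ that]) (use Suc.prems in auto)
 have "EX ga. qhom ?d A a ?Q be ga & (ALL s:cube ?d. ga s ~= a --> be s ~= a) & (ALL m:C. ALL s:cube ?d. incell ?d N m s --> ga s = a)"
  if "finite C" "C <= ?C" for C
  using that
 proof (induction C rule: finite_induct)
  case empty
  have "qhom ?d A a ?Q be be" by (rule qhom_refl[OF qhom_end(2)[OF b(2)]]) (use qhom_end(3)[OF b(2)] in blast)
  thus ?case by blast
 next
  case (insert m C)
  then obtain ga where g: "qhom ?d A a ?Q be ga" "!!s. s : cube ?d ==> ga s ~= a ==> be s ~= a"
   "!!m s. m : C ==> s : cube ?d ==> incell ?d N m s ==> ga s = a" by auto
  show ?case
  proof (cases "EX s:cube ?d. incell ?d N m s & ga s ~= a")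
   case False
   thus ?thesis using g by (intro exI[of _ ga]) blast
  next
   case True
   then obtain s0 where s0: "s0 : cube ?d" "incell ?d N m s0" "ga s0 ~= a" by blast
   \<comment> \<open>The cell still meets the support of \<open>be\<close>, so by
     \<open>cellsub\<close> all of it lies in the support of \<open>al\<close> and may be
     filled.\<close>
   have cs: "al s ~= a" if "s : cube ?d" "incell ?d N m s" for s
    using b(4)[OF s0(1) g(2)[OF s0(1,3)]] s0(2) that unfolding cellsub_def by blast
   have mi: "- int N <= m i & m i < int N" if "i < ?d" for i using insert.prems that by (auto simp: PiE_def Pi_def)
   have van: "real N * s i ~= of_int j" if "s : cube ?d" "ga s ~= a" "i < ?d" for s i j
    using b(3)[OF that(1) g(2)[OF that(1,2)] that(3), of j] by auto
   obtain ga' where g': "qhom ?d A a (%s. ga s ~= a | incell ?d N m s) ga ga'" "!!s. s : cube ?d ==> incell ?d N m s ==> ga' s = a"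
     "!!s. s : cube ?d ==> ga' s ~= a ==> ga s ~= a"
    by (rule cell_stage[of N "Suc d" A ga a m, OF b(1) qhom_end(2)[OF g(1)]]) (use van mi con in blast)+
   have "qhom ?d A a ?Q ga ga'" by (rule qhom_mono[OF g'(1)]) (use cs qhom_end(3)[OF g(1)] in blast)
   hence "qhom ?d A a ?Q be ga'" by (rule qhom_trans[OF g(1)])
   thus ?thesis using g g' by (intro exI[of _ ga']) blast
  qed
 qed
 from this[of ?C] obtain ga where g: "qhom ?d A a ?Q be ga" "!!s. s : cube ?d ==> ga s ~= a ==> be s ~= a"
   "!!m s. m : ?C ==> s : cube ?d ==> incell ?d N m s ==> ga s = a" by (auto simp: finite_PiE)
 have "ga s = a" if s: "s : cube ?d" for s
 proof (rule ccontr)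
  assume ne: "ga s ~= a"
  define m where "m = (\<lambda>i\<in>{..<?d}. \<lfloor>real N * s i\<rfloor>)"
  have "- int N <= \<lfloor>real N * s i\<rfloor> & \<lfloor>real N * s i\<rfloor> < int N" if i: "i < ?d" for i
  proof -
   have "-1 <= s i" "s i <= 1" using s i by (auto simp: cube_def)
   hence "- real N <= real N * s i" "real N * s i <= real N"
    using mult_left_mono[of "-1" "s i" "real N"] mult_left_mono[of "s i" 1 "real N"] by auto
   moreover have "real N * s i ~= of_int (int N)" using b(3)[OF s g(2)[OF s ne] i, of "int N"] by (intro notI) simp
   ultimately have "of_int (- int N) <= real N * s i" "real N * s i < of_int (int N)" by simp_all
   thus ?thesis unfolding le_floor_iff floor_less_iff by blast
  qed
  hence "m : ?C" by (auto simp: m_def)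
  moreover have "incell ?d N m s" by (auto simp: incell_def m_def)
  ultimately show False using g(3) s ne by blast
 qed
 hence "qhom ?d A a ?Q be (%_. a)" using qhom_cong[OF g(1)] by auto
 thus ?case by (rule qhom_trans[OF b(2)])
qed

text \<open>In dimension \<open>n\<close> the connectivity still clears the hyperplanes, whose
  slices have dimension \<open>n - 1\<close>, but no longer contracts the cells: these retain
  elements of the \<open>n\<close>-th homotopy group.\<close>

lemma grid_discs:
 fixes A :: "'b topology"
 assumes wp: "well_pointed A a" and T: "t1_space A" "a : topspace A" and A: "k_connected_space (n - 1) A" and al: "cmap n A a al"
 obtains N :: nat and be where "0 < N" "qhom n A a (%s. al s ~= a) al be"
  "!!s i j. s : cube n ==> be s ~= a ==> i < n ==> 1/4 < abs (real N * s i - of_int j)"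
  "!!s. s : cube n ==> be s ~= a ==> cellsub n N (%s. al s ~= a) s"
proof -
 have V: "qhom (n - 1) A a (%u. g u ~= a) g (%_. a)"
  if "cmap_on (cube (n - 1)) A g" "!!u. u : bdry (n - 1) ==> g u = a" for g
  by (rule contract_supported[OF wp T A order_refl that])
 have c: "cmap_on (cube n) A al" "!!s. s : bdry n ==> al s = a" using al unfolding cmap_def by auto
 show ?thesis
  using grid_vanish[where d=n and al=al, OF wp T c V] that by blast
qed

section \<open>Waves carrying discs into slabs\<close>

text \<open>The triangle wave of period 2; written as a distance to the even integers, it is
  1-Lipschitz at once.\<close>

definition tri :: "real => real" where "tri x = infdist x (range (%k::int. 2 * of_int k))"

lemma tri_lip: "abs (tri x - tri y) <= abs (x - y)"
 using infdist_triangle_abs[of x "range (%k::int. 2 * of_int k :: real)" y] by (simp add: tri_def dist_real_def)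

lemma continuous_tri: "continuous_on S f ==> continuous_on S (%z. tri (f z))"
 unfolding tri_def by (rule continuous_on_infdist)

lemma tri_le: "tri x <= abs (x - 2 * of_int k)"
 unfolding tri_def by (rule infdist_le2[of "2 * of_int k"]) (auto simp: dist_real_def)

lemma tri_ge: "(!!k::int. c <= abs (x - 2 * of_int k)) ==> c <= tri x"
 unfolding tri_def infdist_def by (auto simp: dist_real_def intro!: cINF_greatest)

lemma tri_bounds: "0 <= tri x" "tri x <= 1"
proof -
 show "0 <= tri x" unfolding tri_def by (rule infdist_nonneg)
 have "abs (x - 2 * of_int \<lfloor>x / 2 + 1/2\<rfloor>) <= 1" by linarith
 thus "tri x <= 1" using tri_le[of x "\<lfloor>x / 2 + 1/2\<rfloor>"] by linarith
qed

lemma tri_id: "0 <= x ==> x <= 1 ==> tri x = x"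
proof (rule antisym)
 assume x: "0 <= x" "x <= 1"
 show "tri x <= x" using tri_le[of x 0] x by simp
 show "x <= tri x"
 proof (rule tri_ge)
  fix k :: int
  show "x <= abs (x - 2 * of_int k)"
  proof (cases "k <= 0")
   case True
   thus ?thesis using x by linarith
  next
   case False
   hence "1 <= real_of_int k" by linarith
   thus ?thesis using x by linarith
  qed
 qed
qed

lemma tri_even: "tri (2 * of_int k) = 0"
 using tri_le[of "2 * of_int k" k] tri_bounds(1)[of "2 * of_int k"] by simp

lemma tri_odd: "tri (2 * of_int k + 1) = 1"
proof (rule antisym[OF tri_bounds(2)], rule tri_ge)
 fix j :: int
 have "1 <= abs (2 * k + 1 - 2 * j)" by presburger
 hence "1 <= abs (real_of_int (2 * k + 1 - 2 * j))" by linarith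
 thus "1 <= abs (2 * of_int k + 1 - 2 * real_of_int j)" by simp
qed

lemma tri_ends: "tri (real b) <= v & v <= tri (real b + 1) | tri (real b + 1) <= v & v <= tri (real b)" if "0 <= v" "v <= 1"
proof (cases "even b")
 case True
 then obtain k where "b = 2 * k" by (elim evenE)
 hence "tri (real b) = 0" "tri (real b + 1) = 1" using tri_even[of "int k"] tri_odd[of "int k"] by simp_all
 thus ?thesis using that by simp
next
 case False
 then obtain k where "b = 2 * k + 1" by (elim oddE)
 hence b: "real b = 2 * of_int (int k) + 1" "real b + 1 = 2 * of_int (int k + 1)" by simp_all
 have "tri (real b) = 1" "tri (real b + 1) = 0" unfolding b(2) tri_even using b(1) tri_odd[of "int k"] by simp_all
 thus ?thesis using that by simp
qed

text \<open>On each interval of length \<open>1 / N\<close> the wave runs through all of [0,1], so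
  every level is attained within \<open>1 / N\<close> of \<open>y\<close>.\<close>

lemma tri_position:
 assumes v: "0 <= v" "v <= 1" and N: "0 < (N::nat)" and y: "abs y <= 1/2"
 obtains x where "abs x <= 1/2" "abs (x - y) <= 1 / real N" "tri (real N * (x + 1/2)) = v"
proof -
 have y01: "0 <= real N * (y + 1/2)" "real N * (y + 1/2) <= real N"
  using y N mult_left_mono[of "y + 1/2" 1 "real N"] by (auto simp: abs_le_iff)
 define b where "b = (if y = 1/2 then N - 1 else nat \<lfloor>real N * (y + 1/2)\<rfloor>)"
 have b: "real b <= real N * (y + 1/2)" "real N * (y + 1/2) <= real b + 1" "b < N"
 proof -
  have "real b <= real N * (y + 1/2) & real N * (y + 1/2) <= real b + 1 & b < N"
  proof (cases "y = 1/2")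
   case True
   hence "y + 1/2 = 1" by simp
   hence "real N * (y + 1/2) = real N" by (simp only: mult_1_right)
   moreover have "real b = real N - 1" "b < N" using True N by (simp_all add: b_def of_nat_diff)
   ultimately show ?thesis by linarith
  next
   case False
   have "real b = of_int \<lfloor>real N * (y + 1/2)\<rfloor>" using False y01 by (simp add: b_def)
   moreover have "real N * (y + 1/2) < real N * 1" using N y False by (intro mult_strict_left_mono) (auto simp: abs_le_iff)
   ultimately have "real b <= real N * (y + 1/2)" "real N * (y + 1/2) <= real b + 1" "real b < real N" by linarith+
   thus ?thesis by simp
  qed
  thus "real b <= real N * (y + 1/2)" "real N * (y + 1/2) <= real b + 1" "b < N" by auto
 qed
 have c: "continuous_on {real b..real b + 1} tri" by (intro continuous_tri continuous_on_id)
 have "EX z. real b <= z & z <= real b + 1 & tri z = v"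
  using tri_ends[OF v, of b]
 proof
  assume *: "tri (real b) <= v & v <= tri (real b + 1)"
  show ?thesis by (rule IVT') (use * c in auto)
 next
  assume *: "tri (real b + 1) <= v & v <= tri (real b)"
  show ?thesis by (rule IVT2') (use * c in auto)
 qed
 then obtain z where z: "real b <= z" "z <= real b + 1" "tri z = v" by blast
 have N': "0 < real N" using N by simp
 have zN: "0 <= z" "z <= real N" using z b(3) by linarith+
 show ?thesis
 proof (rule that[of "z / real N - 1/2"])
  show "abs (z / real N - 1/2) <= 1/2" using zN N' by (auto simp: abs_le_iff field_simps)
  have "abs (z - real N * (y + 1/2)) <= 1" using z b by linarith
  moreover have "z - real N * (y + 1/2) = real N * (z / real N - 1/2 - y)" using N' by (simp add: field_simps)
  ultimately have "real N * abs (z / real N - 1/2 - y) <= 1" using N' by (simp add: abs_mult)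
  thus "abs (z / real N - 1/2 - y) <= 1 / real N" using N' by (simp add: field_simps)
  show "tri (real N * (z / real N - 1/2 + 1/2)) = v" using z(3) N' by simp
 qed
qed

text \<open>With \<open>tau = 1 / (1 + et)\<close>, \<open>ramp a\<close> rises from 0 to 1 while the time \<open>et\<close> runs from \<open>a\<close> to \<open>a + 1\<close>.\<close>

definition ramp :: "nat => real => real" where
 "ramp a tau = max 0 (min 1 (1 / max tau (1 / (real a + 2)) - 1 - real a))"

lemma ramp_bounds: "0 <= ramp a tau" "ramp a tau <= 1"
 by (auto simp: ramp_def)

lemma ramp_early: "0 < tau ==> 1 / tau <= real a + 1 ==> ramp a tau = 0"
proof -
 assume t: "0 < tau" "1 / tau <= real a + 1"
 hence "1 / (real a + 2) <= tau" by (simp add: field_simps)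
 hence "max tau (1 / (real a + 2)) = tau" by simp
 thus ?thesis using t by (simp add: ramp_def)
qed

lemma ramp_late:
 assumes t: "tau <= 0 | real a + 2 <= 1 / tau"
 shows "ramp a tau = 1"
proof -
 have "tau <= 1 / (real a + 2)"
 proof (cases "tau <= 0")
  case True
  thus ?thesis by (rule order_trans) simp
 next
  case False
  thus ?thesis using t by (simp add: field_simps)
 qed
 hence "max tau (1 / (real a + 2)) = 1 / (real a + 2)" by (rule max_absorb2)
 thus ?thesis by (simp add: ramp_def)
qed

lemma continuous_ramp: "continuous_on S f ==> continuous_on S (%z. ramp a (f z))"
proof -
 have "0 < max x (1 / (real a + 2))" for x by (simp add: less_max_iff_disj)
 hence "max x (1 / (real a + 2)) ~= 0" for x by (metis less_irrefl)
 thus "continuous_on S f ==> continuous_on S (%z. ramp a (f z))" unfolding ramp_def by (intro continuous_intros) auto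
qed

lemma parity_telescope:
 fixes x :: "nat => real"
 assumes "e < 2"
 shows "x e + (\<Sum>k<m. if k mod 2 = e then x (k + 2) - x k else 0) = x (if m mod 2 = e then m else m + 1)"
proof (induction m)
 case 0
 thus ?case using assms less_2_cases[of e] by auto
next
 case (Suc m)
 have "m mod 2 = 0 | m mod 2 = 1" by presburger
 thus ?case using Suc assms by (auto simp: mod_Suc)
qed

lemma convex_close:
 fixes a b c h d :: real
 assumes "0 <= h" "h <= 1" "abs (a - c) <= d" "abs (b - c) <= d" shows "abs (a + h * (b - a) - c) <= d"
proof -
 have "a + h * (b - a) - c = (1 - h) * (a - c) + h * (b - c)" by (simp add: algebra_simps)
 also have "abs (...) <= (1 - h) * abs (a - c) + h * abs (b - c)"
  using assms(1,2) by (intro order_trans[OF abs_triangle_ineq]) (simp add: abs_mult)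
 also have "... <= (1 - h) * d + h * d" using assms by (intro add_mono mult_left_mono) auto
 finally show ?thesis by (simp add: algebra_simps)
qed

section \<open>The wave homotopy\<close>

locale wave_base =
 fixes n :: nat and D :: "'d::metric_space set" and l :: "'d => 'd => real" and sig :: "'d => 'd => real => 'd"
  and F :: "(nat => real) => 'd" and tht :: "real => 'd" and t0 :: 'd and M :: real
 assumes n: "2 <= n" and compD: "compact D"
  and lc: "continuous_on (D \<times> D) (%(u, p). l u p)" and l0: "!!u. u : D ==> l u u = 0"
  and sigc: "continuous_on (D \<times> D \<times> {0::real..}) (%(u, w, z). sig u w z)"
  and sigD: "!!u w z. u : D ==> w : D ==> 0 <= z ==> sig u w z : D"
  and sig0: "!!u w. u : D ==> w : D ==> sig u w 0 = u"
  and sige: "!!u w z. u : D ==> w : D ==> l u w <= z ==> sig u w z = w"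
  and Fc: "continuous_on (cube n) F" and FD: "!!s. s : cube n ==> F s : D"
  and Ft0: "!!s. s : cube n ==> 1/2 <= mx n s ==> F s = t0" and t0D: "t0 : D"
  and thtc: "continuous_on {0..1} tht" and thtD: "!!c. c : {0..1} ==> tht c : D"
  and M: "0 < M" "!!u w. u : D ==> w : D ==> l u w <= M"

text \<open>In terms of the time \<open>1 / tau - 1\<close>, level \<open>k\<close> is the interval
  from \<open>2 * k\<close> to \<open>2 * k + 2\<close>: wave \<open>k\<close>, of frequency
  \<open>N k\<close> in coordinate \<open>k mod 2\<close>, acts alone in the first half, and wave
  \<open>k + 1\<close> is blended in during the second. Disc \<open>i\<close> sits where wave
  \<open>k\<close> has level \<open>v i\<close>, at \<open>x i k\<close>, shrunk to radius
  \<open>q i\<close> so that the waves vary on it by at most \<open>w i\<close>. From time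
  \<open>2 * K i\<close> on it grows into its original place \<open>p i\<close> with radius
  \<open>r i\<close>.\<close>

locale wave_data = wave_base n D l sig F tht t0 M
 for n :: nat and D :: "'d::metric_space set" and l sig F tht t0 M +
 fixes N :: "nat => nat" and I :: "nat set" and p :: "nat => nat => real" and r :: "nat => real" and tt :: "nat => 'd"
  and v w :: "nat => real" and K :: "nat => nat" and q :: "nat => real" and x :: "nat => nat => real"
 assumes N0: "N 0 = 1" and Nm: "!!i j. i <= j ==> N i <= N j" and Nk: "!!k. k + 1 <= N k"
  and NF: "!!k s s'. s : cube n ==> s' : cube n ==> (!!e. e < n ==> abs (s e - s' e) <= 2 / N k) ==> l (F s) (F s') <= M / (real k + 1)"
  and pc: "!!i. i : I ==> p i : cube n" and r0: "!!i. i : I ==> 0 < r i"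
  and pr: "!!i e. i : I ==> e < n ==> abs (p i e) + r i <= 1/2"
  and pF: "!!i s. i : I ==> s : cube n ==> (!!e. e < n ==> abs (s e - p i e) <= r i) ==> F s = tt i"
  and sep: "!!i i'. i : I ==> i' : I ==> i ~= i' ==> EX e<n. 2 * r i + 2 * r i' <= abs (p i e - p i' e)"
  and v: "!!i. i : I ==> 0 <= v i & v i <= 1" and w: "!!i. i : I ==> 0 < w i"
  and vtht: "!!i c. i : I ==> c : {0..1} ==> abs (c - v i) <= w i ==> tht c = tt i"
  and vsep: "!!i i'. i : I ==> i' : I ==> i ~= i' ==> w i + w i' < abs (v i - v i')"
  and Ki: "!!i. i : I ==> i + 3 <= K i" and Kr: "!!i k. i : I ==> K i <= k + 2 ==> 1 / N k <= r i / 4"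
  and q: "!!i. i : I ==> 0 < q i" "!!i. i : I ==> q i <= 1/8" "!!i. i : I ==> q i <= r i / 2"
   "!!i. i : I ==> q i <= w i / N (K i)" "!!i. i : I ==> q i <= 1 / N (K i)"
  and x: "!!i k. i : I ==> abs (x i k) <= 1/2" "!!i k. i : I ==> abs (x i k - p i (k mod 2)) <= 1 / N k"
   "!!i k. i : I ==> tri (N k * (x i k + 1/2)) = v i"
begin

definition wave :: "nat => (nat => real) => real" where
 "wave k s = tri (N k * (s (k mod 2) + 1/2))"

definition csum :: "nat => real => (nat => real) => real" where
 "csum m tau s = wave 0 s + (\<Sum>k<m. ramp (2 * k + 1) tau * (wave (Suc k) s - wave k s))"

text \<open>The truncation drops only terms whose ramp has not started. For \<open>tau\<close>
  bounded away from 0 a common number of terms will do, which gives continuity there.\<close>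

definition cc :: "real => (nat => real) => real" where
 "cc tau s = csum (nat \<lceil>1 / tau\<rceil>) tau s"

definition bum :: "nat => (nat => real) => real" where
 "bum i s = max 0 (min 1 (3 - 2 * mx n (%e. (s e - p i e) / r i)))"

text \<open>The flow is switched off around discs that settle. The ramp of index
  \<open>2 * K i - 1\<close> is complete exactly when disc \<open>i\<close> begins to grow.\<close>

definition ksum :: "nat => real => (nat => real) => real" where
 "ksum m tau s = max 0 (1 - (\<Sum>i<m. if i : I then bum i s * ramp (2 * K i - 1) tau else 0))"

definition chi :: "(nat => real) => real" where "chi s = max 0 (min 1 (4 * (1 - mx n s)))"

text \<open>At level \<open>k >= 1\<close> one has \<open>1 / tau < 2 * k + 3 <= 5 * k\<close>, so
  \<open>5 * M * tau\<close> exceeds \<open>M / k\<close>, the size of the arc to be covered for a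
  disc in motion. The factor \<open>tau\<close> gives continuity at 0.\<close>

definition zz :: "real => (nat => real) => real" where
 "zz tau s = 5 * M * tau * ksum (nat \<lceil>1 / tau\<rceil>) tau s * chi s"

definition GG :: "real => (nat => real) => 'd" where
 "GG tau s = sig (F s) (tht (cc tau s)) (zz tau s)"

text \<open>The slide from \<open>x i k\<close> to \<open>x i (k + 2)\<close> takes place from time
  \<open>2 * k + 2\<close> to \<open>2 * k + 3\<close>, when wave \<open>k + 1\<close> in the other
  coordinate is alone in force.\<close>

definition cen :: "nat => real => nat => real" where
 "cen i tau e = (if e < 2 then x i e + (\<Sum>k<K i. if k mod 2 = e then ramp (2 * k + 2) tau * (x i (k + 2) - x i k) else 0) else p i e)"

definition Cen :: "nat => real => nat => real" where
 "Cen i tau e = cen i tau e + ramp (2 * K i) tau * (p i e - cen i tau e)"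

definition siz :: "nat => real => real" where
 "siz i tau = q i + ramp (2 * K i) tau * (r i - q i)"

definition UU :: "nat => real => (nat => real) => nat => real" where
 "UU i tau s e = (if e < n then max (-1) (min 1 ((s e - Cen i tau e) / siz i tau)) else 0)"

lemma csum_extend:
 assumes "0 < tau" "nat \<lceil>1 / tau\<rceil> <= m" shows "csum m tau s = cc tau s"
proof -
 have "(\<Sum>k<m. ramp (2 * k + 1) tau * (wave (Suc k) s - wave k s)) = (\<Sum>k<nat \<lceil>1 / tau\<rceil>. ramp (2 * k + 1) tau * (wave (Suc k) s - wave k s))"
 proof (rule sum.mono_neutral_right)
  show "ALL k:{..<m} - {..<nat \<lceil>1 / tau\<rceil>}. ramp (2 * k + 1) tau * (wave (Suc k) s - wave k s) = 0"
  proof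
   fix k assume "k : {..<m} - {..<nat \<lceil>1 / tau\<rceil>}"
   hence "nat \<lceil>1 / tau\<rceil> <= k" by simp
   hence "1 / tau <= real k" by (simp add: nat_le_iff ceiling_le_iff)
   hence "ramp (2 * k + 1) tau = 0" by (intro ramp_early assms(1)) simp
   thus "ramp (2 * k + 1) tau * (wave (Suc k) s - wave k s) = 0" by simp
  qed
 qed (use assms in auto)
 thus ?thesis by (simp add: cc_def csum_def)
qed

lemma ksum_extend:
 assumes "0 < tau" "nat \<lceil>1 / tau\<rceil> <= m" shows "ksum m tau s = ksum (nat \<lceil>1 / tau\<rceil>) tau s"
proof -
 have "(\<Sum>i<m. if i : I then bum i s * ramp (2 * K i - 1) tau else 0) = (\<Sum>i<nat \<lceil>1 / tau\<rceil>. if i : I then bum i s * ramp (2 * K i - 1) tau else 0)"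
 proof (rule sum.mono_neutral_right)
  show "ALL i:{..<m} - {..<nat \<lceil>1 / tau\<rceil>}. (if i : I then bum i s * ramp (2 * K i - 1) tau else 0) = 0"
  proof
   fix i assume "i : {..<m} - {..<nat \<lceil>1 / tau\<rceil>}"
   hence "nat \<lceil>1 / tau\<rceil> <= i" by simp
   hence i: "1 / tau <= real i" by (simp add: nat_le_iff ceiling_le_iff)
   show "(if i : I then bum i s * ramp (2 * K i - 1) tau else 0) = 0"
   proof (cases "i : I")
    case True
    hence "real i + 3 <= real (K i)" using Ki by (metis of_nat_le_iff of_nat_add of_nat_numeral)
    hence "ramp (2 * K i - 1) tau = 0" using i Ki[OF True] by (intro ramp_early assms(1)) (simp add: of_nat_diff)
    thus ?thesis by simp
   qed simp
  qed
 qed (use assms in auto)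
 thus ?thesis by (simp add: ksum_def)
qed

lemma cc_step:
 assumes t: "0 < tau" "2 * real k + 1 <= 1 / tau" "1 / tau < 2 * real k + 3"
 shows "cc tau s = wave k s + ramp (2 * k + 1) tau * (wave (Suc k) s - wave k s)"
proof -
 let ?f = "%j. ramp (2 * j + 1) tau * (wave (Suc j) s - wave j s)"
 let ?m = "max (Suc k) (nat \<lceil>1 / tau\<rceil>)"
 have "cc tau s = csum ?m tau s" using csum_extend[OF t(1), of ?m s] by simp
 also have "... = wave 0 s + (\<Sum>j<Suc k. ?f j)"
  unfolding csum_def
 proof (intro arg_cong2[where f="(+)"] refl sum.mono_neutral_right ballI)
  fix j assume "j : {..<?m} - {..<Suc k}"
  hence "real k + 1 <= real j" by simp
  hence "ramp (2 * j + 1) tau = 0" using t by (intro ramp_early) simp_all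
  thus "?f j = 0" by simp
 qed auto
 finally have c: "cc tau s = wave 0 s + (\<Sum>j<Suc k. ?f j)" .
 have "(\<Sum>j<k. ?f j) = (\<Sum>j<k. wave (Suc j) s - wave j s)"
 proof (rule sum.cong)
  fix j assume "j : {..<k}"
  hence "real j + 1 <= real k" by simp
  hence "ramp (2 * j + 1) tau = 1" using t by (intro ramp_late) simp
  thus "?f j = wave (Suc j) s - wave j s" by simp
 qed simp
 also have "... = wave k s - wave 0 s" by (rule sum_lessThan_telescope)
 finally have "(\<Sum>j<k. ?f j) = wave k s - wave 0 s" .
 thus ?thesis using c by simp
qed

lemma cen_step:
 assumes e: "e < 2" and k: "k <= K i"
  and one: "!!j. j + 1 < k ==> ramp (2 * j + 2) tau = 1" and zero: "!!j. k <= j ==> j < K i ==> ramp (2 * j + 2) tau = 0"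
 shows "cen i tau e = (if k mod 2 = e then x i k else if k = 0 then x i 1
   else x i (k - 1) + ramp (2 * k) tau * (x i (k + 1) - x i (k - 1)))"
proof -
 let ?f = "%j. if j mod 2 = e then ramp (2 * j + 2) tau * (x i (j + 2) - x i j) else 0"
 have "(\<Sum>j<K i. ?f j) = (\<Sum>j<k. ?f j)"
  using k zero by (intro sum.mono_neutral_right) auto
 hence c: "cen i tau e = x i e + (\<Sum>j<k. ?f j)" using e by (simp add: cen_def)
 show ?thesis
 proof (cases k)
  case 0
  thus ?thesis using c less_2_cases[OF e] by auto
 next
  case (Suc m)
  have "(\<Sum>j<m. ?f j) = (\<Sum>j<m. if j mod 2 = e then x i (j + 2) - x i j else 0)"
   using one Suc by (intro sum.cong) auto
  hence "cen i tau e = x i (if m mod 2 = e then m else m + 1) + ?f m"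
   using c parity_telescope[OF e, of "x i" m] Suc by simp
  moreover have "Suc m mod 2 = e \<longleftrightarrow> m mod 2 ~= e" using e by presburger
  ultimately show ?thesis using Suc by auto
 qed
qed

lemma cen_early:
 assumes i: "i : I" and e: "e < 2" and t: "0 < tau" "2 * real k + 1 <= 1 / tau" "1 / tau < 2 * real k + 3" and k: "k <= K i"
 shows "cen i tau e = (if k mod 2 = e then x i k else if k = 0 then x i 1
   else x i (k - 1) + ramp (2 * k) tau * (x i (k + 1) - x i (k - 1)))"
proof (rule cen_step[OF e k])
 fix j assume "j + 1 < k"
 hence "real j + 2 <= real k" by linarith
 thus "ramp (2 * j + 2) tau = 1" using t by (intro ramp_late) simp
next
 fix j assume "k <= j"
 hence "real k <= real j" by linarith
 thus "ramp (2 * j + 2) tau = 0" using t by (intro ramp_early) simp_all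
qed

lemma cen_late:
 assumes i: "i : I" and e: "e < 2" and t: "tau <= 0 | 2 * real (K i) + 1 <= 1 / tau"
 shows "cen i tau e = (if K i mod 2 = e then x i (K i) else if K i = 0 then x i 1
   else x i (K i - 1) + ramp (2 * K i) tau * (x i (K i + 1) - x i (K i - 1)))"
proof (rule cen_step[OF e order_refl])
 fix j assume "j + 1 < K i"
 hence "real j + 2 <= real (K i)" by linarith
 thus "ramp (2 * j + 2) tau = 1" using t by (intro ramp_late) auto
qed simp

lemma cen_form_close:
 assumes i: "i : I" and e: "e < 2" and k: "0 < k"
  and f: "c = (if k mod 2 = e then x i k else if k = 0 then x i 1 else x i (k - 1) + ramp (2 * k) tau * (x i (k + 1) - x i (k - 1)))"
 shows "abs (c - p i e) <= 1 / N (k - 1)"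
proof -
 have "abs (x i j - p i e) <= 1 / N (k - 1)" if "k - 1 <= j" "j mod 2 = e" for j
 proof -
  have "0 < N (k - 1)" using Nk[of "k - 1"] by simp
  hence "1 / real (N j) <= 1 / real (N (k - 1))" using Nm[OF that(1)] by (intro divide_left_mono) auto
  thus ?thesis using x(2)[OF i, of j] that(2) by simp
 qed
 note * = this
 show ?thesis
 proof (cases "k mod 2 = e")
  case True
  thus ?thesis using f *[of k] by simp
 next
  case False
  obtain m where m: "k = Suc m" using k by (cases k) auto
  have "m mod 2 = e" using False e unfolding m by presburger
  hence "(k - 1) mod 2 = e" "(k + 1) mod 2 = e" using m by simp_all
  hence *: "abs (x i (k - 1) - p i e) <= 1 / N (k - 1)" "abs (x i (k + 1) - p i e) <= 1 / N (k - 1)"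
   using *[of "k - 1"] *[of "k + 1"] by auto
  have "c = x i (k - 1) + ramp (2 * k) tau * (x i (k + 1) - x i (k - 1))" using f False k by simp
  thus ?thesis using convex_close[OF ramp_bounds *] by simp
 qed
qed

lemma cen_inner:
 assumes i: "i : I" and e: "e < n"
  and f: "e < 2 ==> cen i tau e = (if k mod 2 = e then x i k else if k = 0 then x i 1 else x i (k - 1) + ramp (2 * k) tau * (x i (k + 1) - x i (k - 1)))"
 shows "abs (cen i tau e) <= 1/2"
proof (cases "e < 2")
 case True
 thus ?thesis using f[OF True] x(1)[OF i] convex_close[OF ramp_bounds, of "x i (k - 1)" 0 "1/2" "x i (k + 1)"] by auto
next
 case False
 thus ?thesis using pr[OF i e] r0[OF i] by (simp add: cen_def)
qed

lemma siz_pos: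
 assumes i: "i : I"
 shows "0 < siz i tau"
proof -
 have "siz i tau = (1 - ramp (2 * K i) tau) * q i + ramp (2 * K i) tau * r i" by (simp add: siz_def algebra_simps)
 moreover have "0 < (1 - ramp (2 * K i) tau) * q i + ramp (2 * K i) tau * r i"
 proof (cases "ramp (2 * K i) tau = 0")
  case False
  hence "0 < ramp (2 * K i) tau * r i" using ramp_bounds(1)[of "2 * K i" tau] r0[OF i] by simp
  moreover have "0 <= (1 - ramp (2 * K i) tau) * q i" using ramp_bounds(2)[of "2 * K i" tau] q(1)[OF i] by simp
  ultimately show ?thesis by linarith
 qed (use q(1)[OF i] in simp)
 ultimately show ?thesis by simp
qed

lemma mx_UU:
 assumes i: "i : I"
 shows "mx n (UU i tau s) < 1 \<longleftrightarrow> (ALL e<n. abs (s e - Cen i tau e) < siz i tau)"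
proof -
 have *: "abs (max (-1) (min 1 y)) < 1 \<longleftrightarrow> abs y < 1" for y :: real by (auto simp: max_def min_def abs_if)
 have "mx n (UU i tau s) < 1 \<longleftrightarrow> ~ (EX e<n. 1 <= abs (UU i tau s e))" using mx_ge[of 1 n "UU i tau s"] by auto
 also have "... \<longleftrightarrow> (ALL e<n. abs ((s e - Cen i tau e) / siz i tau) < 1)" using * by (auto simp: UU_def not_le)
 also have "... \<longleftrightarrow> (ALL e<n. abs (s e - Cen i tau e) < siz i tau)" using siz_pos[OF i, of tau] by (simp add: abs_divide)
 finally show ?thesis .
qed

lemma UU_cube: "UU i tau s : cube n"
 by (auto simp: cube_def UU_def)

text \<open>With \<open>?h\<close> the progress of settling, the centre is off by at most
  \<open>(1 - ?h) * r i / 2\<close>, and the radius is at most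
  \<open>(1 - ?h) * r i / 2 + ?h * r i\<close>. Together this is \<open>r i\<close>.\<close>

lemma late_tube:
 assumes i: "i : I" and t: "tau <= 0 | 2 * real (K i) + 1 <= 1 / tau" and U: "mx n (UU i tau s) < 1" and e: "e < n"
 shows "abs (s e - p i e) < r i"
proof -
 let ?h = "ramp (2 * K i) tau"
 have K3: "3 <= K i" using Ki[OF i] by linarith
 have c: "abs (cen i tau e - p i e) <= r i / 4"
 proof (cases "e < 2")
  case True
  have "abs (cen i tau e - p i e) <= 1 / N (K i - 1)"
   by (rule cen_form_close[OF i True _ cen_late[OF i True t]]) (use K3 in simp)
  also have "... <= r i / 4" using Kr[OF i, of "K i - 1"] K3 by simp
  finally show ?thesis .
 next
  case False
  thus ?thesis using r0[OF i] by (simp add: cen_def)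
 qed
 have "Cen i tau e - p i e = (1 - ?h) * (cen i tau e - p i e)" by (simp add: Cen_def algebra_simps)
 hence "abs (Cen i tau e - p i e) = (1 - ?h) * abs (cen i tau e - p i e)" using ramp_bounds(2)[of "2 * K i" tau] by (simp add: abs_mult)
 also have "... <= (1 - ?h) * (r i / 2)" using c r0[OF i] ramp_bounds(2)[of "2 * K i" tau] by (intro mult_left_mono) auto
 finally have 1: "abs (Cen i tau e - p i e) <= (1 - ?h) * (r i / 2)" .
 have "siz i tau = (1 - ?h) * q i + ?h * r i" by (simp add: siz_def algebra_simps)
 also have "... <= (1 - ?h) * (r i / 2) + ?h * r i" using q(3)[OF i] ramp_bounds[of "2 * K i" tau] by (intro add_mono mult_left_mono) auto
 finally have "siz i tau <= (1 - ?h) * (r i / 2) + ?h * r i" .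
 moreover have "(1 - ?h) * (r i / 2) + (1 - ?h) * (r i / 2) + ?h * r i = r i" by (simp add: algebra_simps)
 moreover have "abs (s e - Cen i tau e) < siz i tau" using U mx_UU[OF i] e by blast
 ultimately show ?thesis using 1 by linarith
qed

lemma wave_bounds: "0 <= wave k s" "wave k s <= 1"
 unfolding wave_def by (rule tri_bounds)+

lemma level_exists:
 assumes "0 < tau" "tau <= 1" obtains k :: nat where "2 * real k + 1 <= 1 / tau" "1 / tau < 2 * real k + 3"
proof -
 have "1 <= 1 / tau" using assms by simp
 hence "real (nat \<lfloor>(1 / tau - 1) / 2\<rfloor>) = of_int \<lfloor>(1 / tau - 1) / 2\<rfloor>" by simp
 moreover have "of_int \<lfloor>(1 / tau - 1) / 2\<rfloor> <= (1 / tau - 1) / 2" "(1 / tau - 1) / 2 < of_int \<lfloor>(1 / tau - 1) / 2\<rfloor> + 1"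
  by (rule of_int_floor_le, rule real_of_int_floor_add_one_gt)
 ultimately have "2 * real (nat \<lfloor>(1 / tau - 1) / 2\<rfloor>) + 1 <= 1 / tau" "1 / tau < 2 * real (nat \<lfloor>(1 / tau - 1) / 2\<rfloor>) + 3"
  by argo+
 thus ?thesis by (rule that)
qed

lemma cc_bounds: assumes "0 <= tau" "tau <= 1" shows "cc tau s : {0..1}"
proof (cases "tau = 0")
 case True
 thus ?thesis using wave_bounds[of 0 s] by (simp add: cc_def csum_def)
next
 case False
 hence t: "0 < tau" using assms by simp
 obtain k :: nat where k: "2 * real k + 1 <= 1 / tau" "1 / tau < 2 * real k + 3" using level_exists[OF t assms(2)] .
 have "abs (wave k s - 1/2) <= 1/2" "abs (wave (Suc k) s - 1/2) <= 1/2" using wave_bounds[of k s] wave_bounds[of "Suc k" s] by argo+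
 from convex_close[OF ramp_bounds this, of "2 * k + 1" tau] show ?thesis unfolding cc_step[OF t k] atLeastAtMost_iff by argo
qed

lemma ksum_bounds: "0 <= ksum m tau s" "ksum m tau s <= 1"
proof -
 show "0 <= ksum m tau s" by (simp add: ksum_def)
 have "0 <= (\<Sum>i<m. if i : I then bum i s * ramp (2 * K i - 1) tau else 0)"
  by (intro sum_nonneg) (auto simp: bum_def ramp_bounds)
 thus "ksum m tau s <= 1" by (simp add: ksum_def)
qed

lemma zz_bounds: assumes "0 <= tau" shows "0 <= zz tau s" "zz tau s <= 5 * M * tau"
proof -
 have c: "0 <= chi s" "chi s <= 1" by (auto simp: chi_def)
 have m: "0 <= 5 * M * tau" using assms M(1) by simp
 show "0 <= zz tau s" unfolding zz_def by (rule mult_nonneg_nonneg[OF mult_nonneg_nonneg[OF m ksum_bounds(1)] c(1)])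
 have "5 * M * tau * ksum (nat \<lceil>1 / tau\<rceil>) tau s <= 5 * M * tau" using m ksum_bounds by (intro mult_left_le)
 moreover have "zz tau s <= 5 * M * tau * ksum (nat \<lceil>1 / tau\<rceil>) tau s"
  unfolding zz_def by (rule mult_left_le[OF c(2) mult_nonneg_nonneg[OF m ksum_bounds(1)]])
 ultimately show "zz tau s <= 5 * M * tau" by linarith
qed

lemma GG_D: "0 <= tau ==> tau <= 1 ==> s : cube n ==> GG tau s : D"
 unfolding GG_def by (intro sigD FD thtD cc_bounds zz_bounds(1))

lemma bum_one: assumes i: "i : I" and s: "!!e. e < n ==> abs (s e - p i e) <= r i" shows "bum i s = 1"
proof -
 have "mx n (%e. (s e - p i e) / r i) <= 1" by (subst mx_le) (use s r0[OF i] in "auto simp: abs_divide")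
 thus ?thesis by (simp add: bum_def)
qed

lemma bum_zero: assumes i: "i : I" and s: "e < n" "3/2 * r i <= abs (s e - p i e)" shows "bum i s = 0"
proof -
 have "3/2 <= mx n (%e. (s e - p i e) / r i)" by (subst mx_ge) (use s r0[OF i] in "auto simp: abs_divide field_simps")
 thus ?thesis by (simp add: bum_def)
qed

text \<open>The tube lies in the original disc, where \<open>F\<close> equals \<open>tt i\<close>,
  and the bump of disc \<open>i\<close> has stopped the flow.\<close>

lemma late_G:
 assumes i: "i : I" and tau: "0 <= tau" "tau <= 1" and t: "tau <= 0 | 2 * real (K i) + 1 <= 1 / tau"
  and U: "mx n (UU i tau s) < 1" and s: "s : cube n"
 shows "GG tau s = tt i"
proof -
 have sr: "abs (s e - p i e) <= r i" if "e < n" for e using late_tube[OF i t U that] by simp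
 have F: "F s = tt i" by (rule pF[OF i s sr])
 have "zz tau s = 0"
 proof (cases "tau = 0")
  case True
  thus ?thesis by (simp add: zz_def)
 next
  case False
  hence t': "2 * real (K i) + 1 <= 1 / tau" using t tau by simp
  let ?m = "nat \<lceil>1 / tau\<rceil>" and ?g = "%i. if i : I then bum i s * ramp (2 * K i - 1) tau else 0"
  have "real i + 3 <= real (K i)" using Ki[OF i] by (metis of_nat_le_iff of_nat_add of_nat_numeral)
  hence "real i < 1 / tau" using t' by linarith
  hence im: "i < ?m" by (simp add: zless_nat_eq_int_zless less_ceiling_iff)
  have "ramp (2 * K i - 1) tau = 1" using t' Ki[OF i] by (intro ramp_late) (simp add: of_nat_diff)
  hence "?g i = 1" using i bum_one[OF i sr] by simp
  moreover have "?g i <= (\<Sum>i<?m. ?g i)" using im by (intro member_le_sum) (auto simp: bum_def ramp_bounds)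
  ultimately have "ksum ?m tau s = 0" by (simp add: ksum_def)
  thus ?thesis by (simp add: zz_def)
 qed
 thus ?thesis unfolding GG_def using sig0[OF FD[OF s] thtD[OF cc_bounds[OF tau]]] F by simp
qed

context
 fixes i :: nat and tau :: real and s :: "nat => real" and k :: nat
 assumes i: "i : I" and tau: "0 < tau" "tau <= 1" and t: "1 / tau < 2 * real (K i) + 1"
  and U: "mx n (UU i tau s) < 1" and s: "s : cube n"
  and k: "2 * real k + 1 <= 1 / tau" "1 / tau < 2 * real k + 3"
begin

lemma early_k: "k < K i"
 using k(1) t by simp

lemma early_near: assumes "e < n" shows "abs (s e - cen i tau e) < q i"
proof -
 have "ramp (2 * K i) tau = 0" using t tau by (intro ramp_early) simp_all
 thus ?thesis using U assms unfolding mx_UU[OF i] by (simp add: Cen_def siz_def)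
qed

lemma early_inner:
 assumes e: "e < n"
 shows "abs (s e) <= 5/8"
proof -
 have "abs (cen i tau e) <= 1/2"
  by (rule cen_inner[OF i e]) (use cen_early[OF i _ tau(1) k] early_k in auto)
 thus ?thesis using early_near[OF e] q(2)[OF i] by linarith
qed

lemma N_pos: "0 < real (N j)"
 using Nk[of j] by simp

lemma early_wave_val:
 assumes j: "j <= K i" and c: "cen i tau (j mod 2) = x i j"
 shows "abs (wave j s - v i) <= w i"
proof -
 have "j mod 2 < n" using n by (simp add: less_le_trans)
 from early_near[OF this] have "abs (s (j mod 2) - x i j) <= q i" using c by simp
 hence "real (N j) * abs (s (j mod 2) - x i j) <= real (N (K i)) * q i"
  using Nm[OF j] by (intro mult_mono) auto
 also have "... <= w i" using q(4)[OF i] N_pos[of "K i"] by (simp add: field_simps)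
 finally have "real (N j) * abs (s (j mod 2) - x i j) <= w i" .
 moreover have "abs (wave j s - v i) <= real (N j) * abs (s (j mod 2) - x i j)"
  using tri_lip[of "N j * (s (j mod 2) + 1/2)" "N j * (x i j + 1/2)"] x(3)[OF i, of j]
  by (simp add: wave_def abs_mult flip: right_diff_distrib)
 ultimately show ?thesis by linarith
qed

text \<open>Once the blend of wave \<open>k\<close> with wave \<open>k + 1\<close> has begun, the
  slide in the other coordinate is complete, so both waves are within \<open>w i\<close> of
  \<open>v i\<close>, and so is every convex combination.\<close>

lemma early_cc: "abs (cc tau s - v i) <= w i"
proof -
 have 1: "abs (wave k s - v i) <= w i"
  by (rule early_wave_val) (use early_k cen_early[OF i _ tau(1) k, of "k mod 2"] in auto)
 show ?thesis
 proof (cases "ramp (2 * k + 1) tau = 0")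
  case True
  thus ?thesis using 1 cc_step[OF tau(1) k, of s] by simp
 next
  case False
  hence "2 * real k + 2 <= 1 / tau" using ramp_early[of tau "2 * k + 1"] tau(1) by fastforce
  hence "ramp (2 * k) tau = 1" by (intro ramp_late) simp
  moreover have "k mod 2 ~= Suc k mod 2" by presburger
  ultimately have "cen i tau (Suc k mod 2) = x i (Suc k)"
   using cen_early[OF i _ tau(1) k, of "Suc k mod 2"] early_k by auto
  hence "abs (wave (Suc k) s - v i) <= w i" using early_k by (intro early_wave_val) auto
  from convex_close[OF ramp_bounds 1 this] show ?thesis unfolding cc_step[OF tau(1) k] .
 qed
qed

lemma early_drift:
 assumes "0 < k" "e < n" shows "abs (s e - p i e) <= 2 / N (k - 1)" "abs (s e - p i e) <= 1 / N (k - 1) + q i"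
proof -
 have "abs (cen i tau e - p i e) <= 1 / N (k - 1)"
 proof (cases "e < 2")
  case True
  show ?thesis by (rule cen_form_close[OF i True assms(1) cen_early[OF i True tau(1) k]]) (use early_k in simp)
 next
  case False
  thus ?thesis using N_pos by (simp add: cen_def)
 qed
 thus 2: "abs (s e - p i e) <= 1 / N (k - 1) + q i" using early_near[OF assms(2)] by linarith
 have "q i <= 1 / N (K i)" by (rule q(5)[OF i])
 also have "... <= 1 / N (k - 1)" using N_pos Nm[of "k - 1" "K i"] early_k by (intro divide_left_mono) auto
 finally show "abs (s e - p i e) <= 2 / N (k - 1)" using 2 by linarith
qed

text \<open>By the time disc \<open>i'\<close> has been put in its place, the other discs hardly move any more.\<close>

lemma early_avoid:
 assumes i': "i' : I" and ne: "2 * real (K i') < 1 / tau"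
 shows "i' = i ==> F s = tt i" "i' ~= i ==> EX e<n. 3/2 * r i' <= abs (s e - p i' e)"
proof -
 have k': "K i' <= (k - 1) + 2" using ne k by linarith
 have "3 <= K i'" using Ki[OF i'] by linarith
 hence k0: "0 < k" using k' by simp
 have N4: "1 / N (k - 1) <= r i' / 4" by (rule Kr[OF i' k'])
 have d: "abs (s e - p i e) <= r i' / 2" if "e < n" for e using early_drift(1)[OF k0 that] N4 by simp
 show "F s = tt i" if "i' = i" by (rule pF[OF i s]) (use d r0[OF i] that in "fastforce")
 assume "i' ~= i"
 then obtain e where e: "e < n" "2 * r i + 2 * r i' <= abs (p i e - p i' e)" using sep[OF i i'] by blast
 hence "3/2 * r i' <= abs (s e - p i' e)" using d[OF e(1)] r0[OF i] by linarith
 thus "EX e<n. 3/2 * r i' <= abs (s e - p i' e)" using e by blast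
qed

text \<open>The level is within \<open>w i\<close> of \<open>v i\<close>, so the target of the flow
  is \<open>tt i\<close>. Unless \<open>F s\<close> is already \<open>tt i\<close>, no settling disc
  slows the flow by \<open>early_avoid\<close>; its length \<open>5 * M * tau\<close> then suffices,
  because \<open>s\<close> is so close to \<open>p i\<close> that the arc from \<open>F s\<close> to
  \<open>tt i\<close> has size at most \<open>M / k\<close>.\<close>

lemma early_G: "GG tau s = tt i"
proof -
 have th: "tht (cc tau s) = tt i" by (rule vtht[OF i cc_bounds early_cc]) (use tau in auto)
 have tD: "tt i : D" using thtD[OF cc_bounds, of tau s] tau th by simp
 have Fp: "F (p i) = tt i" by (rule pF[OF i pc[OF i]]) (use r0[OF i] in simp)
 have "l (F s) (tt i) <= zz tau s"
 proof (cases "F s = tt i")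
  case True
  thus ?thesis using zz_bounds(1)[of tau s] tau l0[OF tD] by simp
 next
  case False
  let ?m = "nat \<lceil>1 / tau\<rceil>" and ?g = "%i. if i : I then bum i s * ramp (2 * K i - 1) tau else 0"
  have "?g i' = 0" for i'
  proof (cases "i' : I & 2 * real (K i') < 1 / tau")
   case True
   then obtain e where "e < n" "3/2 * r i' <= abs (s e - p i' e)" using early_avoid False by blast
   thus ?thesis using bum_zero True by simp
  next
   case False
   show ?thesis
   proof (cases "i' : I")
    case True
    hence "ramp (2 * K i' - 1) tau = 0" using False Ki[OF True] tau by (intro ramp_early) (simp_all add: of_nat_diff)
    thus ?thesis by simp
   qed simp
  qed
  hence "ksum ?m tau s = 1" by (simp add: ksum_def)
  moreover have "mx n s <= 3/4" by (subst mx_le) (use early_inner in force)+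
  hence "chi s = 1" by (simp add: chi_def)
  ultimately have z: "zz tau s = 5 * M * tau" by (simp add: zz_def)
  show ?thesis
  proof (cases "k = 0")
   case True
   hence "1 <= 5 * tau" using k tau by (simp add: field_simps)
   hence "M <= M * (5 * tau)" using M(1) by (simp add: mult_le_cancel_left1)
   thus ?thesis using M(2)[OF FD[OF s] tD] z by (simp add: mult.assoc mult.left_commute)
  next
   case False
   have "l (F s) (F (p i)) <= M / (real (k - 1) + 1)" by (rule NF[OF s pc[OF i]]) (use early_drift(1) False in auto)
   also have "... = M / real k" using False by (simp add: of_nat_diff)
   also have "... <= 5 * M * tau"
   proof -
    have "1 / tau <= 5 * real k" using k(2) False by simp
    hence "1 <= 5 * real k * tau" using tau(1) by (simp add: field_simps)
    hence "M <= M * (5 * real k * tau)" using M(1) by (simp add: mult_le_cancel_left1)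
    thus ?thesis using False by (simp add: field_simps)
   qed
   finally show ?thesis using z Fp by simp
  qed
 qed
 thus ?thesis unfolding GG_def th by (intro sige FD s tD)
qed

end

lemma tube_G:
 assumes i: "i : I" and tau: "0 <= tau" "tau <= 1" and U: "mx n (UU i tau s) < 1" and s: "s : cube n"
 shows "GG tau s = tt i"
proof (cases "tau <= 0 | 2 * real (K i) + 1 <= 1 / tau")
 case True
 thus ?thesis using late_G[OF i tau _ U s] by blast
next
 case False
 hence t: "0 < tau" "1 / tau < 2 * real (K i) + 1" by auto
 obtain k :: nat where k: "2 * real k + 1 <= 1 / tau" "1 / tau < 2 * real k + 3" using level_exists[OF t(1) tau(2)] .
 show ?thesis by (rule early_G[OF i t(1) tau(2) t(2) U s k])
qed

lemma tube_inner:
 assumes i: "i : I" and tau: "0 <= tau" "tau <= 1" and U: "mx n (UU i tau s) < 1" and s: "s : cube n"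
 shows "mx n s <= 5/8"
proof (cases "tau <= 0 | 2 * real (K i) + 1 <= 1 / tau")
 case True
 have "abs (s e) <= 5/8" if "e < n" for e using late_tube[OF i True U that] pr[OF i that] by linarith
 thus ?thesis by (subst mx_le) auto
next
 case False
 hence t: "0 < tau" "1 / tau < 2 * real (K i) + 1" by auto
 obtain k :: nat where k: "2 * real k + 1 <= 1 / tau" "1 / tau < 2 * real k + 3" using level_exists[OF t(1) tau(2)] .
 show ?thesis by (subst mx_le) (use early_inner[OF i t(1) tau(2) t(2) U s k] in auto)
qed

lemma tube_disjoint_aux:
 assumes i: "i : I" "i' : I" "i ~= i'" and tau: "0 < tau" "tau <= 1" and s: "s : cube n"
  and U: "mx n (UU i tau s) < 1" "mx n (UU i' tau s) < 1"
  and t: "1 / tau < 2 * real (K i) + 1" "2 * real (K i') + 1 <= 1 / tau"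
 shows False
proof -
 obtain k :: nat where k: "2 * real k + 1 <= 1 / tau" "1 / tau < 2 * real k + 3" using level_exists[OF tau] .
 obtain e where e: "e < n" "3/2 * r i' <= abs (s e - p i' e)"
  using early_avoid(2)[OF i(1) tau t(1) U(1) s k i(2)] i(3) t(2) by fastforce
 have "abs (s e - p i' e) < r i'" by (rule late_tube[OF i(2) _ U(2) e(1)]) (use t(2) in simp)
 thus False using e(2) r0[OF i(2)] by linarith
qed

text \<open>Tubes in motion have disjoint ranges of levels, settling tubes lie in disjoint discs,
  and a moving tube stays away from a settling one by \<open>early_avoid\<close>.\<close>

lemma tube_disjoint:
 assumes i: "i : I" "i' : I" "i ~= i'" and tau: "0 <= tau" "tau <= 1" and s: "s : cube n"
  and U: "mx n (UU i tau s) < 1" "mx n (UU i' tau s) < 1"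
 shows False
proof -
 let ?L = "%i. tau <= 0 | 2 * real (K i) + 1 <= 1 / tau"
 consider "?L i" "?L i'" | "~ ?L i" "~ ?L i'" | "~ ?L i" "?L i'" | "?L i" "~ ?L i'" by blast
 thus False
 proof cases
  case 1
  obtain e where e: "e < n" "2 * r i + 2 * r i' <= abs (p i e - p i' e)" using sep[OF i] by blast
  have "abs (s e - p i e) < r i" "abs (s e - p i' e) < r i'" using late_tube[OF i(1) 1(1) U(1) e(1)] late_tube[OF i(2) 1(2) U(2) e(1)] .
  thus False using e(2) r0[OF i(1)] r0[OF i(2)] by linarith
 next
  case 2
  hence t: "0 < tau" "1 / tau < 2 * real (K i) + 1" "1 / tau < 2 * real (K i') + 1" by auto
  obtain k :: nat where k: "2 * real k + 1 <= 1 / tau" "1 / tau < 2 * real k + 3" using level_exists[OF t(1) tau(2)] .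
  have "abs (cc tau s - v i) <= w i" "abs (cc tau s - v i') <= w i'"
   using early_cc[OF i(1) t(1) tau(2) t(2) U(1) s k] early_cc[OF i(2) t(1) tau(2) t(3) U(2) s k] .
  thus False using vsep[OF i] by linarith
 next
  case 3
  thus False using tube_disjoint_aux[OF i _ tau(2) s U] by auto
 next
  case 4
  thus False using tube_disjoint_aux[OF i(2,1) i(3)[symmetric] _ tau(2) s U(2,1)] by auto
 qed
qed

lemma continuous_UU:
 assumes i: "i : I" shows "continuous_on S (%z. UU i (fst z) (snd z))"
proof -
 have cen: "continuous_on S (%z. cen i (fst z) e)" for e and S :: "(real \<times> (nat => real)) set"
 proof (cases "e < 2")
  case True
  have "continuous_on S (%z. if k mod 2 = e then ramp (2 * k + 2) (fst z) * (x i (k + 2) - x i k) else 0)" for k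
   by (cases "k mod 2 = e") (auto intro!: continuous_intros continuous_ramp)
  thus ?thesis unfolding cen_def using True by (simp add: continuous_on_sum continuous_on_add)
 qed (simp add: cen_def)
 have sz: "siz i t ~= 0" for t using siz_pos[OF i, of t] by simp
 have "continuous_on S (%z. UU i (fst z) (snd z) e)" for e
 proof (cases "e < n")
  case True
  thus ?thesis unfolding UU_def Cen_def using sz unfolding siz_def
   by (simp, intro continuous_intros continuous_ramp cen) auto
 qed (simp add: UU_def)
 thus ?thesis by (rule continuous_on_coords)
qed

lemma continuous_wave: "continuous_on S (%z. wave k (snd z))" for S :: "(real \<times> (nat => real)) set"
 unfolding wave_def by (intro continuous_tri continuous_intros)

lemma continuous_chi: "continuous_on S (%z. chi (snd z))" for S :: "(real \<times> (nat => real)) set"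
 unfolding chi_def by (intro continuous_intros continuous_mx)

lemma continuous_bum: "i : I ==> continuous_on S (%z. bum i (snd z))" for S :: "(real \<times> (nat => real)) set"
 unfolding bum_def using r0[of i] by (intro continuous_intros continuous_mx) auto

lemma continuous_GG_pos:
 assumes "0 < c" shows "continuous_on ({c..1} \<times> cube n) (%z. GG (fst z) (snd z))"
proof -
 let ?S = "{c..1} \<times> cube n" and ?m = "nat \<lceil>1 / c\<rceil>"
 have m: "nat \<lceil>1 / tau\<rceil> <= ?m" if "c <= tau" for tau
 proof -
  have "1 / tau <= 1 / c" using assms that by (simp add: frac_le)
  thus ?thesis by (intro nat_mono ceiling_mono)
 qed
 have c1: "continuous_on ?S (%z. csum ?m (fst z) (snd z))"
  unfolding csum_def by (intro continuous_intros continuous_wave continuous_ramp)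
 have "continuous_on ?S (%z. if i : I then bum i (snd z) * ramp (2 * K i - 1) (fst z) else 0)" for i
  by (cases "i : I") (auto intro!: continuous_intros continuous_bum continuous_ramp)
 hence c2: "continuous_on ?S (%z. 5 * M * fst z * ksum ?m (fst z) (snd z) * chi (snd z))"
  unfolding ksum_def by (intro continuous_intros continuous_chi)
 have c3: "continuous_on ?S (%z. F (snd z))"
  by (rule continuous_on_compose2[OF Fc continuous_on_snd[OF continuous_on_id]]) auto
 have e: "csum ?m (fst z) (snd z) = cc (fst z) (snd z)" "5 * M * fst z * ksum ?m (fst z) (snd z) * chi (snd z) = zz (fst z) (snd z)"
  if "z : ?S" for z
 proof -
  have "0 < fst z" "c <= fst z" using that assms by auto
  thus "csum ?m (fst z) (snd z) = cc (fst z) (snd z)" "5 * M * fst z * ksum ?m (fst z) (snd z) * chi (snd z) = zz (fst z) (snd z)"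
   using csum_extend[OF _ m] ksum_extend[OF _ m] by (simp_all add: zz_def)
 qed
 have c1': "continuous_on ?S (%z. cc (fst z) (snd z))" by (rule continuous_on_eq[OF c1 e(1)])
 have c2': "continuous_on ?S (%z. zz (fst z) (snd z))" by (rule continuous_on_eq[OF c2 e(2)])
 have ccb: "cc (fst z) (snd z) : {0..1}" and zb: "0 <= zz (fst z) (snd z)" if "z : ?S" for z
  using cc_bounds[of "fst z" "snd z"] zz_bounds(1)[of "fst z"] that assms by auto
 have c4: "continuous_on ?S (%z. tht (cc (fst z) (snd z)))"
  by (rule continuous_on_compose2[OF thtc c1']) (use ccb in auto)
 have "continuous_on ?S (%z. (%(u, w, z). sig u w z) (F (snd z), tht (cc (fst z) (snd z)), zz (fst z) (snd z)))"
  by (rule continuous_on_compose2[OF sigc]) (use c3 c4 c2' FD thtD ccb zb in "auto intro!: continuous_intros")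
 thus ?thesis by (simp add: GG_def)
qed

lemma GG_zero: "s : cube n ==> GG 0 s = F s"
 unfolding GG_def using sig0[OF FD thtD[OF cc_bounds[of 0]]] by (simp add: zz_def)

text \<open>The flow is uniformly continuous for bounded lengths, and its length is at most
  \<open>5 * M * tau\<close>, uniformly in \<open>s\<close>.\<close>

lemma GG_near:
 assumes "0 < e" obtains d where "0 < d" "!!tau s. 0 <= tau ==> tau <= 1 ==> tau < d ==> s : cube n ==> dist (GG tau s) (F s) < e"
proof -
 let ?C = "D \<times> D \<times> {0..5 * M}"
 have "uniformly_continuous_on ?C (%(u, w, z). sig u w z)"
  by (intro compact_uniformly_continuous continuous_on_subset[OF sigc] compact_Times compD) auto
 then obtain d where d: "0 < d" "!!a b. a : ?C ==> b : ?C ==> dist b a < d ==>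
   dist ((%(u, w, z). sig u w z) b) ((%(u, w, z). sig u w z) a) < e"
  unfolding uniformly_continuous_on_def using assms by metis
 show ?thesis
 proof (rule that[of "d / (5 * M)"])
  show "0 < d / (5 * M)" using d(1) M(1) by simp
  fix tau s assume t: "0 <= tau" "tau <= 1" "tau < d / (5 * M)" and s: "s : cube n"
  note z = zz_bounds[OF t(1), of s]
  have "5 * M * tau <= 5 * M * 1" using M(1) t(2) by (intro mult_left_mono) auto
  hence z5: "zz tau s <= 5 * M" using z(2) by simp
  have "5 * M * tau < d" using t(3) M(1) by (simp add: field_simps)
  hence "dist (F s, tht (cc tau s), zz tau s) (F s, tht (cc tau s), 0) < d" using z by (simp add: dist_Pair_Pair)
  from d(2)[OF _ _ this] have "dist (GG tau s) (sig (F s) (tht (cc tau s)) 0) < e"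
   using FD[OF s] thtD[OF cc_bounds[OF t(1,2)]] z z5 M(1) by (simp add: GG_def)
  thus "dist (GG tau s) (F s) < e" using sig0[OF FD[OF s] thtD[OF cc_bounds[OF t(1,2)]]] by simp
 qed
qed

lemma continuous_GG: "continuous_on (prism n) (%z. GG (fst z) (snd z))"
 unfolding continuous_on_iff
proof (intro ballI allI impI)
 fix z :: "real \<times> (nat => real)" and e :: real assume z: "z : prism n" and e: "0 < e"
 obtain tau s where zs: "z = (tau, s)" "0 <= tau" "tau <= 1" "s : cube n" using z by auto
 show "EX d>0. ALL x':prism n. dist x' z < d --> dist (GG (fst x') (snd x')) (GG (fst z) (snd z)) < e"
 proof (cases "tau = 0")
  case True
  have e2: "0 < e / 2" using e by simp
  obtain d where d: "0 < d" "!!tau s. 0 <= tau ==> tau <= 1 ==> tau < d ==> s : cube n ==> dist (GG tau s) (F s) < e / 2"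
   using GG_near[OF e2] by blast
  obtain d' where d': "0 < d'" "!!s'. s' : cube n ==> dist s' s < d' ==> dist (F s') (F s) < e / 2"
   using Fc zs(4) e2 unfolding continuous_on_iff by metis
  show ?thesis
  proof (intro exI[of _ "min d d'"] conjI ballI impI)
   fix x' assume x': "x' : prism n" "dist x' z < min d d'"
   have "dist (fst x') tau < d" "dist (snd x') s < d'"
    using x'(2) dist_fst_le[of x' z] dist_snd_le[of x' z] zs by auto
   hence "dist (GG (fst x') (snd x')) (F (snd x')) < e / 2" "dist (F (snd x')) (F s) < e / 2"
    using d(2)[of "fst x'" "snd x'"] d'(2)[of "snd x'"] x'(1) True by (auto simp: dist_real_def)
   hence "dist (GG (fst x') (snd x')) (F s) < e" using dist_triangle_half_l[of "GG (fst x') (snd x')" "F (snd x')" e "F s"] by (simp add: dist_commute)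
   thus "dist (GG (fst x') (snd x')) (GG (fst z) (snd z)) < e" using zs True GG_zero by simp
  qed (use d d' in simp)
 next
  case False
  hence c: "0 < tau / 2" "z : {tau/2..1} \<times> cube n" using zs by auto
  obtain d where d: "0 < d" "!!x'. x' : {tau/2..1} \<times> cube n ==> dist x' z < d ==> dist (GG (fst x') (snd x')) (GG (fst z) (snd z)) < e"
   using continuous_GG_pos[OF c(1)] c(2) e unfolding continuous_on_iff by metis
  show ?thesis
  proof (intro exI[of _ "min d (tau / 2)"] conjI ballI impI)
   fix x' assume x': "x' : prism n" "dist x' z < min d (tau / 2)"
   have "dist (fst x') tau < tau / 2" using x'(2) dist_fst_le[of x' z] zs by auto
   hence "tau / 2 <= fst x'" by (simp add: dist_real_def abs_if split: if_splits)
   thus "dist (GG (fst x') (snd x')) (GG (fst z) (snd z)) < e" using x' by (intro d(2)) auto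
  qed (use d c in simp)
 qed
qed

lemma GG_bdry: assumes "0 <= tau" "tau <= 1" "s : bdry n" shows "GG tau s = t0"
proof -
 have s: "s : cube n" using assms(3) bdry_cube by blast
 have m: "mx n s = 1" using mx_bdry[OF s] assms(3) by simp
 hence "zz tau s = 0" by (simp add: zz_def chi_def)
 thus ?thesis unfolding GG_def using sig0[OF FD[OF s] thtD[OF cc_bounds[OF assms(1,2)]]] Ft0[OF s] m by simp
qed

text \<open>The map \<open>F\<close> disappears from the formula: in the outer shell it is
  \<open>t0\<close>, and inside the cut-off is 1 and the length \<open>5 * M\<close> reaches the
  target from every starting point. Hence two maps with the same path end in the same map.\<close>

lemma GG_one: assumes s: "s : cube n" shows "GG 1 s = sig t0 (tht (tri (s 0 + 1/2))) (5 * M * chi s)"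
proof -
 have "cc 1 s = wave 0 s" using cc_step[of 1 0 s] ramp_early[of 1 1] by simp
 hence c: "cc 1 s = tri (s 0 + 1/2)" by (simp add: wave_def N0)
 have "(\<Sum>i<m. if i : I then bum i s * ramp (2 * K i - 1) 1 else 0) = 0" for m
 proof (intro sum.neutral ballI)
  fix i show "(if i : I then bum i s * ramp (2 * K i - 1) 1 else 0) = 0"
   using ramp_early[of 1 "2 * K i - 1"] by auto
 qed
 hence z: "zz 1 s = 5 * M * chi s" by (simp add: zz_def ksum_def)
 show ?thesis
 proof (cases "1/2 <= mx n s")
  case True
  thus ?thesis using Ft0[OF s] c z by (simp add: GG_def)
 next
  case False
  have th: "tht (tri (s 0 + 1/2)) : D" by (rule thtD) (simp add: tri_bounds)
  have "chi s = 1" using False by (simp add: chi_def)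
  hence "GG 1 s = tht (tri (s 0 + 1/2))" "sig t0 (tht (tri (s 0 + 1/2))) (5 * M * chi s) = tht (tri (s 0 + 1/2))"
   using sige[OF FD[OF s] th, of "5 * M"] sige[OF t0D th, of "5 * M"] M(2)[OF FD[OF s] th] M(2)[OF t0D th] M(1) c z by (auto simp: GG_def)
  thus ?thesis by simp
 qed
qed

lemma UU_zero:
 assumes i: "i : I" shows "UU i 0 s = (%e. if e < n then max (-1) (min 1 ((s e - p i e) / r i)) else 0)"
proof -
 have "ramp (2 * K i) 0 = 1" by (rule ramp_late) simp
 thus ?thesis by (simp add: UU_def Cen_def siz_def fun_eq_iff)
qed

lemma UU_one:
 assumes i: "i : I" and s: "s : cube n" and U: "mx n (UU i 1 s) < 1"
 shows "abs (s 0 + 1/2 - v i) <= w i"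
proof -
 have K: "3 <= K i" using Ki[OF i] by linarith
 have t: "1 / 1 < 2 * real (K i) + 1" "2 * real 0 + 1 <= 1 / (1::real)" "1 / 1 < 2 * real 0 + (3::real)" using K by auto
 have "cen i 1 0 = x i 0" using cen_early[OF i _ _ t(2,3), of 0] by simp
 moreover have "x i 0 + 1/2 = v i"
  using x(3)[OF i, of 0] x(1)[OF i, of 0] tri_id[of "x i 0 + 1/2"] by (auto simp: N0 abs_le_iff)
 moreover have "abs (s 0 - cen i 1 0) < q i" using early_near[OF i _ _ t(1) U s t(2,3), of 0] n by simp
 moreover have "q i <= w i"
 proof -
  have "1 <= real (N (K i))" using Nk[of "K i"] by simp
  hence "w i / N (K i) <= w i" using w[OF i] by (simp add: divide_le_eq mult_le_cancel_left1)
  thus ?thesis using q(4)[OF i] by linarith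
 qed
 ultimately show ?thesis by linarith
qed

end

section \<open>Choice of frequencies, positions and radii\<close>

lemma closeness_modulus:
 fixes L :: "(nat => real) => (nat => real) => real"
 assumes L: "continuous_on (cube n \<times> cube n) (%(s, s'). L s s')" "!!s. s : cube n ==> L s s = 0" and b: "0 < b"
 obtains N0 :: nat where "0 < N0" "!!N s s'. N0 <= N ==> s : cube n ==> s' : cube n ==> (!!e. e < n ==> abs (s e - s' e) <= 2 / real N) ==> L s s' <= b"
proof -
 let ?Q = "cube n \<times> cube n"
 let ?C = "{z : ?Q. b <= (%(s, s'). L s s') z}"
 have "closedin (top_of_set ?Q) {z : ?Q. (%(s, s'). L s s') z : {b..}}"
  using continuous_closedin_preimage[OF L(1), of "{b..}"] by (simp add: vimage_def Int_def)
 hence "compact ?C" using closedin_compact[OF compact_Times[OF compact_cube compact_cube]] by simp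
 then obtain k where k: "!!s s'. (s, s') : ?C ==> 1 / real (Suc k) < mx n (%i. s i - s' i)"
  by (rule cube_gap) (use L(2) b in auto)
 show ?thesis
 proof (rule that[of "2 * Suc k"])
  fix N s s' assume s: "2 * Suc k <= N" "s : cube n" "s' : cube n" "!!e. e < n ==> abs (s e - s' e) <= 2 / real N"
  have "mx n (%i. s i - s' i) <= 2 / real N" by (subst mx_le) (use s(4) in auto)
  also have "... <= 2 / real (2 * Suc k)" using s(1) by (intro divide_left_mono) auto
  also have "... = 1 / real (Suc k)" by (simp add: field_simps)
  finally have "(s, s') ~: ?C" using k[of s s'] by linarith
  thus "L s s' <= b" using s(2,3) by simp
 qed simp
qed

lemma (in wave_base) wave_homotopy:
 fixes I :: "nat set" and p :: "nat => nat => real" and r v w :: "nat => real" and tt :: "nat => 'd"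
 assumes p: "!!i. i : I ==> p i : cube n" "!!i. i : I ==> 0 < r i"
   "!!i e. i : I ==> e < n ==> abs (p i e) + r i <= 1/2"
   "!!i s. i : I ==> s : cube n ==> (!!e. e < n ==> abs (s e - p i e) <= r i) ==> F s = tt i"
   "!!i i'. i : I ==> i' : I ==> i ~= i' ==> EX e<n. 2 * r i + 2 * r i' <= abs (p i e - p i' e)"
  and v: "!!i. i : I ==> 0 <= v i & v i <= 1" "!!i. i : I ==> 0 < w i"
   "!!i c. i : I ==> c : {0..1} ==> abs (c - v i) <= w i ==> tht c = tt i"
   "!!i i'. i : I ==> i' : I ==> i ~= i' ==> w i + w i' < abs (v i - v i')"
 obtains G :: "real => (nat => real) => 'd" and U :: "nat => real => (nat => real) => nat => real" where
  "continuous_on (prism n) (%z. G (fst z) (snd z))" "!!tau s. 0 <= tau ==> tau <= 1 ==> s : cube n ==> G tau s : D"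
  "!!s. s : cube n ==> G 0 s = F s" "!!tau s. 0 <= tau ==> tau <= 1 ==> s : bdry n ==> G tau s = t0"
  "!!s. s : cube n ==> G 1 s = sig t0 (tht (tri (s 0 + 1/2))) (5 * M * max 0 (min 1 (4 * (1 - mx n s))))"
  "!!i S. i : I ==> continuous_on S (%z. U i (fst z) (snd z))" "!!i tau s. U i tau s : cube n"
  "!!i s. i : I ==> U i 0 s = (%e. if e < n then max (-1) (min 1 ((s e - p i e) / r i)) else 0)"
  "!!i tau s. i : I ==> 0 <= tau ==> tau <= 1 ==> s : cube n ==> mx n (U i tau s) < 1 ==> G tau s = tt i & mx n s <= 5/8"
  "!!i i' tau s. i : I ==> i' : I ==> i ~= i' ==> 0 <= tau ==> tau <= 1 ==> s : cube n ==> mx n (U i tau s) < 1 ==> ~ mx n (U i' tau s) < 1"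
  "!!i s. i : I ==> s : cube n ==> mx n (U i 1 s) < 1 ==> abs (s 0 + 1/2 - v i) <= w i"
proof -
 have lF: "continuous_on (cube n \<times> cube n) (%(s, s'). l (F s) (F s'))"
  unfolding case_prod_beta
  by (rule continuous_on_compose2[OF lc, of _ "%z. (F (fst z), F (snd z))", simplified])
   (auto intro!: continuous_on_Pair continuous_on_compose2[OF Fc] continuous_on_fst continuous_on_snd continuous_on_id FD)
 have "EX m::nat. 0 < m & (ALL N s s'. m <= N --> s : cube n --> s' : cube n --> (ALL e<n. abs (s e - s' e) <= 2 / real N) --> l (F s) (F s') <= M / (real k + 1))" for k
  by (rule closeness_modulus[OF lF, of "M / (real k + 1)"]) (use l0 FD M(1) in "simp, simp, blast")
 then obtain m :: "nat => nat" where m: "!!k. 0 < m k" "!!k N s s'. m k <= N ==> s : cube n ==> s' : cube n ==>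
   (ALL e<n. abs (s e - s' e) <= 2 / real N) ==> l (F s) (F s') <= M / (real k + 1)" by metis
 \<comment> \<open>The summand for \<open>j = k - 1\<close> is \<open>m k\<close>, so
   \<open>N k\<close> exceeds the modulus required for \<open>k\<close>. For \<open>k = 0\<close>
   the bound \<open>M\<close> on \<open>l\<close> suffices, and \<open>N 0\<close> can be 1.\<close>
 define N where "N k = 1 + (\<Sum>j<k. m (Suc j))" for k
 have N0: "N 0 = 1" by (simp add: N_def)
 have Nm: "N i <= N j" if "i <= j" for i j unfolding N_def using that by (intro add_left_mono sum_mono2) auto
 have Nk: "k + 1 <= N k" for k
 proof -
  have "(\<Sum>j<k. 1) <= (\<Sum>j<k. m (Suc j))" by (intro sum_mono) (use m(1) in "auto simp: Suc_le_eq")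
  thus ?thesis by (simp add: N_def)
 qed
 have NF: "l (F s) (F s') <= M / (real k + 1)" if s: "s : cube n" "s' : cube n" "!!e. e < n ==> abs (s e - s' e) <= 2 / N k" for k s s'
 proof (cases k)
  case 0
  thus ?thesis using M(2)[OF FD[OF s(1)] FD[OF s(2)]] by simp
 next
  case (Suc j)
  have "m k <= (\<Sum>j<k. m (Suc j))" unfolding Suc by simp
  hence "m k <= N k" by (simp add: N_def)
  from m(2)[OF this s(1,2)] s(3) show ?thesis by (simp add: add.commute)
 qed
 \<comment> \<open>The part \<open>i + 3\<close> ensures that only finitely many discs have started
   to settle at any given \<open>tau > 0\<close>; the rest makes \<open>N k\<close> at least
   \<open>4 / r i\<close> two levels before disc \<open>i\<close> settles.\<close>
 define K where "K i = i + 3 + nat \<lceil>4 / r i\<rceil>" for i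
 have Kr: "1 / N k <= r i / 4" if i: "i : I" and k: "K i <= k + 2" for i k
 proof -
  have "4 / r i <= real (nat \<lceil>4 / r i\<rceil>)" by (rule real_nat_ceiling_ge)
  moreover have "nat \<lceil>4 / r i\<rceil> <= k" "k <= N k" using k[unfolded K_def] Nk[of k] by linarith+
  ultimately have "4 / r i <= real (N k)" by linarith
  moreover have "0 < real (N k)" using Nk[of k] by simp
  ultimately show ?thesis using p(2)[OF i] by (simp add: field_simps)
 qed
 define q where "q i = min (min (1/8) (r i / 2)) (min (w i / N (K i)) (1 / N (K i)))" for i
 have "0 < real (N k)" for k using Nk[of k] by simp
 hence q: "0 < q i" if "i : I" for i using p(2)[OF that] v(2)[OF that] by (simp add: q_def)
 have "EX x. abs x <= 1/2 & abs (x - p i (k mod 2)) <= 1 / N k & tri (N k * (x + 1/2)) = v i" if i: "i : I" for i k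
 proof -
  have "k mod 2 < n" using n by (simp add: less_le_trans)
  hence "abs (p i (k mod 2)) <= 1/2" using p(2)[OF i] p(3)[OF i, of "k mod 2"] by simp
  thus ?thesis using tri_position[of "v i" "N k" "p i (k mod 2)"] v(1)[OF i] Nk[of k] by (metis add_gr_0 less_le_trans zero_less_one)
 qed
 hence "ALL i k. EX x. i : I --> abs x <= 1/2 & abs (x - p i (k mod 2)) <= 1 / N k & tri (N k * (x + 1/2)) = v i" by blast
 then obtain x where x: "!!i k. i : I ==> abs (x i k) <= 1/2 & abs (x i k - p i (k mod 2)) <= 1 / N k & tri (N k * (x i k + 1/2)) = v i"
  by metis
 interpret W: wave_data n D l sig F tht t0 M N I p r tt v w K q x
 proof
  show "i + 3 <= K i" for i by (simp add: K_def)
  show "q i <= 1/8" "q i <= r i / 2" "q i <= w i / N (K i)" "q i <= 1 / N (K i)" for i unfolding q_def by (meson min.cobounded1 min.cobounded2 order_trans)+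
  show "l (F s) (F s') <= M / (real k + 1)" if s: "s : cube n" "s' : cube n" "!!e. e < n ==> abs (s e - s' e) <= 2 / N k" for k s s'
   by (rule NF[OF s])
 qed (fact p v N0 Nm Nk Kr q | use x in blast)+
 show ?thesis
 proof (rule that[of W.GG W.UU])
  show "W.GG 1 s = sig t0 (tht (tri (s 0 + 1/2))) (5 * M * max 0 (min 1 (4 * (1 - mx n s))))" if "s : cube n" for s
   using W.GG_one[OF that] by (simp add: W.chi_def)
  show "W.GG tau s = tt i & mx n s <= 5/8" if "i : I" "0 <= tau" "tau <= 1" "s : cube n" "mx n (W.UU i tau s) < 1" for i tau s
   using W.tube_G[OF that(1-3,5,4)] W.tube_inner[OF that(1-3,5,4)] by blast
  show "~ mx n (W.UU i' tau s) < 1" if "i : I" "i' : I" "i ~= i'" "0 <= tau" "tau <= 1" "s : cube n" "mx n (W.UU i tau s) < 1" for i i' tau s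
   using W.tube_disjoint[OF that] by blast
 qed (fact W.continuous_GG W.GG_D W.GG_zero W.GG_bdry W.continuous_UU W.UU_cube W.UU_zero W.UU_one)+
qed

section \<open>Paths through a dendrite\<close>

lemma tri_shift: "0 <= x ==> x <= 1 ==> tri (2 * of_int k + x) = x"
proof (rule antisym)
 assume x: "0 <= x" "x <= 1"
 show "tri (2 * of_int k + x) <= x" using tri_le[of "2 * of_int k + x" k] x by simp
 show "x <= tri (2 * of_int k + x)"
 proof (rule tri_ge)
  fix j :: int
  show "x <= abs (2 * of_int k + x - 2 * of_int j)"
  proof (cases "j <= k")
   case True
   hence "real_of_int j <= of_int k" by simp
   thus ?thesis using x by linarith
  next
   case False
   hence "real_of_int k + 1 <= of_int j" by linarith
   thus ?thesis using x by linarith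
  qed
 qed
qed

definition sch :: "real => real" where "sch x = max 0 (min 1 (3 * tri x - 1))"

text \<open>Schoenberg's space-filling curve: at the point of the Cantor set with ternary digits \<open>2 * ep j\<close>,
 the function \<open>sch\<close> of \<open>3 ^ m\<close> times the argument reads off \<open>ep m\<close>.\<close>

lemma sch_digit:
 fixes ep :: "nat => real"
 assumes ep: "!!j. ep j = 0 | ep j = 1"
 shows "summable (%j. 2 * ep j / 3 ^ Suc j)" "0 <= (\<Sum>j. 2 * ep j / 3 ^ Suc j)" "(\<Sum>j. 2 * ep j / 3 ^ Suc j) <= 1"
  "sch (3 ^ m * (\<Sum>j. 2 * ep j / 3 ^ Suc j)) = ep m"
proof -
 have g: "(%j. 2 / 3 ^ Suc j) sums (1::real)"
  using sums_mult[OF geometric_sums[of "1/3::real"], of "2/3"] by (simp add: power_one_over field_simps)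
 have main: "summable (%j. 2 * de j / 3 ^ Suc j)" "0 <= (\<Sum>j. 2 * de j / 3 ^ Suc j)" "(\<Sum>j. 2 * de j / 3 ^ Suc j) <= 1"
  if d: "!!j. de j = 0 | de j = 1" for de :: "nat => real"
 proof -
  have b: "0 <= de j" "de j <= 1" for j using d[of j] by auto
  show s: "summable (%j. 2 * de j / 3 ^ Suc j)"
   by (rule summable_comparison_test'[OF sums_summable[OF g], of 0]) (use b in "auto simp: divide_right_mono")
  show "0 <= (\<Sum>j. 2 * de j / 3 ^ Suc j)" using b by (intro suminf_nonneg s) auto
  have "(\<Sum>j. 2 * de j / 3 ^ Suc j) <= (\<Sum>j. 2 / 3 ^ Suc j)"
   by (intro suminf_le s sums_summable[OF g]) (use b in "auto simp: divide_right_mono")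
  thus "(\<Sum>j. 2 * de j / 3 ^ Suc j) <= 1" using sums_unique[OF g] by simp
 qed
 show "summable (%j. 2 * ep j / 3 ^ Suc j)" "0 <= (\<Sum>j. 2 * ep j / 3 ^ Suc j)" "(\<Sum>j. 2 * ep j / 3 ^ Suc j) <= 1"
  using main[of ep] ep by blast+
 let ?R = "%m. \<Sum>j. 2 * ep (j + m) / 3 ^ Suc j"
 have R: "0 <= ?R m" "?R m <= 1" "summable (%j. 2 * ep (j + m) / 3 ^ Suc j)" for m by (rule main, rule ep)+
 have step: "3 * ?R m = 2 * ep m + ?R (Suc m)" for m
 proof -
  have "?R m = 2 * ep m / 3 + (\<Sum>j. 2 * ep (Suc j + m) / 3 ^ Suc (Suc j))"
   using suminf_split_head[OF R(3)[of m]] by simp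
  also have "(\<Sum>j. 2 * ep (Suc j + m) / 3 ^ Suc (Suc j)) = ?R (Suc m) / 3"
   using suminf_divide[OF R(3)[of "Suc m"], of 3] by (simp add: field_simps)
  finally show ?thesis by simp
 qed
 have "EX k::int. 3 ^ m * ?R 0 = 2 * of_int k + ?R m"
 proof (induction m)
  case 0
  show ?case by (rule exI[of _ 0]) simp
 next
  case (Suc m)
  then obtain k :: int where k: "3 ^ m * ?R 0 = 2 * of_int k + ?R m" by blast
  have "3 ^ Suc m * ?R 0 = 3 * (3 ^ m * ?R 0)" by simp
  also have "... = 2 * (3 * of_int k + ep m) + ?R (Suc m)" unfolding k using step[of m] by (simp add: algebra_simps)
  finally have e: "3 ^ Suc m * ?R 0 = 2 * (3 * of_int k + ep m) + ?R (Suc m)" .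
  obtain d :: int where "ep m = of_int d" using ep[of m] by (metis of_int_0 of_int_1)
  thus ?case using e by (intro exI[of _ "3 * k + d"]) simp
 qed
 then obtain k :: int where k: "3 ^ m * ?R 0 = 2 * of_int k + ?R m" by blast
 hence t: "tri (3 ^ m * (\<Sum>j. 2 * ep j / 3 ^ Suc j)) = ?R m" using tri_shift[OF R(1,2)[of m]] by simp
 show "sch (3 ^ m * (\<Sum>j. 2 * ep j / 3 ^ Suc j)) = ep m"
  unfolding sch_def t using step[of m] R(1,2)[of "Suc m"] ep[of m] by auto
qed

lemma binary_digits:
 fixes y :: real assumes "0 <= y" "y <= 1"
 obtains de :: "nat => real" where "!!k. de k = 0 | de k = 1" "(%k. de k / 2 ^ Suc k) sums y"
proof (cases "y = 1")
 case True
 have "(%k. 1 / 2 ^ Suc k) sums y"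
  using sums_mult[OF geometric_sums[of "1/2::real"], of "1/2"] True by (simp add: power_one_over)
 thus ?thesis using that[of "%_. 1"] by simp
next
 case False
 define de where "de k = real_of_int (\<lfloor>2 ^ Suc k * y\<rfloor> - 2 * \<lfloor>2 ^ k * y\<rfloor>)" for k
 have "de k = 0 | de k = 1" for k
 proof -
  have "\<lfloor>2 ^ Suc k * y\<rfloor> - 2 * \<lfloor>2 ^ k * y\<rfloor> = 0 | \<lfloor>2 ^ Suc k * y\<rfloor> - 2 * \<lfloor>2 ^ k * y\<rfloor> = 1"
   unfolding power_Suc mult.assoc by linarith
  thus ?thesis by (auto simp: de_def)
 qed
 moreover have "(%k. de k / 2 ^ Suc k) sums y"
  unfolding sums_def
 proof -
  have p: "(\<Sum>k<m. de k / 2 ^ Suc k) = of_int \<lfloor>2 ^ m * y\<rfloor> / 2 ^ m" for m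
  proof (induction m)
   case 0
   have "\<lfloor>y\<rfloor> = 0" using assms False by linarith
   thus ?case by simp
  next
   case (Suc m)
   have "(\<Sum>k<Suc m. de k / 2 ^ Suc k) = of_int \<lfloor>2 ^ m * y\<rfloor> / 2 ^ m + de m / 2 ^ Suc m" using Suc by simp
   also have "... = of_int \<lfloor>2 ^ Suc m * y\<rfloor> / 2 ^ Suc m" by (simp add: de_def diff_divide_distrib)
   finally show ?case .
  qed
  have "(%m. of_int \<lfloor>2 ^ m * y\<rfloor> / 2 ^ m) \<longlonglongrightarrow> y"
  proof (rule real_tendsto_sandwich)
   have "y - (1/2) ^ m <= of_int \<lfloor>2 ^ m * y\<rfloor> / 2 ^ m" for m
   proof -
    have "2 ^ m * y - 1 <= of_int \<lfloor>2 ^ m * y\<rfloor>" by linarith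
    hence "(2 ^ m * y - 1) / 2 ^ m <= of_int \<lfloor>2 ^ m * y\<rfloor> / 2 ^ m" by (rule divide_right_mono) simp
    thus ?thesis by (simp add: diff_divide_distrib power_one_over)
   qed
   thus "\<forall>\<^sub>F m in sequentially. y - (1/2) ^ m <= of_int \<lfloor>2 ^ m * y\<rfloor> / 2 ^ m" by simp
   show "\<forall>\<^sub>F m in sequentially. of_int \<lfloor>2 ^ m * y\<rfloor> / 2 ^ m <= y" by (simp add: divide_le_eq mult.commute)
   have "(%m. y - (1/2) ^ m) \<longlonglongrightarrow> y - 0" by (intro tendsto_intros LIMSEQ_power_zero) simp
   thus "(%m. y - (1/2) ^ m) \<longlonglongrightarrow> y" by simp
  qed simp
  thus "(%m. \<Sum>k<m. de k / 2 ^ Suc k) \<longlonglongrightarrow> y" by (simp only: p)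
 qed
 ultimately show ?thesis by (rule that)
qed

text \<open>Coordinate \<open>e\<close> is assembled from the ternary digits in the positions
  congruent to \<open>e\<close> modulo \<open>n\<close>, so all coordinates can be prescribed
  independently. At parameter 0 every digit is 0, which gives a corner.\<close>

lemma cube_curve:
 assumes n: "0 < n"
 obtains psi :: "real => nat => real" where "continuous_on {0..1} psi" "psi ` {0..1} = cube n" "psi 0 : bdry n"
proof -
 define cv where "cv e t = (\<Sum>k. sch (3 ^ (n * k + e) * t) / 2 ^ Suc k)" for e t
 define psi where "psi t e = (if e < n then 2 * cv e t - 1 else 0)" for t e
 have g: "(%k. 1 / 2 ^ Suc k) sums (1::real)"
  using sums_mult[OF geometric_sums[of "1/2::real"], of "1/2"] by (simp add: power_one_over)
 have sb: "0 <= sch x" "sch x <= 1" for x by (auto simp: sch_def)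
 have s: "summable (%k. sch (3 ^ (n * k + e) * t) / 2 ^ Suc k)" for e t
  by (rule summable_comparison_test'[OF sums_summable[OF g], of 0]) (use sb in "auto simp: divide_right_mono")
 have cvb: "0 <= cv e t" "cv e t <= 1" for e t
 proof -
  show "0 <= cv e t" unfolding cv_def using sb by (intro suminf_nonneg s) auto
  have "cv e t <= (\<Sum>k. 1 / 2 ^ Suc k)" unfolding cv_def
   by (intro suminf_le s sums_summable[OF g]) (use sb in "auto simp: divide_right_mono")
  thus "cv e t <= 1" using sums_unique[OF g] by simp
 qed
 have cc: "continuous_on {0..1} (cv e)" for e
 proof (rule uniform_limit_theorem)
  show "uniform_limit {0..1} (%m t. \<Sum>k<m. sch (3 ^ (n * k + e) * t) / 2 ^ Suc k) (cv e) sequentially"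
   unfolding cv_def by (rule Weierstrass_m_test[OF _ sums_summable[OF g]]) (use sb in "auto simp: divide_right_mono")
  show "\<forall>\<^sub>F m in sequentially. continuous_on {0..1} (%t. \<Sum>k<m. sch (3 ^ (n * k + e) * t) / 2 ^ Suc k)"
   unfolding sch_def by (intro always_eventually allI continuous_intros continuous_tri) auto
 qed simp
 have 1: "continuous_on {0..1} psi"
  unfolding psi_def
  by (intro continuous_on_coords, rename_tac e, case_tac "e < n") (auto intro!: continuous_intros cc)
 have 2: "psi t : cube n" for t using cvb by (auto simp: psi_def cube_def)
 have 3: "EX t:{0..1}. psi t = s" if s: "s : cube n" for s
 proof -
  have "EX de::nat => real. (ALL k. de k = 0 | de k = 1) & (%k. de k / 2 ^ Suc k) sums ((s e + 1) / 2)" if "e < n" for e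
  proof -
   have "0 <= (s e + 1) / 2" "(s e + 1) / 2 <= 1" using s that by (auto simp: cube_def)
   thus ?thesis using binary_digits by metis
  qed
  hence "ALL e. EX de::nat => real. e < n --> (ALL k. de k = 0 | de k = 1) & (%k. de k / 2 ^ Suc k) sums ((s e + 1) / 2)" by blast
  then obtain de :: "nat => nat => real" where d: "!!e k. e < n ==> de e k = 0 | de e k = 1"
   "!!e. e < n ==> (%k. de e k / 2 ^ Suc k) sums ((s e + 1) / 2)" by metis
  define ep where "ep j = de (j mod n) (j div n)" for j
  have e: "ep j = 0 | ep j = 1" for j using d(1)[of "j mod n"] n by (simp add: ep_def)
  let ?t = "\<Sum>j. 2 * ep j / 3 ^ Suc j"
  have cvt: "cv e ?t = (s e + 1) / 2" if en: "e < n" for e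
  proof -
   have "sch (3 ^ (n * k + e) * ?t) = de e k" for k unfolding sch_digit(4)[OF e] using en by (simp add: ep_def)
   hence "cv e ?t = (\<Sum>k. de e k / 2 ^ Suc k)" by (simp add: cv_def)
   thus ?thesis using sums_unique[OF d(2)[OF en]] by simp
  qed
  have "psi ?t e = s e" if "e < n" for e using that cvt[OF that] unfolding psi_def by simp
  moreover have "psi ?t e = s e" if "~ e < n" for e using that s by (simp add: psi_def cube_def)
  ultimately have "psi ?t e = s e" for e by blast
  hence "psi ?t = s" by (rule ext)
  moreover have "?t : {0..1}" using sch_digit(2,3)[OF e] by simp
  ultimately show ?thesis by blast
 qed
 have "tri 0 = 0" using tri_even[of 0] by simp
 hence "cv e 0 = 0" for e by (simp add: cv_def sch_def)
 hence "psi 0 0 = -1" using n by (simp add: psi_def)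
 hence 4: "psi 0 : bdry n" using 2[of 0] n by (auto simp: bdry_def intro!: exI[of _ 0])
 have "psi ` {0..1} = cube n" using 2 3 by blast
 thus ?thesis using 1 4 by (intro that[of psi])
qed

text \<open>A monotone reparametrization of the path that rests for a while at each of countably many parameters:
 the generalized inverse of a strictly increasing function with jumps there.\<close>

lemma dwelling_path:
 fixes psi :: "real => 'd::topological_space" and u :: "nat => real"
 assumes psi: "continuous_on {0..1} psi" and u: "!!b. u b : {0..1}"
 obtains tht c om where "continuous_on {0..1} tht" "!!y. y : {0..1} ==> tht y : psi ` {0..1}" "!!b. 0 < (om b :: real)"
  "!!b. 0 <= c b - om b & c b + om b <= 1" "!!b y. abs (y - c b) <= om b ==> tht y = psi (u b)"
  "!!b b'. b ~= b' ==> om b + om b' < abs (c b - c b')"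
proof -
 define w :: "nat => real" where "w b = (1/2) ^ Suc b" for b
 have w0: "0 < w b" for b by (simp add: w_def)
 have ws: "w sums 1" using sums_mult[OF geometric_sums[of "1/2::real"], of "1/2"] by (simp add: w_def[abs_def])
 define S where "S B = (\<Sum>b. if b : B then w b else 0)" for B
 have Ss: "summable (%b. if b : B then w b else 0)" for B
  by (rule summable_comparison_test'[OF sums_summable[OF ws], of 0]) (use w0 in "auto simp: less_imp_le")
 have S_mono: "S B <= S B'" if "B <= B'" for B B'
  unfolding S_def by (intro suminf_le Ss) (use that w0 in "auto simp: less_imp_le")
 have S_ins: "S (insert b B) = S B + w b" if "b ~: B" for b B
 proof -
  have "(%b'. if b' : insert b B then w b' else 0) = (%b'. (if b' : B then w b' else 0) + (if b' = b then w b' else 0))"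
   using that by auto
  moreover have sg: "(%b'. if b' = b then w b' else 0) sums w b" by (rule sums_single)
  ultimately show ?thesis unfolding S_def using suminf_add[OF Ss[of B] sums_summable[OF sg]] sums_unique[OF sg] by simp
 qed
 have S1: "S B <= 1" for B using S_mono[of B UNIV] sums_unique[OF ws] by (simp add: S_def)
 have S0: "0 <= S B" for B using S_mono[of "{}" B] by (simp add: S_def)
 \<comment> \<open>Each \<open>u b\<close> contributes a jump of height \<open>w b\<close>; the
   jumps have total height 1, so times run through an interval of length 2.\<close>
 define G where "G z = z + S {b. u b < z}" for z
 have G_mono: "G z + (z' - z) <= G z'" if "z <= z'" for z z'
 proof -
  have "{b. u b < z} <= {b. u b < z'}" using that by auto
  thus ?thesis using S_mono unfolding G_def by fastforce
 qed
 define h where "h y = Sup {z : {0..1}. G z <= y}" for y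
 have G00: "G 0 = 0"
 proof -
  have "{b. u b < 0} = {}" using u by (auto simp: not_less)
  thus ?thesis by (simp add: G_def S_def)
 qed
 have bdd: "bdd_above {z : {0..1}. G z <= y}" for y by (rule bdd_aboveI[of _ 1]) auto
 have ne: "{z : {0..1}. G z <= y} ~= {}" if "0 <= y" for y using G00 that by (auto intro!: exI[of _ 0])
 have h01: "h y : {0..1}" if "0 <= y" for y
  unfolding h_def using cSup_least[OF ne[OF that], of 1] cSup_upper[OF _ bdd, of 0 y] G00 that by auto
 have h_lip: "h y' <= h y + (y' - y)" if y: "0 <= y" "y <= y'" for y y'
  unfolding h_def[of y']
 proof (rule cSup_least)
  show "{z : {0..1}. G z <= y'} ~= {}" using ne y by simp
  fix z assume z: "z : {z : {0..1}. G z <= y'}"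
  show "z <= h y + (y' - y)"
  proof (rule ccontr)
   assume n: "~ ?thesis"
   define z' where "z' = z - (y' - y)"
   have z': "h y < z'" "z' <= z" using n y by (auto simp: z'_def)
   hence "z' : {0..1}" using h01[OF y(1)] z by auto
   moreover have "G z' <= y" using G_mono[OF z'(2)] z by (simp add: z'_def)
   ultimately have "z' <= h y" unfolding h_def by (intro cSup_upper bdd) simp
   thus False using z'(1) by simp
  qed
 qed
 have h_mono: "h y <= h y'" if "0 <= y" "y <= y'" for y y'
  unfolding h_def by (rule cSup_subset_mono[OF ne bdd]) (use that in auto)
 have hc: "continuous_on {0..} h"
  unfolding continuous_on_iff
 proof (intro ballI allI impI)
  fix y e :: real assume y: "y : {0..}" and e: "0 < e"
  show "EX d>0. ALL y':{0..}. dist y' y < d --> dist (h y') (h y) < e"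
  proof (intro exI[of _ e] conjI ballI impI e)
   fix y' assume y': "y' : {0..}" "dist y' y < e"
   show "dist (h y') (h y) < e"
    using h_lip[of y y'] h_lip[of y' y] h_mono[of y y'] h_mono[of y' y] y y' by (cases "y <= y'") (auto simp: dist_real_def)
  qed
 qed
 \<comment> \<open>The time at which the rest belonging to \<open>b\<close> begins. Equal parameters
   are ordered by index, so they receive disjoint intervals.\<close>
 define P where "P b = u b + S {b'. u b' < u b | u b' = u b & b' < b}" for b
 have h_P: "h y = u b" if y: "P b <= y" "y <= P b + w b" for b y
 proof (rule antisym)
  have "G (u b) <= P b" unfolding G_def P_def by (intro add_left_mono S_mono) auto
  thus "u b <= h y" unfolding h_def using u y by (intro cSup_upper bdd) auto
  have y0: "0 <= y" using y(1) S0[of "{b'. u b' < u b | u b' = u b & b' < b}"] u[of b] unfolding P_def by simp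
  show "h y <= u b" unfolding h_def
  proof (rule cSup_least[OF ne[OF y0]])
   fix z assume z: "z : {z : {0..1}. G z <= y}"
   show "z <= u b"
   proof (rule ccontr)
    assume n: "~ z <= u b"
    let ?B = "{b'. u b' < u b | u b' = u b & b' < b}"
    have "insert b ?B <= {b'. u b' < z}" using n by auto
    hence "S ?B + w b <= S {b'. u b' < z}" using S_mono[of "insert b ?B" "{b'. u b' < z}"] S_ins[of b ?B] by simp
    hence "P b + w b < G z" using n by (simp add: P_def G_def)
    thus False using z y by simp
   qed
  qed
 qed
 have P_sep: "P b + w b <= P b'" if "u b < u b' | u b = u b' & b < b'" for b b'
 proof -
  let ?B = "%b. {b'. u b' < u b | u b' = u b & b' < b}"
  have "insert b (?B b) <= ?B b'" using that by auto
  hence "S (?B b) + w b <= S (?B b')" using S_mono[of "insert b (?B b)" "?B b'"] S_ins[of b "?B b"] by simp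
  thus ?thesis using that by (auto simp: P_def)
 qed
 have P01: "0 <= P b" "P b + w b <= 2" for b
 proof -
  let ?B = "{b'. u b' < u b | u b' = u b & b' < b}"
  have "S ?B + w b <= 1" using S_ins[of b ?B] S1[of "insert b ?B"] by simp
  thus "0 <= P b" "P b + w b <= 2" using S0[of ?B] u[of b] by (auto simp: P_def)
 qed
 show ?thesis
 \<comment> \<open>Times are halved to fit into [0,1], and only the middle half of each resting
   interval is kept, which makes the separation strict.\<close>
 proof (rule that[of "%y. psi (h (2 * y))" "%b. w b / 8" "%b. P b / 2 + w b / 4"])
  show "continuous_on {0..1} (%y. psi (h (2 * y)))"
  proof (rule continuous_on_compose2[OF psi])
   show "continuous_on {0..1} (%y. h (2 * y))"
    by (rule continuous_on_compose2[OF hc]) (auto intro!: continuous_intros)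
  qed (use h01 in force)
  show "psi (h (2 * y)) : psi ` {0..1}" if "y : {0..1}" for y using h01[of "2 * y"] that by (intro imageI) simp
  show "0 < w b / 8" for b using w0[of b] by simp
  show "0 <= P b / 2 + w b / 4 - w b / 8 & P b / 2 + w b / 4 + w b / 8 <= 1" for b using P01[of b] w0[of b] by simp
  show "psi (h (2 * y)) = psi (u b)" if "abs (y - (P b / 2 + w b / 4)) <= w b / 8" for b y
  proof -
   have "P b <= 2 * y" "2 * y <= P b + w b" using that w0[of b] by linarith+
   thus ?thesis using h_P[of b "2 * y"] by simp
  qed
  show "w b / 8 + w b' / 8 < abs (P b / 2 + w b / 4 - (P b' / 2 + w b' / 4))" if ne: "b ~= b'" for b b'
  proof -
   consider "u b < u b' | u b = u b' & b < b'" | "u b' < u b | u b' = u b & b' < b" using ne linorder_less_linear[of "u b" "u b'"] linorder_less_linear[of b b'] by (elim disjE) auto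
   thus ?thesis
   proof cases
    case 1
    thus ?thesis using P_sep[OF 1] w0[of b] w0[of b'] by linarith
   next
    case 2
    thus ?thesis using P_sep[OF 2] w0[of b] w0[of b'] by linarith
   qed
  qed
 qed
qed

section \<open>Reassembling a map from its discs\<close>

lemma star_connected:
 fixes C :: "(nat => real) set"
 assumes "s0 : C" "!!s t. s : C ==> t : {0..1} ==> (%e. s0 e + t * (s e - s0 e)) : C"
 shows "connected C"
proof -
 let ?P = "%s. (%t e. s0 e + t * (s e - s0 e)) ` {0..1}"
 have "connected (?P s)" for s
  by (intro connected_continuous_image continuous_on_coords continuous_intros) simp
 moreover have "s0 : ?P s" for s by (rule image_eqI[of _ _ 0]) auto
 moreover have "C = (\<Union>s\<in>C. ?P s)"
 proof
  have "s : ?P s" for s by (rule image_eqI[of _ _ 1]) auto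
  thus "C <= (\<Union>s\<in>C. ?P s)" by blast
  show "(\<Union>s\<in>C. ?P s) <= C" using assms(2) by blast
 qed
 ultimately show ?thesis using connected_Union[of "?P ` C"] by (metis (no_types, lifting) INT_I empty_iff imageE image_eqI)
qed

lemma cube_nbhd:
 assumes W: "openin (top_of_set (cube n)) W" "s : W"
 obtains V where "openin (top_of_set (cube n)) V" "s : V" "V <= W" "connected V"
proof -
 have sc: "s : cube n" using openin_subset[OF W(1)] W(2) by auto
 have "closedin (top_of_set (cube n)) {s}" using sc by (simp add: closed_subset)
 then obtain N :: nat where N: "0 < N" "!!s' s''. s' : {s} ==> s'' : cube n ==> (!!i. i < n ==> abs (s' i - s'' i) <= 1 / N) ==> s'' : W"
  using lebesgue_grid[of n "{s}" W] W by blast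
 let ?V = "{s' : cube n. mx n (%i. s' i - s i) < 1 / N}"
 have N1: "0 < 1 / real N" using N(1) by simp
 have Vi: "mx n (%i. s' i - s i) < 1 / N \<longleftrightarrow> (ALL i<n. abs (s' i - s i) < 1 / N)" for s'
 proof -
  have "mx n (%i. s' i - s i) < 1 / N \<longleftrightarrow> ~ 1 / N <= mx n (%i. s' i - s i)" by (rule linorder_not_le[symmetric])
  also have "... \<longleftrightarrow> (ALL i<n. abs (s' i - s i) < 1 / N)" unfolding mx_ge[OF N1] by (simp add: not_le)
  finally show ?thesis .
 qed
 have "openin (top_of_set (cube n)) (cube n Int (%s'. mx n (%i. s' i - s i)) -` {..<1 / N})"
  by (intro continuous_openin_preimage_gen continuous_mx continuous_intros open_lessThan)
 moreover have "cube n Int (%s'. mx n (%i. s' i - s i)) -` {..<1 / N} = ?V" by auto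
 ultimately have "openin (top_of_set (cube n)) ?V" by simp
 moreover have sV: "s : ?V" using sc N1 Vi by simp
 moreover have "?V <= W" using N(2)[of s] Vi by (auto simp: abs_minus_commute less_imp_le)
 moreover have "connected ?V"
 proof (rule star_connected[OF sV])
  fix s' and t :: real assume s': "s' : ?V" and t: "t : {0..1}"
  have "(%e. s e + t * (s' e - s e)) : cube n"
  proof -
   have "-1 <= s e + t * (s' e - s e) & s e + t * (s' e - s e) <= 1" if "e < n" for e
   proof -
    have "abs (s e - 0) <= 1" "abs (s' e - 0) <= 1" using sc s' that by (auto simp: cube_def abs_le_iff)
    from convex_close[OF _ _ this, of t] t show ?thesis by (simp add: abs_le_iff)
   qed
   thus ?thesis using sc s' by (auto simp: cube_def)
  qed
  moreover have "abs (s e + t * (s' e - s e) - s e) < 1 / N" if "e < n" for e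
  proof -
   have "abs (t * (s' e - s e)) <= abs (s' e - s e)" using t by (simp add: abs_mult mult_left_le_one_le)
   also have "... < 1 / N" using s' that Vi by blast
   finally show ?thesis by simp
  qed
  ultimately show "(%e. s e + t * (s' e - s e)) : ?V" unfolding mem_Collect_eq Vi by blast
 qed
 ultimately show ?thesis by (rule that)
qed

text \<open>Among the points where \<open>h\<close> is off the base point the label \<open>c\<close>
  is locally constant. Sending all points with another label to \<open>a\<close> therefore creates
  no jump.\<close>

lemma continuous_res:
 assumes h: "continuous_map Z A h" and a: "a : topspace A" "t1_space A"
  and loc: "!!z. z : topspace Z ==> h z ~= a ==> EX V. openin Z V & z : V & (ALL z':V. h z' ~= a --> c z' = c z)"
 shows "continuous_map Z A (%z. if c z = ka then h z else a)"
 unfolding continuous_map_def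
proof (intro conjI allI impI)
 show "(%z. if c z = ka then h z else a) : topspace Z \<rightarrow> topspace A"
  using cmap_image[OF h] a by auto
 fix U assume U: "openin A U"
 have oU: "openin Z {z : topspace Z. h z : U}" by (rule openin_continuous_map_preimage[OF h U])
 have oa: "openin Z {z : topspace Z. h z : topspace A - {a}}"
  by (rule openin_continuous_map_preimage[OF h]) (use a in "metis closedin_def closedin_t1_singleton")
 let ?S = "{z : topspace Z. (if c z = ka then h z else a) : U}"
 have "EX T. openin Z T & z : T & T <= ?S" if z: "z : ?S" for z
 proof (cases "h z = a")
  case True
  hence "a : U" using z by (auto split: if_splits)
  thus ?thesis using True z oU by (intro exI[of _ "{z : topspace Z. h z : U}"]) auto
 next
  case False
  then obtain V where V: "openin Z V" "z : V" "ALL z':V. h z' ~= a --> c z' = c z" using loc z by blast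
  have V': "openin Z (V Int {z : topspace Z. h z : topspace A - {a}})" using V oa by blast
  have zt: "h z : topspace A" using cmap_image[OF h] z by blast
  show ?thesis
  proof (cases "c z = ka")
   case True
   have "openin Z (V Int {z : topspace Z. h z : topspace A - {a}} Int {z : topspace Z. h z : U})" using V' oU by blast
   thus ?thesis using V(2,3) z zt False True
    by (intro exI[of _ "V Int {z : topspace Z. h z : topspace A - {a}} Int {z : topspace Z. h z : U}"]) auto
  next
   case c: False
   hence "a : U" using z by auto
   have "V Int {z : topspace Z. h z : topspace A - {a}} <= ?S"
   proof
    fix z' assume z': "z' : V Int {z : topspace Z. h z : topspace A - {a}}"
    hence "c z' = c z" using V(3) by blast
    thus "z' : ?S" using c z' `a : U` by auto
   qed
   moreover have "z : V Int {z : topspace Z. h z : topspace A - {a}}" using V(2) z zt False by blast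
   ultimately show ?thesis using V' by blast
  qed
 qed
 thus "openin Z ?S" by (subst openin_subopen) blast
qed

text \<open>Superposition of maps with disjoint supports: at most one index is active at a point, so
  the choice made by \<open>SOME\<close> is harmless.\<close>

definition bunch :: "'b => 'i set => ('i => 'z => 'b) => 'z => 'b" where
 "bunch a I k z = (if EX i:I. k i z ~= a then k (SOME i. i : I & k i z ~= a) z else a)"

lemma bunch_ne: assumes "bunch a I k z ~= a" obtains i where "i : I" "k i z ~= a" "bunch a I k z = k i z"
proof -
 have ex: "EX i. i : I & k i z ~= a" using assms by (auto simp: bunch_def split: if_splits)
 from someI_ex[OF this] that[of "SOME i. i : I & k i z ~= a"] ex show ?thesis by (auto simp: bunch_def)
qed

lemma bunch_val:
 assumes "i : I" "k i z ~= a" "!!i'. i' : I ==> k i' z ~= a ==> i' = i" shows "bunch a I k z = k i z"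
proof -
 have "(SOME i. i : I & k i z ~= a) = i" by (rule some_equality) (use assms in blast)+
 thus ?thesis using assms(1,2) by (auto simp: bunch_def)
qed

lemma bunch_a: "(!!i. i : I ==> k i z = a) ==> bunch a I k z = a"
 by (auto simp: bunch_def)

lemma bunch_cong:
 assumes "!!i. i : I ==> k i z = k' i z'" shows "bunch a I k z = bunch a I k' z'"
proof (cases "EX i:I. k i z ~= a")
 case True
 have e: "(%i. i : I & k i z ~= a) = (%i. i : I & k' i z' ~= a)" using assms by auto
 have "(SOME i. i : I & k i z ~= a) : I" using someI_ex[of "%i. i : I & k i z ~= a"] True by blast
 hence "k (SOME i. i : I & k i z ~= a) z = k' (SOME i. i : I & k' i z' ~= a) z'" unfolding e by (rule assms)
 moreover have "EX i:I. k' i z' ~= a" using True assms by auto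
 ultimately show ?thesis using True by (simp add: bunch_def)
next
 case False
 thus ?thesis using assms by (simp add: bunch_def)
qed

lemma continuous_bunch:
 assumes I: "finite I" and k: "!!i. i : I ==> continuous_map Z A (k i)" and a: "a : topspace A"
  and disj: "!!i i' z. i : I ==> i' : I ==> z : topspace Z ==> k i z ~= a ==> k i' z ~= a ==> i = i'"
 shows "continuous_map Z A (bunch a I k)"
 unfolding continuous_map_def
proof (intro conjI allI impI)
 have val: "bunch a I k z = k i z" if "z : topspace Z" "i : I" "k i z ~= a" for z i
  by (rule bunch_val) (use that disj in blast)+
 have "bunch a I k z : topspace A" if z: "z : topspace Z" for z
 proof (cases "bunch a I k z = a")
  case False
  then obtain i where "i : I" "bunch a I k z = k i z" by (rule bunch_ne)
  thus ?thesis using cmap_image[OF k] z by (metis image_subset_iff)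
 qed (use a in simp)
 thus "bunch a I k : topspace Z \<rightarrow> topspace A" by blast
 fix U assume U: "openin A U"
 have o: "openin Z {z : topspace Z. k i z : U}" if "i : I" for i by (rule openin_continuous_map_preimage[OF k[OF that] U])
 show "openin Z {z : topspace Z. bunch a I k z : U}"
 proof (cases "a : U")
  case True
  have "{z : topspace Z. bunch a I k z : U} = (\<Inter>i\<in>I. {z : topspace Z. k i z : U}) Int topspace Z"
  proof (intro equalityI subsetI)
   fix z assume z: "z : {z : topspace Z. bunch a I k z : U}"
   have "k i z : U" if "i : I" for i using val[of z i] z that True by (cases "k i z = a") auto
   thus "z : (\<Inter>i\<in>I. {z : topspace Z. k i z : U}) Int topspace Z" using z by auto
  next
   fix z assume z: "z : (\<Inter>i\<in>I. {z : topspace Z. k i z : U}) Int topspace Z"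
   show "z : {z : topspace Z. bunch a I k z : U}"
   proof (cases "bunch a I k z = a")
    case False
    then obtain i where "i : I" "bunch a I k z = k i z" by (rule bunch_ne)
    thus ?thesis using z by auto
   qed (use True z in auto)
  qed
  moreover have "openin Z ((\<Inter>i\<in>I. {z : topspace Z. k i z : U}) Int topspace Z)" by (rule openin_INT[OF I o])
  ultimately show ?thesis by simp
 next
  case False
  have "{z : topspace Z. bunch a I k z : U} = (\<Union>i\<in>I. {z : topspace Z. k i z : U})"
  proof (intro equalityI subsetI)
   fix z assume z: "z : {z : topspace Z. bunch a I k z : U}"
   hence "bunch a I k z ~= a" using False by auto
   then obtain i where "i : I" "bunch a I k z = k i z" by (rule bunch_ne)
   thus "z : (\<Union>i\<in>I. {z : topspace Z. k i z : U})" using z by auto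
  next
   fix z assume "z : (\<Union>i\<in>I. {z : topspace Z. k i z : U})"
   then obtain i where i: "i : I" "z : topspace Z" "k i z : U" by blast
   hence "k i z ~= a" using False by auto
   thus "z : {z : topspace Z. bunch a I k z : U}" using val[of z i] i by simp
  qed
  moreover have "openin Z (\<Union>i\<in>I. {z : topspace Z. k i z : U})" using o by (intro openin_Union) auto
  ultimately show ?thesis by simp
 qed
qed

lemma espace_chomI:
 assumes Q: "cmap_on (prism n) X Q"
  and h: "!!j. cmap_on (prism n) (A j) (h j)"
  and supp: "!!z j. z : prism n ==> h j z ~= a j ==> Q z = x j & (ALL i. i ~= j --> h i z = a i)"
  and b: "!!t s. t : {0..1} ==> s : bdry n ==> Q (t, s) = p0" "!!t s j. t : {0..1} ==> s : bdry n ==> h j (t, s) = a j"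
  and e: "!!s. s : cube n ==> Q (0, s) = Q0 s" "!!s j. s : cube n ==> h j (0, s) = h0 j s"
   "!!s. s : cube n ==> Q (1, s) = Q1 s" "!!s j. s : cube n ==> h j (1, s) = h1 j s"
 shows "chom n (espace X x A a) (p0, a) (%s. (Q0 s, %j. h0 j s)) (%s. (Q1 s, %j. h1 j s))"
 unfolding chom_def
proof (intro exI[of _ "%z. (Q z, %j. h j z)"] conjI ballI)
 show "cmap_on (prism n) (espace X x A a) (%z. (Q z, %j. h j z))"
  unfolding continuous_espace_components using Q h supp by (simp add: o_def)
qed (use b e in auto)

text \<open>The box is expanded to the whole cube by \<open>E\<close>, and the homotopy is carried
  out in the expanded coordinates. During the expansion no point outside the box is brought into it,
  and at its end all such points lie on the boundary of the cube.\<close>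

lemma chom_squeeze:
 assumes T: "a : topspace A" and g: "chom n A a ga ga'"
  and box: "!!e. e < n ==> 0 < hw e & abs (md e) + hw e < 1"
  and s: "!!s. s : cube n ==> ga s ~= a ==> ALL e<n. abs (s e - md e) <= hw e" "!!s. s : cube n ==> ga' s ~= a ==> ALL e<n. abs (s e - md e) <= hw e"
 shows "qhom n A a (%s. ALL e<n. abs (s e - md e) <= hw e) ga ga'"
proof -
 let ?Q = "%s. ALL e<n. abs (s e - md e) <= hw e"
 define E where "E z = (%e. if e < n then max (-1) (min 1 ((1 - fst z) * snd z e + fst z * ((snd z e - md e) / hw e))) else 0)"
  for z :: "real \<times> (nat => real)"
 have Ec: "continuous_on S E" for S
 proof -
  have "continuous_on S (%z. E z e)" for e
  proof (cases "e < n")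
   case True
   hence "hw e ~= 0" using box by force
   thus ?thesis using True unfolding E_def by (simp, intro continuous_intros) auto
  qed (simp add: E_def)
  thus ?thesis by (rule continuous_on_coords)
 qed
 have Ecube: "E z : cube n" for z by (auto simp: E_def cube_def)
 have E0: "E (0, s) = s" if "s : cube n" for s using that by (auto simp: E_def cube_def fun_eq_iff)
 have EQ: "?Q s" if t: "t : {0..1}" and sc: "s : cube n" and Q: "?Q (E (t, s))" for t s
 proof (intro allI impI, rule ccontr)
  fix e assume e: "e < n" and n: "~ abs (s e - md e) <= hw e"
  note b = box[OF e]
  let ?y = "(s e - md e) / hw e"
  have Ee: "E (t, s) e = max (-1) (min 1 ((1 - t) * s e + t * ?y))" using e by (simp add: E_def)
  have q: "abs (E (t, s) e - md e) <= hw e" using Q e by blast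
  consider "md e + hw e < s e" | "s e < md e - hw e" using n by linarith
  thus False
  proof cases
   case 1
   hence "1 < ?y" using b by (simp add: field_simps)
   have "md e + hw e < (1 - t) * s e + t * ?y"
   proof (cases "t = 0")
    case False
    hence "t * 1 < t * ?y" using t `1 < ?y` by (intro mult_strict_left_mono) auto
    moreover have "(1 - t) * (md e + hw e) <= (1 - t) * s e" using t 1 by (intro mult_left_mono) auto
    moreover have "t * (md e + hw e) <= t * 1" using t b by (intro mult_left_mono) auto
    ultimately show ?thesis by (simp add: algebra_simps)
   qed (use 1 in simp)
   moreover have "md e + hw e < 1" using b by linarith
   ultimately have "md e + hw e < E (t, s) e" unfolding Ee by simp
   thus False using q by linarith
  next
   case 2
   hence "?y < -1" using b by (simp add: field_simps)
   have "(1 - t) * s e + t * ?y < md e - hw e"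
   proof (cases "t = 0")
    case False
    hence "t * ?y < t * (-1)" using t `?y < -1` by (intro mult_strict_left_mono) auto
    moreover have "(1 - t) * s e <= (1 - t) * (md e - hw e)" using t 2 by (intro mult_left_mono) auto
    moreover have "t * (-1) <= t * (md e - hw e)" using t b by (intro mult_left_mono) auto
    ultimately show ?thesis by (simp add: algebra_simps)
   qed (use 2 in simp)
   moreover have "-1 < md e - hw e" using b by linarith
   ultimately have "E (t, s) e < md e - hw e" unfolding Ee by simp
   thus False using q by linarith
  qed
 qed
 have E1: "E (1, s) : bdry n" if nQ: "~ ?Q s" for s
 proof -
  obtain e where e: "e < n" "hw e < abs (s e - md e)" using nQ by auto
  have "1 <= abs ((s e - md e) / hw e)" using e box[OF e(1)] by (simp add: abs_divide)
  hence "abs (max (-1) (min 1 ((s e - md e) / hw e))) = 1" by (auto simp: abs_if min_def max_def split: if_splits)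
  hence "abs (E (1, s) e) = 1" using e by (simp add: E_def)
  thus ?thesis using Ecube e(1) unfolding bdry_def by blast
 qed
 have sq: "qhom n A a ?Q de (%s. de (E (1, s)))"
  if d: "cmap_on (cube n) A de" "!!s. s : cube n ==> de s ~= a ==> ?Q s" for de
 proof (rule qhomI[of _ _ "de o E"])
  show "cmap_on (prism n) A (de o E)"
   by (rule cmap_comp[OF _ d(1)]) (use Ec Ecube in auto)
 qed (use E0 d(2) Ecube EQ in fastforce)+
 obtain h where h: "cmap_on (prism n) A h" "ALL s:cube n. h (0, s) = ga s & h (1, s) = ga' s"
  "ALL t:{0..1}. ALL s:bdry n. h (t, s) = a" using g unfolding chom_def by blast
 have 2: "qhom n A a ?Q (%s. ga (E (1, s))) (%s. ga' (E (1, s)))"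
 proof (rule qhomI[of _ _ "h o (%z. (fst z, E (1, snd z)))"])
  show "cmap_on (prism n) A (h o (%z. (fst z, E (1, snd z))))"
  proof (rule cmap_comp[OF _ h(1)])
   have "continuous_on (prism n) (%z. E (1, snd z))"
    by (rule continuous_on_compose2[OF Ec[of UNIV]]) (auto intro!: continuous_intros)
   thus "cmap_on (prism n) (top_of_set (prism n)) (%z. (fst z, E (1, snd z)))"
    using Ecube by (auto intro!: continuous_on_Pair continuous_on_fst[OF continuous_on_id])
  qed
 qed (use h Ecube E1 in auto)
 have 1: "qhom n A a ?Q ga (%s. ga (E (1, s)))" by (rule sq) (use chom_cmap[OF g] s in "auto simp: cmap_def")
 have 3: "qhom n A a ?Q ga' (%s. ga' (E (1, s)))" by (rule sq) (use chom_cmap[OF g] s in "auto simp: cmap_def")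
 show ?thesis by (rule qhom_trans[OF 1 qhom_trans[OF 2 qhom_sym[OF 3]]])
qed

text \<open>The discs of \<open>be j\<close> are the half-size concentric cubes in the cells of the grid of mesh \<open>1 / N j\<close> that carry \<open>be j\<close>.\<close>

locale disc_data =
 fixes n :: nat and A :: "nat => 'b topology" and a :: "nat => 'b"
  and F :: "(nat => real) => 'd::metric_space" and al be :: "nat => (nat => real) => 'b" and N :: "nat => nat"
 assumes a: "!!j. a j : topspace (A j)" and T: "!!j. t1_space (A j)"
  and out: "!!j s. s : cube n ==> 1/2 <= mx n s ==> al j s = a j"
  and disj: "!!i j s. s : cube n ==> al i s ~= a i ==> al j s ~= a j ==> i = j"
  and const: "!!j C s s'. connected C ==> C <= cube n ==> (!!s. s : C ==> al j s ~= a j) ==> s : C ==> s' : C ==> F s = F s'"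
  and N: "!!j. 0 < N j" and hom: "!!j. qhom n (A j) (a j) (%s. al j s ~= a j) (al j) (be j)"
  and far: "!!j s i k. s : cube n ==> be j s ~= a j ==> i < n ==> 1/4 < abs (real (N j) * s i - of_int k)"
  and cell: "!!j s. s : cube n ==> be j s ~= a j ==> cellsub n (N j) (%s. al j s ~= a j) s"
begin

definition Delta :: "(nat \<times> (nat => int)) set" where
 "Delta = {(j, m). m : PiE {..<n} (%_. {- int (N j)..<int (N j)}) & (EX s:cube n. incell n (N j) m s & be j s ~= a j)}"

definition I :: "nat set" where "I = to_nat_on Delta ` Delta"
definition jj :: "nat => nat" where "jj i = fst (from_nat_into Delta i)"
definition mm :: "nat => nat => int" where "mm i = snd (from_nat_into Delta i)"
definition p :: "nat => nat => real" where "p i e = (if e < n then (2 * of_int (mm i e) + 1) / (2 * real (N (jj i))) else 0)"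
text \<open>A quarter of the mesh: a cell is the cube of half-width \<open>2 * r i\<close> about
  \<open>p i\<close>, and by \<open>far\<close> the support inside it stays closer than
  \<open>r i\<close> to the centre.\<close>

definition r :: "nat => real" where "r i = 1 / (4 * real (N (jj i)))"
definition tt :: "nat => 'd" where "tt i = F (p i)"

lemma beta_alpha: "s : cube n ==> be j s ~= a j ==> al j s ~= a j"
 using cellsub_self[OF _ cell] by blast

lemma beta_cont: "cmap_on (cube n) (A j) (be j)"
 by (rule qhom_end(2)[OF hom])

lemma finite_cells: "finite (PiE {..<n} (%_. {- int (N j)..<int (N j)}))"
 by (intro finite_PiE) auto

lemma countable_Delta: "countable Delta"
proof -
 have "Delta <= (\<Union>j. {j} \<times> PiE {..<n} (%_. {- int (N j)..<int (N j)}))" by (auto simp: Delta_def)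
 moreover have "countable (\<Union>j. {j} \<times> PiE {..<n} (%_. {- int (N j)..<int (N j)}))"
  by (rule countable_UN[OF countableI_type]) (intro countable_finite finite_cartesian_product finite_cells, simp)
 ultimately show ?thesis by (rule countable_subset)
qed

lemma I_Delta: "i : I ==> (jj i, mm i) : Delta"
 using countable_Delta by (auto simp: I_def jj_def mm_def from_nat_into_to_nat_on)

lemma Delta_I: "(j, m) : Delta ==> EX i:I. jj i = j & mm i = m"
 using countable_Delta by (intro bexI[of _ "to_nat_on Delta (j, m)"]) (auto simp: I_def jj_def mm_def)

lemma I_inj: "i : I ==> i' : I ==> jj i = jj i' ==> mm i = mm i' ==> i = i'"
 using countable_Delta by (auto simp: I_def jj_def mm_def prod_eq_iff)

lemma finite_I: "finite {i : I. jj i = j}"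
proof -
 have "mm ` {i : I. jj i = j} <= PiE {..<n} (%_. {- int (N j)..<int (N j)})" using I_Delta by (auto simp: Delta_def)
 hence "finite (mm ` {i : I. jj i = j})" using finite_cells finite_subset by blast
 moreover have "inj_on mm {i : I. jj i = j}" using I_inj by (auto simp: inj_on_def)
 ultimately show ?thesis by (rule finite_imageD)
qed

lemma N_pos: "0 < real (N j)" using N by simp

lemma r_pos: "0 < r i" using N_pos by (simp add: r_def)

lemma cell_iff: "incell n (N (jj i)) (mm i) s \<longleftrightarrow> (ALL e<n. abs (s e - p i e) <= 2 * r i)"
proof -
 have "of_int (mm i e) <= real (N (jj i)) * s e & real (N (jj i)) * s e <= of_int (mm i e) + 1 \<longleftrightarrow> abs (s e - p i e) <= 2 * r i" if "e < n" for e
 proof -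
  have 1: "real (N (jj i)) * (s e - p i e) = real (N (jj i)) * s e - of_int (mm i e) - 1/2"
   using that N_pos[of "jj i"] by (simp add: p_def field_simps)
  have 2: "abs (s e - p i e) <= 2 * r i \<longleftrightarrow> real (N (jj i)) * abs (s e - p i e) <= 1/2"
   using N_pos[of "jj i"] by (simp add: r_def field_simps)
  have 3: "real (N (jj i)) * abs (s e - p i e) = abs (real (N (jj i)) * (s e - p i e))" by (simp add: abs_mult)
  show ?thesis unfolding 2 3 1 by linarith
 qed
 thus ?thesis by (auto simp: incell_def)
qed

lemma m_range: "i : I ==> e < n ==> - real (N (jj i)) <= of_int (mm i e) & of_int (mm i e) + 1 <= real (N (jj i))"
proof -
 assume "i : I" "e < n"
 hence "- int (N (jj i)) <= mm i e & mm i e + 1 <= int (N (jj i))" using I_Delta[of i] by (auto simp: Delta_def PiE_def Pi_def)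
 thus ?thesis by linarith
qed

lemma cell_in_cube:
 assumes i: "i : I" and e: "e < n" and y: "abs (y - p i e) <= 2 * r i"
 shows "abs y <= 1"
proof -
 have "real (N (jj i)) * (y - p i e) = real (N (jj i)) * y - of_int (mm i e) - 1/2"
  using e N_pos[of "jj i"] by (simp add: p_def field_simps)
 moreover have "real (N (jj i)) * abs (y - p i e) <= 1/2" using y N_pos[of "jj i"] by (simp add: r_def field_simps)
 hence "abs (real (N (jj i)) * (y - p i e)) <= 1/2" by (simp add: abs_mult)
 ultimately have "abs (real (N (jj i)) * y) <= real (N (jj i))" using m_range[OF i e] by linarith
 thus ?thesis using N_pos[of "jj i"] by (simp add: abs_mult)
qed

lemma p_cube:
 assumes i: "i : I"
 shows "p i : cube n"
proof -
 have "abs (p i e) <= 1" if "e < n" for e by (rule cell_in_cube[OF i that]) (use r_pos[of i] in simp)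
 moreover have "p i e = 0" if "n <= e" for e using that by (simp add: p_def)
 ultimately show "p i : cube n" by (auto simp: cube_def abs_le_iff)
qed

lemma cell_alpha: "i : I ==> s : cube n ==> (!!e. e < n ==> abs (s e - p i e) <= 2 * r i) ==> al (jj i) s ~= a (jj i)"
proof -
 assume i: "i : I" and s: "s : cube n" "!!e. e < n ==> abs (s e - p i e) <= 2 * r i"
 obtain s0 where s0: "s0 : cube n" "incell n (N (jj i)) (mm i) s0" "be (jj i) s0 ~= a (jj i)" using I_Delta[OF i] by (auto simp: Delta_def)
 show ?thesis using cell[OF s0(1,3)] s0(2) s cell_iff unfolding cellsub_def by blast
qed

text \<open>The whole cell lies in the support of \<open>al (jj i)\<close> and is connected, so
  \<open>const\<close> applies to it.\<close>

lemma cell_F: "i : I ==> s : cube n ==> (!!e. e < n ==> abs (s e - p i e) <= 2 * r i) ==> F s = tt i"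
proof -
 assume i: "i : I" and s: "s : cube n" "!!e. e < n ==> abs (s e - p i e) <= 2 * r i"
 let ?C = "{s : cube n. ALL e<n. abs (s e - p i e) <= 2 * r i}"
 have pC: "p i : ?C" using p_cube[OF i] r_pos[of i] by simp
 have "connected ?C"
 proof (rule star_connected[OF pC])
  fix s' and t :: real assume s': "s' : ?C" and t: "t : {0..1}"
  have *: "abs (p i e + t * (s' e - p i e) - p i e) <= 2 * r i" if "e < n" for e
   by (rule convex_close) (use s' t r_pos[of i] that in auto)
  hence "(%e. p i e + t * (s' e - p i e)) : cube n"
   using cell_in_cube[OF i] s' p_cube[OF i] by (auto simp: cube_def abs_le_iff)
  thus "(%e. p i e + t * (s' e - p i e)) : ?C" using * by blast
 qed
 thus ?thesis unfolding tt_def by (rule const[of ?C "jj i"]) (use pC s cell_alpha[OF i] in auto)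
qed

text \<open>The cell reaches \<open>2 * r i\<close> beyond its centre, and \<open>al (jj i)\<close>
  is off the base point on all of it. By \<open>out\<close> even its outer face has norm below
  1/2.\<close>

lemma p_inner:
 assumes i: "i : I" and e: "e < n"
 shows "abs (p i e) + r i <= 1/2"
proof -
 define s where "s = (p i)(e := p i e + 2 * r i * (if 0 <= p i e then 1 else -1))"
 have c: "abs (s e' - p i e') <= 2 * r i" for e' using r_pos[of i] by (auto simp: s_def)
 have "s : cube n"
  using cell_in_cube[OF i _ c] e p_cube[OF i] by (auto simp: cube_def abs_le_iff s_def)
 hence "al (jj i) s ~= a (jj i)" "s : cube n" using cell_alpha[OF i] c by auto
 hence "mx n s < 1/2" using out by (metis linorder_not_le)
 hence "abs (s e) < 1/2" using mx_ge[of "1/2" n s] e by (auto simp: not_le[symmetric])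
 thus ?thesis using r_pos[of i] by (auto simp: s_def split: if_splits)
qed

text \<open>Cells of one component belong to one grid, so distinct centres differ by at least a mesh
  width, four times the radius. Cells of different components are disjoint because the supports of
  the two components are.\<close>

lemma disc_sep:
 assumes i: "i : I" "i' : I" "i ~= i'"
 shows "EX e<n. 2 * r i + 2 * r i' <= abs (p i e - p i' e)"
proof -
 show ?thesis
 proof (cases "jj i = jj i'")
  case True
  hence "mm i ~= mm i'" using I_inj i by blast
  moreover have "mm i : PiE {..<n} (%_. {- int (N (jj i))..<int (N (jj i))})" "mm i' : PiE {..<n} (%_. {- int (N (jj i'))..<int (N (jj i'))})"
   using I_Delta[OF i(1)] I_Delta[OF i(2)] by (auto simp: Delta_def)
  ultimately obtain e where e: "e < n" "mm i e ~= mm i' e" using True by (metis PiE_ext lessThan_iff)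
  hence "1 <= abs (real_of_int (mm i e) - of_int (mm i' e))" by linarith
  moreover have "p i e - p i' e = (of_int (mm i e) - of_int (mm i' e)) / real (N (jj i))"
   using e True N_pos[of "jj i"] by (simp add: p_def field_simps)
  ultimately have "1 / real (N (jj i)) <= abs (p i e - p i' e)" using N_pos[of "jj i"] by (simp add: abs_divide divide_right_mono)
  thus ?thesis using e True by (intro exI[of _ e]) (simp add: r_def)
 next
  case False
  show ?thesis
  proof (rule ccontr)
   assume "~ ?thesis"
   hence n: "abs (p i e - p i' e) < 2 * r i + 2 * r i'" if "e < n" for e using that by (auto simp: not_le)
   define s where "s e = (if e < n then max (p i e - 2 * r i) (min (p i e + 2 * r i) (p i' e)) else 0)" for e
   have s: "abs (s e - p i e) <= 2 * r i" "abs (s e - p i' e) <= 2 * r i'" if "e < n" for e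
    using n[OF that] r_pos[of i] r_pos[of i'] that by (auto simp: s_def max_def min_def abs_if split: if_splits)
   have "s : cube n" using cell_in_cube[OF i(1) _ s(1)] by (auto simp: cube_def abs_le_iff s_def)
   thus False using cell_alpha[OF i(1) _ s(1)] cell_alpha[OF i(2) _ s(2)] disj False by blast
  qed
 qed
qed

lemma disc_of:
 assumes s: "s : cube n" "be j s ~= a j"
 obtains i where "i : I" "jj i = j" "!!e. e < n ==> abs (s e - p i e) < r i"
proof -
 define m where "m = (\<lambda>e\<in>{..<n}. \<lfloor>real (N j) * s e\<rfloor>)"
 have f: "of_int (m e) + 1/4 < real (N j) * s e & real (N j) * s e < of_int (m e) + 3/4" if e: "e < n" for e
 proof -
  have "m e = \<lfloor>real (N j) * s e\<rfloor>" using e by (simp add: m_def)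
  hence "of_int (m e) <= real (N j) * s e" "real (N j) * s e < of_int (m e) + 1" by linarith+
  moreover have "1/4 < abs (real (N j) * s e - of_int (m e))" "1/4 < abs (real (N j) * s e - (of_int (m e) + 1))"
   using far[OF s e, of "m e"] far[OF s e, of "m e + 1"] by simp_all
  ultimately show ?thesis by linarith
 qed
 have "- int (N j) <= m e & m e < int (N j)" if e: "e < n" for e
 proof -
  have "-1 <= s e" "s e <= 1" using s e by (auto simp: cube_def)
  hence "- real (N j) <= real (N j) * s e" "real (N j) * s e <= real (N j)"
   using mult_left_mono[of "-1" "s e" "real (N j)"] mult_left_mono[of "s e" 1 "real (N j)"] by auto
  thus ?thesis using f[OF e] by linarith
 qed
 hence "m : PiE {..<n} (%_. {- int (N j)..<int (N j)})" by (auto simp: m_def)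
 moreover have "incell n (N j) m s" by (auto simp: incell_def m_def)
 ultimately have "(j, m) : Delta" using s by (auto simp: Delta_def)
 then obtain i where i: "i : I" "jj i = j" "mm i = m" using Delta_I by blast
 have "abs (s e - p i e) < r i" if e: "e < n" for e
 proof -
  have "real (N j) * (s e - p i e) = real (N j) * s e - of_int (m e) - 1/2"
   using e N_pos[of j] i by (simp add: p_def field_simps)
  hence "abs (real (N j) * (s e - p i e)) < 1/4" using f[OF e] by linarith
  hence "real (N j) * abs (s e - p i e) < 1/4" by (simp add: abs_mult)
  thus ?thesis using N_pos[of j] i by (simp add: r_def field_simps)
 qed
 thus ?thesis using that i by blast
qed

lemma finite_types: "finite (F ` {s : cube n. be j s ~= a j})"
proof (rule finite_subset)
 show "F ` {s : cube n. be j s ~= a j} <= tt ` {i : I. jj i = j}"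
 proof
  fix t assume "t : F ` {s : cube n. be j s ~= a j}"
  then obtain s where s: "s : cube n" "be j s ~= a j" "t = F s" by blast
  obtain i where i: "i : I" "jj i = j" "!!e. e < n ==> abs (s e - p i e) < r i" using disc_of[OF s(1,2)] by blast
  have "F s = tt i" by (rule cell_F[OF i(1) s(1)]) (use i(3) r_pos[of i] in fastforce)
  thus "t : tt ` {i : I. jj i = j}" using i s by blast
 qed
qed (use finite_I in blast)

lemma tt_type: "i : I ==> EX s:cube n. be (jj i) s ~= a (jj i) & F s = tt i"
proof -
 assume i: "i : I"
 obtain s where s: "s : cube n" "incell n (N (jj i)) (mm i) s" "be (jj i) s ~= a (jj i)" using I_Delta[OF i] by (auto simp: Delta_def)
 thus ?thesis using cell_F[OF i s(1)] cell_iff by blast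
qed

text \<open>The homotopy from \<open>al\<close> to \<open>be\<close> never leaves the support of
  \<open>al\<close>, on which \<open>F\<close>, and hence the label, is locally constant. It can
  therefore be cut down to one label.\<close>

lemma hom_res:
 assumes P: "!!s s'. F s = F s' ==> P s = P s'"
 shows "chom n (A j) (a j) (%s. if P s = ka then al j s else a j) (%s. if P s = ka then be j s else a j)"
proof -
 obtain h where h: "cmap_on (prism n) (A j) h"
  "ALL s:cube n. h (0, s) = al j s & h (1, s) = be j s" "ALL t:{0..1}. ALL s:cube n. ~ al j s ~= a j --> h (t, s) = a j"
  using hom unfolding qhom_def by blast
 let ?W = "{s : cube n. al j s : topspace (A j) - {a j}}"
 have ac: "cmap_on (cube n) (A j) (al j)" by (rule qhom_end(1)[OF hom])
 have "openin (A j) (topspace (A j) - {a j})" using T a by (metis closedin_def closedin_t1_singleton)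
 from openin_continuous_map_preimage[OF ac this] have W: "openin (top_of_set (cube n)) ?W" by simp
 have c: "cmap_on (prism n) (A j) (%z. if (P o snd) z = ka then h z else a j)"
 proof (rule continuous_res[OF h(1) a T])
  fix z assume z: "z : topspace (top_of_set (prism n))" "h z ~= a j"
  hence "snd z : cube n" "al j (snd z) ~= a j" using h(3) by (cases z; auto)+
  hence "snd z : ?W" using cmap_image[OF ac] by auto
  then obtain V where V: "openin (top_of_set (cube n)) V" "snd z : V" "V <= ?W" "connected V" using cube_nbhd[OF W] by blast
  have "openin (top_of_set (prism n)) ({0..1} \<times> V)" using V(1) by (intro openin_Times) auto
  moreover have "P s = P (snd z)" if "s : V" for s
   by (rule P, rule const[OF V(4), of j]) (use V(2,3) that in auto)
  ultimately show "EX V. openin (top_of_set (prism n)) V & z : V & (ALL z':V. h z' ~= a j --> (P o snd) z' = (P o snd) z)"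
  proof (intro exI[of _ "{0..1} \<times> V"] conjI)
   show "z : {0..1} \<times> V" using V(2) z by (cases z) auto
  qed auto
 qed
 have "al j s = a j" if "s : bdry n" for s using out[of s j] mx_bdry[of s n] that bdry_cube by fastforce
 thus ?thesis unfolding chom_def
  by (intro exI[of _ "%z. if (P o snd) z = ka then h z else a j"] conjI c) (use h subsetD[OF bdry_cube] in auto)
qed

lemma bdry_alpha: "s : bdry n ==> al j s = a j"
 using out[of s j] mx_bdry[of s n] subsetD[OF bdry_cube] by fastforce

lemma grid_chom:
 fixes q :: "'d => 'x"
 assumes q: "cmap_on (cube n) X (%s. q (F s))" and qx: "!!j s. s : cube n ==> al j s ~= a j ==> q (F s) = x j"
  and t0: "!!s. s : bdry n ==> F s = t0"
 shows "chom n (espace X x A a) (q t0, a) (%s. (q (F s), %j. al j s)) (%s. (q (F s), %j. be j s))"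
proof -
 have "ALL j. EX h. cmap_on (prism n) (A j) h &
   (ALL s:cube n. h (0, s) = al j s & h (1, s) = be j s) & (ALL t:{0..1}. ALL s:cube n. ~ al j s ~= a j --> h (t, s) = a j)"
  using hom unfolding qhom_def by blast
 then obtain h where "ALL j. cmap_on (prism n) (A j) (h j) &
   (ALL s:cube n. h j (0, s) = al j s & h j (1, s) = be j s) & (ALL t:{0..1}. ALL s:cube n. ~ al j s ~= a j --> h j (t, s) = a j)"
  by metis
 hence h: "!!j. cmap_on (prism n) (A j) (h j)"
  "!!j s. s : cube n ==> h j (0, s) = al j s" "!!j s. s : cube n ==> h j (1, s) = be j s"
  "!!j t s. t : {0..1} ==> s : cube n ==> h j (t, s) ~= a j ==> al j s ~= a j" by blast+
 show ?thesis
 proof (rule espace_chomI[of _ _ "(%s. q (F s)) o snd" _ h])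
  show "cmap_on (prism n) X ((%s. q (F s)) o snd)"
   by (rule cmap_comp[OF _ q]) (auto intro: continuous_intros)
  show "((%s. q (F s)) o snd) z = x j & (ALL i. i ~= j --> h i z = a i)" if z: "z : prism n" "h j z ~= a j" for z j
  proof -
   have s: "snd z : cube n" "al j (snd z) ~= a j" using z h(4)[of "fst z" "snd z" j] by auto
   have "h i z = a i" if "i ~= j" for i
   proof (rule ccontr)
    assume "h i z ~= a i"
    hence "al i (snd z) ~= a i" using z h(4)[of "fst z" "snd z" i] by auto
    thus False using disj[OF s(1)] s(2) that by blast
   qed
   thus ?thesis using qx[OF s] by simp
  qed
  show "h j (t, s) = a j" if "t : {0..1}" "s : bdry n" for t s j
   using h(4)[OF that(1), of s j] bdry_alpha[OF that(2)] subsetD[OF bdry_cube that(2)] by blast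
 qed (use h t0 in auto)
qed

text \<open>The wave carries each disc inside its tube, where the map to \<open>D\<close> is
  constantly \<open>tt i\<close>, so that its image under \<open>q\<close> is the attaching point
  \<open>x (jj i)\<close> all the time. In the end slab \<open>b\<close> contains all discs of type
  \<open>ty b\<close>. Moving only those discs proves the last conclusion.\<close>

lemma wave_types:
 fixes q :: "'d => 'x" and ty :: "nat => nat \<times> 'd"
 assumes W: "wave_base n D l sig F tht t0 M"
  and q: "cmap_on D X q" and qx: "!!j s. s : cube n ==> al j s ~= a j ==> q (F s) = x j"
  and ty: "inj_on ty B" "!!j s. s : cube n ==> be j s ~= a j ==> EX b:B. ty b = (j, F s)"
  and c: "!!b. 0 < om b" "!!b. 0 <= c b - om b & c b + om b <= 1" "!!b y. b : B ==> abs (y - c b) <= om b ==> tht y = snd (ty b)"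
   "!!b b'. b ~= b' ==> om b + om b' < abs (c b - c b')"
 obtains ga where
  "chom n (espace X x A a) (q t0, a) (%s. (q (F s), %j. be j s))
    (%s. (q (sig t0 (tht (tri (s 0 + 1/2))) (5 * M * max 0 (min 1 (4 * (1 - mx n s))))), %j. bunch (a j) {b : B. fst (ty b) = j} ga s))"
  "!!b s. b : B ==> s : cube n ==> ga b s ~= a (fst (ty b)) ==> abs (s 0 + 1/2 - c b) <= om b & mx n s <= 5/8"
  "!!b. b : B ==> chom n (A (fst (ty b))) (a (fst (ty b))) (%s. if F s = snd (ty b) then be (fst (ty b)) s else a (fst (ty b))) (ga b)"
proof -
 interpret W: wave_base n D l sig F tht t0 M by (rule W)
 have "EX b:B. ty b = (jj i, tt i)" if "i : I" for i using tt_type[OF that] ty(2) by metis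
 then obtain bt where bt: "!!i. i : I ==> bt i : B" "!!i. i : I ==> ty (bt i) = (jj i, tt i)" by metis
 \<comment> \<open>All discs of one type share its resting interval. Levels at distances
   \<open>(1/2) ^ (i + 1)\<close> from the centre, in units of \<open>om\<close>, with widths eight
   times smaller, are disjoint.\<close>
 define v where "v i = c (bt i) + om (bt i) * (1/2) ^ (i + 1)" for i
 define w where "w i = om (bt i) * (1/2) ^ (i + 4)" for i
 have pw: "0 < (1/2::real) ^ k" "(1/2::real) ^ k <= 1" for k by (simp_all add: power_le_one)
 have vw: "0 < w i" "w i <= om (bt i) / 16" "c (bt i) <= v i" "v i <= c (bt i) + om (bt i) / 2" for i
 proof -
  have "om (bt i) * (1/2) ^ i <= om (bt i)" using c(1)[of "bt i"] pw(2)[of i] by (simp add: mult_left_le)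
  moreover have "0 < om (bt i) * (1/2) ^ i" using c(1)[of "bt i"] by simp
  moreover have "w i = om (bt i) * (1/2) ^ i / 16" "v i = c (bt i) + om (bt i) * (1/2) ^ i / 2"
   by (simp_all add: w_def v_def power_add power_divide)
  ultimately show "0 < w i" "w i <= om (bt i) / 16" "c (bt i) <= v i" "v i <= c (bt i) + om (bt i) / 2" by linarith+
 qed
 have vwin: "abs (y - c (bt i)) <= om (bt i)" if "abs (y - v i) <= w i" for y i
  using that vw[of i] c(1)[of "bt i"] by linarith
 have vsep1: "w i + w i' < abs (v i - v i')" if ii: "i < i'" "bt i = bt i'" for i i'
 proof -
  have "(1/2::real) ^ i' <= (1/2) ^ Suc i" using ii(1) by (intro power_decreasing) auto
  hence "om (bt i) * (1/2) ^ i' <= om (bt i) * (1/2) ^ Suc i" using c(1)[of "bt i"] by (intro mult_left_mono) auto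
  moreover have "0 < om (bt i) * (1/2) ^ i" using c(1)[of "bt i"] by simp
  moreover have "w i = om (bt i) * (1/2) ^ i / 16" "v i = c (bt i) + om (bt i) * (1/2) ^ i / 2"
   "w i' = om (bt i) * (1/2) ^ i' / 16" "v i' = c (bt i) + om (bt i) * (1/2) ^ i' / 2" "om (bt i) * (1/2) ^ Suc i = om (bt i) * (1/2) ^ i / 2"
   using ii(2) by (simp_all add: w_def v_def power_add power_divide)
  ultimately show ?thesis by linarith
 qed
 have vsep: "w i + w i' < abs (v i - v i')" if ne: "i ~= i'" for i i'
 proof (cases "bt i = bt i'")
  case True
  thus ?thesis using vsep1[of i i'] vsep1[of i' i] ne by (cases "i < i'") (auto simp: abs_minus_commute add.commute)
 next
  case False
  thus ?thesis using c(4)[OF False] vw[of i] vw[of i'] c(1)[of "bt i"] c(1)[of "bt i'"] by linarith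
 qed
 have v01: "0 <= v i & v i <= 1" for i using vw[of i] c(1,2)[of "bt i"] by auto
 have vtht: "tht y = tt i" if "i : I" "y : {0..1}" "abs (y - v i) <= w i" for i y
  using c(3)[OF bt(1)[OF that(1)] vwin[OF that(3)]] bt(2)[OF that(1)] by simp
 have pF: "F s = tt i" if "i : I" "s : cube n" "!!e. e < n ==> abs (s e - p i e) <= r i" for i s
  by (rule cell_F[OF that(1,2)]) (use that(3) r_pos[of i] in fastforce)
 obtain G :: "real => (nat => real) => 'd" and U :: "nat => real => (nat => real) => nat => real" where
  G: "continuous_on (prism n) (%z. G (fst z) (snd z))" "!!tau s. 0 <= tau ==> tau <= 1 ==> s : cube n ==> G tau s : D"
  "!!s. s : cube n ==> G 0 s = F s" "!!tau s. 0 <= tau ==> tau <= 1 ==> s : bdry n ==> G tau s = t0"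
  "!!s. s : cube n ==> G 1 s = sig t0 (tht (tri (s 0 + 1/2))) (5 * M * max 0 (min 1 (4 * (1 - mx n s))))"
  and U: "!!i S. i : I ==> continuous_on S (%z. U i (fst z) (snd z))" "!!i tau s. U i tau s : cube n"
  "!!i s. i : I ==> U i 0 s = (%e. if e < n then max (-1) (min 1 ((s e - p i e) / r i)) else 0)"
  "!!i tau s. i : I ==> 0 <= tau ==> tau <= 1 ==> s : cube n ==> mx n (U i tau s) < 1 ==> G tau s = tt i & mx n s <= 5/8"
  "!!i i' tau s. i : I ==> i' : I ==> i ~= i' ==> 0 <= tau ==> tau <= 1 ==> s : cube n ==> mx n (U i tau s) < 1 ==> ~ mx n (U i' tau s) < 1"
  "!!i s. i : I ==> s : cube n ==> mx n (U i 1 s) < 1 ==> abs (s 0 + 1/2 - v i) <= w i"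
  by (rule W.wave_homotopy[of I p r tt v w])
   ((erule thin_rl, fact p_cube p_inner pF disc_sep vtht) | (erule thin_rl, rule r_pos v01 vw(1)) | (erule thin_rl, rule vsep, assumption) | (rule that, (assumption | blast)+))+
 let ?Z = "prism n"
 \<comment> \<open>The point of the original disc with the same relative position as
   \<open>z\<close> has in the moving tube; \<open>k i\<close> reads the value of \<open>be\<close>
   there.\<close>
 define pt where "pt i z = (%e. if e < n then p i e + r i * U i (fst z) (snd z) e else 0)" for i and z :: "real \<times> (nat => real)"
 define k where "k i z = be (jj i) (pt i z)" for i z
 have pt: "pt i z : cube n" if i: "i : I" for i z
 proof -
  have "abs (pt i z e) <= 1" if e: "e < n" for e
  proof -
   have "abs (U i (fst z) (snd z) e) <= 1" using U(2)[of i "fst z" "snd z"] e by (auto simp: cube_def abs_le_iff)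
   hence "abs (r i * U i (fst z) (snd z) e) <= r i" using r_pos[of i] by (simp add: abs_mult mult_left_le)
   thus ?thesis using p_inner[OF i e] e by (simp add: pt_def)
  qed
  hence "-1 <= pt i z e & pt i z e <= 1" if "e < n" for e using that unfolding abs_le_iff by fastforce
  moreover have "pt i z e = 0" if "n <= e" for e using that by (simp add: pt_def)
  ultimately show ?thesis by (simp add: cube_def)
 qed
 have kc: "cmap_on ?Z (A (jj i)) (k i)" if i: "i : I" for i
 proof -
  have "continuous_on ?Z (%z. pt i z e)" for e
   unfolding pt_def by (cases "e < n") (auto intro!: continuous_intros continuous_on_coord[OF U(1)[OF i]])
  hence "continuous_on ?Z (pt i)" by (rule continuous_on_coords)
  hence "cmap_on ?Z (top_of_set (cube n)) (pt i)" using pt[OF i] by auto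
  from cmap_comp[OF this beta_cont] show ?thesis by (simp add: k_def[abs_def] o_def)
 qed
 \<comment> \<open>On the edge of the tube a scaled coordinate of \<open>pt i z\<close> is at
   distance exactly 1/4 from an integer, which \<open>far\<close> excludes on the support. So
   \<open>k i\<close> is the base value outside the tube.\<close>
 have kmx: "mx n (U i (fst z) (snd z)) < 1" if i: "i : I" and ne: "k i z ~= a (jj i)" for i z
 proof (rule ccontr)
  assume "~ mx n (U i (fst z) (snd z)) < 1"
  then obtain e where e: "e < n" "1 <= abs (U i (fst z) (snd z) e)" using mx_ge[of 1 n "U i (fst z) (snd z)"] by auto
  hence u: "U i (fst z) (snd z) e = 1 | U i (fst z) (snd z) e = -1"
   using U(2)[of i "fst z" "snd z"] e(1) by (fastforce simp: cube_def abs_if split: if_splits)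
  note f = far[OF pt[OF i] ne[unfolded k_def] e(1)]
  have N: "real (N (jj i)) * pt i z e = of_int (mm i e) + 1/2 + U i (fst z) (snd z) e / 4"
   using e(1) N_pos[of "jj i"] by (simp add: pt_def p_def r_def field_simps)
  show False using u f[of "mm i e"] f[of "mm i e + 1"] unfolding N by auto
 qed
 have kG: "G (fst z) (snd z) = tt i" "mx n (snd z) <= 5/8" if i: "i : I" and z: "z : ?Z" and ne: "k i z ~= a (jj i)" for i z
  using U(4)[OF i _ _ _ kmx[OF i ne]] z by auto
 have kd: "i = i'" if "i : I" "i' : I" "z : ?Z" "k i z ~= a (jj i)" "k i' z ~= a (jj i')" for i i' z
 proof (rule ccontr)
  assume "i ~= i'"
  thus False using U(5)[OF that(1,2) _ _ _ _ kmx[OF that(1,4)]] kmx[OF that(2,5)] that(3) by auto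
 qed
 have kt: "q (tt i) = x (jj i)" if "i : I" for i
  using tt_type[OF that] beta_alpha qx by metis
 have kb: "k i (t, s) = a (jj i)" if i: "i : I" and t: "t : {0..1}" and s: "s : bdry n" for i t s
 proof (rule ccontr)
  assume ne: "k i (t, s) ~= a (jj i)"
  have "s : cube n" using s bdry_cube by blast
  thus False using kG(2)[OF i _ ne] t mx_bdry[of s n] s by simp
 qed
 have k0: "k i (0, s) = be (jj i) s & F s = tt i" if i: "i : I" and s: "s : cube n" and ne: "k i (0, s) ~= a (jj i)" for i s
 proof -
  have m: "mx n (U i 0 s) < 1" using kmx[OF i ne] by simp
  have e1: "p i e + r i * U i 0 s e = s e" if e: "e < n" for e
  proof -
   have "abs (U i 0 s e) < 1" using m mx_ge[of 1 n "U i 0 s"] e by (auto simp: not_le[symmetric])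
   hence "U i 0 s e = (s e - p i e) / r i" using e by (auto simp: U(3)[OF i] max_def min_def split: if_splits)
   thus ?thesis using r_pos[of i] by simp
  qed
  have "pt i (0, s) = s" using e1 s by (auto simp: pt_def fun_eq_iff cube_def)
  moreover have "G 0 s = tt i" using kG(1)[OF i _ ne] s by simp
  ultimately show ?thesis using G(3)[OF s] by (simp add: k_def)
 qed
 have k0': "EX i:I. jj i = j & k i (0, s) = be j s & tt i = F s" if s: "s : cube n" "be j s ~= a j" for j s
 proof -
  obtain i where i: "i : I" "jj i = j" "!!e. e < n ==> abs (s e - p i e) < r i" using disc_of[OF s] by blast
  have "U i 0 s e = (s e - p i e) / r i" if "e < n" for e
  proof -
   have "abs ((s e - p i e) / r i) < 1" using i(3)[OF that] r_pos[of i] by (simp add: abs_divide)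
   moreover have "max (-1) (min 1 y) = y" if "abs y < 1" for y :: real using that by auto
   ultimately have "max (-1) (min 1 ((s e - p i e) / r i)) = (s e - p i e) / r i" by blast
   thus ?thesis using that unfolding U(3)[OF i(1)] by simp
  qed
  hence "pt i (0, s) = s" using s(1) r_pos[of i] by (auto simp: pt_def fun_eq_iff cube_def)
  hence e: "k i (0, s) = be j s" using i by (simp add: k_def)
  hence "tt i = F s" using k0[OF i(1) s(1)] s(2) i(2) by simp
  thus ?thesis using i e by blast
 qed
 have val: "bunch (a j) J k z = k i z" if "J <= {i : I. jj i = j}" "i : J" "z : ?Z" "k i z ~= a j" for J j i z
  by (rule bunch_val) (use that kd[of _ i z] in blast)+
 have cont: "cmap_on ?Z (A j) (bunch (a j) J k)" if J: "J <= {i : I. jj i = j}" for J j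
 proof (rule continuous_bunch)
  show "finite J" by (rule finite_subset[OF J finite_I])
  show "cmap_on ?Z (A j) (k i)" if "i : J" for i using kc[of i] J that by auto
  show "i = i'" if "i : J" "i' : J" "z : topspace (top_of_set ?Z)" "k i z ~= a j" "k i' z ~= a j" for i i' z
   by (rule kd[of i i' z]) (use that J in auto)
 qed (rule a)
 define ga where "ga b s = bunch (a (fst (ty b))) {i : I. bt i = b} k (1, s)" for b s
 have Jb: "{i : I. bt i = b} <= {i : I. jj i = fst (ty b)}" for b using bt(2) by auto
 show ?thesis
 proof (rule that[of ga])
  show "chom n (espace X x A a) (q t0, a) (%s. (q (F s), %j. be j s))
    (%s. (q (sig t0 (tht (tri (s 0 + 1/2))) (5 * M * max 0 (min 1 (4 * (1 - mx n s))))), %j. bunch (a j) {b : B. fst (ty b) = j} ga s))"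
  proof (rule espace_chomI[of _ _ "q o (%z. G (fst z) (snd z))" _ "%j. bunch (a j) {i : I. jj i = j} k"])
   show "cmap_on ?Z X (q o (%z. G (fst z) (snd z)))"
    by (rule cmap_comp[OF _ q]) (use G(1,2) in auto)
   show "cmap_on ?Z (A j) (bunch (a j) {i : I. jj i = j} k)" for j by (rule cont) simp
   show "(q o (%z. G (fst z) (snd z))) z = x j & (ALL i. i ~= j --> bunch (a i) {i' : I. jj i' = i} k z = a i)"
    if z: "z : ?Z" "bunch (a j) {i : I. jj i = j} k z ~= a j" for z j
   proof -
    obtain i where i: "i : I" "jj i = j" "k i z ~= a j" using bunch_ne[OF z(2)] by blast
    have "bunch (a i') {i'' : I. jj i'' = i'} k z = a i'" if "i' ~= j" for i'
    proof (rule bunch_a, rule ccontr)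
     fix i'' assume "i'' : {i'' : I. jj i'' = i'}" "k i'' z ~= a i'"
     thus False using kd[OF i(1) _ z(1), of i''] i that by auto
    qed
    thus ?thesis using kG(1)[OF i(1) z(1)] kt[OF i(1)] i by simp
   qed
   show "bunch (a j) {i : I. jj i = j} k (t, s) = a j" if "t : {0..1}" "s : bdry n" for t s j
    by (rule bunch_a) (use kb that in auto)
   show "bunch (a j) {i : I. jj i = j} k (0, s) = be j s" if s: "s : cube n" for s j
   proof (cases "be j s = a j")
    case True
    have "bunch (a j) {i : I. jj i = j} k (0, s) = a j"
     by (rule bunch_a, rule ccontr) (use k0[OF _ s] True in auto)
    thus ?thesis using True by simp
   next
    case False
    obtain i where i: "i : I" "jj i = j" "k i (0, s) = be j s" using k0'[OF s False] by blast
    have "bunch (a j) {i : I. jj i = j} k (0, s) = k i (0, s)" by (rule val) (use i s False in auto)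
    thus ?thesis using i by simp
   qed
   show "bunch (a j) {i : I. jj i = j} k (1, s) = bunch (a j) {b : B. fst (ty b) = j} ga s" if s: "s : cube n" for s j
   proof (cases "EX i:I. jj i = j & k i (1, s) ~= a j")
    case True
    then obtain i where i: "i : I" "jj i = j" "k i (1, s) ~= a j" by blast
    have z: "(1, s) : ?Z" using s by simp
    have l: "bunch (a j) {i : I. jj i = j} k (1, s) = k i (1, s)" by (rule val) (use i z in auto)
    have fj: "fst (ty (bt i)) = j" using bt(2)[OF i(1)] i(2) by simp
    have g: "ga (bt i) s = k i (1, s)" unfolding ga_def fj by (rule val) (use i z Jb[of "bt i"] fj in auto)
    have "bunch (a j) {b : B. fst (ty b) = j} ga s = ga (bt i) s"
    proof (rule bunch_val)
     show "bt i : {b : B. fst (ty b) = j}" using bt(1)[OF i(1)] fj by simp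
     show "ga (bt i) s ~= a j" using g i by simp
     fix b assume b: "b : {b : B. fst (ty b) = j}" "ga b s ~= a j"
     hence "bunch (a (fst (ty b))) {i : I. bt i = b} k (1, s) ~= a (fst (ty b))" by (simp add: ga_def)
     then obtain i' where i': "i' : I" "bt i' = b" "k i' (1, s) ~= a (fst (ty b))" by (rule bunch_ne) blast
     have "jj i' = fst (ty b)" using bt(2)[OF i'(1)] i'(2) by simp
     hence "i' = i" using kd[OF i'(1) i(1) z] i' i by simp
     thus "b = bt i" using i' by simp
    qed
    thus ?thesis using l g by simp
   next
    case False
    have "ga b s = a j" if b: "b : {b : B. fst (ty b) = j}" for b
    proof -
     have "fst (ty b) = j" using b by simp
     moreover have "bunch (a j) {i : I. bt i = b} k (1, s) = a j" by (rule bunch_a) (use Jb[of b] False calculation in auto)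
     ultimately show ?thesis by (simp add: ga_def)
    qed
    hence "bunch (a j) {b : B. fst (ty b) = j} ga s = a j" by (intro bunch_a) blast
    moreover have "bunch (a j) {i : I. jj i = j} k (1, s) = a j" by (rule bunch_a) (use False in auto)
    ultimately show ?thesis by simp
   qed
  qed (use G in "auto simp: bdry_def")
  show "abs (s 0 + 1/2 - c b) <= om b & mx n s <= 5/8" if b: "b : B" and s: "s : cube n" and ne: "ga b s ~= a (fst (ty b))" for b s
  proof -
   obtain i where i: "i : I" "bt i = b" "k i (1, s) ~= a (fst (ty b))" using bunch_ne[OF ne[unfolded ga_def]] by blast
   have j: "jj i = fst (ty b)" using bt(2)[OF i(1)] i(2) by simp
   hence ne': "k i (1, s) ~= a (jj i)" using i by simp
   have "mx n (U i 1 s) < 1" using kmx[OF i(1) ne'] by simp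
   hence "abs (s 0 + 1/2 - v i) <= w i" by (rule U(6)[OF i(1) s])
   thus ?thesis using vwin[of "s 0 + 1/2" i] kG(2)[OF i(1) _ ne'] s i(2) by simp
  qed
  show "chom n (A (fst (ty b))) (a (fst (ty b))) (%s. if F s = snd (ty b) then be (fst (ty b)) s else a (fst (ty b))) (ga b)" if b: "b : B" for b
   unfolding chom_def
  proof (intro exI[of _ "bunch (a (fst (ty b))) {i : I. bt i = b} k"] conjI ballI)
   show "cmap_on ?Z (A (fst (ty b))) (bunch (a (fst (ty b))) {i : I. bt i = b} k)" by (rule cont[OF Jb])
   show "bunch (a (fst (ty b))) {i : I. bt i = b} k (t, s) = a (fst (ty b))" if "t : {0..1}" "s : bdry n" for t s
    by (rule bunch_a) (use kb that Jb[of b] in fastforce)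
   fix s assume s: "s : cube n"
   show "bunch (a (fst (ty b))) {i : I. bt i = b} k (1, s) = ga b s" by (simp add: ga_def)
   let ?j = "fst (ty b)"
   have none: "bunch (a ?j) {i : I. bt i = b} k (0, s) = a ?j" if "~ (F s = snd (ty b) & be ?j s ~= a ?j)"
   proof (rule bunch_a, rule ccontr)
    fix i assume i: "i : {i : I. bt i = b}" "k i (0, s) ~= a ?j"
    hence "jj i = ?j" "tt i = snd (ty b)" using bt(2)[of i] by auto
    thus False using k0[OF _ s, of i] i that by auto
   qed
   show "bunch (a ?j) {i : I. bt i = b} k (0, s) = (if F s = snd (ty b) then be ?j s else a ?j)"
   proof (cases "F s = snd (ty b) & be ?j s ~= a ?j")
    case True
    then obtain i where i: "i : I" "jj i = ?j" "k i (0, s) = be ?j s" "tt i = F s" using k0'[OF s, of ?j] by blast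
    have "ty (bt i) = ty b" using bt(2)[OF i(1)] i True by (simp add: prod_eq_iff)
    hence "bt i = b" using inj_onD[OF ty(1)] bt(1)[OF i(1)] b by blast
    hence "bunch (a ?j) {i : I. bt i = b} k (0, s) = k i (0, s)" by (intro val[OF Jb]) (use i s True in auto)
    thus ?thesis using i True by simp
   next
    case False
    thus ?thesis using none by auto
   qed
  qed
 qed
qed

end

section \<open>Comparison of two maps over a common dendrite\<close>

lemma dendrite_assembly:
 fixes D :: "'d::metric_space set" and A :: "nat => 'b topology" and q :: "'d => 'x"
 assumes n: "2 <= n" and D: "dendrite D"
  and A: "!!j. well_pointed (A j) (a j)" "!!j. t1_space (A j)" "!!j. a j : topspace (A j)" "!!j. k_connected_space (n - 1) (A j)"
  and q: "cmap_on D X q" and t0: "t0 : D"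
  and F: "continuous_on (cube n) F" "!!s. s : cube n ==> F s : D" "!!s. s : cube n ==> 1/2 <= mx n s ==> F s = t0"
  and al: "!!j. cmap n (A j) (a j) (al j)" "!!j s. s : cube n ==> 1/2 <= mx n s ==> al j s = a j"
   "!!i j s. s : cube n ==> al i s ~= a i ==> al j s ~= a j ==> i = j"
   "!!j C s s'. connected C ==> C <= cube n ==> (!!s. s : C ==> al j s ~= a j) ==> s : C ==> s' : C ==> F s = F s'"
   "!!j s. s : cube n ==> al j s ~= a j ==> q (F s) = x j"
  and G: "continuous_on (cube n) G" "!!s. s : cube n ==> G s : D" "!!s. s : cube n ==> 1/2 <= mx n s ==> G s = t0"
  and be: "!!j. cmap n (A j) (a j) (be j)" "!!j s. s : cube n ==> 1/2 <= mx n s ==> be j s = a j"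
   "!!i j s. s : cube n ==> be i s ~= a i ==> be j s ~= a j ==> i = j"
   "!!j C s s'. connected C ==> C <= cube n ==> (!!s. s : C ==> be j s ~= a j) ==> s : C ==> s' : C ==> G s = G s'"
   "!!j s. s : cube n ==> be j s ~= a j ==> q (G s) = x j"
  and inv: "!!j T. finite T ==> T <= D ==> EX P :: 'd => 'k. inj_on P T & (ALL ka. chom n (A j) (a j)
    (%s. if P (F s) = ka then al j s else a j) (%s. if P (G s) = ka then be j s else a j))"
 shows "chom n (espace X x A a) (q t0, a) (%s. (q (F s), %j. al j s)) (%s. (q (G s), %j. be j s))"
proof -
 interpret D: dendrite D by (rule D)
 obtain l sig where l: "continuous_on (D \<times> D) (%(u, p). l u p)" "!!u p. 0 <= (l u p :: real)" "!!u. u : D ==> l u u = 0"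
  and sig: "continuous_on (D \<times> D \<times> {0::real..}) (%(u, w, z). sig u w z)"
  "!!u w z. u : D ==> w : D ==> 0 <= z ==> sig u w z : D"
  "!!u w. u : D ==> w : D ==> sig u w 0 = u"
  "!!u w z. u : D ==> w : D ==> l u w <= z ==> sig u w z = w"
  by (rule D.flow_exists) blast
 have "bounded ((%(u, p). l u p) ` (D \<times> D))"
  by (intro compact_imp_bounded compact_continuous_image l(1) compact_Times D.compD)
 then obtain M where M: "0 < M" "!!u w. u : D ==> w : D ==> l u w <= M"
  unfolding bounded_pos by (force simp: abs_le_iff)
 define good where "good ph N ph' j \<longleftrightarrow> 0 < N & qhom n (A j) (a j) (%s. ph s ~= a j) ph ph' &
   (ALL s i k. s : cube n --> ph' s ~= a j --> i < n --> 1/4 < abs (real N * s i - of_int k)) &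
   (ALL s. s : cube n --> ph' s ~= a j --> cellsub n N (%s. ph s ~= a j) s)" for ph ph' :: "(nat => real) => 'b" and N j
 have ex: "EX N ph'. good ph N ph' j" if c: "cmap n (A j) (a j) ph" for ph j
 proof -
  obtain N :: nat and ph' where "0 < N" "qhom n (A j) (a j) (%s. ph s ~= a j) ph ph'"
   "!!s i k. s : cube n ==> ph' s ~= a j ==> i < n ==> 1/4 < abs (real N * s i - of_int k)"
   "!!s. s : cube n ==> ph' s ~= a j ==> cellsub n N (%s. ph s ~= a j) s"
   using grid_discs[OF A(1,2,3,4) c] by blast
  thus ?thesis unfolding good_def by blast
 qed
 obtain N1 al' where g1: "!!j. good (al j) (N1 j) (al' j) j" using ex[OF al(1)] by metis
 obtain N2 be' where g2: "!!j. good (be j) (N2 j) (be' j) j" using ex[OF be(1)] by metis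
 interpret f: disc_data n A a F al al' N1
  by (unfold_locales; (rule A(3) A(2) al(2-4) | (use g1 in "simp add: good_def"))?) (assumption | blast)+
 interpret g: disc_data n A a G be be' N2
  by (unfold_locales; (rule A(3) A(2) be(2-4) | (use g2 in "simp add: good_def"))?) (assumption | blast)+
 \<comment> \<open>The types of both maps are collected, so that corresponding parts of
   \<open>F\<close> and \<open>G\<close> are brought into the same slab.\<close>
 define Ty where "Ty = {(j, t). t : F ` {s : cube n. al' j s ~= a j} Un G ` {s : cube n. be' j s ~= a j}}"
 have TyD: "t : D" if "(j, t) : Ty" for j t using that F(2) G(2) by (auto simp: Ty_def)
 have finT: "finite {t. (j, t) : Ty}" for j
 proof -
  have "{t. (j, t) : Ty} = F ` {s : cube n. al' j s ~= a j} Un G ` {s : cube n. be' j s ~= a j}" by (auto simp: Ty_def)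
  thus ?thesis using f.finite_types g.finite_types by simp
 qed
 have "Ty = (\<Union>j. Pair j ` {t. (j, t) : Ty})" by auto
 moreover have "countable (\<Union>j. Pair j ` {t. (j, t) : Ty})"
  by (rule countable_UN[OF countableI_type]) (intro countable_finite finite_imageI finT)
 ultimately have ctTy: "countable Ty" by simp
 define ty where "ty = from_nat_into Ty"
 define B where "B = to_nat_on Ty ` Ty"
 have tyB: "ty b : Ty" if "b : B" for b using that ctTy by (auto simp: ty_def B_def)
 have tyinj: "inj_on ty B" using ctTy by (auto simp: inj_on_def ty_def B_def)
 have tyex: "EX b:B. ty b = z" if "z : Ty" for z using that ctTy by (intro bexI[of _ "to_nat_on Ty z"]) (auto simp: ty_def B_def)
 have finB: "finite {b : B. fst (ty b) = j}" for j
 proof (rule finite_imageD)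
  have "ty ` {b : B. fst (ty b) = j} <= Pair j ` {t. (j, t) : Ty}"
  proof
   fix z assume "z : ty ` {b : B. fst (ty b) = j}"
   hence "z : Ty" "fst z = j" using tyB by auto
   thus "z : Pair j ` {t. (j, t) : Ty}" by (cases z) auto
  qed
  thus "finite (ty ` {b : B. fst (ty b) = j})" using finT finite_surj by blast
  show "inj_on ty {b : B. fst (ty b) = j}" using tyinj by (auto simp: inj_on_def)
 qed
 obtain psi :: "real => nat => real" where psi: "continuous_on {0..1} psi" "psi ` {0..1} = cube n" "psi 0 : bdry n"
  using cube_curve[of n] n by auto
 have FG0: "F (psi 0) = t0" "G (psi 0) = t0"
 proof -
  have "psi 0 : cube n" using psi(3) bdry_cube by blast
  moreover have "1/2 <= mx n (psi 0)" using mx_bdry[OF calculation] psi(3) by simp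
  ultimately show "F (psi 0) = t0" "G (psi 0) = t0" using F(3) G(3) by auto
 qed
 \<comment> \<open>Backwards through the image of \<open>F\<close> and then forwards through that of
   \<open>G\<close>. The halves fit because both maps are \<open>t0\<close> at the boundary point
   \<open>psi 0\<close>, and the path meets the point of every type.\<close>
 define tht0 where "tht0 y = (if y <= 1/2 then F (psi (1 - 2 * y)) else G (psi (2 * y - 1)))" for y :: real
 have psic: "psi y : cube n" if "y : {0..1}" for y using psi(2) that by blast
 have half: "F (psi (1 - 2 * y)) = G (psi (2 * y - 1))" if "y * 2 = 1" for y
 proof -
  have "1 - 2 * y = 0" "2 * y - 1 = 0" using that by linarith+
  thus ?thesis using FG0 by (simp only:)
 qed
 have c0: "continuous_on ({0..1/2} Un {1/2..1}) tht0"
  unfolding tht0_def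
 proof (rule continuous_on_If)
  show "continuous_on {0..1/2} (%y. F (psi (1 - 2 * y)))"
   by (rule continuous_on_compose2[OF F(1)], rule continuous_on_compose2[OF psi(1)]) (use psic in "auto intro!: continuous_intros")
  show "continuous_on {1/2..1} (%y. G (psi (2 * y - 1)))"
   by (rule continuous_on_compose2[OF G(1)], rule continuous_on_compose2[OF psi(1)]) (use psic in "auto intro!: continuous_intros")
 qed (use half in auto)
 have "{0..1/2} Un {1/2..1} = {0..1::real}" by auto
 hence c0': "continuous_on {0..1} tht0" using c0 by simp
 have tht0D: "tht0 y : D" if "y : {0..1}" for y unfolding tht0_def using psic that F(2) G(2) by auto
 have ex_u: "EX y:{0..1}. tht0 y = snd (ty b)" if b: "b : B" for b
 proof -
  obtain j t where jt: "ty b = (j, t)" by force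
  hence "(j, t) : Ty" using tyB[OF b] by simp
  then consider s where "s : cube n" "t = F s" | s where "s : cube n" "t = G s" by (auto simp: Ty_def)
  thus ?thesis
  proof cases
   case 1
   then obtain y where y: "y : {0..1}" "psi y = s" using psi(2) by (metis imageE)
   thus ?thesis using 1 jt by (intro bexI[of _ "(1 - y) / 2"]) (auto simp: tht0_def diff_divide_distrib)
  next
   case 2
   then obtain y where y: "y : {0..1}" "psi y = s" using psi(2) by (metis imageE)
   show ?thesis
   proof (cases "y = 0")
    case True
    thus ?thesis using 2 y jt FG0 psic[of 1] psi(2) by (intro bexI[of _ "1/2"]) (auto simp: tht0_def)
   next
    case False
    thus ?thesis using 2 y jt by (intro bexI[of _ "(1 + y) / 2"]) (auto simp: tht0_def field_simps)
   qed
  qed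
 qed
 have "EX y. y : {0..1} & (b : B --> tht0 y = snd (ty b))" for b
 proof (cases "b : B")
  case True
  thus ?thesis using ex_u[OF True] by blast
 qed (auto intro!: exI[of _ 0])
 then obtain u where u: "!!b. u b : {0..1}" "!!b. b : B ==> tht0 (u b) = snd (ty b)" by metis
 obtain tht c om where tht: "continuous_on {0..1} tht" "!!y. y : {0..1} ==> tht y : tht0 ` {0..1}" and c: "!!b. 0 < (om b :: real)"
  "!!b. 0 <= c b - om b & c b + om b <= 1" "!!b y. abs (y - c b) <= om b ==> tht y = tht0 (u b)"
  "!!b b'. b ~= b' ==> om b + om b' < abs (c b - c b')"
  by (rule dwelling_path[OF c0' u(1)]) (rule that, (assumption | blast)+)
 have thtD: "tht y : D" if "y : {0..1}" for y using tht(2)[OF that] tht0D by auto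
 have cB: "tht y = snd (ty b)" if "b : B" "abs (y - c b) <= om b" for b y using c(3)[OF that(2)] u(2)[OF that(1)] by simp
 have tyF: "EX b:B. ty b = (j, F s)" if "s : cube n" "al' j s ~= a j" for j s by (rule tyex) (use that in "auto simp: Ty_def")
 have tyG: "EX b:B. ty b = (j, G s)" if "s : cube n" "be' j s ~= a j" for j s by (rule tyex) (use that in "auto simp: Ty_def")
 have wF: "wave_base n D l sig F tht t0 M" and wG: "wave_base n D l sig G tht t0 M"
  by (unfold_locales; fact n D.compD l sig F G t0 tht(1) thtD M)+
 define F2 where "F2 s = sig t0 (tht (tri (s 0 + 1/2))) (5 * M * max 0 (min 1 (4 * (1 - mx n s))))" for s
 obtain ga1 where ga1: "chom n (espace X x A a) (q t0, a) (%s. (q (F s), %j. al' j s)) (%s. (q (F2 s), %j. bunch (a j) {b : B. fst (ty b) = j} ga1 s))"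
  "!!b s. b : B ==> s : cube n ==> ga1 b s ~= a (fst (ty b)) ==> abs (s 0 + 1/2 - c b) <= om b & mx n s <= 5/8"
  "!!b. b : B ==> chom n (A (fst (ty b))) (a (fst (ty b))) (%s. if F s = snd (ty b) then al' (fst (ty b)) s else a (fst (ty b))) (ga1 b)"
  by (rule f.wave_types[of D l sig tht t0 M X q x ty B om c, folded F2_def])
   ((erule thin_rl, rule wF) | (erule thin_rl, fact q al(5) tyinj tyF c(1,2,4) cB) | (rule that, (assumption | blast)+))+
 obtain ga2 where ga2: "chom n (espace X x A a) (q t0, a) (%s. (q (G s), %j. be' j s)) (%s. (q (F2 s), %j. bunch (a j) {b : B. fst (ty b) = j} ga2 s))"
  "!!b s. b : B ==> s : cube n ==> ga2 b s ~= a (fst (ty b)) ==> abs (s 0 + 1/2 - c b) <= om b & mx n s <= 5/8"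
  "!!b. b : B ==> chom n (A (fst (ty b))) (a (fst (ty b))) (%s. if G s = snd (ty b) then be' (fst (ty b)) s else a (fst (ty b))) (ga2 b)"
  by (rule g.wave_types[of D l sig tht t0 M X q x ty B om c, folded F2_def])
   ((erule thin_rl, rule wG) | (erule thin_rl, fact q be(5) tyinj tyG c(1,2,4) cB) | (rule that, (assumption | blast)+))+
 define box where "box b s \<longleftrightarrow> (ALL e<n. abs (s e - (if e = 0 then c b - 1/2 else 0)) <= (if e = 0 then om b else 3/4))" for b and s :: "nat => real"
 have boxI: "box b s" if "abs (s 0 + 1/2 - c b) <= om b" "mx n s <= 5/8" for b s
 proof -
  have "abs (s e) <= 5/8" if "e < n" for e using `mx n s <= 5/8` mx_le[of "5/8" n s] that by simp
  thus ?thesis using that(1) by (force simp: box_def algebra_simps)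
 qed
 have box0: "abs (s 0 + 1/2 - c b) <= om b" if "box b s" for b s
  using that n unfolding box_def by (auto dest!: spec[of _ 0] simp: algebra_simps)
 have "qhom n (A (fst (ty b))) (a (fst (ty b))) (box b) (ga1 b) (ga2 b)" if b: "b : B" for b
 proof -
  let ?j = "fst (ty b)" and ?t = "snd (ty b)"
  let ?T = "{t. (?j, t) : Ty}"
  have tT: "?t : ?T" using tyB[OF b] by simp
  \<comment> \<open>Only finitely many points occur with component \<open>?j\<close>; a label
    injective on them singles out the part over \<open>?t\<close>.\<close>
  obtain P :: "'d => 'k" where P: "inj_on P ?T" "!!ka. chom n (A ?j) (a ?j)
    (%s. if P (F s) = ka then al ?j s else a ?j) (%s. if P (G s) = ka then be ?j s else a ?j)"
   using inv[OF finT[of ?j], of ?j] TyD by blast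
  have 1: "chom n (A ?j) (a ?j) (%s. if P (F s) = P ?t then al ?j s else a ?j) (%s. if P (F s) = P ?t then al' ?j s else a ?j)"
   by (rule f.hom_res) simp
  have 2: "chom n (A ?j) (a ?j) (%s. if P (G s) = P ?t then be ?j s else a ?j) (%s. if P (G s) = P ?t then be' ?j s else a ?j)"
   by (rule g.hom_res) simp
  have 3: "chom n (A ?j) (a ?j) (%s. if P (F s) = P ?t then al' ?j s else a ?j) (%s. if P (G s) = P ?t then be' ?j s else a ?j)"
   by (rule chom_trans[OF chom_sym[OF 1] chom_trans[OF P(2) 2]])
  have c1: "(if P (F s) = P ?t then al' ?j s else a ?j) = (if F s = ?t then al' ?j s else a ?j)" if "s : cube n" for s
   using inj_onD[OF P(1) _ _ tT, of "F s"] that by (auto simp: Ty_def)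
  have c2: "(if P (G s) = P ?t then be' ?j s else a ?j) = (if G s = ?t then be' ?j s else a ?j)" if "s : cube n" for s
   using inj_onD[OF P(1) _ _ tT, of "G s"] that by (auto simp: Ty_def)
  have 4: "chom n (A ?j) (a ?j) (%s. if F s = ?t then al' ?j s else a ?j) (%s. if G s = ?t then be' ?j s else a ?j)"
   by (rule chom_cong[OF 3], fact c1, fact c2)
  have "chom n (A ?j) (a ?j) (ga1 b) (ga2 b)"
   by (rule chom_trans[OF chom_sym[OF ga1(3)[OF b]] chom_trans[OF 4 ga2(3)[OF b]]])
  hence "qhom n (A ?j) (a ?j) (%s. ALL e<n. abs (s e - (if e = 0 then c b - 1/2 else 0)) <= (if e = 0 then om b else 3/4)) (ga1 b) (ga2 b)"
  proof (rule chom_squeeze[OF A(3)])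
   show "0 < (if e = 0 then om b else 3/4) & abs (if e = 0 then c b - 1/2 else 0) + (if e = 0 then om b else 3/4) < 1" if "e < n" for e
    using c(1,2)[of b] by (auto simp: abs_if)
  qed (use ga1(2)[OF b] ga2(2)[OF b] boxI in "unfold box_def, blast")+
  thus ?thesis by (simp add: box_def[abs_def])
 qed
 hence "EX h. b : B --> cmap_on (prism n) (A (fst (ty b))) h &
   (ALL s:cube n. h (0, s) = ga1 b s & h (1, s) = ga2 b s) & (ALL t:{0..1}. ALL s:cube n. ~ box b s --> h (t, s) = a (fst (ty b)))" for b
  unfolding qhom_def by blast
 hence "EX h. ALL b. b : B --> cmap_on (prism n) (A (fst (ty b))) (h b) &
   (ALL s:cube n. h b (0, s) = ga1 b s & h b (1, s) = ga2 b s) & (ALL t:{0..1}. ALL s:cube n. ~ box b s --> h b (t, s) = a (fst (ty b)))"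
  by (intro choice) blast
 then obtain h where hh: "ALL b. b : B --> cmap_on (prism n) (A (fst (ty b))) (h b) &
   (ALL s:cube n. h b (0, s) = ga1 b s & h b (1, s) = ga2 b s) & (ALL t:{0..1}. ALL s:cube n. ~ box b s --> h b (t, s) = a (fst (ty b)))"
  by blast
 have h: "!!b. b : B ==> cmap_on (prism n) (A (fst (ty b))) (h b)"
  "!!b s. b : B ==> s : cube n ==> h b (0, s) = ga1 b s" "!!b s. b : B ==> s : cube n ==> h b (1, s) = ga2 b s"
  "!!b t s. b : B ==> t : {0..1} ==> s : cube n ==> h b (t, s) ~= a (fst (ty b)) ==> box b s" using hh by blast+
 have hd: "b = b'" if "b : B" "b' : B" "z : prism n" "h b z ~= a (fst (ty b))" "h b' z ~= a (fst (ty b'))" for b b' z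
 proof (rule ccontr)
  assume "b ~= b'"
  have "box b (snd z)" "box b' (snd z)" using h(4)[OF that(1), of "fst z" "snd z"] h(4)[OF that(2), of "fst z" "snd z"] that by auto
  thus False using box0[of b "snd z"] box0[of b' "snd z"] c(4)[OF `b ~= b'`] by linarith
 qed
 have F2D: "F2 s : D" for s
  unfolding F2_def using M(1) t0 by (intro sig(2) thtD) (auto simp: tri_bounds)
 have F2box: "F2 s = snd (ty b)" if b: "b : B" and s: "box b s" for b s
 proof -
  note s0 = box0[OF s]
  have "0 <= s 0 + 1/2" "s 0 + 1/2 <= 1" using s0 c(2)[of b] by linarith+
  hence t: "tht (tri (s 0 + 1/2)) = snd (ty b)" using cB[OF b s0] tri_id by simp
  have "abs (s e) <= 3/4" if e: "e < n" for e
  proof (cases "e = 0")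
   case True
   show ?thesis using s0 c(1,2)[of b] unfolding True by linarith
  next
   case False
   thus ?thesis using s e unfolding box_def by auto
  qed
  hence "mx n s <= 3/4" by (subst mx_le) auto
  hence "max 0 (min 1 (4 * (1 - mx n s))) = 1" by simp
  moreover have tD: "snd (ty b) : D" using TyD[of "fst (ty b)" "snd (ty b)"] tyB[OF b] by simp
  ultimately show ?thesis unfolding F2_def t using sig(4)[OF t0 tD, of "5 * M"] M(2)[OF t0 tD] M(1) by simp
 qed
 have F2c: "continuous_on (cube n) F2"
 proof -
  have "continuous_on (cube n) (%s. (t0, tht (tri (s 0 + 1/2)), 5 * M * max 0 (min 1 (4 * (1 - mx n s)))))"
   by (intro continuous_intros continuous_mx continuous_on_compose2[OF tht(1)] continuous_tri) (auto simp: tri_bounds)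
  hence "continuous_on (cube n) (%s. (%(u, w, z). sig u w z) (t0, tht (tri (s 0 + 1/2)), 5 * M * max 0 (min 1 (4 * (1 - mx n s)))))"
   by (rule continuous_on_compose2[OF sig(1)]) (use t0 thtD M(1) in "auto simp: tri_bounds")
  thus ?thesis by (simp add: F2_def[abs_def])
 qed
 have qt: "q (snd (ty b)) = x (fst (ty b))" if b: "b : B" for b
  using tyB[OF b] f.beta_alpha g.beta_alpha al(5) be(5) by (cases "ty b") (auto simp: Ty_def)
 let ?Z = "prism n"
 let ?h = "%j. bunch (a j) {b : B. fst (ty b) = j} h"
 \<comment> \<open>Both maps to \<open>D\<close> have become \<open>F2\<close>, which is constant on
   each box, and the boxes are disjoint; so the contents of all slabs are deformed simultaneously
   over a fixed map to \<open>X\<close>.\<close>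
 have mid: "chom n (espace X x A a) (q t0, a) (%s. (q (F2 s), %j. bunch (a j) {b : B. fst (ty b) = j} ga1 s))
   (%s. (q (F2 s), %j. bunch (a j) {b : B. fst (ty b) = j} ga2 s))"
 proof (rule espace_chomI[of _ _ "q o (F2 o snd)" _ ?h])
  show "cmap_on ?Z X (q o (F2 o snd))"
   by (rule cmap_comp[OF _ q], rule cmap_comp[of _ "top_of_set (cube n)"]) (use F2c F2D in "auto intro: continuous_intros")
  show "cmap_on ?Z (A j) (?h j)" for j
   by (rule continuous_bunch[OF finB _ A(3)]) (use h(1) hd in auto)
  show "(q o (F2 o snd)) z = x j & (ALL i. i ~= j --> ?h i z = a i)" if z: "z : ?Z" "?h j z ~= a j" for z j
  proof -
   obtain b where b: "b : B" "fst (ty b) = j" "h b z ~= a j" using bunch_ne[OF z(2)] by blast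
   have "?h i z = a i" if "i ~= j" for i
   proof (rule bunch_a, rule ccontr)
    fix b' assume "b' : {b : B. fst (ty b) = i}" "h b' z ~= a i"
    thus False using hd[OF b(1) _ z(1), of b'] b that by auto
   qed
   moreover have "box b (snd z)" using h(4)[OF b(1), of "fst z" "snd z"] b z by auto
   hence "F2 (snd z) = snd (ty b)" by (rule F2box[OF b(1)])
   ultimately show ?thesis using qt[OF b(1)] b by simp
  qed
  have nb: "~ box b s" if sb: "s : bdry n" for b s
  proof
   assume s: "box b s"
   have lt: "abs (s e) < 1" if e: "e < n" for e
   proof (cases "e = 0")
    case True
    show ?thesis using box0[OF s] c(1,2)[of b] unfolding True by linarith
   next
    case False
    hence "abs (s e - 0) <= 3/4" using s[unfolded box_def, rule_format, OF e] by simp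
    thus ?thesis by simp
   qed
   obtain e where "e < n" "abs (s e) = 1" using sb by (auto simp: bdry_def)
   thus False using lt[of e] by simp
  qed
  show "?h j (t, s) = a j" if "t : {0..1}" "s : bdry n" for t s j
   by (rule bunch_a) (use h(4) that nb subsetD[OF bdry_cube that(2)] in blast)
  show "(q o (F2 o snd)) (t, s) = q t0" if "t : {0..1}" "s : bdry n" for t s
  proof -
   have "mx n s = 1" using mx_bdry[of s n] that(2) bdry_cube by blast
   thus ?thesis using sig(3)[OF t0 thtD, of "tri (s 0 + 1/2)"] by (simp add: F2_def tri_bounds)
  qed
  show "?h j (0, s) = bunch (a j) {b : B. fst (ty b) = j} ga1 s" if "s : cube n" for s j
   using h(2)[OF _ that] by (intro bunch_cong) blast
  show "?h j (1, s) = bunch (a j) {b : B. fst (ty b) = j} ga2 s" if "s : cube n" for s j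
   using h(3)[OF _ that] by (intro bunch_cong) blast
 qed auto
 have e1: "chom n (espace X x A a) (q t0, a) (%s. (q (F s), %j. al j s)) (%s. (q (F s), %j. al' j s))"
  by (rule f.grid_chom) (use F q al(5) mx_bdry[OF subsetD[OF bdry_cube]] subsetD[OF bdry_cube] cmap_comp[of "top_of_set (cube n)" "top_of_set D" F X q] in "auto simp: o_def")
 have e2: "chom n (espace X x A a) (q t0, a) (%s. (q (G s), %j. be j s)) (%s. (q (G s), %j. be' j s))"
  by (rule g.grid_chom) (use G q be(5) mx_bdry[OF subsetD[OF bdry_cube]] subsetD[OF bdry_cube] cmap_comp[of "top_of_set (cube n)" "top_of_set D" G X q] in "auto simp: o_def")
 show ?thesis
  by (rule chom_trans[OF e1 chom_trans[OF ga1(1) chom_trans[OF mid chom_trans[OF chom_sym[OF ga2(1)] chom_sym[OF e2]]]]])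
qed

section \<open>Finite graphs and the tower of trees\<close>

text \<open>As a sum of two terms this also covers \<open>u = v\<close>, where it is constantly the
  vertex.\<close>

definition edge_point :: "'v => 'v => real => 'v => real" where
 "edge_point u v t i = (if i = u then 1 - t else 0) + (if i = v then t else 0)"

lemma geom_edge: "geom_simplex {u, v} = edge_point u v ` {0..1}"
proof (intro equalityI subsetI)
 fix y assume y: "y : geom_simplex {u, v}"
 show "y : edge_point u v ` {0..1}"
 proof (cases "u = v")
  case True
  hence "y = edge_point u v 0" using y by (auto simp: geom_simplex_def edge_point_def fun_eq_iff)
  thus ?thesis by (rule image_eqI) simp
 next
  case False
  hence s: "y u + y v = 1" "0 <= y u" "0 <= y v" using y by (auto simp: geom_simplex_def)
  have "y = edge_point u v (y v)" using y False s by (auto simp: geom_simplex_def edge_point_def fun_eq_iff)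
  thus ?thesis by (rule image_eqI) (use s in simp)
 qed
next
 fix y assume "y : edge_point u v ` {0..1}"
 thus "y : geom_simplex {u, v}" by (cases "u = v") (auto simp: geom_simplex_def edge_point_def)
qed

lemma edge_cases:
 assumes "finite sig" "sig ~= {}" "card sig <= 2" obtains u v where "sig = {u, v}"
proof -
 have "card sig = 1 | card sig = 2" using assms card_gt_0_iff[of sig] by linarith
 thus ?thesis
 proof
  assume "card sig = 1"
  then obtain u where "sig = {u}" by (rule card_1_singletonE)
  thus ?thesis using that[of u u] by simp
 next
  assume "card sig = 2"
  thus ?thesis using that by (auto simp: card_2_iff)
 qed
qed

lemma in_graph_sum:
 assumes "in_graph x" "finite S" "!!u. 0 < x u ==> u : S" shows "sum x S = 1"
proof -
 obtain u v t where uv: "u ~= v" "0 <= t" "t <= 1" and x: "x = (%i. if i = u then 1 - t else if i = v then t else 0)"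
  using assms(1) unfolding in_graph_def by blast
 have "sum x S = sum x (S Int {u, v})" using assms(2) by (intro sum.mono_neutral_right) (auto simp: x)
 also have "... = sum x {u, v}"
 proof (intro sum.mono_neutral_left ballI)
  fix i assume i: "i : {u, v} - S Int {u, v}"
  hence "~ 0 < x i" using assms(3) by blast
  thus "x i = 0" using in_graph_bounds[OF assms(1), of i] by simp
 qed auto
 also have "... = 1" using uv by (simp add: x)
 finally show ?thesis .
qed

lemma compact_realization:
 assumes K: "simplicial_cx K" "finite K" "!!sig. sig : K ==> card sig <= 2"
 shows "compact_space (realization K)"
proof -
 have "compactin (realization K) (geom_simplex sig)" if s: "sig : K" for sig
 proof -
  have "finite sig" "sig ~= {}" using K(1) s by (auto simp: simplicial_cx_def)
  then obtain u v where uv: "sig = {u, v}" using K(3)[OF s] by (rule edge_cases)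
  have gs: "geom_simplex sig = edge_point u v ` {0..1}" using geom_edge uv by simp
  have c1: "cmap_on {0..1} (powertop_real UNIV) (edge_point u v)"
   unfolding continuous_map_componentwise_UNIV
  proof
   fix k
   have "continuous_on {0..1} (%t. edge_point u v t k)"
    by (cases "k = u"; cases "k = v") (auto simp: edge_point_def intro!: continuous_intros)
   thus "cmap_on {0..1} euclideanreal (%t. edge_point u v t k)" by simp
  qed
  have "cmap_on {0..1} (realization K) (edge_point u v)"
   unfolding continuous_map_def
  proof (intro conjI allI impI)
   show "edge_point u v : topspace (top_of_set {0..1}) \<rightarrow> topspace (realization K)"
    using gs s by (auto simp: topspace_realization realization_carrier_def)
   fix U assume "openin (realization K) U"
   hence "openin (subtopology (powertop_real UNIV) (geom_simplex sig)) (U Int geom_simplex sig)"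
    using s by (simp add: openin_realization realization_open_def)
   then obtain O' where O': "openin (powertop_real UNIV) O'" "U Int geom_simplex sig = O' Int geom_simplex sig"
    by (auto simp: openin_subtopology)
   have "{t : topspace (top_of_set {0..1}). edge_point u v t : U} = {t : topspace (top_of_set {0..1}). edge_point u v t : O'}"
    using O'(2) gs by auto
   thus "openin (top_of_set {0..1}) {t : topspace (top_of_set {0..1}). edge_point u v t : U}"
    using openin_continuous_map_preimage[OF c1 O'(1)] by simp
  qed
  hence "compactin (realization K) (edge_point u v ` {0..1})"
   by (rule image_compactin[rotated]) (simp add: compactin_subtopology)
  thus ?thesis using gs by simp
 qed
 hence "compactin (realization K) (\<Union>(geom_simplex ` K))" using K(2) by (intro compactin_Union) auto
 thus ?thesis by (simp add: compact_space_def topspace_realization realization_carrier_def)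
qed

text \<open>Numbering the vertices of a finite graph turns barycentric coordinates into functions on \<open>nat\<close>.\<close>

lemma graph_embedding:
 assumes "finite_graph G"
 obtains e g Ga V where "homeomorphic_maps G (top_of_set Ga) e g" "!!x. x : Ga ==> in_graph x"
  "!!x u. x : Ga ==> (V::nat) <= u ==> x u = 0"
  "!!x x'. x : Ga ==> in_graph x' ==> (!!u. 0 < x' u ==> 0 < x u) ==> x' : Ga"
proof -
 obtain K :: "'a set set" where K: "simplicial_cx K" "finite K" "!!sig. sig : K ==> card sig <= 2" and h: "G homeomorphic_space realization K"
  using assms unfolding finite_graph_def by blast
 obtain f f' where f: "homeomorphic_maps G (realization K) f f'" using h unfolding homeomorphic_space_def by blast
 have fin: "finite sig" "sig ~= {}" if "sig : K" for sig using that K(1) by (auto simp: simplicial_cx_def)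
 have "finite (\<Union>K)" using K(2) fin by blast
 then obtain nv where nv: "bij_betw nv {0..<card (\<Union>K)} (\<Union>K)" using ex_bij_betw_nat_finite by blast
 let ?N = "card (\<Union>K)"
 define B where "B y i = (if i < ?N then y (nv i) else 0)" for y :: "'a => real" and i
 have vert: "EX k<?N. u = nv k" if "u : sig" "sig : K" for u sig
 proof -
  have "u : nv ` {0..<?N}" using nv that by (auto simp: bij_betw_def)
  thus ?thesis by auto
 qed
 have nvi: "nv i = nv k \<longleftrightarrow> i = k" if "i < ?N" "k < ?N" for i k using nv that by (auto simp: bij_betw_def inj_on_def)
 have B1: "continuous_map (powertop_real UNIV) (powertop_real UNIV) B"
  unfolding continuous_map_componentwise_UNIV B_def
 proof
  fix i show "continuous_map (powertop_real UNIV) euclideanreal (%y. if i < ?N then y (nv i) else 0)"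
   by (cases "i < ?N") (auto intro: continuous_map_product_projection)
 qed
 have B2: "continuous_map (realization K) euclidean B"
  using cmap_comp[OF continuous_realization_id B1] by (simp add: euclidean_product_topology o_def)
 let ?Ga = "B ` realization_carrier K"
 have supp: "y i = 0" if "y : geom_simplex sig" "i ~: sig" for y i sig using that by (auto simp: geom_simplex_def)
 have inj: "inj_on B (realization_carrier K)"
 proof (rule inj_onI, rule ext)
  fix y y' i assume y: "y : realization_carrier K" "y' : realization_carrier K" "B y = B y'"
  obtain sig sig' where s: "sig : K" "y : geom_simplex sig" "sig' : K" "y' : geom_simplex sig'"
   using y by (auto simp: realization_carrier_def)
  show "y i = y' i"
  proof (cases "i : \<Union>K")
   case True
   then obtain k where "k < ?N" "i = nv k" using vert by blast
   thus ?thesis using fun_cong[OF y(3), of k] by (simp add: B_def)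
  next
   case False
   thus ?thesis using supp s by (metis UnionI)
  qed
 qed
 have "homeomorphic_map (realization K) (top_of_set ?Ga) B"
 proof (rule continuous_imp_homeomorphic_map[OF _ compact_realization[OF K]])
  show "continuous_map (realization K) (top_of_set ?Ga) B"
   using B2 by (auto simp: continuous_map_in_subtopology topspace_realization)
  show "Hausdorff_space (top_of_set ?Ga)" by (intro Hausdorff_space_subtopology) simp
 qed (use inj in "auto simp: topspace_realization")
 then obtain B' where B': "homeomorphic_maps (realization K) (top_of_set ?Ga) B B'" unfolding homeomorphic_map_maps by blast
 show ?thesis
 proof (rule that[of ?Ga "B o f" "f' o B'" ?N])
  show "homeomorphic_maps G (top_of_set ?Ga) (B o f) (f' o B')" by (rule homeomorphic_maps_compose[OF conjI[OF f B']])
  show "x u = 0" if "x : ?Ga" "?N <= u" for x u using that by (auto simp: B_def)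
  show "in_graph x" if x: "x : ?Ga" for x
  proof -
   obtain sig y where s: "sig : K" "y : geom_simplex sig" "x = B y" using x by (auto simp: realization_carrier_def)
   obtain u v where uv: "sig = {u, v}" using edge_cases[OF fin[OF s(1)] K(3)[OF s(1)]] .
   obtain t where t: "t : {0..1}" "y = edge_point u v t" using s(2) unfolding uv geom_edge by blast
   obtain k l where kl: "k < ?N" "u = nv k" "l < ?N" "v = nv l" using vert[of u sig] vert[of v sig] uv s(1) by auto
   show ?thesis
   proof (cases "k = l")
    case True
    have "x = (%i. if i = k then 1 - 0 else if i = Suc k then 0 else 0)"
     using kl True nvi by (auto simp: s(3) t(2) B_def edge_point_def fun_eq_iff)
    thus ?thesis unfolding in_graph_def by (intro exI[of _ k] exI[of _ "Suc k"] exI[of _ 0]) simp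
   next
    case False
    have "x = (%i. if i = k then 1 - t else if i = l then t else 0)"
     using kl False nvi by (auto simp: s(3) t(2) B_def edge_point_def fun_eq_iff)
    thus ?thesis unfolding in_graph_def using False t(1) by (intro exI[of _ k] exI[of _ l] exI[of _ t]) simp
   qed
  qed
  show "x' : ?Ga" if x: "x : ?Ga" and x': "in_graph x'" "!!u. 0 < x' u ==> 0 < x u" for x x'
  proof -
   obtain sig y where s: "sig : K" "y : geom_simplex sig" "x = B y" using x by (auto simp: realization_carrier_def)
   define y' where "y' v = (if v : \<Union>K then x' (inv_into {0..<?N} nv v) else 0)" for v
   have y'n: "y' (nv k) = x' k" if "k < ?N" for k
    using that nv bij_betw_apply[OF nv, of k] by (simp add: y'_def bij_betw_def inv_into_f_f)
   have x'0: "x' i = 0" if "~ i < ?N" for i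
   proof -
    have "~ 0 < x' i" using x'(2)[of i] that by (auto simp: s(3) B_def)
    thus ?thesis using in_graph_bounds[OF x'(1), of i] by simp
   qed
   have By: "B y' = x'" using y'n x'0 by (auto simp: B_def fun_eq_iff)
   have y'0: "0 <= y' v" for v using in_graph_bounds[OF x'(1)] by (auto simp: y'_def)
   have y's: "v : sig" if "y' v ~= 0" for v
   proof -
    have "v : \<Union>K" using that by (auto simp: y'_def split: if_splits)
    then obtain k where k: "k < ?N" "v = nv k" using vert by blast
    hence "0 < x' k" using that y'n[OF k(1)] in_graph_bounds[OF x'(1), of k] by simp
    hence "0 < x k" by (rule x'(2))
    hence "y v ~= 0" using k by (simp add: s(3) B_def)
    thus ?thesis using supp[OF s(2)] by blast
   qed
   let ?tau = "{v. y' v ~= 0}"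
   have tau: "?tau <= sig" using y's by blast
   have ft: "finite ?tau" using tau fin(1)[OF s(1)] finite_subset by blast
   have "sum x' {0..<?N} = 1" by (rule in_graph_sum[OF x'(1)]) (use x'0 in force)+
   also have "sum x' {0..<?N} = (\<Sum>k\<in>{0..<?N}. y' (nv k))" using y'n by (intro sum.cong) auto
   also have "... = sum y' (\<Union>K)" by (rule sum.reindex_bij_betw[OF nv])
   also have "sum y' (\<Union>K) = sum y' ?tau"
    using `finite (\<Union>K)` tau s(1) by (intro sum.mono_neutral_right) auto
   finally have sm: "sum y' ?tau = 1" by simp
   hence "?tau ~= {}" by (metis sum.empty zero_neq_one)
   hence "?tau : K" using tau s(1) K(1) unfolding simplicial_cx_def by blast
   moreover have "y' : geom_simplex ?tau" using sm y'0 by (auto simp: geom_simplex_def)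
   ultimately have "y' : realization_carrier K" by (auto simp: realization_carrier_def)
   thus ?thesis using By by (metis imageI)
  qed
 qed
qed

section \<open>Shells of the cube and limits of trees\<close>

definition corner :: "nat => nat => real" where "corner n = (%i. if i < n then 1 else 0)"

lemma corner_cube: "corner n : cube n"
 by (simp add: corner_def cube_def)

lemma cube_contract:
 assumes "s : cube n" "s' : cube n" "t : {0..1}" shows "(%e. s e + t * (s' e - s e)) : cube n"
proof -
 have "-1 <= s e + t * (s' e - s e) & s e + t * (s' e - s e) <= 1" if "e < n" for e
 proof -
  have "abs (s e - 0) <= 1" "abs (s' e - 0) <= 1" using assms that by (auto simp: cube_def abs_le_iff)
  from convex_close[OF _ _ this, of t] assms(3) show ?thesis by (simp add: abs_le_iff)
 qed
 thus ?thesis using assms by (auto simp: cube_def)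
qed

lemma connected_cube: "connected (cube n)"
 by (rule star_connected[OF corner_cube cube_contract[OF corner_cube]])

text \<open>The shell is the union of the sets \<open>P i c\<close> on which one coordinate is large
  with a fixed sign. Each is star-shaped, the positive ones share the corner, and a negative one
  meets the positive one of another coordinate, which exists as \<open>n >= 2\<close>.\<close>

lemma connected_shell:
 assumes n: "2 <= n" and r: "0 < r" "r <= 1" shows "connected {s : cube n. r <= mx n s}"
proof -
 define P where "P i c = {s : cube n. r <= c * s i}" for i :: nat and c :: real
 have Pc: "connected (P i c)" if i: "i < n" and c: "c = 1 | c = -1" for i c
 proof (rule star_connected[of "%e. if e < n then c else 0"])
  have cc: "(%e. if e < n then c else 0) : cube n" using c by (auto simp: cube_def)
  show "(%e. if e < n then c else 0) : P i c" using cc i c r by (auto simp: P_def)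
  fix s and t :: real assume s: "s : P i c" and t: "t : {0..1}"
  have 1: "r <= c * s i" "c * c = 1" using s c by (auto simp: P_def)
  have "c * (c + t * (s i - c)) = (1 - t) * (c * c) + t * (c * s i)" by (simp add: algebra_simps)
  moreover have "(1 - t) * r + t * r <= (1 - t) * (c * c) + t * (c * s i)" using t 1 r by (intro add_mono mult_left_mono) auto
  moreover have "(1 - t) * r + t * r = r" by (simp add: algebra_simps)
  ultimately have "r <= c * (c + t * (s i - c))" by linarith
  thus "(%e. (if e < n then c else 0) + t * (s e - (if e < n then c else 0))) : P i c"
   using cube_contract[OF cc _ t, of s] s i by (auto simp: P_def)
 qed
 have sub: "P i c <= {s : cube n. r <= mx n s}" if "i < n" "c = 1 | c = -1" for i c
 proof
  fix s assume s: "s : P i c"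
  hence "r <= abs (s i)" using that(2) by (auto simp: P_def)
  thus "s : {s : cube n. r <= mx n s}" using s that(1) mx_ge[OF r(1), of n s] by (auto simp: P_def)
 qed
 have cor: "corner n : P i 1" if "i < n" for i using that r corner_cube[of n] by (auto simp: P_def corner_def)
 have ex: "EX C. connected C & C <= {s : cube n. r <= mx n s} & corner n : C & s : C" if s: "s : {s : cube n. r <= mx n s}" for s
 proof -
  obtain i where i: "i < n" "r <= abs (s i)" using s mx_ge[OF r(1), of n s] by auto
  show ?thesis
  proof (cases "0 <= s i")
   case True
   hence "s : P i 1" using i s by (auto simp: P_def)
   thus ?thesis using Pc[OF i(1), of 1] sub[OF i(1), of 1] cor[OF i(1)] by blast
  next
   case False
   hence sP: "s : P i (-1)" using i s by (auto simp: P_def)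
   define j where "j = (if i = 0 then 1 else 0::nat)"
   have j: "j < n" "j ~= i" using n by (auto simp: j_def)
   let ?z = "%e. if e = i then -1 else if e = j then 1 else (0::real)"
   have "?z : P i (-1) Int P j 1" using i j r by (auto simp: P_def cube_def)
   hence "connected (P i (-1) Un P j 1)" using Pc[OF i(1), of "-1"] Pc[OF j(1), of 1] by (intro connected_Un) auto
   thus ?thesis using sP cor[OF j(1)] sub[OF i(1), of "-1"] sub[OF j(1), of 1] by blast
  qed
 qed
 hence "connected_component {s : cube n. r <= mx n s} (corner n) s" if "s : {s : cube n. r <= mx n s}" for s
  unfolding connected_component_def using that by blast
 thus ?thesis unfolding connected_iff_connected_component
  by (metis (no_types, lifting) connected_component_sym connected_component_trans)
qed

text \<open>Local connectedness descends from the cube. For unicoherence, a separation of the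
  intersection of two continua would show up in a single coordinate far enough up the sequence,
  contradicting \<open>connected_Int_rtree\<close>.\<close>

lemma quotient_dendrite:
 fixes E :: "nat => (nat => real) => rtree"
 assumes E: "!!m. continuous_on (cube n) (E m)"
  and comp: "!!m s s'. s : cube n ==> s' : cube n ==> E (Suc m) s = E (Suc m) s' ==> E m s = E m s'"
 shows "dendrite ((%s m. E m s) ` cube n)"
proof -
 let ?E = "%s m. E m s" and ?D = "(%s m. E m s) ` cube n"
 have Ec: "continuous_on (cube n) ?E" by (rule continuous_on_coords[OF E])
 have compD: "compact ?D" by (rule compact_continuous_image[OF Ec compact_cube])
 have down: "u i = v i" if "u : ?D" "v : ?D" "u m = v m" "i <= m" for u v i m
  using that(4,3)
 proof (induction rule: dec_induct)
  case (step k)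
  thus ?case using comp that(1,2) by blast
 qed
 have coord: "continuous_on UNIV (%u :: nat => rtree. u M)" for M
  by (rule continuous_on_coord[OF continuous_on_id])
 show ?thesis
 proof
  show "compact ?D" by (rule compD)
  show "connected ?D" by (rule connected_continuous_image[OF Ec connected_cube])
 next
  fix e :: real assume e: "0 < e"
  show "EX d>0. ALL u:?D. ALL v:?D. dist u v < d --> (EX K. compact K & connected K & K <= ?D & u : K & v : K & K <= cball u e)"
  proof (rule ccontr)
   assume "~ ?thesis"
   hence "EX u v. u : ?D & v : ?D & dist u v < 1 / real (Suc k) & ~ (EX K. compact K & connected K & K <= ?D & u : K & v : K & K <= cball u e)" for k
    by (metis divide_pos_pos of_nat_0_less_iff zero_less_Suc zero_less_one)
   then obtain u v where uv: "!!k. u k : ?D" "!!k. v k : ?D" "!!k. dist (u k) (v k) < 1 / real (Suc k)"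
    "!!k. ~ (EX K. compact K & connected K & K <= ?D & u k : K & v k : K & K <= cball (u k) e)" by metis
   have "ALL k. EX z. z : cube n \<times> cube n & u k = ?E (fst z) & v k = ?E (snd z)"
   proof
    fix k
    obtain s s' where "s : cube n" "u k = ?E s" "s' : cube n" "v k = ?E s'" using uv(1)[of k] uv(2)[of k] by blast
    thus "EX z. z : cube n \<times> cube n & u k = ?E (fst z) & v k = ?E (snd z)" by (intro exI[of _ "(s, s')"]) simp
   qed
   then obtain z where z: "!!k. z k : cube n \<times> cube n" "!!k. u k = ?E (fst (z k))" "!!k. v k = ?E (snd (z k))" by metis
   have "seq_compact (cube n \<times> cube n)" by (intro compact_imp_seq_compact compact_Times compact_cube)
   then obtain z0 r where z0: "z0 : cube n \<times> cube n" "strict_mono (r :: nat => nat)" "(z o r) \<longlonglongrightarrow> z0"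
    using z(1) by (metis seq_compactE)
   obtain s t where st: "z0 = (s, t)" "s : cube n" "t : cube n" using z0(1) by auto
   have ls: "(%k. fst (z (r k))) \<longlonglongrightarrow> s" "(%k. snd (z (r k))) \<longlonglongrightarrow> t"
    using tendsto_fst[OF z0(3)] tendsto_snd[OF z0(3)] st(1) by (simp_all add: o_def)
   have lu: "(%k. u (r k)) \<longlonglongrightarrow> ?E s" "(%k. v (r k)) \<longlonglongrightarrow> ?E t"
    unfolding z using continuous_on_tendsto_compose[OF Ec ls(1) st(2)] continuous_on_tendsto_compose[OF Ec ls(2) st(3)] z(1)
    by (auto simp: mem_Times_iff)
   have "(%k. dist (u (r k)) (v (r k))) \<longlonglongrightarrow> 0"
   proof (rule tendsto_sandwich[of "%_. 0" _ _ "%k. 1 / real (Suc k)"])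
    show "\<forall>\<^sub>F k in sequentially. dist (u (r k)) (v (r k)) <= 1 / real (Suc k)"
    proof (intro always_eventually allI)
     fix k
     have "1 / real (Suc (r k)) <= 1 / real (Suc k)" using seq_suble[OF z0(2), of k] by (simp add: frac_le)
     thus "dist (u (r k)) (v (r k)) <= 1 / real (Suc k)" using uv(3)[of "r k"] by linarith
    qed
    show "(%k. 1 / real (Suc k)) \<longlonglongrightarrow> 0" using LIMSEQ_inverse_real_of_nat by (simp add: inverse_eq_divide)
   qed auto
   hence "dist (?E s) (?E t) = 0" using LIMSEQ_unique tendsto_dist[OF lu] by blast
   hence eq: "?E s = ?E t" by simp
   \<comment> \<open>Two sequences whose images approach each other have limits \<open>s\<close> and
     \<open>t\<close> with the same image. The images of small connected neighbourhoods of
     \<open>s\<close> and \<open>t\<close> meet in it, and their closures form the small continuum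
     that was denied.\<close>
   have nb: "EX V. openin (top_of_set (cube n)) V & p : V & connected V & V <= cube n & ?E ` V <= ball (?E p) (e/3)" if p: "p : cube n" for p
   proof -
    have "openin (top_of_set (cube n)) (cube n Int ?E -` ball (?E p) (e/3))"
     by (rule continuous_openin_preimage_gen[OF Ec]) simp
    moreover have "p : cube n Int ?E -` ball (?E p) (e/3)" using p e by simp
    ultimately obtain V where "openin (top_of_set (cube n)) V" "p : V" "V <= cube n Int ?E -` ball (?E p) (e/3)" "connected V"
     by (rule cube_nbhd)
    thus ?thesis by (intro exI[of _ V]) blast
   qed
   obtain V where V: "openin (top_of_set (cube n)) V" "s : V" "connected V" "V <= cube n" "?E ` V <= ball (?E s) (e/3)" using nb[OF st(2)] by blast
   obtain W where W: "openin (top_of_set (cube n)) W" "t : W" "connected W" "W <= cube n" "?E ` W <= ball (?E t) (e/3)" using nb[OF st(3)] by blast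
   have ev: "\<forall>\<^sub>F k in sequentially. f k : O'" if op: "openin (top_of_set (cube n)) O'" "f \<longlonglongrightarrow> p" "p : O'" "!!k. f k : cube n" for f p O'
   proof -
    obtain Q where Q: "open Q" "O' = cube n Int Q" using op(1) by (auto simp: openin_open)
    hence "\<forall>\<^sub>F k in sequentially. f k : Q" using topological_tendstoD[OF op(2) Q(1)] op(3) by blast
    thus ?thesis using Q op(4) by (auto elim: eventually_mono)
   qed
   have zc: "fst (z k) : cube n" "snd (z k) : cube n" for k using z(1)[of k] by (auto simp: mem_Times_iff)
   have "\<forall>\<^sub>F k in sequentially. fst (z (r k)) : V & snd (z (r k)) : W"
    by (intro eventually_conj ev[OF V(1) ls(1) V(2)] ev[OF W(1) ls(2) W(2)] zc)
   then obtain k where k: "fst (z (r k)) : V" "snd (z (r k)) : W" by (auto simp: eventually_sequentially)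
   let ?K = "closure (?E ` V) Un closure (?E ` W)"
   have cV: "continuous_on V ?E" "continuous_on W ?E" using continuous_on_subset[OF Ec] V(4) W(4) by auto
   have cl: "closure (?E ` V) <= ?D" "closure (?E ` W) <= ?D"
    using V(4) W(4) by (intro closure_minimal image_mono compact_imp_closed[OF compD]; simp)+
   have KD: "?K <= ?D" using cl by simp
   have "closed ?K" by (intro closed_Un closed_closure)
   hence "compact (?D Int ?K)" by (rule compact_Int_closed[OF compD])
   hence cK: "compact ?K" using KD by (simp add: Int_absorb1)
   have "connected (closure (?E ` V))" "connected (closure (?E ` W))"
    using connected_continuous_image[OF cV(1) V(3)] connected_continuous_image[OF cV(2) W(3)] by (auto intro: connected_imp_connected_closure)
   moreover have "?E s : ?E ` V" using V(2) by (rule imageI)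
   hence "?E s : closure (?E ` V)" by (rule subsetD[OF closure_subset])
   moreover have "?E s : ?E ` W" unfolding eq using W(2) by (rule imageI)
   hence "?E s : closure (?E ` W)" by (rule subsetD[OF closure_subset])
   ultimately have conK: "connected ?K" by (intro connected_Un) auto
   have "closure (?E ` V) <= cball (?E s) (e/3)" "closure (?E ` W) <= cball (?E s) (e/3)"
    using V(5) W(5) eq by (intro closure_minimal; auto simp: less_imp_le subset_iff)+
   hence small: "?K <= cball (?E s) (e/3)" by simp
   have in1: "u (r k) : ?K" "v (r k) : ?K"
   proof -
    have "u (r k) : ?E ` V" "v (r k) : ?E ` W" unfolding z(2,3) using k by (auto intro: imageI)
    note uvE = this
    show "u (r k) : ?K" by (rule UnI1[OF subsetD[OF closure_subset uvE(1)]])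
    show "v (r k) : ?K" by (rule UnI2[OF subsetD[OF closure_subset uvE(2)]])
   qed
   have "?K <= cball (u (r k)) e"
   proof
    fix y assume "y : ?K"
    hence "dist (?E s) y <= e/3" "dist (?E s) (u (r k)) <= e/3" using small in1(1) by (auto simp: subset_iff)
    thus "y : cball (u (r k)) e" using dist_triangle[of "u (r k)" y "?E s"] e by (simp add: dist_commute)
   qed
   thus False using uv(4)[of "r k"] cK conK KD in1 by blast
  qed
 next
  fix K L assume K: "compact K" "connected K" "K <= ?D" and L: "compact L" "connected L" "L <= ?D"
  show "connected (K Int L)"
  proof (rule ccontr)
   assume "~ connected (K Int L)"
   then obtain A0 B0 where AB0: "closed A0" "closed B0" "K Int L <= A0 Un B0" "A0 Int B0 Int (K Int L) = {}" "A0 Int (K Int L) ~= {}" "B0 Int (K Int L) ~= {}"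
    unfolding connected_closed by blast
   define A where "A = A0 Int (K Int L)"
   define B where "B = B0 Int (K Int L)"
   have clKL: "closed (K Int L)" using K(1) L(1) by (intro closed_Int compact_imp_closed)
   have AB: "closed A" "closed B" "K Int L = A Un B" "A Int B = {}" "A ~= {}" "B ~= {}"
    using AB0 clKL by (auto simp: A_def B_def)
   define U where "U = {y. infdist y A < infdist y B}"
   define W where "W = {y. infdist y B < infdist y A}"
   have UW: "U Int W = {}" by (auto simp: U_def W_def)
   have oU: "open U" "open W" unfolding U_def W_def by (intro open_Collect_less continuous_on_infdist continuous_on_id)+
   have pos: "0 < infdist y C" if "closed C" "C ~= {}" "y ~: C" for y :: "nat => rtree" and C
    using in_closed_iff_infdist_zero[OF that(1,2), of y] that(3) infdist_nonneg[of y C] by simp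
   have AU: "A <= U" "B <= W"
   proof -
    have "infdist y A < infdist y B" if "y : A" for y
     using pos[OF AB(2,6), of y] that AB(4) by auto
    moreover have "infdist y B < infdist y A" if "y : B" for y
     using pos[OF AB(1,5), of y] that AB(4) by auto
    ultimately show "A <= U" "B <= W" unfolding U_def W_def by blast+
   qed
   let ?O = "%k l. k : U & l : U | k : W & l : W"
   \<comment> \<open>Otherwise there are pairs agreeing in ever higher coordinates but not lying on
     the same side. By \<open>down\<close> they agree in all lower ones too, so a limit pair is a
     single point of the intersection; it lies in \<open>U\<close> or in \<open>W\<close>, and so do
     nearby pairs.\<close>
   have "EX M. ALL k:K. ALL l:L. k M = l M --> ?O k l"
   proof (rule ccontr)
    assume "~ ?thesis"
    hence "ALL M. EX z. z : K \<times> L & fst z M = snd z M & ~ ?O (fst z) (snd z)" by force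
    then obtain z where z: "!!M. z M : K \<times> L" "!!M. fst (z M) M = snd (z M) M" "!!M. ~ ?O (fst (z M)) (snd (z M))" by metis
    have "seq_compact (K \<times> L)" by (intro compact_imp_seq_compact compact_Times K(1) L(1))
    then obtain z0 r where z0: "z0 : K \<times> L" "strict_mono (r :: nat => nat)" "(z o r) \<longlonglongrightarrow> z0"
     using z(1) by (metis seq_compactE)
    obtain k l where kl: "z0 = (k, l)" "k : K" "l : L" using z0(1) by auto
    have lk: "(%i. fst (z (r i))) \<longlonglongrightarrow> k" "(%i. snd (z (r i))) \<longlonglongrightarrow> l"
     using tendsto_fst[OF z0(3)] tendsto_snd[OF z0(3)] kl(1) by (simp_all add: o_def)
    have "k M = l M" for M
    proof (rule LIMSEQ_unique)
     show "(%i. fst (z (r i)) M) \<longlonglongrightarrow> k M" by (rule continuous_on_tendsto_compose[OF coord lk(1)]) auto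
     have "(%i. snd (z (r i)) M) \<longlonglongrightarrow> l M" by (rule continuous_on_tendsto_compose[OF coord lk(2)]) auto
     moreover have "\<forall>\<^sub>F i in sequentially. snd (z (r i)) M = fst (z (r i)) M"
     proof (rule eventually_sequentiallyI[of M])
      fix i assume "M <= i"
      hence "M <= r i" using seq_suble[OF z0(2), of i] by linarith
      thus "snd (z (r i)) M = fst (z (r i)) M"
       using down[of "fst (z (r i))" "snd (z (r i))" "r i" M] z(1)[of "r i"] z(2)[of "r i"] K(3) L(3)
       unfolding mem_Times_iff by (metis subsetD)
     qed
     ultimately show "(%i. fst (z (r i)) M) \<longlonglongrightarrow> l M" by (rule Lim_transform_eventually)
    qed
    hence kl': "k = l" by blast
    hence "k : U | k : W" using kl AB(3) AU by blast
    thus False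
    proof
     assume kU: "k : U"
     hence "\<forall>\<^sub>F i in sequentially. fst (z (r i)) : U & snd (z (r i)) : U"
      using topological_tendstoD[OF lk(1) oU(1)] topological_tendstoD[OF lk(2) oU(1)] kl' by (intro eventually_conj) auto
     thus False using z(3) by (auto simp: eventually_sequentially)
    next
     assume kW: "k : W"
     hence "\<forall>\<^sub>F i in sequentially. fst (z (r i)) : W & snd (z (r i)) : W"
      using topological_tendstoD[OF lk(1) oU(2)] topological_tendstoD[OF lk(2) oU(2)] kl' by (intro eventually_conj) auto
     thus False using z(3) by (auto simp: eventually_sequentially)
    qed
   qed
   then obtain M where M: "!!k l. k : K ==> l : L ==> k M = l M ==> ?O k l" by blast
   let ?rh = "%u :: nat => rtree. u M"
   have conn: "connected (?rh ` K Int ?rh ` L)"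
    by (intro connected_Int_rtree connected_continuous_image[OF continuous_on_subset[OF coord]] K(2) L(2)) auto
   define C where "C = {z : K \<times> L. fst z M = snd z M}"
   have cc: "continuous_on UNIV (%z :: (nat => rtree) \<times> (nat => rtree). fst z M)" "continuous_on UNIV (%z :: (nat => rtree) \<times> (nat => rtree). snd z M)"
    by (rule continuous_on_compose2[OF coord]; auto intro: continuous_intros)+
   have "closed {z :: (nat => rtree) \<times> (nat => rtree). fst z M = snd z M}" by (rule closed_Collect_eq[OF cc])
   moreover have "C = (K \<times> L) Int {z. fst z M = snd z M}" by (auto simp: C_def)
   ultimately have Cc: "compact C" using compact_Int_closed[OF compact_Times[OF K(1) L(1)]] by simp
   define CU where "CU = C Int (- (W \<times> UNIV))"
   define CW where "CW = C Int (- (U \<times> UNIV))"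
   have "compact CU" "compact CW" unfolding CU_def CW_def
    by (intro compact_Int_closed[OF Cc]; simp add: closed_def open_Times oU)+
   hence clS: "closed ((%z. fst z M) ` CU)" "closed ((%z. fst z M) ` CW)"
    by (intro compact_imp_closed compact_continuous_image continuous_on_subset[OF cc(1)]; simp)+
   have "~ connected (?rh ` K Int ?rh ` L)"
    unfolding connected_closed not_not
   proof (rule exI[of _ "(%z. fst z M) ` CU"], rule exI[of _ "(%z. fst z M) ` CW"], intro conjI)
    show "?rh ` K Int ?rh ` L <= (%z. fst z M) ` CU Un (%z. fst z M) ` CW"
    proof
     fix y assume "y : ?rh ` K Int ?rh ` L"
     then obtain k l where kl: "k : K" "l : L" "y = k M" "y = l M" by blast
     hence "(k, l) : C" "?O k l" using M[of k l] by (auto simp: C_def)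
     hence "(k, l) : CU | (k, l) : CW" using UW by (auto simp: CU_def CW_def)
     thus "y : (%z. fst z M) ` CU Un (%z. fst z M) ` CW" using kl(3) by force
    qed
    show "(%z. fst z M) ` CU Int (%z. fst z M) ` CW Int (?rh ` K Int ?rh ` L) = {}"
    proof (rule ccontr)
     assume "~ ?thesis"
     then obtain z z' where z: "z : CU" "z' : CW" "fst z M = fst z' M" by blast
     have a: "fst z : K" "snd z' : L" "fst z M = snd z' M" "fst z' : K" "fst z' M = snd z' M" "snd z : L" "fst z M = snd z M"
      using z by (auto simp: CU_def CW_def C_def)
     have "?O (fst z) (snd z')" "?O (fst z) (snd z)" "?O (fst z') (snd z')" using M a by auto
     moreover have "fst z ~: W" "fst z' ~: U" using z by (cases z; cases z'; auto simp: CU_def CW_def)+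
     ultimately show False using UW by blast
    qed
    show "(%z. fst z M) ` CU Int (?rh ` K Int ?rh ` L) ~= {}"
    proof -
     obtain k where k: "k : A" using AB(5) by blast
     hence "(k, k) : CU" using AB(3) AU UW by (auto simp: CU_def C_def)
     thus ?thesis using k AB(3) by force
    qed
    show "(%z. fst z M) ` CW Int (?rh ` K Int ?rh ` L) ~= {}"
    proof -
     obtain k where k: "k : B" using AB(6) by blast
     hence "(k, k) : CW" using AB(3) AU UW by (auto simp: CW_def C_def)
     thus ?thesis using k AB(3) by force
    qed
   qed (rule clS)+
   thus False using conn by blast
  qed
 qed
qed

lemma concat_continuous:
 assumes f: "cmap_on (cube n) Y f" "cmap_on (cube n) Y g"
  and b: "!!s. s : bdry n ==> f s = y0" "!!s. s : bdry n ==> g s = y0" and n: "0 < n"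
 shows "cmap_on (cube n) Y (%s. if s 0 <= 0 then f (s(0 := 2 * s 0 + 1)) else g (s(0 := 2 * s 0 - 1)))"
proof -
 let ?l = "%s :: nat => real. s(0 := 2 * s 0 + 1)" and ?r = "%s :: nat => real. s(0 := 2 * s 0 - 1)"
 have c: "continuous_on S ?l" "continuous_on S ?r" for S :: "(nat => real) set"
  by (rule continuous_on_coords, rename_tac i, case_tac "i = 0"; simp add: continuous_intros)+
 have lc: "?l s : cube n" if "s : cube n" "s 0 <= 0" for s using that n by (auto simp: cube_def)
 have rc: "?r s : cube n" if "s : cube n" "0 <= s 0" for s using that n by (auto simp: cube_def)
 have "cmap_on (cube n) Y (%s. if s 0 <= 0 then (f o ?l) s else (g o ?r) s)"
 proof (rule cmap_on_cases_le)
  show "cmap_on {s : cube n. s 0 <= 0} Y (f o ?l)"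
   by (rule cmap_comp[OF _ f(1)]) (use c lc in "auto simp: subtopology_subtopology")
  show "cmap_on {s : cube n. 0 <= s 0} Y (g o ?r)"
   by (rule cmap_comp[OF _ f(2)]) (use c rc in "auto simp: subtopology_subtopology")
  show "continuous_on (cube n) (%s. s 0)" by (rule coord_continuous)
  fix s assume s: "s : cube n" "s 0 = 0"
  have "?l s : bdry n" "?r s : bdry n" using lc[of s] rc[of s] s n by (auto simp: bdry_def intro!: exI[of _ 0])
  thus "(f o ?l) s = (g o ?r) s" using b by simp
 qed
 thus ?thesis unfolding o_def .
qed

locale tower =
 fixes n :: nat and X :: "'a topology" and Xm :: "nat => 'c topology" and bb :: "nat => 'c => 'c" and b :: "nat => 'a => 'c"
  and e :: "nat => 'c => nat => real" and g :: "nat => (nat => real) => 'c" and Ga :: "nat => (nat => real) set" and V :: "nat => nat"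
  and x0 :: 'a
 assumes n: "2 <= n" and hm: "!!m. homeomorphic_maps (Xm m) (top_of_set (Ga m)) (e m) (g m)"
  and Ga: "!!m x. x : Ga m ==> in_graph x" "!!m x u. x : Ga m ==> V m <= u ==> x u = 0"
   "!!m x x'. x : Ga m ==> in_graph x' ==> (!!u. 0 < x' u ==> 0 < x u) ==> x' : Ga m"
  and b: "!!m. continuous_map X (Xm m) (b m)" and bb: "!!m. continuous_map (Xm (Suc m)) (Xm m) (bb m)"
  and comp: "!!m p. p : topspace X ==> bb m (b (Suc m) p) = b m p"
  and inj: "!!p p'. p : topspace X ==> p' : topspace X ==> (!!m. b m p = b m p') ==> p = p'"
  and x0: "x0 : topspace X"
begin

definition Phi :: "nat => 'a => nat => real" where "Phi m p = e m (b m p)"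

lemma e_cont: "continuous_map (Xm m) (top_of_set (Ga m)) (e m)" and g_cont: "cmap_on (Ga m) (Xm m) (g m)"
 and ge: "y : topspace (Xm m) ==> g m (e m y) = y"
 using hm[of m] by (auto simp: homeomorphic_maps_def)

lemma b_top: "p : topspace X ==> b m p : topspace (Xm m)"
 using cmap_image[OF b] by blast

lemma e_Ga: "y : topspace (Xm m) ==> e m y : Ga m"
 using cmap_image[OF e_cont] by auto

lemma Phi_Ga: "p : topspace X ==> Phi m p : Ga m"
 unfolding Phi_def by (intro e_Ga b_top)

lemma e_inj: "y : topspace (Xm m) ==> y' : topspace (Xm m) ==> e m y = e m y' ==> y = y'"
 using ge by metis

definition vb :: "nat => nat" where "vb m = (SOME v. 0 < Phi m x0 v)"
text \<open>The common base point of all lifts to stage \<open>m\<close>, chosen in the star of a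
  one-letter word as \<open>rlift_compatible\<close> demands.\<close>

definition yb :: "nat => rtree" where "yb m = rlift [vb m] (Phi m x0)"

lemma vb: "0 < Phi m x0 (vb m)"
proof -
 obtain u v t where "u ~= v" "0 <= t" "t <= 1" "Phi m x0 = (%i. if i = u then 1 - t else if i = v then t else 0)"
  using Ga(1)[OF Phi_Ga[OF x0, of m]] unfolding in_graph_def by blast
 hence "0 < Phi m x0 u | 0 < Phi m x0 v" by (cases "t = 0") auto
 thus ?thesis unfolding vb_def by (metis someI_ex)
qed

lemma rproj_yb: "rproj (yb m) = Phi m x0"
 unfolding yb_def by (rule rproj_rlift) (use vb Ga(1)[OF Phi_Ga[OF x0]] in "auto simp: reduced_def")

lemma lift_cube:
 assumes ph: "cmap_on (cube n) X ph" "ph (corner n) = x0"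
 shows "EX F. continuous_on (cube n) F & (ALL s:cube n. rproj (F s) = Phi m (ph s)) & F (corner n) = yb m"
proof -
 have c: "cmap_on (cube n) (top_of_set (Ga m)) (%s. Phi m (ph s))"
  using cmap_comp[OF ph(1) cmap_comp[OF b e_cont]] by (simp add: Phi_def[abs_def] o_def)
 have phX: "ph s : topspace X" if "s : cube n" for s using cmap_image[OF ph(1)] that by auto
 obtain F where "continuous_on (cube n) F" "!!s. s : cube n ==> rproj (F s) = Phi m (ph s)" "F (corner n) = yb m"
 proof (rule rlift_exists[of "cube n" "corner n" "%(s, t). (%i. corner n i + t * (s i - corner n i))" "%s. Phi m (ph s)" "V m" "yb m"])
  show "continuous_on (cube n \<times> {0..1}) (%(s, t). (%i. corner n i + t * (s i - corner n i)))"
   unfolding case_prod_beta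
   by (intro continuous_on_coords continuous_intros continuous_on_coord[OF continuous_on_fst[OF continuous_on_id]])
  show "(case (z, t) of (s, t) => (%i. corner n i + t * (s i - corner n i))) : cube n" if "z : cube n" "t : {0..1}" for z t
   using cube_contract[OF corner_cube that] by simp
  show "continuous_on (cube n) (%s. Phi m (ph s))" using c by auto
  show "rproj (yb m) = Phi m (ph (corner n))" by (simp add: rproj_yb ph(2))
  show "in_graph (Phi m (ph z))" if "z : cube n" for z by (rule Ga(1)[OF Phi_Ga[OF phX[OF that]]])
  show "Phi m (ph z) u = 0" if "z : cube n" "V m <= u" for z u by (rule Ga(2)[OF Phi_Ga[OF phX[OF that(1)]] that(2)])
 qed (use compact_cube corner_cube in auto)
 thus ?thesis by blast
qed

lemma lift_homotopy:
 assumes R: "cmap_on (prism n) (Xm m) R" "R (0, corner n) = b m x0"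
 obtains L where "continuous_on (prism n) L" "!!z. z : prism n ==> rproj (L z) = e m (R z)" "L (0, corner n) = yb m"
proof -
 let ?Z = "prism n"
 have c: "cmap_on ?Z (top_of_set (Ga m)) (%z. e m (R z))"
  using cmap_comp[OF R(1) e_cont] by (simp add: o_def)
 hence eR: "e m (R z) : Ga m" if "z : ?Z" for z using that by auto
 show ?thesis
 proof (rule rlift_exists[of ?Z "(0, corner n)" "%(z, t). (t * fst z, %i. corner n i + t * (snd z i - corner n i))" "%z. e m (R z)" "V m" "yb m"])
  show "continuous_on (?Z \<times> {0..1}) (%(z, t). (t * fst z, %i. corner n i + t * (snd z i - corner n i)))"
   unfolding case_prod_beta
   by (intro continuous_on_Pair continuous_on_coords continuous_intros
     continuous_on_coord[OF continuous_on_snd[OF continuous_on_fst[OF continuous_on_id]]])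
  show "(case (z, t) of (z, t) => (t * fst z, %i. corner n i + t * (snd z i - corner n i))) : ?Z" if "z : ?Z" "t : {0..1}" for z t
   using cube_contract[OF corner_cube _ that(2), of "snd z" n] that by (auto simp: mult_le_one)
  show "continuous_on ?Z (%z. e m (R z))" using c by auto
  show "rproj (yb m) = e m (R (0, corner n))" using rproj_yb[of m] R(2) by (simp add: Phi_def)
  show "in_graph (e m (R z))" if "z : ?Z" for z by (rule Ga(1)[OF eR[OF that]])
  show "e m (R z) u = 0" if "z : ?Z" "V m <= u" for z u by (rule Ga(2)[OF eR[OF that(1)] that(2)])
  show "compact ?Z" by (intro compact_Times compact_cube compact_Icc)
 qed (use corner_cube that in "auto simp: prod_eq_iff")
qed

lemma lift_const:
 assumes F: "continuous_on C F" "connected C" and c: "!!z. z : C ==> rproj (F z) = w" and z: "z : C" "z' : C"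
 shows "F z = F z'"
 by (rule rlift_unique[OF F(2,1) continuous_on_const _ z(2) _ z(1), of "F z'"]) (use c z in auto)

lemma lift_step:
 assumes ph: "cmap_on (cube n) X ph"
  and F: "continuous_on (cube n) F" "!!s. s : cube n ==> rproj (F s) = Phi (Suc m) (ph s)" "F (corner n) = yb (Suc m)" "ph (corner n) = x0"
  and F': "continuous_on (cube n) F'" "!!s. s : cube n ==> rproj (F' s) = Phi m (ph s)"
  and s: "s : cube n" "s' : cube n" "F s = F s'"
 shows "F' s = F' s'"
proof (rule rlift_compatible[of "cube n" "corner n" F F' "Ga (Suc m)" "e m o bb m o g (Suc m)" "V m" "Phi (Suc m) x0" "vb (Suc m)"])
 have phX: "ph s : topspace X" if "s : cube n" for s using cmap_image[OF ph] that by auto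
 have G: "cmap_on (Ga (Suc m)) (top_of_set (Ga m)) (e m o bb m o g (Suc m))"
  using cmap_comp[OF g_cont[of "Suc m"] cmap_comp[OF bb e_cont]] by (simp add: o_assoc)
 hence GGa: "(e m o bb m o g (Suc m)) y : Ga m" if "y : Ga (Suc m)" for y using that by auto
 show "continuous_on (Ga (Suc m)) (e m o bb m o g (Suc m))" using G by auto
 show "in_graph ((e m o bb m o g (Suc m)) y)" if "y : Ga (Suc m)" for y by (rule Ga(1)[OF GGa[OF that]])
 show "(e m o bb m o g (Suc m)) y u = 0" if "y : Ga (Suc m)" "V m <= u" for y u by (rule Ga(2)[OF GGa[OF that(1)] that(2)])
 show "y' : Ga (Suc m)" if "y : Ga (Suc m)" "in_graph y'" "!!u. 0 < y' u ==> 0 < y u" for y y' by (rule Ga(3)[OF that])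
 show "rproj (F z) : Ga (Suc m)" if "z : cube n" for z unfolding F(2)[OF that] by (rule Phi_Ga[OF phX[OF that]])
 show "rproj (F' z) = (e m o bb m o g (Suc m)) (rproj (F z))" if "z : cube n" for z
  unfolding F(2)[OF that] F'(2)[OF that] using ge[OF b_top[OF phX[OF that]], of "Suc m"] comp[OF phX[OF that]] by (simp add: Phi_def)
 show "in_graph (Phi (Suc m) x0)" by (rule Ga(1)[OF Phi_Ga[OF x0]])
 show "F (corner n) = rlift [vb (Suc m)] (Phi (Suc m) x0)" using F(3) by (simp add: yb_def)
qed (use compact_cube connected_cube corner_cube vb F F' s in auto)

text \<open>Over the stage \<open>m\<close>, lifting a homotopy to the tree separates the parts of the map into \<open>A j\<close> lying over different points.\<close>

lemma stage_invariant:
 assumes A: "!!j. a j : topspace (A j)" "!!j. t1_space (A j)" and j: "j < k"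
  and ph: "cmap_on (cube n) X ph" "ph (corner n) = x0" and psi: "cmap_on (cube n) X psi" "psi (corner n) = x0"
  and F: "continuous_on (cube n) F" "!!s. s : cube n ==> rproj (F s) = Phi m (ph s)" "F (corner n) = yb m"
  and G: "continuous_on (cube n) G" "!!s. s : cube n ==> rproj (G s) = Phi m (psi s)" "G (corner n) = yb m"
  and hyp: "chom n (espace (Xm m) (%j. b m (x j)) A a) (b m x0, a)
    (%s. (b m (ph s), %j. if j < k then al j s else a j)) (%s. (b m (psi s), %j. if j < k then be j s else a j))"
 shows "chom n (A j) (a j) (%s. if F s = ka then al j s else a j) (%s. if G s = ka then be j s else a j)"
proof -
 let ?Z = "prism n"
 obtain H where H: "cmap_on ?Z (espace (Xm m) (%j. b m (x j)) A a) H"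
  "!!s. s : cube n ==> H (0, s) = (b m (ph s), %j. if j < k then al j s else a j)"
  "!!s. s : cube n ==> H (1, s) = (b m (psi s), %j. if j < k then be j s else a j)"
  "!!t s. t : {0..1} ==> s : bdry n ==> H (t, s) = (b m x0, a)"
  using hyp unfolding chom_def by blast
 define R where "R = fst o H"
 define h where "h z = snd (H z) j" for z
 have Rc: "cmap_on ?Z (Xm m) R" and hc: "cmap_on ?Z (A j) h"
  and supp: "!!z. z : ?Z ==> h z ~= a j ==> R z = b m (x j)"
  using H(1) unfolding continuous_espace_components by (auto simp: R_def h_def[abs_def])
 have cb: "corner n : bdry n" using corner_cube[of n] n by (auto simp: bdry_def corner_def intro!: exI[of _ 0])
 have Rb: "R (t, s) = b m x0" if "t : {0..1}" "s : bdry n" for t s using H(4)[OF that] by (simp add: R_def)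
 obtain L where L: "continuous_on ?Z L" "!!z. z : ?Z ==> rproj (L z) = e m (R z)" "L (0, corner n) = yb m"
  using lift_homotopy[OF Rc Rb[OF _ cb]] by auto
 have Lc: "continuous_on (cube n) (%s. L (t, s))" if "t : {0..1}" for t
  by (rule continuous_on_compose2[OF L(1)]) (use that in "auto intro!: continuous_intros")
 have "L (1, corner n) = L (0, corner n)"
 proof (rule lift_const[of "(%t. (t, corner n)) ` {0..1}" L])
  show "continuous_on ((%t. (t, corner n)) ` {0..1}) L" by (rule continuous_on_subset[OF L(1)]) (use corner_cube in auto)
  show "connected ((%t::real. (t, corner n)) ` {0..1})" by (intro connected_continuous_image continuous_intros) simp
  show "rproj (L z) = e m (b m x0)" if "z : (%t. (t, corner n)) ` {0..1}" for z
   using that L(2) Rb[OF _ cb] corner_cube[of n] by auto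
 qed auto
 hence L1: "L (1, corner n) = yb m" using L(3) by simp
 have LF: "L (0, s) = F s" if s: "s : cube n" for s
  by (rule rlift_unique[OF connected_cube Lc F(1) _ corner_cube _ s]) (use L F H(2) in "auto simp: Phi_def R_def")
 have LG: "L (1, s) = G s" if s: "s : cube n" for s
  by (rule rlift_unique[OF connected_cube Lc G(1) _ corner_cube _ s]) (use L L1 G H(3) in "auto simp: Phi_def R_def")
 have c: "cmap_on ?Z (A j) (%z. if L z = ka then h z else a j)"
 proof (rule continuous_res[OF hc A])
  fix z assume z: "z : topspace (top_of_set ?Z)" "h z ~= a j"
  let ?V = "?Z Int L -` ball (L z) (1/2)"
  have "openin (top_of_set ?Z) ?V" by (rule continuous_openin_preimage_gen[OF L(1)]) simp
  moreover have "z : ?V" using z(1) by simp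
  moreover have "L z' = L z" if "z' : ?V" "h z' ~= a j" for z'
  proof -
   have a: "rproj (L z') = rproj (L z)" using supp[of z'] supp[of z] that z L(2) by auto
   have r: "rlift (rnear (L z)) (rproj (L z')) = L z'" "rlift (rnear (L z)) (rproj (L z)) = L z"
    using rproj_inj_near(1)[of "L z" "L z'"] rproj_inj_near(1)[of "L z" "L z"] that(1) by auto
   show ?thesis by (rule trans[OF sym[OF r(1)[unfolded a]] r(2)])
  qed
  ultimately show "EX V. openin (top_of_set ?Z) V & z : V & (ALL z':V. h z' ~= a j --> L z' = L z)" by blast
 qed
 show ?thesis unfolding chom_def
 proof (intro exI[of _ "%z. if L z = ka then h z else a j"] conjI ballI c)
  fix t :: real and s assume "t : {0..1}" "s : bdry n"
  thus "(if L (t, s) = ka then h (t, s) else a j) = a j" using H(4) by (simp add: h_def)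
 qed (use LF LG H(2,3) j in "auto simp: h_def")
qed

lemma espace_injective:
 fixes A :: "nat => 'b topology"
 assumes A: "!!j. well_pointed (A j) (a j)" "!!j. t1_space (A j)" "!!j. a j : topspace (A j)" "!!j. k_connected_space (n - 1) (A j)"
  and f: "cmap_on (cube n) (espace X x A a) f" "!!s. s : cube n ==> 1/2 <= mx n s ==> f s = (x0, a)"
  and g: "cmap_on (cube n) (espace X x A a) f'" "!!s. s : cube n ==> 1/2 <= mx n s ==> f' s = (x0, a)"
  and hyp: "!!k m. chom n (espace (Xm m) (%j. b m (x j)) A a) (b m x0, a)
    (%s. (b m (fst (f s)), %j. if j < k then snd (f s) j else a j)) (%s. (b m (fst (f' s)), %j. if j < k then snd (f' s) j else a j))"
 shows "chom n (espace X x A a) (x0, a) f f'"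
proof -
 define ph where "ph = fst o f"
 define psi where "psi = fst o f'"
 define al where "al j s = snd (f s) j" for j s
 define be where "be j s = snd (f' s) j" for j s
 have ff: "f s = (ph s, %j. al j s)" "f' s = (psi s, %j. be j s)" for s by (simp_all add: ph_def al_def psi_def be_def)
 have ph: "cmap_on (cube n) X ph" "!!j. cmap_on (cube n) (A j) (al j)"
  "!!s j. s : cube n ==> al j s ~= a j ==> ph s = x j & (ALL i. i ~= j --> al i s = a i)"
  using f(1) unfolding continuous_espace_components by (auto simp: ph_def al_def[abs_def])
 have psi: "cmap_on (cube n) X psi" "!!j. cmap_on (cube n) (A j) (be j)"
  "!!s j. s : cube n ==> be j s ~= a j ==> psi s = x j & (ALL i. i ~= j --> be i s = a i)"
  using g(1) unfolding continuous_espace_components by (auto simp: psi_def be_def[abs_def])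
 have out: "ph s = x0" "psi s = x0" "al j s = a j" "be j s = a j" if "s : cube n" "1/2 <= mx n s" for s j
  using f(2)[OF that] g(2)[OF that] by (auto simp: ff dest: fun_cong)
 have bh: "s : cube n & 1/2 <= mx n s" if "s : bdry n" for s
  using mx_bdry[of s n] that bdry_cube by fastforce
 have cb: "corner n : bdry n" using corner_cube[of n] n by (auto simp: bdry_def corner_def intro!: exI[of _ 0])
 have cor: "ph (corner n) = x0" "psi (corner n) = x0" using out bh[OF cb] by auto
 obtain F where F: "!!m. continuous_on (cube n) (F m)" "!!m s. s : cube n ==> rproj (F m s) = Phi m (ph s)" "!!m. F m (corner n) = yb m"
  using lift_cube[OF ph(1) cor(1)] by metis
 obtain G where G: "!!m. continuous_on (cube n) (G m)" "!!m s. s : cube n ==> rproj (G m s) = Phi m (psi s)" "!!m. G m (corner n) = yb m"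
  using lift_cube[OF psi(1) cor(2)] by metis
 \<comment> \<open>Where a map is constantly \<open>x0\<close>, its lift is constant on connected
   sets; the shell is connected because \<open>n >= 2\<close>.\<close>
 have shell: "L (s::nat => real) = L (corner n)"
  if L: "continuous_on (cube n) L" "!!s. s : cube n ==> rproj (L s) = Phi m (rh s)" "!!s. s : cube n ==> 1/2 <= mx n s ==> rh s = x0"
   and s: "s : cube n" "1/2 <= mx n s" for L m rh s
 proof (rule lift_const[of "{s : cube n. 1/2 <= mx n s}" L])
  show "continuous_on {s : cube n. 1/2 <= mx n s} L" by (rule continuous_on_subset[OF L(1)]) auto
  show "connected {s : cube n. 1/2 <= mx n s}" by (rule connected_shell[OF n]) auto
  show "rproj (L z) = Phi m x0" if "z : {s : cube n. 1/2 <= mx n s}" for z using L(2,3) that by simp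
 qed (use s bh[OF cb] in auto)
 have Fo: "F m s = yb m" and Go: "G m s = yb m" if "s : cube n" "1/2 <= mx n s" for m s
  using shell[OF F(1,2) out(1) that] shell[OF G(1,2) out(2) that] F(3) G(3) by auto
 \<comment> \<open>The two projections are put side by side along coordinate 0 to form one map. Its
   lifts contain those of both, so a single dendrite serves \<open>f\<close> and
   \<open>f'\<close>.\<close>
 let ?l = "%s :: nat => real. s(0 := 2 * s 0 + 1)" and ?r = "%s :: nat => real. s(0 := 2 * s 0 - 1)"
 define om where "om s = (if s 0 <= 0 then ph (?l s) else psi (?r s))" for s
 define E where "E m s = (if s 0 <= 0 then F m (?l s) else G m (?r s))" for m s
 have s0: "-1 <= s 0 & s 0 <= 1" if "s : cube n" for s using that n by (auto simp: cube_def)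
 have upd: "s(0 := y) : cube n" if "s : cube n" "-1 <= y" "y <= 1" for s y using that n by (auto simp: cube_def)
 have lc: "?l s : cube n" if "s : cube n" "s 0 <= 0" for s by (rule upd) (use that s0[OF that(1)] in linarith)+
 have rc: "?r s : cube n" if "s : cube n" "0 <= s 0" for s by (rule upd) (use that s0[OF that(1)] in linarith)+
 have lb: "?l s : bdry n" "?r s : bdry n" if "s : cube n" "s 0 = 0" for s
  using lc[OF that(1)] rc[OF that(1)] that(2) n by (auto simp: bdry_def intro!: exI[of _ 0])
 have om: "cmap_on (cube n) X om"
  unfolding om_def by (rule concat_continuous[OF ph(1) psi(1)]) (use n out bh in auto)
 have "cmap_on (cube n) euclidean (E m)" for m
  unfolding E_def by (rule concat_continuous[of _ _ "F m" "G m" "yb m"]) (use n F(1) G(1) Fo Go bh in auto)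
 hence Ec: "continuous_on (cube n) (E m)" for m by auto
 have Ep: "rproj (E m s) = Phi m (om s)" if "s : cube n" for m s
  using that F(2)[OF lc[OF that]] G(2)[OF rc[OF that]] by (auto simp: E_def om_def)
 have n0: "0 < n" using n by simp
 have "?r (corner n) = corner n" "corner n 0 = 1" using n0 by (auto simp: corner_def)
 hence Ez: "E m (corner n) = yb m" "om (corner n) = x0" for m using G(3) cor by (auto simp: E_def om_def)
 have comp': "E m s = E m s'" if "s : cube n" "s' : cube n" "E (Suc m) s = E (Suc m) s'" for m s s'
  by (rule lift_step[OF om Ec Ep Ez Ec Ep that])
 define D where "D = (%s m. E m s) ` cube n"
 have D: "dendrite D" unfolding D_def by (rule quotient_dendrite[OF Ec comp'])
 have omX: "om s : topspace X" if "s : cube n" for s using cmap_image[OF om] that by auto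
 have omeq: "om s = om s'" if "s : cube n" "s' : cube n" "(%m. E m s) = (%m. E m s')" for s s'
 proof (rule inj[OF omX[OF that(1)] omX[OF that(2)]])
  fix m
  have "Phi m (om s) = Phi m (om s')" using Ep that fun_cong[OF that(3), of m] by metis
  thus "b m (om s) = b m (om s')" unfolding Phi_def by (rule e_inj[OF b_top[OF omX[OF that(1)]] b_top[OF omX[OF that(2)]]])
 qed
 \<comment> \<open>Well defined because a point of \<open>D\<close> determines the projections to
   all graphs, and these separate the points of \<open>X\<close>.\<close>
 define q where "q d = om (SOME s. s : cube n & d = (%m. E m s))" for d
 have qE: "q (%m. E m s) = om s" if s: "s : cube n" for s
 proof -
  have "EX s'. s' : cube n & (%m. E m s) = (%m. E m s')" using s by blast
  from someI_ex[OF this] show ?thesis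
   unfolding q_def by (intro omeq[OF s, symmetric]) simp_all
 qed
 have qc: "cmap_on D X q"
  unfolding continuous_map_closedin
 proof (intro conjI allI impI)
  show "q : topspace (top_of_set D) \<rightarrow> topspace X" using qE omX by (auto simp: D_def)
  fix C assume C: "closedin X C"
  have "{d : D. q d : C} = (%s m. E m s) ` {s : cube n. om s : C}" using qE by (auto simp: D_def)
  moreover have "compact {s : cube n. om s : C}"
   using closedin_continuous_map_preimage[OF om C] closedin_compact[OF compact_cube] by simp
  hence "compact ((%s m. E m s) ` {s : cube n. om s : C})"
   by (intro compact_continuous_image continuous_on_coords continuous_on_subset[OF Ec]) auto
  ultimately have "closed {d : D. q d : C}" by (simp add: compact_imp_closed)
  thus "closedin (top_of_set D) {d : topspace (top_of_set D). q d : C}" by (auto intro: closed_subset)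
 qed
 have FD: "(%m. F m s) : D & q (%m. F m s) = ph s" if s: "s : cube n" for s
 proof -
  define s' where "s' = s(0 := (s 0 - 1) / 2)"
  have c: "s' : cube n" unfolding s'_def by (rule upd[OF s]) (use s0[OF s] in "simp_all add: field_simps")
  have "-1 <= s 0" "s 0 <= 1" using s n by (auto simp: cube_def)
  hence s0': "s' 0 <= 0" by (simp add: s'_def)
  have l: "?l s' = s" by (auto simp: s'_def fun_eq_iff field_simps)
  have "(%m. F m s) = (%m. E m s')" "om s' = ph s" using s0' l by (auto simp: E_def om_def)
  thus ?thesis using c qE[OF c] by (auto simp: D_def)
 qed
 have GD: "(%m. G m s) : D & q (%m. G m s) = psi s" if s: "s : cube n" for s
 proof -
  define s' where "s' = s(0 := (s 0 + 1) / 2)"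
  have c: "s' : cube n" unfolding s'_def by (rule upd[OF s]) (use s0[OF s] in "simp_all add: field_simps")
  have s1: "-1 <= s 0" using s n by (auto simp: cube_def)
  have r: "?r s' = s" by (auto simp: s'_def fun_eq_iff field_simps)
  have e: "(%m. G m s) = (%m. E m s') & om s' = psi s"
  proof (cases "s' 0 = 0")
   case True
   have "s : bdry n" using lb(2)[OF c True] r by simp
   hence 1: "G m s = yb m" "psi s = x0" for m using Go out(2) bh by auto
   have 2: "F m (?l s') = yb m" "ph (?l s') = x0" for m using Fo out(1) bh[OF lb(1)[OF c True]] by auto
   show ?thesis using True 1 2 by (simp add: E_def om_def)
  next
   case False
   hence "~ s' 0 <= 0" using s1 by (simp add: s'_def)
   thus ?thesis using r by (simp add: E_def om_def)
  qed
  thus ?thesis using c qE[OF c] by (auto simp: D_def)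
 qed
 have t0: "yb : D" "q yb = x0"
  using FD[OF corner_cube] F(3) cor(1) by auto
 have down: "u i = v i" if uv: "u : D" "v : D" "u m = v m" and im: "i <= m" for u v i m
  using im uv(3)
 proof (induction rule: dec_induct)
  case (step k)
  thus ?case using comp' uv(1,2) unfolding D_def by blast
 qed
 have "chom n (espace X x A a) (q yb, a) (%s. (q (%m. F m s), %j. al j s)) (%s. (q (%m. G m s), %j. be j s))"
 proof (rule dendrite_assembly[OF n D A qc t0(1)])
  show "continuous_on (cube n) (%s m. F m s)" "continuous_on (cube n) (%s m. G m s)"
   by (intro continuous_on_coords F(1) G(1))+
  show "(%m. F m s) = yb" "(%m. G m s) = yb" if "s : cube n" "1/2 <= mx n s" for s using Fo[OF that] Go[OF that] by auto
  show "cmap n (A j) (a j) (al j)" "cmap n (A j) (a j) (be j)" for j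
   using ph(2) psi(2) out(3,4) bh by (auto simp: cmap_def)
  show "i = j" if "s : cube n" "al i s ~= a i" "al j s ~= a j" for i j s using ph(3)[OF that(1,2)] that(3) by metis
  show "i = j" if "s : cube n" "be i s ~= a i" "be j s ~= a j" for i j s using psi(3)[OF that(1,2)] that(3) by metis
  show "(%m. F m s) = (%m. F m s')" if C: "connected C" "C <= cube n" "!!s. s : C ==> al j s ~= a j" "s : C" "s' : C" for j C s s'
  proof
   fix m show "F m s = F m s'"
   proof (rule lift_const[OF continuous_on_subset[OF F(1) C(2)] C(1) _ C(4,5)])
    show "rproj (F m z) = Phi m (x j)" if "z : C" for z using F(2)[of z m] ph(3)[of z j] C(2,3) that by auto
   qed
  qed
  show "(%m. G m s) = (%m. G m s')" if C: "connected C" "C <= cube n" "!!s. s : C ==> be j s ~= a j" "s : C" "s' : C" for j C s s'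
  proof
   fix m show "G m s = G m s'"
   proof (rule lift_const[OF continuous_on_subset[OF G(1) C(2)] C(1) _ C(4,5)])
    show "rproj (G m z) = Phi m (x j)" if "z : C" for z using G(2)[of z m] psi(3)[of z j] C(2,3) that by auto
   qed
  qed
  show "q (%m. F m s) = x j" if "s : cube n" "al j s ~= a j" for j s using FD[OF that(1)] ph(3)[OF that] by simp
  show "q (%m. G m s) = x j" if "s : cube n" "be j s ~= a j" for j s using GD[OF that(1)] psi(3)[OF that] by simp
  show "EX P :: (nat => rtree) => rtree. inj_on P T & (ALL ka. chom n (A j) (a j)
    (%s. if P (%m. F m s) = ka then al j s else a j) (%s. if P (%m. G m s) = ka then be j s else a j))"
   if T: "finite T" "T <= D" for j T
  proof -
   \<comment> \<open>Distinct points of \<open>D\<close> differ in some coordinate and, by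
     \<open>down\<close>, in all later ones. So one stage separates a finite set, and its coordinate
     serves as label.\<close>
   have "EX M. ALL z:T \<times> T. fst z ~= snd z --> (ALL m>=M. fst z m ~= snd z m)"
   proof -
    have "ALL z:T \<times> T. EX M. fst z ~= snd z --> (ALL m>=M. fst z m ~= snd z m)"
    proof
     fix z assume z: "z : T \<times> T"
     show "EX M. fst z ~= snd z --> (ALL m>=M. fst z m ~= snd z m)"
     proof (cases "fst z = snd z")
      case False
      then obtain M where M: "fst z M ~= snd z M" by blast
      have "fst z m ~= snd z m" if "M <= m" for m
       using down[of "fst z" "snd z" m M] z T(2) M that by (auto simp: mem_Times_iff)
      thus ?thesis by blast
     qed simp
    qed
    then obtain N where N: "!!z. z : T \<times> T ==> fst z ~= snd z ==> ALL m>=N z. fst z m ~= snd z m" by metis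
    have "N z <= Max (insert 0 (N ` (T \<times> T)))" if "z : T \<times> T" for z using T(1) that by (intro Max_ge) auto
    thus ?thesis using N by (intro exI[of _ "Max (insert 0 (N ` (T \<times> T)))"]) (meson order_trans)
   qed
   then obtain M where M: "ALL z:T \<times> T. fst z ~= snd z --> (ALL m>=M. fst z m ~= snd z m)" by blast
   have "inj_on (%d. d M) T"
   proof (rule inj_onI, rule ccontr)
    fix u v assume "u : T" "v : T" "u M = v M" "u ~= v"
    thus False using bspec[OF M, of "(u, v)"] by auto
   qed
   moreover have hj: "chom n (espace (Xm M) (%j. b M (x j)) A a) (b M x0, a)
     (%s. (b M (ph s), %i. if i < Suc j then al i s else a i)) (%s. (b M (psi s), %i. if i < Suc j then be i s else a i))"
    using hyp[of M "Suc j"] by (simp only: ff fst_conv snd_conv)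
   have "chom n (A j) (a j) (%s. if F M s = ka then al j s else a j) (%s. if G M s = ka then be j s else a j)" for ka
    by (rule stage_invariant[where x=x, OF A(3,2) lessI ph(1) cor(1) psi(1) cor(2) F(1,2,3) G(1,2,3)]) (assumption | rule hj)+
   ultimately show ?thesis by (intro exI[of _ "%d. d M"]) simp
  qed
 qed (use FD GD out in auto)
 hence "chom n (espace X x A a) (x0, a) (%s. (q (%m. F m s), %j. al j s)) (%s. (q (%m. G m s), %j. be j s))"
  using t0(2) by simp
 thus ?thesis by (rule chom_cong) (use FD GD ff in auto)
qed

end

lemma metrizable_t1: "metrizable_space X ==> t1_space X"
 using metrizable_imp_Hausdorff_space Hausdorff_imp_t1_space by blast

text \<open>A base point inside an attached space is joined within that space to its attaching
  point; all other components stay at their base points.\<close>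

lemma path_to_base:
 fixes X :: "'a topology" and A :: "nat => 'b topology"
 assumes x: "!!j. x j : topspace X" and a: "!!j. a j : topspace (A j)" and T: "t1_space X" "!!j. t1_space (A j)"
  and pc: "!!j. path_connected_space (A j)" and y0: "y0 : topspace (shrinking_adj X x A a)"
 obtains de :: "real => nat => 'a + nat \<times> 'b" and p where "cmap_on {0..1} (shrinking_adj X x A a) de" "de 0 = y0" "de 1 = (%k. Inl p)" "p : topspace X"
proof -
 define e where "e = from_Y x a y0"
 have e: "e : topspace (espace X x A a)" unfolding e_def by (rule from_Y_espace[OF x a y0])
 have inv: "(%k. stage a k e) = y0" unfolding e_def using stage_from_Y[OF x a y0] by blast
 obtain j and ga :: "real => 'b" where ga: "cmap_on {0..1} (A j) ga" "ga 0 = snd e j" "ga 1 = a j" "!!i. i ~= j ==> snd e i = a i"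
  "!!t. ga t ~= a j ==> fst e = x j"
 proof (cases "EX j. snd e j ~= a j")
  case True
  then obtain j where j: "snd e j ~= a j" by blast
  have "snd e j : topspace (A j)" "fst e = x j" "!!i. i ~= j ==> snd e i = a i" using e j by (auto simp: topspace_espace)
  moreover obtain ga where "pathin (A j) ga" "ga 0 = snd e j" "ga 1 = a j"
   using pc[of j] a[of j] calculation(1) unfolding path_connected_space_def by blast
  ultimately show ?thesis using that[of j ga] by (auto simp: pathin_def)
 next
  case False
  show ?thesis by (rule that[of 0 "%_. a 0"]) (use False a[of 0] in auto)
 qed
 define ep where "ep t = (fst e, %i. if i = j then ga t else a i)" for t :: real
 have "cmap_on {0..1} (espace X x A a) ep"
  unfolding continuous_espace_components
 proof (intro conjI allI ballI impI)
  show "cmap_on {0..1} X (fst o ep)" using e by (auto simp: ep_def o_def topspace_espace)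
  show "cmap_on {0..1} (A i) (%t. snd (ep t) i)" for i
   using ga(1) a[of i] by (cases "i = j") (auto simp: ep_def)
 qed (use ga(5) in "auto simp: ep_def split: if_splits")
 from cmap_comp[OF this continuous_to_Y[OF x a T]]
 have c: "cmap_on {0..1} (shrinking_adj X x A a) (%t k. stage a k (ep t))" by (simp add: o_def)
 show ?thesis
 proof (rule that[OF c])
  have "ep 0 = e" using ga(2,4) by (auto simp: ep_def prod_eq_iff fun_eq_iff)
  thus "(%k. stage a k (ep 0)) = y0" using inv by simp
  show "(%k. stage a k (ep 1)) = (%k. Inl (fst e))"
   by (rule ext, subst stage_Inl) (use ga(3) in "auto simp: ep_def")
  show "fst e : topspace X" using e by (simp add: topspace_espace)
 qed
qed

lemma transp_compose: "transp n (r o de) (r o f) = r o transp n de f"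
 by (auto simp: transp_def fun_eq_iff)

lemma csc2_base: "cmap n Y y0 f ==> s : cube n ==> 1/2 <= mx n s ==> (f o csc 2) s = y0"
 using csc_bdry[of s n 2] by (auto simp: cmap_def)

theorem theorem6p27:
  fixes n :: nat
    and X :: "'a topology" and x :: "nat \<Rightarrow> 'a"
    and A :: "nat \<Rightarrow> 'b topology" and a :: "nat \<Rightarrow> 'b"
    and Xm :: "nat \<Rightarrow> 'c topology" and bb :: "nat \<Rightarrow> 'c \<Rightarrow> 'c" and b :: "nat \<Rightarrow> 'a \<Rightarrow> 'c"
    and y0 :: "nat \<Rightarrow> 'a + nat \<times> 'b"
    and f g :: "(nat \<Rightarrow> real) \<Rightarrow> (nat \<Rightarrow> 'a + nat \<times> 'b)"
  assumes "n \<ge> 2"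
    and "peano_continuum X" and "one_dimensional X"
    and "\<forall>j. x j \<in> topspace X"
    and "\<forall>j. a j \<in> topspace (A j)"
    and "\<forall>j. polyhedron_space (A j) \<and> k_connected_space (n - 1) (A j)"
    and "graph_inverse_limit_rep X Xm bb b"
    and "y0 \<in> topspace (shrinking_adj X x A a)"
    and "based_map n (shrinking_adj X x A a) y0 f"
    and "based_map n (shrinking_adj X x A a) y0 g"
    and "\<forall>k m. based_homotopic n (adj_space (Xm m) (\<lambda>j. b m (x j)) A a k) (canon_proj b k m y0)
                 (canon_proj b k m \<circ> f) (canon_proj b k m \<circ> g)"
  shows "based_homotopic n (shrinking_adj X x A a) y0 f g"
proof -
 let ?Y = "shrinking_adj X x A a" and ?E = "espace X x A a"
 have n2: "2 <= n" and n1: "1 <= n" using assms(1) by simp_all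
 have x: "!!j. x j : topspace X" and a: "!!j. a j : topspace (A j)" using assms(4,5) by auto
 have T: "t1_space X" using assms(2) metrizable_t1 by (auto simp: peano_continuum_def)
 have A: "polyhedron_space (A j)" "k_connected_space (n - 1) (A j)" for j using assms(6) by auto
 have TA: "t1_space (A j)" for j using Hausdorff_polyhedron[OF A(1)] Hausdorff_imp_t1_space by blast
 have wp: "well_pointed (A j) (a j)" for j by (rule well_pointed_polyhedron[OF A(1) a])
 have pc: "path_connected_space (A j)" for j using A(2)[of j] by (simp add: k_connected_space_def)
 have gr: "!!m. finite_graph (Xm m)" "!!m. continuous_map (Xm (Suc m)) (Xm m) (bb m)" "!!m. continuous_map X (Xm m) (b m)"
  "!!m p. p : topspace X ==> bb m (b (Suc m) p) = b m p"
  "homeomorphic_map X (subtopology (product_topology Xm UNIV) {z. ALL m. z m : topspace (Xm m) & bb m (z (Suc m)) = z m}) (%p m. b m p)"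
  using assms(7) unfolding graph_inverse_limit_rep_def by auto
 have inj: "p = p'" if p: "p : topspace X" "p' : topspace X" "!!m. b m p = b m p'" for p p'
  using inj_onD[OF homeomorphic_imp_injective_map[OF gr(5)] _ p(1,2)] p(3) by auto
 define emb where "emb m z \<longleftrightarrow> homeomorphic_maps (Xm m) (top_of_set (fst z)) (fst (snd z)) (fst (snd (snd z))) & (ALL y:fst z. in_graph y) &
   (ALL y:fst z. ALL u>=snd (snd (snd z)). y u = 0) & (ALL y:fst z. ALL y'. in_graph y' --> (ALL u. 0 < y' u --> 0 < y u) --> y' : fst z)"
  for m :: nat and z :: "(nat => real) set \<times> ('c => nat => real) \<times> ((nat => real) => 'c) \<times> nat"
 have "EX z. emb m z" for m
 proof -
  obtain e g Ga V where "homeomorphic_maps (Xm m) (top_of_set Ga) e g" "!!x. x : Ga ==> in_graph x"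
   "!!x u. x : Ga ==> (V::nat) <= u ==> x u = 0" "!!x x'. x : Ga ==> in_graph x' ==> (!!u. 0 < x' u ==> 0 < x u) ==> x' : Ga"
   by (rule graph_embedding[OF gr(1)[of m]]) (rule that, (assumption | blast)+)
  thus ?thesis by (intro exI[of _ "(Ga, e, g, V)"], unfold emb_def fst_conv snd_conv) blast
 qed
 then obtain z where z: "!!m. emb m (z m)" by metis
 \<comment> \<open>The construction needs a base point in \<open>X\<close>, so everything is
   transported along a path from \<open>y0\<close> to such a point.\<close>
 obtain de :: "real => nat => 'a + nat \<times> 'b" and p where de: "cmap_on {0..1} ?Y de" "de 0 = y0" "de 1 = (%k. Inl p)" and p: "p : topspace X"
  using path_to_base[OF x a T TA pc assms(8)] by blast
 interpret tower n X Xm bb b "%m. fst (snd (z m))" "%m. fst (snd (snd (z m)))" "%m. fst (z m)" "%m. snd (snd (snd (z m)))" p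
 proof
  show "homeomorphic_maps (Xm m) (top_of_set (fst (z m))) (fst (snd (z m))) (fst (snd (snd (z m))))" for m
   using z[of m] unfolding emb_def by blast
  show "in_graph y" if "y : fst (z m)" for m y using z[of m] that unfolding emb_def by blast
  show "y u = 0" if "y : fst (z m)" "snd (snd (snd (z m))) <= u" for m y u using z[of m] that unfolding emb_def by blast
  show "y' : fst (z m)" if "y : fst (z m)" "in_graph y'" "!!u. 0 < y' u ==> 0 < y u" for m y y'
   using z[of m] that unfolding emb_def by blast
 qed (fact n2 gr(2,3,4) p inj)+
 let ?io = "from_Y x a"
 note fY = continuous_from_Y[where X=X and x=x and A=A and a=a, OF x a]
 let ?y1 = "%k::nat. Inl p :: 'a + nat \<times> 'b"
 have io1: "?io ?y1 = (p, a)" by (auto simp: from_Y_def[OF x a] ret_X_def ret_A_def)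
 have ck: "cmap n ?Y y0 (h o kap n)" if "based_map n ?Y y0 h" for h
  using that cmap_comp[OF continuous_kap] kap_bdry by (auto simp: cmap_def based_map_def)
 let ?f0 = "f o kap n" and ?g0 = "g o kap n"
 have c0: "cmap n ?Y y0 ?f0" "cmap n ?Y y0 ?g0" using ck assms(9,10) by auto
 let ?f1 = "transp n de ?f0" and ?g1 = "transp n de ?g0"
 have c1: "cmap n ?Y ?y1 ?f1" "cmap n ?Y ?y1 ?g1" using transp_cmap[OF de] c0 by auto
 \<comment> \<open>Doubling and clipping makes both maps constant on the shell where
   \<open>mx n s >= 1/2\<close>, as \<open>espace_injective\<close> requires.\<close>
 let ?f2 = "?f1 o csc 2" and ?g2 = "?g1 o csc 2"
 have h12: "chom n ?Y ?y1 ?f1 ?f2" "chom n ?Y ?y1 ?g1 ?g2" by (rule chom_csc; use c1 in simp)+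
 have c2: "cmap n ?Y ?y1 ?f2" "cmap n ?Y ?y1 ?g2" using chom_cmap[OF h12(1)] chom_cmap[OF h12(2)] by simp_all
 have yt: "?y1 : topspace ?Y"
 proof -
  have "de 1 : de ` {0..1}" by simp
  hence "de 1 : topspace ?Y" using cmap_image[OF de(1)] by auto
  thus ?thesis by (simp add: de(3))
 qed
 have top: "h s : topspace ?Y" if "cmap n ?Y y h" "s : cube n" for y h s
  using that cmap_image[of "top_of_set (cube n)" ?Y h] by (auto simp: cmap_def)
 have e2: "cmap_on (cube n) ?E (?io o ?f2)" "cmap_on (cube n) ?E (?io o ?g2)"
  using c2 cmap_comp[OF _ fY] by (auto simp: cmap_def)
 have o2: "(?io o ?f2) s = (p, a)" "(?io o ?g2) s = (p, a)" if "s : cube n" "1/2 <= mx n s" for s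
  using csc2_base[OF c1(1) that] csc2_base[OF c1(2) that] io1 by simp_all
 have "chom n (espace (Xm m) (%j. b m (x j)) A a) (b m p, a)
   (%s. (b m (fst ((?io o ?f2) s)), %j. if j < k then snd ((?io o ?f2) s) j else a j))
   (%s. (b m (fst ((?io o ?g2) s)), %j. if j < k then snd ((?io o ?g2) s) j else a j))" for k m
 proof -
  let ?S = "espace (Xm m) (%j. b m (x j)) A a"
  \<comment> \<open>The retraction to the stage given by \<open>k\<close> and \<open>m\<close>,
    written in coordinates on all of \<open>Y\<close>. As a continuous map it commutes with
    transport and rescaling, so the hypothesis on \<open>f\<close> and \<open>g\<close> passes to
    the modified maps.\<close>
  define Th where "Th y = (b m (fst (?io y)), %j. if j < k then snd (?io y) j else a j)" for y
  have Thc: "continuous_map ?Y ?S Th"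
   unfolding continuous_espace_components
  proof (intro conjI allI ballI impI)
   note comps = fY[unfolded continuous_espace_components]
   show "continuous_map ?Y (Xm m) (fst o Th)"
    using cmap_comp[OF conjunct1[OF comps] gr(3)[of m]] by (simp add: Th_def o_def)
   show "continuous_map ?Y (A j) (%y. snd (Th y) j)" for j
    using comps a[of j] by (cases "j < k") (auto simp: Th_def)
   fix y j assume "y : topspace ?Y" "snd (Th y) j ~= a j"
   thus "fst (Th y) = b m (x j)" "!!i. i ~= j ==> snd (Th y) i = a i"
    using comps by (auto simp: Th_def split: if_splits)
  qed
  have "based_homotopic n (adj_space (Xm m) (%j. b m (x j)) A a k) (canon_proj b k m y0) (canon_proj b k m o f) (canon_proj b k m o g)"
   using assms(11) by blast
  hence "chom n (adj_space (Xm m) (%j. b m (x j)) A a k) (canon_proj b k m y0) ((canon_proj b k m o f) o kap n) ((canon_proj b k m o g) o kap n)"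
   by (rule iffD1[OF sphere_chom[OF n1]])
  hence "chom n (adj_space (Xm m) (%j. b m (x j)) A a k) (map_sum (b m) id (y0 k)) (%s. map_sum (b m) id (?f0 s k)) (%s. map_sum (b m) id (?g0 s k))"
   by (simp add: canon_proj_def[abs_def] o_def)
  from chom_stage[OF x a b_top this top[OF c0(1)] top[OF c0(2)] assms(8)]
  have "chom n ?S (Th y0) (%s. Th (?f0 s)) (%s. Th (?g0 s))" unfolding Th_def .
  hence "chom n ?S (Th y0) (Th o ?f0) (Th o ?g0)" by (rule chom_cong) simp_all
  moreover have "cmap_on {0..1} ?S (Th o de)" by (rule cmap_comp[OF de(1) Thc])
  ultimately have "chom n ?S (Th ?y1) (transp n (Th o de) (Th o ?f0)) (transp n (Th o de) (Th o ?g0))"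
   using de(2,3) by (intro transp_chom) auto
  hence t: "chom n ?S (Th ?y1) (Th o ?f1) (Th o ?g1)" unfolding transp_compose .
  have "chom n ?S (Th ?y1) (Th o ?f2) (Th o ?g2)"
   by (rule chom_trans[OF chom_sym[OF chom_compose[OF h12(1) Thc]] chom_trans[OF t chom_compose[OF h12(2) Thc]]])
  moreover have "Th ?y1 = (b m p, a)" using io1 by (auto simp: Th_def)
  ultimately have "chom n ?S (b m p, a) (Th o ?f2) (Th o ?g2)" by (simp only:)
  thus ?thesis by (rule chom_cong) (unfold Th_def o_def, (rule refl)+)
 qed
 from espace_injective[OF wp TA a A(2) e2(1) o2(1) e2(2) o2(2) this]
 have "chom n ?E (?io ?y1) (?io o ?f2) (?io o ?g2)" unfolding io1 .
 hence "chom n ?Y ?y1 ?f2 ?g2" by (rule chom_Y_iff[OF x a T TA c2 yt])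
 hence "chom n ?Y ?y1 ?f1 ?g1" by (rule chom_trans[OF h12(1) chom_trans[OF _ chom_sym[OF h12(2)]]])
 hence "chom n ?Y y0 ?f0 ?g0" by (rule chom_transp_iff[OF de c0])
 thus ?thesis by (rule iffD2[OF sphere_chom[OF n1]])
qed

end
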